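(* Let $n\ge 1$, let $s>0$ and suppose $p,q\in\mathbb{R}\setminus\{1\}$ satisfy $\frac{q-1}{p-1}=e^{2s}$. Let $\beta>0$ and assume that the twice differentiable function $v:\mathbb{R}^n\to(0,\infty)$ belongs to $L^2(\gamma_\beta^{-1})$. (1) Suppose $1<p<q<\infty$. When $\beta>1$ let $v$ be $\beta$-semi-log-subharmonic, and when $\beta<1$ let $v$ be $\beta$-semi-log-concave. Then $$\Big\|P_s\Big[\Big(\frac{v}{\gamma}\Big)^{\frac1p}\Big]\Big\|_{L^q(\gamma)}\le \Big\|P_s\Big[\Big(\frac{\gamma_\beta}{\gamma}\Big)^{\frac1p}\Big]\Big\|_{L^q(\gamma)}\Big(\int_{\mathbb{R}^n}\frac{v}{\gamma}\,d\gamma\Big)^{\frac1p}.$$ (2) Suppose $-\infty<q<p<1$ and $p\neq 0,\ 1-e^{-2s}$. Consider the inequality $$\Big\|P_s\Big[\Big(\frac{v}{\gamma}\Big)^{\frac1p}\Big]\Big\|_{L^q(\gamma)}\ge \Big\|P_s\Big[\Big(\frac{\gamma_\beta}{\gamma}\Big)^{\frac1p}\Big]\Big\|_{L^q(\gamma)}\Big(\int_{\mathbb{R}^n}\frac{v}{\gamma}\,d\gamma\Big)^{\frac1p}.\qquad( * )$$ (i) If $pq>0$, $\beta>1$ and $v$ is $\beta$-semi-log-subharmonic, then $( * )$ holds. (ii) If $pq<0$, $0<\beta<1$ and $v$ is $\beta$-semi-log-concave, then $( * )$ holds.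
   Context: For $\beta>0$, $\gamma_\beta(x)=(2\pi\beta)^{-n/2}e^{-|x|^2/(2\beta)}$ on $\mathbb{R}^n$, and $\gamma=\gamma_1$; $d\gamma=\gamma(x)\,dx$. The Ornstein–Uhlenbeck semigroup is $P_sf(x)=\int_{\mathbb{R}^n}f(e^{-s}x+\sqrt{1-e^{-2s}}\,y)\,d\gamma(y)$ for non-negative $f$. For real $q\ne0$ and $g\ge 0$, $\|g\|_{L^q(\gamma)}=(\int_{\mathbb{R}^n}g^q\,d\gamma)^{1/q}$ (also for $q<1$, where it is not a norm). $v\in L^2(\gamma_\beta^{-1})$ means $\int_{\mathbb{R}^n}v^2\gamma_\beta^{-1}\,dx<\infty$. A twice differentiable $v:\mathbb{R}^n\to(0,\infty)$ is $\beta$-semi-log-subharmonic if $\Delta\log v\ge-\frac n\beta$ on $\mathbb{R}^n$, and $\beta$-semi-log-concave if $\nabla^2\log v\le-\frac1\beta\,\mathrm{id}$ on $\mathbb{R}^n$ (in the sense of symmetric matrices). *)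

theory Defs
  imports "HOL-Analysis.Analysis"
begin

definition gauss :: "real \<Rightarrow> real ^ 'n \<Rightarrow> real" where
  "gauss \<beta> x = (2 * pi * \<beta>) powr (- real CARD('n) / 2) * exp (- (norm x)\<^sup>2 / (2 * \<beta>))"

definition gauss_measure :: "(real ^ 'n) measure" where
  "gauss_measure = density lborel (\<lambda>x. ennreal (gauss 1 x))"

text \<open>Integrals of non-negative functions are taken in \<open>[0, \<infinity>]\<close>, so that no integrability has to be
  presupposed. Powers with a real exponent therefore have to be defined on \<open>[0, \<infinity>]\<close>; for a negative
  exponent \<open>a\<close> the conventions are the usual ones, \<open>0\<^sup>a = \<infinity>\<close> and \<open>\<infinity>\<^sup>a = 0\<close>
  (whereas \<open>0 powr a = 0\<close> on the reals).\<close>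

definition ennreal_powr :: "ennreal \<Rightarrow> real \<Rightarrow> ennreal" (infixr \<open>epowr\<close> 80) where
  "x epowr a =
     (if a = 0 then 1
      else if x = 0 then (if a > 0 then 0 else \<infinity>)
      else if x = \<infinity> then (if a > 0 then \<infinity> else 0)
      else ennreal (enn2real x powr a))"

definition OU :: "real \<Rightarrow> (real ^ 'n \<Rightarrow> ennreal) \<Rightarrow> real ^ 'n \<Rightarrow> ennreal" where
  "OU s f x = (\<integral>\<^sup>+ y. f (exp (- s) *\<^sub>R x + sqrt (1 - exp (- 2 * s)) *\<^sub>R y) \<partial>gauss_measure)"

definition Lq_gauss :: "real \<Rightarrow> (real ^ 'n \<Rightarrow> ennreal) \<Rightarrow> ennreal" where
  "Lq_gauss q g = (\<integral>\<^sup>+ x. g x epowr q \<partial>gauss_measure) epowr (1 / q)"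

definition in_L2_inv_gauss :: "real \<Rightarrow> (real ^ 'n \<Rightarrow> real) \<Rightarrow> bool" where
  "in_L2_inv_gauss \<beta> v \<longleftrightarrow> (\<integral>\<^sup>+ x. ennreal ((v x)\<^sup>2 * inverse (gauss \<beta> x)) \<partial>lborel) < \<infinity>"

definition gradient :: "(real ^ 'n \<Rightarrow> real) \<Rightarrow> real ^ 'n \<Rightarrow> real ^ 'n" where
  "gradient f x = (THE D. GDERIV f x :> D)"

definition twice_differentiable :: "(real ^ 'n \<Rightarrow> real) \<Rightarrow> bool" where
  "twice_differentiable f \<longleftrightarrow>
     (\<forall>x. f differentiable (at x)) \<and> (\<forall>x. gradient f differentiable (at x))"

definition hessian :: "(real ^ 'n \<Rightarrow> real) \<Rightarrow> real ^ 'n \<Rightarrow> real ^ 'n ^ 'n" where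
  "hessian f x = jacobian (gradient f) (at x)"

definition laplacian :: "(real ^ 'n \<Rightarrow> real) \<Rightarrow> real ^ 'n \<Rightarrow> real" where
  "laplacian f x = trace (hessian f x)"

text \<open>The order of quadratic forms. Symmetry is not part of the definition: it is used only for
  Hessians of twice differentiable functions and multiples of the identity.\<close>

definition loewner_le :: "real ^ 'n ^ 'n \<Rightarrow> real ^ 'n ^ 'n \<Rightarrow> bool" where
  "loewner_le A B \<longleftrightarrow> (\<forall>u. u \<bullet> (A *v u) \<le> u \<bullet> (B *v u))"

definition semi_log_subharmonic :: "real \<Rightarrow> (real ^ 'n \<Rightarrow> real) \<Rightarrow> bool" where
  "semi_log_subharmonic \<beta> v \<longleftrightarrow>
     (\<forall>x. laplacian (\<lambda>y. ln (v y)) x \<ge> - real CARD('n) / \<beta>)"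

text \<open>Here \<open>mat c\<close> is \<open>c\<close> times the identity matrix.\<close>

definition semi_log_concave :: "real \<Rightarrow> (real ^ 'n \<Rightarrow> real) \<Rightarrow> bool" where
  "semi_log_concave \<beta> v \<longleftrightarrow>
     (\<forall>x. loewner_le (hessian (\<lambda>y. ln (v y)) x) (mat (- 1 / \<beta>)))"

end

theory Submission
  imports Defs "HOL-Probability.Probability" "HOL-Real_Asymp.Real_Asymp"
begin

text \<open>Write \<open>v = u \<gamma>\<^sub>\<beta>\<close> and \<open>L(x) = ln u(\<surd>\<beta> x)\<close>. Completing squares turns the left-hand side into
  a constant, independent of \<open>u\<close>, times the \<open>L\<^sup>q(\<gamma>)\<close> norm of a Gaussian average \<open>\<integral> e\<^bsup>L(a x + b y)/p\<^esup> d\<gamma>(y)\<close>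
  with \<open>q a\<^sup>2 + b\<^sup>2 = p\<close>; the constant is found from \<open>u = 1\<close>. Put \<open>r\<^sup>2 = a\<^sup>2 + b\<^sup>2\<close>. Nelson's
  hypercontractivity, or Borell's reverse form of it, bounds that norm by the \<open>1/p\<close>-th power of
  \<open>X = \<parallel>e\<^bsup>L(r x)\<^esup>\<parallel>\<close> in \<open>L\<^sup>m(\<gamma>)\<close>, \<open>m = r\<^bsup>-2\<^esup>\<close>, and it remains to compare \<open>X\<close> with \<open>\<integral> e\<^sup>L d\<gamma> = \<integral> v dx\<close>.
  The assumption on \<open>v\<close> says that \<open>L\<close> is subharmonic, respectively concave. In the first case the
  comparison is Janson's strong hypercontractivity for log-subharmonic functions, which goes in
  the direction given by the sign of \<open>1 - r\<close>; in the second it goes the other way and follows from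
  Prekopa's theorem. The position of \<open>r\<close> relative to \<open>1\<close> is decided by the sign of \<open>(1 - 1/\<beta>)(1/p - 1)\<close>.\<close>

section \<open>The Gaussian measure\<close>

text \<open>The second derivatives of \<open>v\<close> exist but need not be continuous, so no
  classical divergence theorem applies to the gradient of \<open>L\<close>. The subharmonic case
  therefore works with difference quotients and asks for continuity of the gradient only.
  Hypercontractivity rests on one inequality of Jensen type for two correlated Gaussian vectors,
  governed by a quadratic form. A step of variance 1/k costs an error k^(-3/2), so k steps lose
  k^(-1/2); no flow has to be differentiated. Squares can be completed only if \<theta> = 1 - (1 -
  1/\<beta>)(1 - e^(-2s))/p is positive. This is automatic when (1 - 1/\<beta>)/p <= 0. When \<beta>
  > 1 and p > 0 it follows from p > 1 - e^(-2s), which amounts to q > 0, because p = q e^(-2s) + 1 -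
  e^(-2s). The condition that \<open>v\<close> lies in L^2 of the inverse Gaussian says that e^(2L)
  is Gaussian integrable. It supplies the room above the critical exponent that the limit e -> 0 in
  Janson's argument needs.\<close>

lemma gauss_pos: "\<beta> > 0 \<Longrightarrow> gauss \<beta> x > 0"
  by (simp add: gauss_def)

lemma gauss_nonneg [simp]: "gauss \<beta> x \<ge> 0"
  by (simp add: gauss_def)

lemma continuous_on_gauss [continuous_intros]: "continuous_on S (gauss \<beta>)"
  unfolding gauss_def divide_inverse by (intro continuous_intros)

lemma borel_measurable_gauss [measurable]: "gauss \<beta> \<in> borel_measurable borel"
  by (intro borel_measurable_continuous_onI continuous_on_gauss)

lemma gauss_eq_prod:
  fixes x :: "real ^ 'n"
  assumes "\<beta> > 0"
  shows "gauss \<beta> x = (\<Prod>b\<in>Basis. normal_density 0 (sqrt \<beta>) (x \<bullet> b))"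
proof -
  have "(\<Prod>b\<in>(Basis::(real^'n) set). normal_density 0 (sqrt \<beta>) (x \<bullet> b))
      = (1 / sqrt (2 * pi * \<beta>)) ^ CARD('n) * exp (\<Sum>b\<in>Basis. - (x \<bullet> b)\<^sup>2 / (2 * \<beta>))"
    using assms by (simp add: normal_density_def prod.distrib exp_sum prod_dividef power_one_over)
  also have "(\<Sum>b\<in>Basis. - (x \<bullet> b)\<^sup>2 / (2 * \<beta>)) = - (norm x)\<^sup>2 / (2 * \<beta>)"
    unfolding power2_norm_eq_inner euclidean_inner[of x x]
    by (simp add: sum_negf sum_divide_distrib power2_eq_square)
  also have "(1 / sqrt (2 * pi * \<beta>)) ^ CARD('n) = (2 * pi * \<beta>) powr (- real CARD('n) / 2)"
    using assms
    by (simp add: powr_half_sqrt[symmetric] powr_minus[symmetric] powr_powr field_simps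
        flip: powr_realpow powr_minus_divide)
  finally show ?thesis by (simp add: gauss_def)
qed

lemma nn_integral_gauss:
  assumes "\<beta> > 0"
  shows "(\<integral>\<^sup>+ x. ennreal (gauss \<beta> (x :: real ^ 'n)) \<partial>lborel) = 1"
proof -
  have "(\<integral>\<^sup>+ x. ennreal (gauss \<beta> (x :: real ^ 'n)) \<partial>lborel)
     = (\<integral>\<^sup>+ x. (\<Prod>b\<in>Basis. ennreal (normal_density 0 (sqrt \<beta>) ((x :: real ^ 'n) \<bullet> b))) \<partial>lborel)"
    by (simp add: gauss_eq_prod[OF assms] prod_ennreal)
  also have "\<dots> = (\<Prod>b\<in>(Basis::(real^'n) set). (\<integral>\<^sup>+x. ennreal (normal_density 0 (sqrt \<beta>) x) \<partial>lborel))"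
    by (subst nn_integral_lborel_prod) auto
  also have "(\<integral>\<^sup>+x. ennreal (normal_density 0 (sqrt \<beta>) x) \<partial>lborel) = 1"
    using assms by (subst nn_integral_eq_integral) auto
  finally show ?thesis by simp
qed

lemma sets_gauss_measure [simp, measurable_cong]: "sets gauss_measure = sets borel"
  by (simp add: gauss_measure_def)

lemma space_gauss_measure [simp]: "space gauss_measure = UNIV"
  by (simp add: gauss_measure_def)

lemma nn_integral_gauss_measure:
  assumes [measurable]: "h \<in> borel_measurable borel"
  shows "(\<integral>\<^sup>+ x. h x \<partial>gauss_measure) = (\<integral>\<^sup>+ x. ennreal (gauss 1 x) * h x \<partial>lborel)"
  unfolding gauss_measure_def by (subst nn_integral_density) auto

lemma prob_space_gauss_measure: "prob_space (gauss_measure :: (real ^ 'n) measure)"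
  by (intro prob_spaceI) (simp add: gauss_measure_def emeasure_density nn_integral_gauss)

interpretation G: prob_space "gauss_measure :: (real ^ 'n) measure"
  by (rule prob_space_gauss_measure)

interpretation GG: pair_prob_space "gauss_measure :: (real ^ 'n) measure" "gauss_measure :: (real ^ 'n) measure"
  by unfold_locales

section \<open>Affine changes of variable and Gaussian convolution\<close>

lemma nn_integral_lborel_scale:
  fixes t :: "real ^ 'n"
  assumes "c \<noteq> 0" and [measurable]: "h \<in> borel_measurable borel"
  shows "(\<integral>\<^sup>+ x. h x \<partial>lborel) = ennreal (\<bar>c\<bar> ^ CARD('n)) * (\<integral>\<^sup>+ x. h (t + c *\<^sub>R x) \<partial>lborel)"
  using assms
  by (subst lborel_affine[of c t]) (auto simp: nn_integral_density nn_integral_distr nn_integral_cmult)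

text \<open>The substitution z -> m/\<theta> + z/sqrt \<theta> completes the square in the exponent;
  \<open>\<theta> > 0\<close> keeps the quadratic part integrable. Exponential moments, translations
  (\<open>\<theta> = 1\<close>) and the removal of Gaussian factors are all instances.\<close>

lemma gauss_tilt:
  fixes m :: "real ^ 'n"
  assumes "\<theta> > 0" and [measurable]: "h \<in> borel_measurable borel"
  shows "(\<integral>\<^sup>+ z. ennreal (exp (m \<bullet> z + (1 - \<theta>) * (norm z)\<^sup>2 / 2)) * h z \<partial>gauss_measure)
      = ennreal (\<theta> powr (- real CARD('n) / 2) * exp ((norm m)\<^sup>2 / (2 * \<theta>)))
         * (\<integral>\<^sup>+ z. h ((1 / \<theta>) *\<^sub>R m + (1 / sqrt \<theta>) *\<^sub>R z) \<partial>gauss_measure)"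
proof -
  define c where "c = 1 / sqrt \<theta>"
  define t where "t = (1 / \<theta>) *\<^sub>R m"
  define k where "k = (2 * pi) powr (- real CARD('n) / 2)"
  have c: "c > 0" "c * c = 1 / \<theta>" "\<bar>c\<bar> = c" using assms by (auto simp: c_def)
  have sq: "m \<bullet> (t + c *\<^sub>R z) + (1 - \<theta>) * (norm (t + c *\<^sub>R z))\<^sup>2 / 2 + - (norm (t + c *\<^sub>R z))\<^sup>2 / 2
      = (norm m)\<^sup>2 / (2 * \<theta>) + - (norm z)\<^sup>2 / 2" for z
  proof -
    have "(norm (t + c *\<^sub>R z))\<^sup>2 = (m \<bullet> m) / \<theta>\<^sup>2 + 2 * c * (m \<bullet> z) / \<theta> + c * c * (z \<bullet> z)"
      unfolding power2_norm_eq_inner t_def using assms(1)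
      by (simp add: inner_add_left inner_add_right inner_commute power2_eq_square)
    also have "c * c * (z \<bullet> z) = (z \<bullet> z) / \<theta>" unfolding c by simp
    finally have n: "(norm (t + c *\<^sub>R z))\<^sup>2 = (m \<bullet> m) / \<theta>\<^sup>2 + 2 * c * (m \<bullet> z) / \<theta> + (z \<bullet> z) / \<theta>" .
    have i: "m \<bullet> (t + c *\<^sub>R z) = (m \<bullet> m) / \<theta> + c * (m \<bullet> z)"
      by (simp add: t_def inner_add_right)
    show ?thesis unfolding n i unfolding power2_norm_eq_inner using assms(1)
      by (simp add: field_simps power2_eq_square)
  qed
  \<comment> \<open>The Jacobian of the substitution is the power -n/2 of \<theta>.\<close>
  have pw: "c ^ CARD('n) = \<theta> powr (- real CARD('n) / 2)"
  proof -
    have "c = \<theta> powr (- 1 / 2)"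
      using assms(1) by (simp add: c_def powr_minus_divide powr_half_sqrt)
    then show ?thesis using assms(1) c(1) by (simp add: powr_realpow[symmetric] powr_powr)
  qed
  have *: "\<bar>c\<bar> ^ CARD('n) * (gauss 1 (t + c *\<^sub>R z) * exp (m \<bullet> (t + c *\<^sub>R z) + (1 - \<theta>) * (norm (t + c *\<^sub>R z))\<^sup>2 / 2))
     = \<theta> powr (- real CARD('n) / 2) * exp ((norm m)\<^sup>2 / (2 * \<theta>)) * gauss 1 z" for z
  proof -
    have g: "gauss 1 w = k * exp (- (norm w)\<^sup>2 / 2)" for w :: "real ^ 'n" by (simp add: gauss_def k_def)
    have "gauss 1 (t + c *\<^sub>R z) * exp (m \<bullet> (t + c *\<^sub>R z) + (1 - \<theta>) * (norm (t + c *\<^sub>R z))\<^sup>2 / 2)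
      = k * exp (m \<bullet> (t + c *\<^sub>R z) + (1 - \<theta>) * (norm (t + c *\<^sub>R z))\<^sup>2 / 2 + - (norm (t + c *\<^sub>R z))\<^sup>2 / 2)"
      by (simp only: g exp_add mult_ac)
    also have "\<dots> = k * (exp ((norm m)\<^sup>2 / (2 * \<theta>)) * exp (- (norm z)\<^sup>2 / 2))"
      unfolding sq by (simp only: exp_add)
    finally show ?thesis unfolding g c pw by (simp only: mult_ac)
  qed
  have "(\<integral>\<^sup>+ z. ennreal (exp (m \<bullet> z + (1 - \<theta>) * (norm z)\<^sup>2 / 2)) * h z \<partial>gauss_measure)
    = (\<integral>\<^sup>+ z. ennreal (gauss 1 z * exp (m \<bullet> z + (1 - \<theta>) * (norm z)\<^sup>2 / 2)) * h z \<partial>lborel)"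
    by (subst nn_integral_gauss_measure) (auto simp: ennreal_mult' mult_ac intro!: nn_integral_cong)
  also have "\<dots> = (\<integral>\<^sup>+ z. ennreal (\<bar>c\<bar> ^ CARD('n)) * (ennreal (gauss 1 (t + c *\<^sub>R z) * exp (m \<bullet> (t + c *\<^sub>R z) + (1 - \<theta>) * (norm (t + c *\<^sub>R z))\<^sup>2 / 2)) * h (t + c *\<^sub>R z)) \<partial>lborel)"
    using c(1) by (subst nn_integral_lborel_scale[of c _ t]) (auto simp: nn_integral_cmult)
  also have "\<dots> = (\<integral>\<^sup>+ z. ennreal (\<theta> powr (- real CARD('n) / 2) * exp ((norm m)\<^sup>2 / (2 * \<theta>))) * (ennreal (gauss 1 z) * h (t + c *\<^sub>R z)) \<partial>lborel)"
    unfolding mult.assoc[symmetric]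
    by (subst (1 2) ennreal_mult[symmetric]) (simp_all only: *, auto)
  also have "\<dots> = ennreal (\<theta> powr (- real CARD('n) / 2) * exp ((norm m)\<^sup>2 / (2 * \<theta>)))
         * (\<integral>\<^sup>+ z. h (t + c *\<^sub>R z) \<partial>gauss_measure)"
    by (simp add: nn_integral_cmult nn_integral_gauss_measure)
  finally show ?thesis unfolding c_def t_def .
qed

lemma gauss_shift:
  fixes m :: "real ^ 'n"
  assumes "h \<in> borel_measurable borel"
  shows "(\<integral>\<^sup>+ z. ennreal (exp (m \<bullet> z)) * h z \<partial>gauss_measure)
      = ennreal (exp ((norm m)\<^sup>2 / 2)) * (\<integral>\<^sup>+ z. h (m + z) \<partial>gauss_measure)"
  using gauss_tilt[of 1 h m] assms by simp

text \<open>With z = a x + b y, each side is b^n times the joint density of (x, z), and that density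
  is symmetric in its arguments. This is the reversibility of the Ornstein-Uhlenbeck
  semigroup.\<close>

lemma gauss_mult_rotate:
  fixes x z :: "real ^ 'n"
  assumes "a\<^sup>2 + b\<^sup>2 = 1" "b > 0"
  shows "gauss 1 x * gauss 1 ((1 / b) *\<^sub>R (z - a *\<^sub>R x)) = gauss 1 z * gauss 1 ((1 / b) *\<^sub>R (x - a *\<^sub>R z))"
proof -
  have "(norm x)\<^sup>2 + (norm ((1 / b) *\<^sub>R (z - a *\<^sub>R x)))\<^sup>2 - ((norm z)\<^sup>2 + (norm ((1 / b) *\<^sub>R (x - a *\<^sub>R z)))\<^sup>2)
     = (x \<bullet> x - z \<bullet> z) * (b\<^sup>2 - 1 + a\<^sup>2) / b\<^sup>2"
    unfolding power2_norm_eq_inner using assms(2)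
    by (simp add: inner_diff_left inner_diff_right inner_commute field_simps power2_eq_square)
  also have "\<dots> = 0" using assms(1) by (simp add: algebra_simps)
  finally have *: "(norm x)\<^sup>2 + (norm ((1 / b) *\<^sub>R (z - a *\<^sub>R x)))\<^sup>2 = (norm z)\<^sup>2 + (norm ((1 / b) *\<^sub>R (x - a *\<^sub>R z)))\<^sup>2"
    by simp
  have **: "gauss 1 u * gauss 1 w = ((2 * pi) powr (- real CARD('n) / 2))\<^sup>2 * exp (- ((norm u)\<^sup>2 + (norm w)\<^sup>2) / 2)"
    for u w :: "real ^ 'n"
  proof -
    have "exp (- ((norm u)\<^sup>2 + (norm w)\<^sup>2) / 2) = exp (- (norm u)\<^sup>2 / 2) * exp (- (norm w)\<^sup>2 / 2)"
      by (simp add: exp_add[symmetric] field_simps)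
    then show ?thesis by (simp add: gauss_def power2_eq_square)
  qed
  show ?thesis by (simp only: ** *)
qed

text \<open>In the variables (x, z) with z = a x + b y, \<open>gauss_mult_rotate\<close> turns the
  weight into \<open>gauss 1 z\<close> times a Gaussian density in x centred at a z, whose total
  mass is 1.\<close>

lemma gauss_conv_unit:
  fixes h :: "real ^ 'n \<Rightarrow> ennreal"
  assumes "a\<^sup>2 + b\<^sup>2 = 1" "b > 0" and [measurable]: "h \<in> borel_measurable borel"
  shows "(\<integral>\<^sup>+ x. \<integral>\<^sup>+ y. h (a *\<^sub>R x + b *\<^sub>R y) \<partial>gauss_measure \<partial>gauss_measure) = (\<integral>\<^sup>+ z. h z \<partial>gauss_measure)"
proof -
  let ?N = "CARD('n)"
  have inner: "(\<integral>\<^sup>+ y. h (a *\<^sub>R x + b *\<^sub>R y) \<partial>gauss_measure)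
     = (\<integral>\<^sup>+ z. ennreal ((1 / b) ^ ?N * gauss 1 ((1 / b) *\<^sub>R (z - a *\<^sub>R x))) * h z \<partial>lborel)" for x
  proof -
    have "(\<integral>\<^sup>+ y. h (a *\<^sub>R x + b *\<^sub>R y) \<partial>gauss_measure) = (\<integral>\<^sup>+ y. ennreal (gauss 1 y) * h (a *\<^sub>R x + b *\<^sub>R y) \<partial>lborel)"
      by (simp add: nn_integral_gauss_measure)
    also have "\<dots> = ennreal (\<bar>1 / b\<bar> ^ ?N) * (\<integral>\<^sup>+ z. ennreal (gauss 1 (- (a / b) *\<^sub>R x + (1 / b) *\<^sub>R z)) * h (a *\<^sub>R x + b *\<^sub>R (- (a / b) *\<^sub>R x + (1 / b) *\<^sub>R z)) \<partial>lborel)"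
      using assms(2) by (subst nn_integral_lborel_scale[of "1 / b" _ "- (a / b) *\<^sub>R x"]) auto
    also have "\<dots> = ennreal ((1 / b) ^ ?N) * (\<integral>\<^sup>+ z. ennreal (gauss 1 ((1 / b) *\<^sub>R (z - a *\<^sub>R x))) * h z \<partial>lborel)"
      using assms(2) by (simp add: algebra_simps)
    also have "\<dots> = (\<integral>\<^sup>+ z. ennreal ((1 / b) ^ ?N * gauss 1 ((1 / b) *\<^sub>R (z - a *\<^sub>R x))) * h z \<partial>lborel)"
      using assms(2) by (simp add: ennreal_mult mult.assoc nn_integral_cmult)
    finally show ?thesis .
  qed
  have total: "(\<integral>\<^sup>+ x. ennreal ((1 / b) ^ ?N * gauss 1 ((1 / b) *\<^sub>R (x - a *\<^sub>R z))) \<partial>lborel) = 1" for z :: "real ^ 'n"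
  proof -
    have "(\<integral>\<^sup>+ x. ennreal ((1 / b) ^ ?N * gauss 1 ((1 / b) *\<^sub>R (x - a *\<^sub>R z))) \<partial>lborel)
      = ennreal ((1 / b) ^ ?N) * (\<integral>\<^sup>+ x. ennreal (gauss 1 ((1 / b) *\<^sub>R (x - a *\<^sub>R z))) \<partial>lborel)"
      using assms(2) by (simp add: ennreal_mult nn_integral_cmult)
    also have "\<dots> = ennreal ((1 / b) ^ ?N) * (ennreal (\<bar>b\<bar> ^ ?N) * (\<integral>\<^sup>+ x. ennreal (gauss 1 ((1 / b) *\<^sub>R ((a *\<^sub>R z + b *\<^sub>R x) - a *\<^sub>R z))) \<partial>lborel))"
      using assms(2) by (subst nn_integral_lborel_scale[of b _ "a *\<^sub>R z"]) auto
    also have "\<dots> = ennreal ((1 / b) ^ ?N * \<bar>b\<bar> ^ ?N)"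
      using assms(2) by (simp add: nn_integral_gauss ennreal_mult)
    also have "(1 / b) ^ ?N * \<bar>b\<bar> ^ ?N = 1"
      using assms(2) by (simp add: power_mult_distrib[symmetric])
    finally show ?thesis by simp
  qed
  have "(\<integral>\<^sup>+ x. \<integral>\<^sup>+ y. h (a *\<^sub>R x + b *\<^sub>R y) \<partial>gauss_measure \<partial>gauss_measure)
     = (\<integral>\<^sup>+ x. ennreal (gauss 1 x) * (\<integral>\<^sup>+ z. ennreal ((1 / b) ^ ?N * gauss 1 ((1 / b) *\<^sub>R (z - a *\<^sub>R x))) * h z \<partial>lborel) \<partial>lborel)"
    unfolding inner by (subst nn_integral_gauss_measure) auto
  also have "\<dots> = (\<integral>\<^sup>+ x. (\<integral>\<^sup>+ z. ennreal ((1 / b) ^ ?N * (gauss 1 x * gauss 1 ((1 / b) *\<^sub>R (z - a *\<^sub>R x)))) * h z \<partial>lborel) \<partial>lborel)"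
    using assms(2)
    by (subst nn_integral_cmult[symmetric]) (auto intro!: nn_integral_cong simp: ennreal_mult mult_ac)
  also have "\<dots> = (\<integral>\<^sup>+ z. (\<integral>\<^sup>+ x. ennreal ((1 / b) ^ ?N * (gauss 1 x * gauss 1 ((1 / b) *\<^sub>R (z - a *\<^sub>R x)))) * h z \<partial>lborel) \<partial>lborel)"
    by (intro lborel_pair.Fubini') measurable
  also have "\<dots> = (\<integral>\<^sup>+ z. (\<integral>\<^sup>+ x. ennreal ((1 / b) ^ ?N * gauss 1 ((1 / b) *\<^sub>R (x - a *\<^sub>R z))) * (ennreal (gauss 1 z) * h z) \<partial>lborel) \<partial>lborel)"
    unfolding gauss_mult_rotate[OF assms(1,2)] using assms(2)
    by (intro nn_integral_cong) (simp add: ennreal_mult mult_ac)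
  also have "\<dots> = (\<integral>\<^sup>+ z. ennreal (gauss 1 z) * h z \<partial>lborel)"
    by (subst nn_integral_multc) (auto simp: total)
  also have "\<dots> = (\<integral>\<^sup>+ z. h z \<partial>gauss_measure)"
    by (simp add: nn_integral_gauss_measure)
  finally show ?thesis .
qed

lemma gauss_conv:
  fixes h :: "real ^ 'n \<Rightarrow> ennreal"
  assumes c: "a\<^sup>2 + b\<^sup>2 = c\<^sup>2" "b > 0" "c > 0" and [measurable]: "h \<in> borel_measurable borel"
  shows "(\<integral>\<^sup>+ x. \<integral>\<^sup>+ y. h (a *\<^sub>R x + b *\<^sub>R y) \<partial>gauss_measure \<partial>gauss_measure) = (\<integral>\<^sup>+ z. h (c *\<^sub>R z) \<partial>gauss_measure)"
proof -
  have "(a / c)\<^sup>2 + (b / c)\<^sup>2 = 1"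
    using c by (simp add: power_divide add_divide_distrib[symmetric])
  then have "(\<integral>\<^sup>+ x. \<integral>\<^sup>+ y. h (c *\<^sub>R ((a / c) *\<^sub>R x + (b / c) *\<^sub>R y)) \<partial>gauss_measure \<partial>gauss_measure) = (\<integral>\<^sup>+ z. h (c *\<^sub>R z) \<partial>gauss_measure)"
    using c by (intro gauss_conv_unit) auto
  then show ?thesis using c by (simp add: scaleR_add_right)
qed

lemma gauss_conv_distr:
  assumes c: "a\<^sup>2 + b\<^sup>2 = c\<^sup>2" "b > 0" "c > 0"
  shows "distr (gauss_measure \<Otimes>\<^sub>M gauss_measure) borel (\<lambda>(x, y). a *\<^sub>R x + b *\<^sub>R y)
       = distr gauss_measure borel (\<lambda>z :: real ^ 'n. c *\<^sub>R z)" (is "?L = ?R")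
proof (rule measure_eqI)
  fix A :: "(real ^ 'n) set" assume "A \<in> sets ?L"
  then have [measurable]: "A \<in> sets borel" by simp
  have "emeasure ?L A = (\<integral>\<^sup>+ w. indicator A w \<partial>?L)" by simp
  also have "\<dots> = (\<integral>\<^sup>+ w. indicator A (case w of (x, y) \<Rightarrow> a *\<^sub>R x + b *\<^sub>R y) \<partial>(gauss_measure \<Otimes>\<^sub>M gauss_measure))"
    by (subst nn_integral_distr) auto
  also have "\<dots> = (\<integral>\<^sup>+ x. \<integral>\<^sup>+ y. indicator A (a *\<^sub>R x + b *\<^sub>R y) \<partial>gauss_measure \<partial>gauss_measure)"
    by (subst G.nn_integral_fst[symmetric]) auto
  also have "\<dots> = (\<integral>\<^sup>+ z. indicator A (c *\<^sub>R z) \<partial>gauss_measure)"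
    by (intro gauss_conv c) auto
  also have "\<dots> = emeasure ?R A"
    by (subst nn_integral_indicator[symmetric], simp, subst nn_integral_distr) auto
  finally show "emeasure ?L A = emeasure ?R A" .
qed simp

section \<open>Exponential and polynomial moments\<close>

lemma emeasure_gauss_UNIV [simp]: "emeasure (gauss_measure :: (real ^ 'n) measure) UNIV = 1"
  using prob_space.emeasure_space_1[OF prob_space_gauss_measure] by simp

lemma nn_integral_exp_gauss:
  "(\<integral>\<^sup>+ z. ennreal (exp (m \<bullet> z)) \<partial>(gauss_measure :: (real ^ 'n) measure)) = ennreal (exp ((norm m)\<^sup>2 / 2))"
  using gauss_shift[of "\<lambda>_. 1" m] by simp

lemma integrable_exp_gauss [simp, intro]:
  "integrable (gauss_measure :: (real ^ 'n) measure) (\<lambda>z. exp (m \<bullet> z))"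
  by (intro integrableI_nonneg) (auto simp: nn_integral_exp_gauss)

lemma integral_exp_gauss:
  "(\<integral> z. exp (m \<bullet> z) \<partial>(gauss_measure :: (real ^ 'n) measure)) = exp ((norm m)\<^sup>2 / 2)"
  by (subst integral_eq_nn_integral) (auto simp: nn_integral_exp_gauss)

lemma integrable_exp_norm_sq_gauss:
  assumes "c < 1 / 2"
  shows "integrable (gauss_measure :: (real ^ 'n) measure) (\<lambda>z. exp (c * (norm z)\<^sup>2))"
proof (intro integrableI_nonneg)
  have "(\<integral>\<^sup>+ z. ennreal (exp (c * (norm z)\<^sup>2)) \<partial>(gauss_measure :: (real ^ 'n) measure))
    = ennreal ((1 - 2 * c) powr (- real CARD('n) / 2))"
    using gauss_tilt[of "1 - 2 * c" "\<lambda>_. 1" "0 :: real ^ 'n"] assms by simp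
  then show "(\<integral>\<^sup>+ z. ennreal (exp (c * (norm z)\<^sup>2)) \<partial>(gauss_measure :: (real ^ 'n) measure)) < \<infinity>"
    by simp
qed auto

text \<open>From t^k / k! <= e^t and (t/2 - 1)^2 >= 0. The coefficient 1/4 lies below the threshold
  1/2 of \<open>integrable_exp_norm_sq_gauss\<close>, which makes all moments finite.\<close>

lemma power_le_exp_square:
  fixes t :: real
  assumes "t \<ge> 0"
  shows "t ^ k \<le> fact k * exp 1 * exp (1 / 4 * t\<^sup>2)"
proof -
  have "t ^ k / fact k \<le> exp t"
  proof -
    have "(\<Sum>i\<in>{k}. t ^ i /\<^sub>R fact i) \<le> exp t"
      unfolding exp_def using assms summable_exp_generic[of t] by (intro sum_le_suminf) auto
    then show ?thesis by (simp add: divide_inverse mult.commute)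
  qed
  also have "\<dots> \<le> exp (1 + 1 / 4 * t\<^sup>2)"
    using sum_squares_ge_zero[of "t / 2 - 1" 0] by (simp add: power2_eq_square algebra_simps)
  finally show ?thesis unfolding exp_add by (simp add: field_simps)
qed

lemma integrable_norm_power_gauss [simp, intro]:
  "integrable (gauss_measure :: (real ^ 'n) measure) (\<lambda>z. norm z ^ k)"
proof (rule Bochner_Integration.integrable_bound)
  show "integrable (gauss_measure :: (real ^ 'n) measure) (\<lambda>z. fact k * exp 1 * exp (1 / 4 * (norm z)\<^sup>2))"
    by (intro integrable_mult_right integrable_exp_norm_sq_gauss) auto
  show "AE x in gauss_measure. norm (norm (x :: real ^ 'n) ^ k) \<le> norm (fact k * exp 1 * exp (1 / 4 * (norm x)\<^sup>2) :: real)"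
  proof (rule AE_I2)
    fix x :: "real ^ 'n"
    have "norm x ^ k \<le> fact k * exp 1 * exp (1 / 4 * (norm x)\<^sup>2)" by (intro power_le_exp_square) auto
    then show "norm (norm x ^ k) \<le> norm (fact k * exp 1 * exp (1 / 4 * (norm x)\<^sup>2) :: real)"
      by simp
  qed
qed auto

lemma distr_uminus_gauss: "distr gauss_measure borel uminus = (gauss_measure :: (real ^ 'n) measure)"
proof (rule measure_eqI)
  fix A :: "(real ^ 'n) set" assume "A \<in> sets (distr gauss_measure borel uminus)"
  then have [measurable]: "A \<in> sets borel" by simp
  have "emeasure (distr gauss_measure borel uminus) A = (\<integral>\<^sup>+ w. indicator A w \<partial>distr gauss_measure borel uminus)"
    by simp
  also have "\<dots> = (\<integral>\<^sup>+ w. indicator A (- w) \<partial>gauss_measure)"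
    by (subst nn_integral_distr) auto
  also have "\<dots> = (\<integral>\<^sup>+ w. ennreal (gauss 1 w) * indicator A (- w) \<partial>lborel)"
    by (simp add: nn_integral_gauss_measure)
  also have "\<dots> = (\<integral>\<^sup>+ w. ennreal (gauss 1 w) * indicator A w \<partial>lborel)"
    by (subst nn_integral_lborel_scale[of "-1" _ 0]) (auto simp: gauss_def)
  also have "\<dots> = (\<integral>\<^sup>+ w. indicator A w \<partial>gauss_measure)"
    by (rule nn_integral_gauss_measure[symmetric]) measurable
  finally show "emeasure (distr gauss_measure borel uminus) A = emeasure gauss_measure A" by simp
qed simp

lemma integrable_inner_gauss [simp, intro]:
  "integrable (gauss_measure :: (real ^ 'n) measure) (\<lambda>z. l \<bullet> z)"
proof (rule Bochner_Integration.integrable_bound)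
  show "integrable (gauss_measure :: (real ^ 'n) measure) (\<lambda>z. norm l * norm z ^ 1)" by (intro integrable_mult_right integrable_norm_power_gauss)
qed (auto intro!: Cauchy_Schwarz_ineq2)

lemma integral_inner_gauss [simp]: "(\<integral> z. l \<bullet> z \<partial>(gauss_measure :: (real ^ 'n) measure)) = 0"
proof -
  have "(\<integral> z. l \<bullet> z \<partial>(gauss_measure :: (real ^ 'n) measure)) = (\<integral> z. l \<bullet> z \<partial>(distr gauss_measure borel uminus))"
    by (simp add: distr_uminus_gauss)
  also have "\<dots> = - (\<integral> z. l \<bullet> z \<partial>(gauss_measure :: (real ^ 'n) measure))"
    by (subst integral_distr) auto
  finally show ?thesis by simp
qed

lemma integrable_inner_sq_gauss [simp, intro]:
  "integrable (gauss_measure :: (real ^ 'n) measure) (\<lambda>z. (l \<bullet> z) * (l' \<bullet> z))"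
proof (rule Bochner_Integration.integrable_bound)
  show "integrable (gauss_measure :: (real ^ 'n) measure) (\<lambda>z. norm l * norm l' * norm z ^ 2)" by auto
  show "AE z in gauss_measure. norm ((l \<bullet> z) * (l' \<bullet> z)) \<le> norm (norm l * norm l' * norm (z :: real ^ 'n) ^ 2)"
    using mult_mono[OF Cauchy_Schwarz_ineq2 Cauchy_Schwarz_ineq2, of l _ l' _]
    by (auto simp: abs_mult power2_eq_square mult_ac)
qed auto

lemma abs_sinh_le: "\<bar>sinh y\<bar> \<le> \<bar>y\<bar> * cosh (y :: real)"
proof -
  have *: "sinh y \<le> y * cosh y" if y: "y \<ge> 0" for y :: real
  proof -
    have "(\<lambda>y. y * cosh y - sinh y) 0 \<le> (\<lambda>y. y * cosh y - sinh y) y"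
    proof (rule DERIV_nonneg_imp_nondecreasing[OF y])
      fix x :: real assume "0 \<le> x"
      then show "\<exists>d. ((\<lambda>y. y * cosh y - sinh y) has_real_derivative d) (at x) \<and> 0 \<le> d"
        by (intro exI[of _ "x * sinh x"] conjI) (auto intro!: derivative_eq_intros)
    qed
    then show ?thesis by simp
  qed
  show ?thesis using *[of y] *[of "- y"] by (cases "y \<ge> 0") auto
qed

text \<open>The second difference is k^2 (2 sinh(X/(2k)))^2, and |sinh y| <= |y| cosh y cancels the
  factor k^2. The majorant is free of k and Gaussian integrable when X is linear.\<close>

lemma second_difference_exp_bound:
  fixes X :: real
  assumes "k \<ge> 1"
  shows "\<bar>k\<^sup>2 * (exp (X / k) + exp (- X / k) - 2)\<bar> \<le> 2 * (exp (2 * X) + exp (- 2 * X))"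
proof -
  have e: "exp (X / k) + exp (- X / k) - 2 = (2 * sinh (X / (2 * k)))\<^sup>2"
    by (simp add: sinh_def power2_eq_square algebra_simps exp_add[symmetric] field_simps)
  have "\<bar>k\<^sup>2 * (exp (X / k) + exp (- X / k) - 2)\<bar> = (k * (2 * \<bar>sinh (X / (2 * k))\<bar>))\<^sup>2"
    unfolding e by (simp add: power_mult_distrib)
  also have "\<dots> \<le> (k * (2 * (\<bar>X / (2 * k)\<bar> * cosh (X / (2 * k)))))\<^sup>2"
    using assms by (intro power_mono mult_left_mono abs_sinh_le) auto
  also have "\<dots> = (\<bar>X\<bar> * cosh (X / (2 * k)))\<^sup>2"
    using assms by (simp add: abs_mult)
  also have "\<dots> \<le> (exp \<bar>X\<bar>)\<^sup>2"
  proof (intro power_mono)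
    have "cosh (X / (2 * k)) \<le> exp (\<bar>X\<bar> / 2)"
    proof -
      have "exp (X / (2 * k)) \<le> exp \<bar>X / (2 * k)\<bar>" "exp (- (X / (2 * k))) \<le> exp \<bar>X / (2 * k)\<bar>"
        unfolding exp_le_cancel_iff by (rule abs_ge_self, rule abs_ge_minus_self)
      moreover have "(A + B) / 2 \<le> E" if "A \<le> E" "B \<le> E" for A B E :: real
        using that by simp
      ultimately have "cosh (X / (2 * k)) \<le> exp \<bar>X / (2 * k)\<bar>" unfolding cosh_field_def by blast
      also have "\<dots> = exp (\<bar>X\<bar> / (2 * k))" using assms by simp
      also have "\<dots> \<le> exp (\<bar>X\<bar> / 2)"
        using assms mult_left_mono[of 1 k "\<bar>X\<bar>"] by (simp add: field_simps)
      finally show ?thesis .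
    qed
    moreover have "\<bar>X\<bar> \<le> exp (\<bar>X\<bar> / 2)"
    proof -
      have "\<bar>X\<bar> \<le> (1 + \<bar>X\<bar> / 4)\<^sup>2" using zero_le_power2[of "1 - \<bar>X\<bar> / 4"] by (simp add: power2_eq_square algebra_simps)
      also have "\<dots> \<le> (exp (\<bar>X\<bar> / 4))\<^sup>2" by (intro power_mono exp_ge_add_one_self) auto
      also have "\<dots> = exp (\<bar>X\<bar> / 2)" by (simp add: power2_eq_square exp_add[symmetric])
      finally show ?thesis .
    qed
    ultimately have "\<bar>X\<bar> * cosh (X / (2 * k)) \<le> exp (\<bar>X\<bar> / 2) * exp (\<bar>X\<bar> / 2)"
      by (intro mult_mono) (auto simp: cosh_real_nonneg)
    then show "\<bar>X\<bar> * cosh (X / (2 * k)) \<le> exp \<bar>X\<bar>" by (simp add: exp_add[symmetric])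
  qed (auto simp: cosh_real_nonneg)
  also have "\<dots> = exp (2 * \<bar>X\<bar>)" by (simp add: power2_eq_square exp_add[symmetric])
  also have "\<dots> \<le> 2 * (exp (2 * X) + exp (- 2 * X))"
    using exp_gt_zero[of "2 * X"] exp_gt_zero[of "-2 * X"] by (cases "X \<ge> 0") (auto simp del: exp_gt_zero)
  finally show ?thesis .
qed

text \<open>The second moment is the second derivative at 0 of the exponential moment, taken as a
  limit of second differences with step 1/(k + 1) under dominated convergence.\<close>

lemma integral_inner_sq_gauss: "(\<integral> z. (l \<bullet> z)\<^sup>2 \<partial>(gauss_measure :: (real ^ 'n) measure)) = (norm l)\<^sup>2"
proof -
  let ?s = "\<lambda>k::nat. \<lambda>z :: real ^ 'n. (real (Suc k))\<^sup>2 * (exp ((l \<bullet> z) / Suc k) + exp (- (l \<bullet> z) / Suc k) - 2)"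
  have lim: "(\<lambda>k. \<integral> z. ?s k z \<partial>gauss_measure) \<longlonglongrightarrow> (\<integral> z. (l \<bullet> z)\<^sup>2 \<partial>(gauss_measure :: (real ^ 'n) measure))"
  proof (rule integral_dominated_convergence)
    show "integrable (gauss_measure :: (real ^ 'n) measure) (\<lambda>z. 2 * (exp ((2 *\<^sub>R l) \<bullet> z) + exp ((- 2 *\<^sub>R l) \<bullet> z)))"
      by (intro integrable_mult_right Bochner_Integration.integrable_add integrable_exp_gauss)
    show "AE z in gauss_measure. (\<lambda>k. ?s k z) \<longlonglongrightarrow> (l \<bullet> z)\<^sup>2"
    proof (rule AE_I2)
      fix z :: "real ^ 'n"
      have "(\<lambda>k. (real (Suc k))\<^sup>2 * (exp (X / Suc k) + exp (- X / Suc k) - 2)) \<longlonglongrightarrow> X * X" for X :: real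
        by real_asymp
      from this[of "l \<bullet> z"] show "(\<lambda>k. ?s k z) \<longlonglongrightarrow> (l \<bullet> z)\<^sup>2"
        by (simp add: power2_eq_square)
    qed
    show "AE z in gauss_measure. norm (?s k z) \<le> 2 * (exp ((2 *\<^sub>R l) \<bullet> z) + exp ((- 2 *\<^sub>R l) \<bullet> z))" for k
      using second_difference_exp_bound[of "real (Suc k)" "l \<bullet> _"] by simp
  qed auto
  have i: "(\<integral> z. ?s k z \<partial>gauss_measure) = (real (Suc k))\<^sup>2 * (2 * exp ((norm l)\<^sup>2 / (2 * (real (Suc k))\<^sup>2)) - 2)" for k
  proof -
    define c where "c = 1 / real (Suc k)"
    have "(\<integral> z. ?s k z \<partial>gauss_measure) = (\<integral> z. (real (Suc k))\<^sup>2 * (exp ((c *\<^sub>R l) \<bullet> z) + exp ((- c *\<^sub>R l) \<bullet> z) - 2) \<partial>gauss_measure)"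
      by (simp add: c_def)
    also have "\<dots> = (real (Suc k))\<^sup>2 * (\<integral> z. exp ((c *\<^sub>R l) \<bullet> z) + exp ((- c *\<^sub>R l) \<bullet> z) - 2 \<partial>gauss_measure)"
      by (rule Bochner_Integration.integral_mult_right_zero)
    also have "(\<integral> z. exp ((c *\<^sub>R l) \<bullet> z) + exp ((- c *\<^sub>R l) \<bullet> z) - 2 \<partial>(gauss_measure :: (real ^ 'n) measure))
       = (\<integral> z. exp ((c *\<^sub>R l) \<bullet> z) \<partial>gauss_measure) + (\<integral> z. exp ((- c *\<^sub>R l) \<bullet> z) \<partial>gauss_measure) - 2"
      by (subst Bochner_Integration.integral_diff, intro Bochner_Integration.integrable_add integrable_exp_gauss, simp,
          subst Bochner_Integration.integral_add, (rule integrable_exp_gauss)+, simp add: measure_def)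
    also have "\<dots> = 2 * exp (c\<^sup>2 * (norm l)\<^sup>2 / 2) - 2"
      unfolding integral_exp_gauss by (simp add: power_mult_distrib)
    finally show ?thesis by (simp add: c_def power_divide)
  qed
  have "(\<lambda>k. (real (Suc k))\<^sup>2 * (2 * exp ((norm l)\<^sup>2 / (2 * (real (Suc k))\<^sup>2)) - 2)) \<longlonglongrightarrow> (norm l)\<^sup>2"
    by real_asymp
  with lim[unfolded i] show ?thesis by (rule LIMSEQ_unique)
qed

text \<open>Polarization of \<open>integral_inner_sq_gauss\<close>.\<close>

lemma integral_inner_mult_gauss:
  "(\<integral> z. (l \<bullet> z) * (l' \<bullet> z) \<partial>(gauss_measure :: (real ^ 'n) measure)) = l \<bullet> l'"
proof -
  have "(\<integral> z. ((l + l') \<bullet> z)\<^sup>2 \<partial>(gauss_measure :: (real ^ 'n) measure))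
     = (\<integral> z. (l \<bullet> z) * (l \<bullet> z) + 2 * ((l \<bullet> z) * (l' \<bullet> z)) + (l' \<bullet> z) * (l' \<bullet> z) \<partial>gauss_measure)"
    by (intro Bochner_Integration.integral_cong) (auto simp: inner_add_left power2_eq_square algebra_simps)
  also have "\<dots> = (norm l)\<^sup>2 + 2 * (\<integral> z. (l \<bullet> z) * (l' \<bullet> z) \<partial>gauss_measure) + (norm l')\<^sup>2"
    using integral_inner_sq_gauss[of l] integral_inner_sq_gauss[of l']
    by (simp add: power2_eq_square)
  finally show ?thesis
    unfolding integral_inner_sq_gauss using dot_norm[of l l'] by simp
qed

section \<open>A Gaussian Jensen inequality\<close>

lemma powr_taylor2:
  fixes m M a :: real
  assumes "0 < m"
  obtains C where "C \<ge> 0" "\<And>u u'. \<lbrakk>m \<le> u; u \<le> M; m \<le> u'; u' \<le> M\<rbrakk> \<Longrightarrow>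
    \<bar>u' powr a - (u powr a + a * u powr (a - 1) * (u' - u) + a * (a - 1) / 2 * u powr (a - 2) * (u' - u)\<^sup>2)\<bar>
      \<le> C * \<bar>u' - u\<bar> ^ 3"
proof -
  \<comment> \<open>\<open>D k\<close> is the k-th derivative of x powr a for k <= 3, the only
    indices that Taylor's formula of order 3 evaluates; 3! = 6 enters \<open>C\<close>.\<close>
  define D where "D = (\<lambda>k::nat. \<lambda>x::real. if k = 0 then x powr a else if k = 1 then a * x powr (a - 1)
     else if k = 2 then a * (a - 1) * x powr (a - 2) else a * (a - 1) * (a - 2) * x powr (a - 3))"
  have "continuous_on {m..M} (\<lambda>x. D 3 x)"
    using assms by (auto simp: D_def intro!: continuous_intros)
  then have "bounded ((\<lambda>x. D 3 x) ` {m..M})"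
    by (intro compact_imp_bounded compact_continuous_image) auto
  then obtain B where B: "\<And>x. x \<in> {m..M} \<Longrightarrow> \<bar>D 3 x\<bar> \<le> B"
    unfolding bounded_iff by force
  define C where "C = max B 0 / 6"
  have "\<bar>u' powr a - (u powr a + a * u powr (a - 1) * (u' - u) + a * (a - 1) / 2 * u powr (a - 2) * (u' - u)\<^sup>2)\<bar>
      \<le> C * \<bar>u' - u\<bar> ^ 3" if u: "m \<le> u" "u \<le> M" "m \<le> u'" "u' \<le> M" for u u'
  proof (cases "u' = u")
    case False
    have "\<exists>t. (if u' < u then u' < t \<and> t < u else u < t \<and> t < u') \<and>
      u' powr a = (\<Sum>k<3. D k u / fact k * (u' - u) ^ k) + D 3 t / fact 3 * (u' - u) ^ 3"
    proof (rule Taylor[where a = m and b = M])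
      show "\<forall>k t. k < 3 \<and> m \<le> t \<and> t \<le> M \<longrightarrow> DERIV (D k) t :> D (Suc k) t"
      proof (intro allI impI)
        fix k :: nat and t assume *: "k < 3 \<and> m \<le> t \<and> t \<le> M"
        then have t: "t > 0" using assms by auto
        have pw: "((\<lambda>x. c * x powr d) has_real_derivative (c * d) * t powr (d - 1)) (at t)" for c d
          using DERIV_cmult[OF has_real_derivative_powr[OF t, of d], of c] by (simp add: mult_ac)
        have D: "D 0 = (\<lambda>x. 1 * x powr a)" "D 1 = (\<lambda>x. a * x powr (a - 1))"
          "D 2 = (\<lambda>x. (a * (a - 1)) * x powr (a - 2))" "D 3 = (\<lambda>x. (a * (a - 1) * (a - 2)) * x powr (a - 3))"
          by (auto simp: D_def)
        have s: "Suc 0 = 1" "Suc 1 = 2" "Suc 2 = 3" and e: "a - 1 - 1 = a - 2" "a - 2 - 1 = a - 3" by auto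
        consider "k = 0" | "k = 1" | "k = 2" using * by linarith
        then show "DERIV (D k) t :> D (Suc k) t"
        proof cases
          case 1 show ?thesis unfolding 1 s D using pw[of 1 a] by simp
        next
          case 2 show ?thesis unfolding 2 s D using pw[of a "a - 1"] unfolding e .
        next
          case 3 show ?thesis unfolding 3 s D using pw[of "a * (a - 1)" "a - 2"] unfolding e .
        qed
      qed
    qed (use u False in \<open>auto simp: D_def\<close>)
    then obtain t where "if u' < u then u' < t \<and> t < u else u < t \<and> t < u'"
      and t2: "u' powr a = (\<Sum>k<3. D k u / fact k * (u' - u) ^ k) + D 3 t / fact 3 * (u' - u) ^ 3"
      by blast
    then have t: "t \<in> {m..M}" using u by (auto split: if_splits)
    have "u' powr a - (u powr a + a * u powr (a - 1) * (u' - u) + a * (a - 1) / 2 * u powr (a - 2) * (u' - u)\<^sup>2)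
       = D 3 t / 6 * (u' - u) ^ 3"
      unfolding t2 by (simp add: D_def numeral_3_eq_3 fact_numeral power2_eq_square)
    moreover have "\<bar>D 3 t / 6 * (u' - u) ^ 3\<bar> \<le> C * \<bar>u' - u\<bar> ^ 3"
      unfolding abs_mult power_abs C_def using B[OF t] by (intro mult_right_mono) auto
    ultimately show ?thesis by (simp only:)
  qed simp
  moreover have "C \<ge> 0" by (simp add: C_def)
  ultimately show ?thesis by (rule that[rotated])
qed

lemma continuous_bounded_Icc:
  fixes f :: "real \<Rightarrow> real"
  assumes "continuous_on {m..M} f"
  obtains B where "B \<ge> 0" "\<And>x. m \<le> x \<Longrightarrow> x \<le> M \<Longrightarrow> \<bar>f x\<bar> \<le> B"
proof -
  have "bounded (f ` {m..M})"
    by (intro compact_imp_bounded compact_continuous_image assms) auto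
  then obtain B where "\<And>x. x \<in> {m..M} \<Longrightarrow> \<bar>f x\<bar> \<le> B"
    unfolding bounded_iff by force
  then show ?thesis by (intro that[of "max B 0"]) (auto simp: le_max_iff_disj)
qed

lemma cube_mixed_le:
  fixes x y :: real
  assumes "x \<ge> 0" "y \<ge> 0"
  shows "x * y\<^sup>2 \<le> x ^ 3 + y ^ 3" "x\<^sup>2 * y \<le> x ^ 3 + y ^ 3"
proof -
  have *: "u * v\<^sup>2 \<le> u ^ 3 + v ^ 3" if "u \<ge> 0" "v \<ge> 0" for u v :: real
  proof (cases "u \<le> v")
    case True
    then have "u * v\<^sup>2 \<le> v * v\<^sup>2" by (intro mult_right_mono) auto
    also have "\<dots> = v ^ 3" by (simp add: power2_eq_square power3_eq_cube)
    also have "\<dots> \<le> u ^ 3 + v ^ 3" using that by simp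
    finally show ?thesis .
  next
    case False
    then have "u * v\<^sup>2 \<le> u * u\<^sup>2" using that by (intro mult_left_mono power_mono) auto
    also have "\<dots> = u ^ 3" by (simp add: power2_eq_square power3_eq_cube)
    also have "\<dots> \<le> u ^ 3 + v ^ 3" using that by simp
    finally show ?thesis .
  qed
  show "x * y\<^sup>2 \<le> x ^ 3 + y ^ 3" using *[OF assms] .
  show "x\<^sup>2 * y \<le> x ^ 3 + y ^ 3" using *[OF assms(2,1)] by (simp add: mult.commute add.commute)
qed

text \<open>The expansion is taken relative to u^a v^b, in the ratios \<alpha>/u and \<beta>/v. In
  this form the second-order part is half the quadratic form with coefficients a(a - 1), 2ab, b(b -
  1), whose sign decides the Gaussian Jensen inequality.\<close>

lemma powr_mult_taylor2:
  fixes m M a b :: real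
  assumes "0 < m"
  obtains C where "C \<ge> 0" "\<And>u v \<alpha> \<beta>. \<lbrakk>m \<le> u; u \<le> M; m \<le> v; v \<le> M; m \<le> u + \<alpha>; u + \<alpha> \<le> M; m \<le> v + \<beta>; v + \<beta> \<le> M\<rbrakk> \<Longrightarrow>
    \<bar>(u + \<alpha>) powr a * (v + \<beta>) powr b - u powr a * v powr b * (1 + a * (\<alpha> / u) + b * (\<beta> / v)
       + a * (a - 1) / 2 * (\<alpha> / u)\<^sup>2 + a * b * (\<alpha> / u) * (\<beta> / v) + b * (b - 1) / 2 * (\<beta> / v)\<^sup>2)\<bar>
      \<le> C * (\<bar>\<alpha>\<bar> ^ 3 + \<bar>\<beta>\<bar> ^ 3)"
proof -
  obtain C1 where C1: "C1 \<ge> 0" "\<And>u u'. \<lbrakk>m \<le> u; u \<le> M; m \<le> u'; u' \<le> M\<rbrakk> \<Longrightarrow>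
    \<bar>u' powr a - (u powr a + a * u powr (a - 1) * (u' - u) + a * (a - 1) / 2 * u powr (a - 2) * (u' - u)\<^sup>2)\<bar>
      \<le> C1 * \<bar>u' - u\<bar> ^ 3" using powr_taylor2[OF assms, of M a] by metis
  obtain C2 where C2: "C2 \<ge> 0" "\<And>u u'. \<lbrakk>m \<le> u; u \<le> M; m \<le> u'; u' \<le> M\<rbrakk> \<Longrightarrow>
    \<bar>u' powr b - (u powr b + b * u powr (b - 1) * (u' - u) + b * (b - 1) / 2 * u powr (b - 2) * (u' - u)\<^sup>2)\<bar>
      \<le> C2 * \<bar>u' - u\<bar> ^ 3" using powr_taylor2[OF assms, of M b] by metis
  have bd: "\<exists>B\<ge>0. \<forall>x. m \<le> x \<longrightarrow> x \<le> M \<longrightarrow> \<bar>c * x powr d\<bar> \<le> B" for c d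
  proof -
    have "continuous_on {m..M} (\<lambda>x. c * x powr d)"
      using assms by (auto intro!: continuous_intros)
    then show ?thesis by (metis continuous_bounded_Icc)
  qed
  obtain B0 where B0: "B0 \<ge> 0" "\<And>x. m \<le> x \<Longrightarrow> x \<le> M \<Longrightarrow> \<bar>1 * x powr b\<bar> \<le> B0" using bd[of 1 b] by blast
  obtain A0 where A0: "A0 \<ge> 0" "\<And>x. m \<le> x \<Longrightarrow> x \<le> M \<Longrightarrow> \<bar>1 * x powr a\<bar> \<le> A0" using bd[of 1 a] by blast
  obtain A1 where A1: "A1 \<ge> 0" "\<And>x. m \<le> x \<Longrightarrow> x \<le> M \<Longrightarrow> \<bar>a * x powr (a - 1)\<bar> \<le> A1" using bd[of a "a - 1"] by blast
  obtain A2 where A2: "A2 \<ge> 0" "\<And>x. m \<le> x \<Longrightarrow> x \<le> M \<Longrightarrow> \<bar>(a * (a - 1) / 2) * x powr (a - 2)\<bar> \<le> A2" using bd[of "a * (a - 1) / 2" "a - 2"] by blast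
  obtain B1 where B1: "B1 \<ge> 0" "\<And>x. m \<le> x \<Longrightarrow> x \<le> M \<Longrightarrow> \<bar>b * x powr (b - 1)\<bar> \<le> B1" using bd[of b "b - 1"] by blast
  obtain B2 where B2: "B2 \<ge> 0" "\<And>x. m \<le> x \<Longrightarrow> x \<le> M \<Longrightarrow> \<bar>(b * (b - 1) / 2) * x powr (b - 2)\<bar> \<le> B2" using bd[of "b * (b - 1) / 2" "b - 2"] by blast
  \<comment> \<open>The five summands of \<open>C\<close>: the remainder of the first factor times
    the second factor, the second-order polynomial (bounded by \<open>T\<close>) times the remainder
    of the second factor, and the three products of Taylor terms of total degree 3 or 4.
    \<open>N\<close> bounds the increments and absorbs the extra degree of the last product.\<close>
  define N where "N = \<bar>M - m\<bar>"
  define T where "T = A0 + A1 * N + A2 * N\<^sup>2"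
  define C where "C = C1 * B0 + T * C2 + A1 * B2 + A2 * B1 + A2 * B2 * N"
  have N: "N \<ge> 0" by (simp add: N_def)
  have T: "T \<ge> 0" unfolding T_def using A0(1) A1(1) A2(1) N by auto
  have "\<bar>(u + \<alpha>) powr a * (v + \<beta>) powr b - u powr a * v powr b * (1 + a * (\<alpha> / u) + b * (\<beta> / v)
       + a * (a - 1) / 2 * (\<alpha> / u)\<^sup>2 + a * b * (\<alpha> / u) * (\<beta> / v) + b * (b - 1) / 2 * (\<beta> / v)\<^sup>2)\<bar>
      \<le> C * (\<bar>\<alpha>\<bar> ^ 3 + \<bar>\<beta>\<bar> ^ 3)"
    if u: "m \<le> u" "u \<le> M" and v: "m \<le> v" "v \<le> M"
      and u': "m \<le> u + \<alpha>" "u + \<alpha> \<le> M" and v': "m \<le> v + \<beta>" "v + \<beta> \<le> M" for u v \<alpha> \<beta>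
  proof -
    define p1 where "p1 = a * u powr (a - 1)"
    define p2 where "p2 = a * (a - 1) / 2 * u powr (a - 2)"
    define r1 where "r1 = b * v powr (b - 1)"
    define r2 where "r2 = b * (b - 1) / 2 * v powr (b - 2)"
    define p0 where "p0 = u powr a"
    define r0 where "r0 = v powr b"
    define P where "P = (u + \<alpha>) powr a"
    define R where "R = (v + \<beta>) powr b"
    define x where "x = \<bar>\<alpha>\<bar>"
    define y where "y = \<bar>\<beta>\<bar>"
    have xy: "0 \<le> x" "0 \<le> y" "x \<le> N" "y \<le> N" using u u' v v' by (auto simp: x_def y_def N_def)
    have pos: "u > 0" "v > 0" using u v assms by auto
    have bnd: "\<bar>p0\<bar> \<le> A0" "\<bar>p1\<bar> \<le> A1" "\<bar>p2\<bar> \<le> A2" "\<bar>r1\<bar> \<le> B1" "\<bar>r2\<bar> \<le> B2" "\<bar>R\<bar> \<le> B0"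
      using A0(2)[OF u] A1(2)[OF u] A2(2)[OF u] B1(2)[OF v] B2(2)[OF v] B0(2)[OF v']
      by (simp_all add: p0_def p1_def p2_def r1_def r2_def R_def)
    have eP: "\<bar>P - (p0 + p1 * \<alpha> + p2 * \<alpha>\<^sup>2)\<bar> \<le> C1 * x ^ 3"
      using C1(2)[OF u u'] by (simp add: P_def p0_def p1_def p2_def x_def)
    have eR: "\<bar>R - (r0 + r1 * \<beta> + r2 * \<beta>\<^sup>2)\<bar> \<le> C2 * y ^ 3"
      using C2(2)[OF v v'] by (simp add: R_def r0_def r1_def r2_def y_def)
    have q: "\<bar>p0 + p1 * \<alpha> + p2 * \<alpha>\<^sup>2\<bar> \<le> T"
    proof -
      have "\<bar>p0 + p1 * \<alpha> + p2 * \<alpha>\<^sup>2\<bar> \<le> \<bar>p0\<bar> + \<bar>p1\<bar> * x + \<bar>p2\<bar> * x\<^sup>2"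
        unfolding x_def power2_abs[symmetric, of \<alpha>] abs_mult[symmetric]
        by (intro order_trans[OF abs_triangle_ineq] add_mono) (simp_all add: abs_mult)
      also have "\<dots> \<le> T" unfolding T_def
        
          by (rule add_mono[OF add_mono[OF bnd(1) mult_mono[OF bnd(2) xy(3)]] mult_mono[OF bnd(3) power_mono[OF xy(3)]]])
            (use xy A1(1) A2(1) in auto)
      finally show ?thesis .
    qed
    have main: "u powr a * v powr b * (1 + a * (\<alpha> / u) + b * (\<beta> / v)
       + a * (a - 1) / 2 * (\<alpha> / u)\<^sup>2 + a * b * (\<alpha> / u) * (\<beta> / v) + b * (b - 1) / 2 * (\<beta> / v)\<^sup>2)
      = p0 * r0 + p1 * r0 * \<alpha> + p0 * r1 * \<beta> + p2 * r0 * \<alpha>\<^sup>2 + p1 * r1 * \<alpha> * \<beta> + p0 * r2 * \<beta>\<^sup>2"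
    proof -
      have d: "u powr (a - 1) = u powr a / u" "u powr (a - 2) = u powr a / (u * u)"
         "v powr (b - 1) = v powr b / v" "v powr (b - 2) = v powr b / (v * v)"
        using pos by (simp_all add: powr_diff powr_numeral power2_eq_square)
      define X where "X = \<alpha> / u"
      define Y where "Y = \<beta> / v"
      have XY: "\<alpha> = X * u" "\<beta> = Y * v" using pos by (simp_all add: X_def Y_def)
      have k: "p1 * \<alpha> = a * p0 * X" "p2 * \<alpha>\<^sup>2 = a * (a - 1) / 2 * p0 * X\<^sup>2"
        "r1 * \<beta> = b * r0 * Y" "r2 * \<beta>\<^sup>2 = b * (b - 1) / 2 * r0 * Y\<^sup>2"
        using pos by (simp_all add: p0_def r0_def p1_def p2_def r1_def r2_def d XY power2_eq_square)
      have "p0 * r0 + p1 * r0 * \<alpha> + p0 * r1 * \<beta> + p2 * r0 * \<alpha>\<^sup>2 + p1 * r1 * \<alpha> * \<beta> + p0 * r2 * \<beta>\<^sup>2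
        = p0 * r0 + (p1 * \<alpha>) * r0 + p0 * (r1 * \<beta>) + (p2 * \<alpha>\<^sup>2) * r0 + (p1 * \<alpha>) * (r1 * \<beta>) + p0 * (r2 * \<beta>\<^sup>2)"
        by (simp add: mult_ac)
      also have "\<dots> = p0 * r0 * (1 + a * X + b * Y + a * (a - 1) / 2 * X\<^sup>2 + a * b * X * Y + b * (b - 1) / 2 * Y\<^sup>2)"
        unfolding k by (simp add: algebra_simps)
      finally show ?thesis unfolding X_def Y_def p0_def r0_def by simp
    qed
    have "P * R - (p0 * r0 + p1 * r0 * \<alpha> + p0 * r1 * \<beta> + p2 * r0 * \<alpha>\<^sup>2 + p1 * r1 * \<alpha> * \<beta> + p0 * r2 * \<beta>\<^sup>2)
      = (P - (p0 + p1 * \<alpha> + p2 * \<alpha>\<^sup>2)) * R + (p0 + p1 * \<alpha> + p2 * \<alpha>\<^sup>2) * (R - (r0 + r1 * \<beta> + r2 * \<beta>\<^sup>2))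
        + (p1 * r2) * (\<alpha> * \<beta>\<^sup>2) + (p2 * r1) * (\<alpha>\<^sup>2 * \<beta>) + (p2 * r2) * (\<alpha>\<^sup>2 * \<beta>\<^sup>2)"
      by (simp add: algebra_simps power2_eq_square)
    also have "\<bar>\<dots>\<bar> \<le> \<bar>P - (p0 + p1 * \<alpha> + p2 * \<alpha>\<^sup>2)\<bar> * \<bar>R\<bar> + \<bar>p0 + p1 * \<alpha> + p2 * \<alpha>\<^sup>2\<bar> * \<bar>R - (r0 + r1 * \<beta> + r2 * \<beta>\<^sup>2)\<bar>
        + \<bar>p1\<bar> * \<bar>r2\<bar> * (x * y\<^sup>2) + \<bar>p2\<bar> * \<bar>r1\<bar> * (x\<^sup>2 * y) + \<bar>p2\<bar> * \<bar>r2\<bar> * (x\<^sup>2 * y\<^sup>2)"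
      unfolding abs_mult[symmetric] x_def y_def power2_abs[symmetric, of \<alpha>] power2_abs[symmetric, of \<beta>]
      by (intro order_trans[OF abs_triangle_ineq] add_mono) (simp_all add: abs_mult)
    also have "\<dots> \<le> C1 * x ^ 3 * B0 + T * (C2 * y ^ 3)
        + A1 * B2 * (x ^ 3 + y ^ 3) + A2 * B1 * (x ^ 3 + y ^ 3) + A2 * B2 * (N * (x ^ 3 + y ^ 3))"
    proof -
      have "x\<^sup>2 * y\<^sup>2 = (x\<^sup>2 * y) * y" by (simp add: power2_eq_square)
      also have "\<dots> \<le> (x ^ 3 + y ^ 3) * N" using xy by (intro mult_mono cube_mixed_le) auto
      finally have s: "x\<^sup>2 * y\<^sup>2 \<le> N * (x ^ 3 + y ^ 3)" by (simp add: mult.commute)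
      note nn = xy C1(1) C2(1) T A1(1) A2(1) B1(1) B2(1)
      show ?thesis
        by (rule add_mono[OF add_mono[OF add_mono[OF add_mono[OF mult_mono[OF eP bnd(6)] mult_mono[OF q eR]]
          mult_mono[OF mult_mono[OF bnd(2) bnd(5)] cube_mixed_le(1)[OF xy(1,2)]]]
          mult_mono[OF mult_mono[OF bnd(3) bnd(4)] cube_mixed_le(2)[OF xy(1,2)]]]
          mult_mono[OF mult_mono[OF bnd(3) bnd(5)] s]]) (use nn in auto)
    qed
    also have "\<dots> \<le> C1 * B0 * (x ^ 3 + y ^ 3) + T * C2 * (x ^ 3 + y ^ 3)
        + A1 * B2 * (x ^ 3 + y ^ 3) + A2 * B1 * (x ^ 3 + y ^ 3) + A2 * B2 * N * (x ^ 3 + y ^ 3)"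
    proof -
      have "C1 * B0 * x ^ 3 \<le> C1 * B0 * (x ^ 3 + y ^ 3)" "T * C2 * y ^ 3 \<le> T * C2 * (x ^ 3 + y ^ 3)"
        using xy C1(1) B0(1) T C2(1) by (auto intro!: mult_left_mono)
      then show ?thesis by (simp add: mult_ac)
    qed
    also have "\<dots> = C * (x ^ 3 + y ^ 3)" by (simp add: C_def algebra_simps)
    finally show ?thesis unfolding main by (simp add: P_def R_def x_def y_def)
  qed
  moreover have "C \<ge> 0" unfolding C_def
    using C1(1) C2(1) A1(1) A2(1) B0(1) B1(1) B2(1) T N by auto
  ultimately show ?thesis by (rule that[rotated])
qed

section \<open>Heat averages of bounded functions with Lipschitz gradient\<close>

lemma integrable_gauss_bounded:
  fixes g :: "real ^ 'n \<Rightarrow> 'b::{banach, second_countable_topology}"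
  assumes "g \<in> borel_measurable borel" "\<And>z. norm (g z) \<le> B"
  shows "integrable gauss_measure g"
  using assms by (intro G.integrable_const_bound[of _ B]) auto

lemma measure_gauss_UNIV [simp]: "measure (gauss_measure :: (real ^ 'n) measure) UNIV = 1"
  by (simp add: measure_def)

lemma sets_GG:
  "sets (gauss_measure \<Otimes>\<^sub>M gauss_measure :: ((real ^ 'n) \<times> (real ^ 'n)) measure) = sets borel"
  by (simp only: sets_pair_measure_cong[OF sets_gauss_measure sets_gauss_measure] borel_prod)

lemma abs_le_of_Icc: "m \<le> y \<Longrightarrow> y \<le> M \<Longrightarrow> \<bar>y\<bar> \<le> \<bar>m\<bar> + \<bar>M :: real\<bar>"
  by linarith

lemma integrable_GG_bounded:
  fixes g :: "(real ^ 'n) \<times> (real ^ 'n) \<Rightarrow> 'b::{banach, second_countable_topology}"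
  assumes "g \<in> borel_measurable borel" "\<And>z. norm (g z) \<le> B"
  shows "integrable (gauss_measure \<Otimes>\<^sub>M gauss_measure) g"
proof (rule GG.integrable_const_bound[of _ B])
  show "g \<in> borel_measurable (gauss_measure \<Otimes>\<^sub>M gauss_measure)"
    using assms(1) by (simp only: measurable_cong_sets[OF sets_GG refl])
qed (use assms in auto)

text \<open>Bounded functions with bounded Lipschitz gradient. Stated without derivatives, this class is
  visibly closed under averaging.\<close>

definition C11 :: "real \<Rightarrow> real \<Rightarrow> real \<Rightarrow> (real ^ 'n \<Rightarrow> real) \<Rightarrow> bool" where
  "C11 m M K f \<longleftrightarrow> (\<forall>x. m \<le> f x \<and> f x \<le> M) \<and>
     (\<exists>l. (\<forall>x. norm (l x) \<le> K) \<and> (\<forall>x y. norm (l x - l y) \<le> K * norm (x - y)) \<and>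
          (\<forall>x h. \<bar>f (x + h) - f x - l x \<bullet> h\<bar> \<le> K * (norm h)\<^sup>2))"

lemma C11_continuous:
  assumes "C11 m M K f"
  shows "continuous_on S f"
proof -
  obtain l where l: "\<And>x. norm (l x) \<le> K" "\<And>x h. \<bar>f (x + h) - f x - l x \<bullet> h\<bar> \<le> K * (norm h)\<^sup>2"
    using assms unfolding C11_def by blast
  have "isCont f x" for x
    unfolding isCont_def
  proof (rule Lim_null[THEN iffD2], rule Lim_null_comparison)
    show "\<forall>\<^sub>F y in at x. norm (f y - f x) \<le> K * norm (y - x) + K * (norm (y - x))\<^sup>2"
    proof (rule always_eventually, rule allI)
      fix y
      have "\<bar>f y - f x\<bar> \<le> \<bar>f (x + (y - x)) - f x - l x \<bullet> (y - x)\<bar> + \<bar>l x \<bullet> (y - x)\<bar>"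
        by simp
      also have "\<dots> \<le> K * (norm (y - x))\<^sup>2 + norm (l x) * norm (y - x)"
        by (intro add_mono l Cauchy_Schwarz_ineq2)
      also have "\<dots> \<le> K * (norm (y - x))\<^sup>2 + K * norm (y - x)"
        by (intro add_left_mono mult_right_mono l) auto
      finally show "norm (f y - f x) \<le> K * norm (y - x) + K * (norm (y - x))\<^sup>2" by simp
    qed
    show "((\<lambda>y. K * norm (y - x) + K * (norm (y - x))\<^sup>2) \<longlongrightarrow> 0) (at x)"
      by (auto intro!: tendsto_eq_intros)
  qed
  then show ?thesis by (simp add: continuous_at_imp_continuous_on)
qed

text \<open>The heat semigroup of half the Laplacian at time t^2: \<open>t\<close> is a standard
  deviation, so composition adds squares (\<open>gav_gav\<close>).\<close>

definition gav :: "real \<Rightarrow> (real ^ 'n \<Rightarrow> real) \<Rightarrow> real ^ 'n \<Rightarrow> real" where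
  "gav t f x = (\<integral> z. f (x + t *\<^sub>R z) \<partial>gauss_measure)"

lemma C11_measurable: "C11 m M K f \<Longrightarrow> f \<in> borel_measurable borel"
  by (intro borel_measurable_continuous_onI C11_continuous)

text \<open>The averaged gradient field serves for the averaged function, with the same three
  constants. This invariance keeps the error constant of the small-time estimate fixed while the
  number of steps grows.\<close>

lemma C11_gav:
  fixes f :: "real ^ 'n \<Rightarrow> real"
  assumes "C11 m M K f"
  shows "C11 m M K (gav t f)"
proof -
  obtain l where f: "\<And>x. m \<le> f x" "\<And>x. f x \<le> M" and l: "\<And>x. norm (l x) \<le> K"
    "\<And>x y. norm (l x - l y) \<le> K * norm (x - y)" "\<And>x h. \<bar>f (x + h) - f x - l x \<bullet> h\<bar> \<le> K * (norm h)\<^sup>2"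
    using assms unfolding C11_def by blast
  have [measurable]: "f \<in> borel_measurable borel" by (rule C11_measurable[OF assms])
  have K: "K \<ge> 0" using l(1)[of 0] norm_ge_zero[of "l 0"] by linarith
  have "K-lipschitz_on UNIV l"
    using l(2) K by (intro lipschitz_onI) (auto simp: dist_norm)
  then have [measurable]: "l \<in> borel_measurable borel"
    by (intro borel_measurable_continuous_onI lipschitz_on_continuous_on)
  have fi: "integrable gauss_measure (\<lambda>z. f (x + t *\<^sub>R z))" for x
    by (rule integrable_gauss_bounded[of _ "\<bar>m\<bar> + \<bar>M\<bar>"]) (use f in \<open>auto intro: abs_le_of_Icc\<close>)
  have li: "integrable gauss_measure (\<lambda>z. l (x + t *\<^sub>R z))" for x
    by (rule integrable_gauss_bounded[of _ K]) (use l in auto)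
  have const: "(\<integral> z. c \<partial>(gauss_measure :: (real ^ 'n) measure)) = (c :: real)" for c
    by simp
  define l' where "l' = (\<lambda>x. \<integral> z. l (x + t *\<^sub>R z) \<partial>gauss_measure)"
  show ?thesis unfolding C11_def
  proof (intro conjI allI exI[of _ l'])
    fix x y h :: "real ^ 'n"
    have "(\<integral> z. m \<partial>(gauss_measure :: (real ^ 'n) measure)) \<le> gav t f x" unfolding gav_def
      by (intro integral_mono fi f) auto
    then show "m \<le> gav t f x" by (simp only: const)
    have "gav t f x \<le> (\<integral> z. M \<partial>(gauss_measure :: (real ^ 'n) measure))" unfolding gav_def
      by (intro integral_mono fi f) auto
    then show "gav t f x \<le> M" by (simp only: const)
    have "norm (l' x) \<le> (\<integral> z. norm (l (x + t *\<^sub>R z)) \<partial>gauss_measure)"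
      unfolding l'_def by (rule integral_norm_bound)
    also have "\<dots> \<le> (\<integral> z. K \<partial>(gauss_measure :: (real ^ 'n) measure))"
      by (intro integral_mono l integrable_norm li) auto
    finally show "norm (l' x) \<le> K" by (simp only: const)
    have "norm (l' x - l' y) = norm (\<integral> z. l (x + t *\<^sub>R z) - l (y + t *\<^sub>R z) \<partial>gauss_measure)"
      unfolding l'_def by (subst Bochner_Integration.integral_diff[OF li li]) auto
    also have "\<dots> \<le> (\<integral> z. norm (l (x + t *\<^sub>R z) - l (y + t *\<^sub>R z)) \<partial>gauss_measure)"
      by (rule integral_norm_bound)
    also have "\<dots> \<le> (\<integral> z. K * norm (x - y) \<partial>(gauss_measure :: (real ^ 'n) measure))"
    proof (intro integral_mono integrable_norm Bochner_Integration.integrable_diff li)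
      show "norm (l (x + t *\<^sub>R z) - l (y + t *\<^sub>R z)) \<le> K * norm (x - y)" for z
        using l(2)[of "x + t *\<^sub>R z" "y + t *\<^sub>R z"] by simp
    qed auto
    finally show "norm (l' x - l' y) \<le> K * norm (x - y)" by (simp only: const)
    have eq: "gav t f (x + h) - gav t f x - l' x \<bullet> h
       = (\<integral> z. f ((x + t *\<^sub>R z) + h) - f (x + t *\<^sub>R z) - l (x + t *\<^sub>R z) \<bullet> h \<partial>gauss_measure)"
    proof -
      have e: "(x + t *\<^sub>R z) + h = (x + h) + t *\<^sub>R z" for z by simp
      show ?thesis unfolding gav_def l'_def e using fi li
        by (simp add: Bochner_Integration.integral_diff)
    qed
    have "\<bar>\<integral> z. f ((x + t *\<^sub>R z) + h) - f (x + t *\<^sub>R z) - l (x + t *\<^sub>R z) \<bullet> h \<partial>gauss_measure\<bar> \<le> (\<integral> z. \<bar>f ((x + t *\<^sub>R z) + h) - f (x + t *\<^sub>R z) - l (x + t *\<^sub>R z) \<bullet> h\<bar> \<partial>gauss_measure)"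
      by (rule integral_abs_bound)
    also have "\<dots> \<le> (\<integral> z. K * (norm h)\<^sup>2 \<partial>(gauss_measure :: (real ^ 'n) measure))"
    proof (rule integral_mono[OF _ _ l(3)])
      have e: "(x + t *\<^sub>R z) + h = (x + h) + t *\<^sub>R z" for z by simp
      show "integrable gauss_measure (\<lambda>z. \<bar>f ((x + t *\<^sub>R z) + h) - f (x + t *\<^sub>R z) - l (x + t *\<^sub>R z) \<bullet> h\<bar>)"
        unfolding e by (intro integrable_abs Bochner_Integration.integrable_diff fi integrable_inner_left li)
    qed auto
    finally show "\<bar>gav t f (x + h) - gav t f x - l' x \<bullet> h\<bar> \<le> K * (norm h)\<^sup>2" unfolding eq by (simp only: const)
  qed
qed

text \<open>Because the linear term has mean 0, the average differs from f(x) by order t^2 only, so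
  it may replace f(x) as the centre of the first-order expansion.\<close>

lemma gav_expansion:
  fixes f :: "real ^ 'n \<Rightarrow> real"
  assumes f: "\<And>x. m \<le> f x" "\<And>x. f x \<le> M" and [measurable]: "f \<in> borel_measurable borel"
    and l: "\<And>h. \<bar>f (x + h) - f x - l \<bullet> h\<bar> \<le> K * (norm h)\<^sup>2"
  shows "\<bar>f (x + t *\<^sub>R z) - gav t f x - t * (l \<bullet> z)\<bar> \<le> K * t\<^sup>2 * ((norm z)\<^sup>2 + (\<integral> w. (norm w)\<^sup>2 \<partial>(gauss_measure :: (real ^ 'n) measure)))"
proof -
  have fi: "integrable gauss_measure (\<lambda>z. f (x + t *\<^sub>R z))"
    by (rule integrable_gauss_bounded[of _ "\<bar>m\<bar> + \<bar>M\<bar>"]) (use f in \<open>auto intro: abs_le_of_Icc\<close>)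
  have b: "\<bar>f (x + t *\<^sub>R z) - f x - t * (l \<bullet> z)\<bar> \<le> K * t\<^sup>2 * (norm z)\<^sup>2" for z
    using l[of "t *\<^sub>R z"] by (simp add: power_mult_distrib mult.assoc)
  have "gav t f x - f x = (\<integral> z. f (x + t *\<^sub>R z) - f x - t * (l \<bullet> z) \<partial>gauss_measure)"
    unfolding gav_def using fi by simp
  also have "\<bar>\<dots>\<bar> \<le> (\<integral> z. \<bar>f (x + t *\<^sub>R z) - f x - t * (l \<bullet> z)\<bar> \<partial>gauss_measure)"
    by (rule integral_abs_bound)
  also have "\<dots> \<le> (\<integral> z. K * t\<^sup>2 * (norm z)\<^sup>2 \<partial>(gauss_measure :: (real ^ 'n) measure))"
    by (rule integral_mono[OF _ _ b])
      (intro integrable_abs Bochner_Integration.integrable_diff fi integrable_mult_right integrable_inner_gauss integrable_norm_power_gauss, auto)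
  also have "\<dots> = K * t\<^sup>2 * (\<integral> z. (norm z)\<^sup>2 \<partial>(gauss_measure :: (real ^ 'n) measure))" by simp
  finally show ?thesis using b[of z] by (simp add: algebra_simps)
qed

section \<open>The infinitesimal form of the Jensen inequality\<close>

text \<open>\<open>B\<close> stands for a weight of polynomial growth in the Gaussian variables. All
  its powers are raised to the sixth, so that one moment of the weight controls every error
  term.\<close>

lemma product_error_bound:
  fixes t :: real
  assumes "0 \<le> t" "t \<le> 1" "1 \<le> B" "\<bar>X\<bar> \<le> K * B" "\<bar>Y\<bar> \<le> K * B" "\<bar>r\<bar> \<le> K * t\<^sup>2 * B\<^sup>2" "\<bar>r'\<bar> \<le> K * t\<^sup>2 * B\<^sup>2" "K \<ge> 0"
  shows "\<bar>(t * X + r) * (t * Y + r') - t\<^sup>2 * (X * Y)\<bar> \<le> 3 * K\<^sup>2 * t ^ 3 * B ^ 6"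
proof -
  have B: "B ^ 3 \<le> B ^ 6" "B ^ 4 \<le> B ^ 6" using assms by (auto intro: power_increasing)
  have "(t * X + r) * (t * Y + r') - t\<^sup>2 * (X * Y) = t * X * r' + t * Y * r + r * r'"
    by (simp add: algebra_simps power2_eq_square)
  also have "\<bar>\<dots>\<bar> \<le> t * \<bar>X\<bar> * \<bar>r'\<bar> + t * \<bar>Y\<bar> * \<bar>r\<bar> + \<bar>r\<bar> * \<bar>r'\<bar>"
    using assms(1) by (intro order_trans[OF abs_triangle_ineq] add_mono) (simp_all add: abs_mult)
  also have "\<dots> \<le> t * (K * B) * (K * t\<^sup>2 * B\<^sup>2) + t * (K * B) * (K * t\<^sup>2 * B\<^sup>2) + (K * t\<^sup>2 * B\<^sup>2) * (K * t\<^sup>2 * B\<^sup>2)"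
    using assms by (intro add_mono mult_mono) auto
  also have "\<dots> = 2 * (K\<^sup>2 * t ^ 3) * B ^ 3 + (K\<^sup>2 * t ^ 3) * (t * B ^ 4)"
    by (simp add: power2_eq_square power3_eq_cube power4_eq_xxxx algebra_simps)
  also have "\<dots> \<le> 2 * (K\<^sup>2 * t ^ 3) * B ^ 6 + (K\<^sup>2 * t ^ 3) * (1 * B ^ 6)"
  proof (rule add_mono; rule mult_left_mono)
    show "t * B ^ 4 \<le> 1 * B ^ 6" by (rule mult_mono) (use assms B in auto)
  qed (use assms B in auto)
  also have "\<dots> = 3 * K\<^sup>2 * t ^ 3 * B ^ 6" by (simp add: algebra_simps)
  finally show ?thesis .
qed

lemma cube_error_bound:
  fixes t :: real
  assumes "0 \<le> t" "t \<le> 1" "1 \<le> B" "\<bar>X\<bar> \<le> K * B" "\<bar>r\<bar> \<le> K * t\<^sup>2 * B\<^sup>2" "K \<ge> 0"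
  shows "\<bar>t * X + r\<bar> ^ 3 \<le> 8 * K ^ 3 * t ^ 3 * B ^ 6"
proof -
  have "B \<le> B\<^sup>2" using assms(3) by (simp add: power2_eq_square)
  have "\<bar>t * X + r\<bar> \<le> \<bar>t * X\<bar> + \<bar>r\<bar>" by (rule abs_triangle_ineq)
  also have "\<bar>t * X\<bar> = t * \<bar>X\<bar>" using assms(1) by (simp add: abs_mult)
  also have "t * \<bar>X\<bar> + \<bar>r\<bar> \<le> t * (K * B\<^sup>2) + K * t\<^sup>2 * B\<^sup>2"
  proof (rule add_mono[OF mult_left_mono assms(5)])
    show "\<bar>X\<bar> \<le> K * B\<^sup>2" using assms(4) mult_left_mono[OF \<open>B \<le> B\<^sup>2\<close> assms(6)] by linarith
  qed (rule assms)
  also have "K * t\<^sup>2 * B\<^sup>2 \<le> K * t * B\<^sup>2"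
  proof (rule mult_right_mono, rule mult_left_mono)
    show "t\<^sup>2 \<le> t" using assms(1,2) by (simp add: power2_eq_square mult_left_le_one_le)
  qed (use assms in auto)
  also have "t * (K * B\<^sup>2) + K * t * B\<^sup>2 = 2 * K * t * B\<^sup>2" by simp
  finally have "\<bar>t * X + r\<bar> ^ 3 \<le> (2 * K * t * B\<^sup>2) ^ 3" by (intro power_mono) auto
  then show ?thesis by (simp add: power_mult_distrib)
qed

lemma integrable_GG_weight:
  "integrable (gauss_measure \<Otimes>\<^sub>M gauss_measure) (\<lambda>\<omega> :: (real ^ 'n) \<times> (real ^ 'n). ((1 + norm (fst \<omega>)) * (1 + norm (snd \<omega>))) ^ k)"
proof (rule integrableI_nonneg)
  have 1: "integrable (gauss_measure :: (real ^ 'n) measure) (\<lambda>z. (1 + norm z) ^ k)"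
  proof -
    have "(\<lambda>z :: real ^ 'n. (1 + norm z) ^ k) = (\<lambda>z. \<Sum>j\<le>k. of_nat (k choose j) * norm z ^ (k - j))"
      by (simp add: binomial_ring)
    then show ?thesis by simp
  qed
  then have fin: "(\<integral>\<^sup>+ z. ennreal ((1 + norm z) ^ k) \<partial>(gauss_measure :: (real ^ 'n) measure)) < \<infinity>"
    by (subst nn_integral_eq_integral) auto
  have "(\<integral>\<^sup>+ \<omega>. ennreal (((1 + norm (fst \<omega>)) * (1 + norm (snd \<omega>))) ^ k) \<partial>(gauss_measure \<Otimes>\<^sub>M gauss_measure :: ((real ^ 'n) \<times> (real ^ 'n)) measure))
     = (\<integral>\<^sup>+ z. \<integral>\<^sup>+ w. ennreal ((1 + norm z) ^ k) * ennreal ((1 + norm (w :: real ^ 'n)) ^ k) \<partial>gauss_measure \<partial>(gauss_measure :: (real ^ 'n) measure))"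
    by (subst G.nn_integral_fst[symmetric]) (auto simp: power_mult_distrib ennreal_mult)
  also have "\<dots> = (\<integral>\<^sup>+ z. ennreal ((1 + norm z) ^ k) \<partial>(gauss_measure :: (real ^ 'n) measure)) * (\<integral>\<^sup>+ z. ennreal ((1 + norm z) ^ k) \<partial>(gauss_measure :: (real ^ 'n) measure))"
    by (simp add: nn_integral_cmult nn_integral_multc)
  also have "\<dots> < \<infinity>" using fin by (simp add: ennreal_mult_less_top)
  finally show "(\<integral>\<^sup>+ \<omega>. ennreal (((1 + norm (fst \<omega>)) * (1 + norm (snd \<omega>))) ^ k) \<partial>(gauss_measure \<Otimes>\<^sub>M gauss_measure :: ((real ^ 'n) \<times> (real ^ 'n)) measure)) < \<infinity>" .
qed auto

abbreviation gauss2 :: "((real ^ 'n) \<times> (real ^ 'n)) measure" where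
  "gauss2 \<equiv> gauss_measure \<Otimes>\<^sub>M gauss_measure"

lemma measure_gauss2_UNIV [simp]: "measure (gauss2 :: ((real ^ 'n) \<times> (real ^ 'n)) measure) UNIV = 1"
proof -
  have "measure gauss2 (space (gauss2 :: ((real ^ 'n) \<times> (real ^ 'n)) measure)) = 1" by (rule GG.prob_space)
  then show ?thesis by (simp add: space_pair_measure)
qed

lemma space_gauss2 [simp]: "space (gauss2 :: ((real ^ 'n) \<times> (real ^ 'n)) measure) = UNIV"
  by (simp add: space_pair_measure)

lemma integral_GG_fst:
  fixes h :: "real ^ 'n \<Rightarrow> real"
  assumes [measurable]: "h \<in> borel_measurable borel"
  shows "(\<integral> \<omega>. h (fst \<omega>) \<partial>gauss2) = (\<integral> z. h z \<partial>gauss_measure)"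
proof -
  have "(\<integral> z. h z \<partial>distr gauss2 gauss_measure fst)
      = (\<integral> \<omega>. h (fst \<omega>) \<partial>gauss2)"
    by (rule integral_distr) auto
  moreover have "distr gauss2 gauss_measure fst = (gauss_measure :: (real ^ 'n) measure)"
    by (rule G.distr_pair_fst)
  ultimately show ?thesis by simp
qed

lemma integral_GG_rot:
  fixes h :: "real ^ 'n \<Rightarrow> real"
  assumes [measurable]: "h \<in> borel_measurable borel" and "a\<^sup>2 + b\<^sup>2 = c\<^sup>2" "b > 0" "c > 0"
  shows "(\<integral> \<omega>. h (a *\<^sub>R fst \<omega> + b *\<^sub>R snd \<omega>) \<partial>gauss2) = (\<integral> z. h (c *\<^sub>R z) \<partial>gauss_measure)"
proof -
  have "(\<integral> \<omega>. h (a *\<^sub>R fst \<omega> + b *\<^sub>R snd \<omega>) \<partial>gauss2)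
     = (\<integral> z. h z \<partial>distr gauss2 borel (\<lambda>(x, y). a *\<^sub>R x + b *\<^sub>R y))"
    by (subst integral_distr) (auto simp: case_prod_beta)
  also have "\<dots> = (\<integral> z. h (c *\<^sub>R z) \<partial>gauss_measure)"
    unfolding gauss_conv_distr[OF assms(2-4)] by (subst integral_distr) auto
  finally show ?thesis .
qed

lemma measurable_GG:
  "F \<in> borel_measurable borel \<Longrightarrow> F \<in> borel_measurable gauss2"
  by (simp only: measurable_cong_sets[OF sets_GG refl])

lemma integrable_GG_poly:
  fixes F :: "(real ^ 'n) \<times> (real ^ 'n) \<Rightarrow> real"
  assumes "F \<in> borel_measurable borel" "\<And>\<omega>. \<bar>F \<omega>\<bar> \<le> c * ((1 + norm (fst \<omega>)) * (1 + norm (snd \<omega>))) ^ k"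
  shows "integrable gauss2 F"
proof (rule Bochner_Integration.integrable_bound)
  show "integrable gauss2 (\<lambda>\<omega> :: (real ^ 'n) \<times> (real ^ 'n). c * ((1 + norm (fst \<omega>)) * (1 + norm (snd \<omega>))) ^ k)"
    by (intro integrable_mult_right integrable_GG_weight)
  show "F \<in> borel_measurable gauss2"
    by (rule measurable_GG[OF assms(1)])
  show "AE \<omega> in gauss2. norm (F \<omega>) \<le> norm (c * ((1 + norm (fst \<omega>)) * (1 + norm (snd \<omega>))) ^ k)"
    using assms(2) by (intro AE_I2) (metis abs_ge_self order_trans real_norm_def)
qed

text \<open>A Gaussian vector and \<rho> times it plus \<rho>' times an independent copy have
  covariance \<rho> times the identity; integrating out the copy first kills its linear
  contribution.\<close>

lemma integral_GG_inner_mult: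
  fixes l l' :: "real ^ 'n"
  shows "(\<integral> \<omega>. (l \<bullet> fst \<omega>) * (l' \<bullet> (\<rho> *\<^sub>R fst \<omega> + \<rho>' *\<^sub>R snd \<omega>)) \<partial>gauss2) = \<rho> * (l \<bullet> l')"
proof -
  let ?F = "\<lambda>\<omega> :: (real ^ 'n) \<times> (real ^ 'n). (l \<bullet> fst \<omega>) * (l' \<bullet> (\<rho> *\<^sub>R fst \<omega> + \<rho>' *\<^sub>R snd \<omega>))"
  have int: "integrable gauss2 ?F"
  proof (rule integrable_GG_poly[where c = "norm l * (norm l' * (\<bar>\<rho>\<bar> + \<bar>\<rho>'\<bar>))" and k = 2])
    show "?F \<in> borel_measurable borel" by (intro borel_measurable_continuous_onI continuous_intros)
    fix \<omega> :: "(real ^ 'n) \<times> (real ^ 'n)"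
    let ?B = "(1 + norm (fst \<omega>)) * (1 + norm (snd \<omega>))"
    have B: "norm (fst \<omega>) \<le> ?B" "norm (snd \<omega>) \<le> ?B"
      by (auto simp: algebra_simps)
    have "\<bar>?F \<omega>\<bar> \<le> (norm l * norm (fst \<omega>)) * (norm l' * norm (\<rho> *\<^sub>R fst \<omega> + \<rho>' *\<^sub>R snd \<omega>))"
      unfolding abs_mult by (intro mult_mono Cauchy_Schwarz_ineq2) auto
    also have "\<dots> \<le> (norm l * ?B) * (norm l' * ((\<bar>\<rho>\<bar> + \<bar>\<rho>'\<bar>) * ?B))"
    proof (intro mult_mono mult_left_mono B)
      have "norm (\<rho> *\<^sub>R fst \<omega> + \<rho>' *\<^sub>R snd \<omega>) \<le> \<bar>\<rho>\<bar> * norm (fst \<omega>) + \<bar>\<rho>'\<bar> * norm (snd \<omega>)"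
        by (rule order_trans[OF norm_triangle_ineq]) simp
      also have "\<dots> \<le> \<bar>\<rho>\<bar> * ?B + \<bar>\<rho>'\<bar> * ?B" using B by (intro add_mono mult_left_mono) auto
      finally show "norm (\<rho> *\<^sub>R fst \<omega> + \<rho>' *\<^sub>R snd \<omega>) \<le> (\<bar>\<rho>\<bar> + \<bar>\<rho>'\<bar>) * ?B" by (simp only: distrib_right)
    qed auto
    finally show "\<bar>?F \<omega>\<bar> \<le> norm l * (norm l' * (\<bar>\<rho>\<bar> + \<bar>\<rho>'\<bar>)) * ?B ^ 2"
      by (simp only: power2_eq_square mult_ac)
  qed
  have "(\<integral> \<omega>. ?F \<omega> \<partial>gauss2) = (\<integral> z. \<integral> w. ?F (z, w) \<partial>gauss_measure \<partial>gauss_measure)"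
    by (rule GG.integral_fst'[OF int, symmetric])
  also have "(\<lambda>z. \<integral> w. ?F (z, w) \<partial>gauss_measure) = (\<lambda>z. \<rho> * ((l \<bullet> z) * (l' \<bullet> z)))"
  proof
    fix z
    have "(\<integral> w. ?F (z, w) \<partial>gauss_measure) = (\<integral> w. \<rho> * ((l \<bullet> z) * (l' \<bullet> z)) + (\<rho>' * (l \<bullet> z)) * (l' \<bullet> w) \<partial>gauss_measure)"
      by (intro Bochner_Integration.integral_cong) (auto simp: inner_add_right algebra_simps)
    also have "\<dots> = \<rho> * ((l \<bullet> z) * (l' \<bullet> z))"
      by (subst Bochner_Integration.integral_add) auto
    finally show "(\<integral> w. ?F (z, w) \<partial>gauss_measure) = \<rho> * ((l \<bullet> z) * (l' \<bullet> z))" .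
  qed
  also have "(\<integral> z. \<rho> * ((l \<bullet> z) * (l' \<bullet> z)) \<partial>gauss_measure) = \<rho> * (l \<bullet> l')"
    by (simp add: integral_inner_mult_gauss)
  finally show ?thesis .
qed

lemma abs_rho_le_1: "\<rho>\<^sup>2 + \<rho>'\<^sup>2 = (1::real) \<Longrightarrow> \<bar>\<rho>\<bar> \<le> 1"
  by (metis abs_le_square_iff abs_one le_add_same_cancel1 one_power2 zero_le_power2)

text \<open>Both functions are expanded around their averages u and v, so the first-order terms have
  mean 0. Multiplied by \<sigma>, the mean of the second-order terms is at most t^2 u^a v^b times
  half the form in \<open>quad\<close>, evaluated at the lengths of the gradients divided by u and
  v; Cauchy-Schwarz takes care of the mixed term. The sign \<sigma> = 1 yields an upper and \<sigma>
  = -1 a lower bound for the integral.\<close>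

lemma small_time_estimate:
  fixes m M K a b \<rho> \<rho>' \<sigma> :: real
  assumes "0 < m" "0 \<le> K" "\<rho>\<^sup>2 + \<rho>'\<^sup>2 = 1" "\<rho>' > 0" "\<bar>\<sigma>\<bar> = 1"
    and quad: "\<And>s t. \<sigma> * (a * (a - 1) * s\<^sup>2 + b * (b - 1) * t\<^sup>2) + 2 * \<bar>\<rho> * a * b * s * t\<bar> \<le> 0"
  obtains C where "C \<ge> 0" "\<And>f g (x :: real ^ 'n) y t. \<lbrakk>C11 m M K f; C11 m M K g; 0 \<le> t; t \<le> 1\<rbrakk> \<Longrightarrow>
    \<sigma> * (\<integral> \<omega>. f (x + t *\<^sub>R fst \<omega>) powr a * g (y + t *\<^sub>R (\<rho> *\<^sub>R fst \<omega> + \<rho>' *\<^sub>R snd \<omega>)) powr b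
         \<partial>gauss2)
      \<le> \<sigma> * (gav t f x powr a * gav t g y powr b) + C * t ^ 3"
proof -
  obtain C0 where C0: "C0 \<ge> 0" "\<And>u v \<alpha> \<beta>. \<lbrakk>m \<le> u; u \<le> M; m \<le> v; v \<le> M; m \<le> u + \<alpha>; u + \<alpha> \<le> M; m \<le> v + \<beta>; v + \<beta> \<le> M\<rbrakk> \<Longrightarrow>
    \<bar>(u + \<alpha>) powr a * (v + \<beta>) powr b - u powr a * v powr b * (1 + a * (\<alpha> / u) + b * (\<beta> / v)
       + a * (a - 1) / 2 * (\<alpha> / u)\<^sup>2 + a * b * (\<alpha> / u) * (\<beta> / v) + b * (b - 1) / 2 * (\<beta> / v)\<^sup>2)\<bar>
      \<le> C0 * (\<bar>\<alpha>\<bar> ^ 3 + \<bar>\<beta>\<bar> ^ 3)" using powr_mult_taylor2[OF assms(1), of M a b] by metis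
  have bd: "\<exists>B\<ge>0. \<forall>x. m \<le> x \<longrightarrow> x \<le> M \<longrightarrow> \<bar>x powr d\<bar> \<le> B" for d
  proof -
    have "continuous_on {m..M} (\<lambda>x. x powr d)"
      using assms by (auto intro!: continuous_intros)
    then show ?thesis by (metis continuous_bounded_Icc)
  qed
  obtain A0 where A0: "A0 \<ge> 0" "\<And>x. m \<le> x \<Longrightarrow> x \<le> M \<Longrightarrow> \<bar>x powr a\<bar> \<le> A0" using bd[of a] by blast
  obtain B0 where B0: "B0 \<ge> 0" "\<And>x. m \<le> x \<Longrightarrow> x \<le> M \<Longrightarrow> \<bar>x powr b\<bar> \<le> B0" using bd[of b] by blast
  \<comment> \<open>The second moment of the norm enters through \<open>gav_expansion\<close>;
    \<open>K1\<close> absorbs it, so that first- and second-order errors share one constant.\<close>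
  define c2 where "c2 = (\<integral> w. (norm w)\<^sup>2 \<partial>(gauss_measure :: (real ^ 'n) measure))"
  have c2: "c2 \<ge> 0" unfolding c2_def by (intro integral_nonneg_AE) auto
  define K1 where "K1 = K * (1 + c2)"
  have K1: "K \<le> K1" "K1 \<ge> 0" unfolding K1_def using assms(2) c2 by (auto simp: algebra_simps)
  define W where "W = (\<lambda>\<omega> :: (real ^ 'n) \<times> (real ^ 'n). (1 + norm (fst \<omega>)) * (1 + norm (snd \<omega>)))"
  \<comment> \<open>The 16 collects two cubes with a factor 8 each from
    \<open>cube_error_bound\<close>, the 3 comes from \<open>product_error_bound\<close>, and the
    division by m^2 from the lower bound m on u and v.\<close>
  define C1 where "C1 = C0 * (16 * K1 ^ 3) + A0 * B0 * ((\<bar>a * (a - 1)\<bar> + \<bar>a * b\<bar> + \<bar>b * (b - 1)\<bar>) / m\<^sup>2) * (3 * K1\<^sup>2)"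
  define C where "C = C1 * (\<integral> \<omega>. W \<omega> ^ 6 \<partial>gauss2)"
  have C1: "C1 \<ge> 0" unfolding C1_def using C0(1) K1 A0(1) B0(1) by (intro add_nonneg_nonneg mult_nonneg_nonneg divide_nonneg_nonneg) auto
  have W: "1 \<le> W \<omega>" "norm (fst \<omega>) \<le> W \<omega>" "norm (snd \<omega>) \<le> W \<omega>" "norm (fst \<omega>) + norm (snd \<omega>) \<le> W \<omega>" for \<omega>
    by (auto simp: W_def algebra_simps)
  have Wi: "integrable gauss2 (\<lambda>\<omega>. W \<omega> ^ 6)"
    unfolding W_def by (rule integrable_GG_weight)
  have C: "C \<ge> 0" unfolding C_def using C1 W(1) by (intro mult_nonneg_nonneg integral_nonneg_AE AE_I2) (auto intro: order_trans[OF zero_le_one])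
  have rho: "\<bar>\<rho>\<bar> \<le> 1" "\<bar>\<rho>'\<bar> \<le> 1" using abs_rho_le_1[of \<rho> \<rho>'] abs_rho_le_1[of \<rho>' \<rho>] assms(3) by (auto simp: add.commute)
  have "\<sigma> * (\<integral> \<omega>. f (x + t *\<^sub>R fst \<omega>) powr a * g (y + t *\<^sub>R (\<rho> *\<^sub>R fst \<omega> + \<rho>' *\<^sub>R snd \<omega>)) powr b
         \<partial>gauss2)
      \<le> \<sigma> * (gav t f x powr a * gav t g y powr b) + C * t ^ 3"
    if fC: "C11 m M K f" and gC: "C11 m M K g" and t: "0 \<le> t" "t \<le> 1" for f g :: "real ^ 'n \<Rightarrow> real" and x y :: "real ^ 'n" and t
  proof -
    obtain lf where f: "\<And>x. m \<le> f x" "\<And>x. f x \<le> M" and lf: "\<And>x. norm (lf x) \<le> K"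
      "\<And>x h. \<bar>f (x + h) - f x - lf x \<bullet> h\<bar> \<le> K * (norm h)\<^sup>2"
      using fC unfolding C11_def by blast
    obtain lg where g: "\<And>x. m \<le> g x" "\<And>x. g x \<le> M" and lg: "\<And>x. norm (lg x) \<le> K"
      "\<And>x h. \<bar>g (x + h) - g x - lg x \<bullet> h\<bar> \<le> K * (norm h)\<^sup>2"
      using gC unfolding C11_def by blast
    have [measurable]: "f \<in> borel_measurable borel" "g \<in> borel_measurable borel"
      using C11_measurable[OF fC] C11_measurable[OF gC] by auto
    have fcont: "continuous_on S f" and gcont: "continuous_on S g" for S
      using C11_continuous[OF fC] C11_continuous[OF gC] by auto
    \<comment> \<open>The centres are the averages at scale t and not the values at x and y: only
      then do the increments \<alpha> and \<beta> have integral 0.\<close>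
    define u where "u = gav t f x"
    define v where "v = gav t g y"
    have u: "m \<le> u" "u \<le> M" and v: "m \<le> v" "v \<le> M"
      using C11_gav[OF fC, of t] C11_gav[OF gC, of t] unfolding C11_def u_def v_def by auto
    have uv0: "u > 0" "v > 0" using u v assms(1) by auto
    define Y where "Y = (\<lambda>\<omega> :: (real ^ 'n) \<times> (real ^ 'n). \<rho> *\<^sub>R fst \<omega> + \<rho>' *\<^sub>R snd \<omega>)"
    have Yb: "norm (Y \<omega>) \<le> W \<omega>" for \<omega>
    proof -
      have "norm (Y \<omega>) \<le> \<bar>\<rho>\<bar> * norm (fst \<omega>) + \<bar>\<rho>'\<bar> * norm (snd \<omega>)"
        unfolding Y_def by (rule order_trans[OF norm_triangle_ineq]) simp
      also have "\<dots> \<le> 1 * norm (fst \<omega>) + 1 * norm (snd \<omega>)" using rho by (intro add_mono mult_right_mono) auto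
      finally show ?thesis using W(4)[of \<omega>] by simp
    qed
    define X1 where "X1 = (\<lambda>\<omega> :: (real ^ 'n) \<times> (real ^ 'n). lf x \<bullet> fst \<omega>)"
    define X2 where "X2 = (\<lambda>\<omega>. lg y \<bullet> Y \<omega>)"
    define \<alpha> where "\<alpha> = (\<lambda>\<omega> :: (real ^ 'n) \<times> (real ^ 'n). f (x + t *\<^sub>R fst \<omega>) - u)"
    define \<beta> where "\<beta> = (\<lambda>\<omega>. g (y + t *\<^sub>R Y \<omega>) - v)"
    define r1 where "r1 = (\<lambda>\<omega>. \<alpha> \<omega> - t * X1 \<omega>)"
    define r2 where "r2 = (\<lambda>\<omega>. \<beta> \<omega> - t * X2 \<omega>)"
    have Xb: "\<bar>X1 \<omega>\<bar> \<le> K1 * W \<omega>" "\<bar>X2 \<omega>\<bar> \<le> K1 * W \<omega>" for \<omega>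
    proof -
      have "\<bar>X1 \<omega>\<bar> \<le> norm (lf x) * norm (fst \<omega>)" unfolding X1_def by (rule Cauchy_Schwarz_ineq2)
      also have "\<dots> \<le> K1 * W \<omega>" using lf(1)[of x] K1 W by (intro mult_mono) auto
      finally show "\<bar>X1 \<omega>\<bar> \<le> K1 * W \<omega>" .
      have "\<bar>X2 \<omega>\<bar> \<le> norm (lg y) * norm (Y \<omega>)" unfolding X2_def by (rule Cauchy_Schwarz_ineq2)
      also have "\<dots> \<le> K1 * W \<omega>" using lg(1)[of y] K1 Yb by (intro mult_mono) auto
      finally show "\<bar>X2 \<omega>\<bar> \<le> K1 * W \<omega>" .
    qed
    have rem: "K * t\<^sup>2 * ((norm z)\<^sup>2 + c2) \<le> K1 * t\<^sup>2 * (W \<omega>)\<^sup>2" if "norm z \<le> W \<omega>" for z :: "real ^ 'n" and \<omega>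
    proof -
      have "(norm z)\<^sup>2 + c2 \<le> (W \<omega>)\<^sup>2 + c2 * (W \<omega>)\<^sup>2"
        using that c2 W(1)[of \<omega>] mult_left_mono[of 1 "(W \<omega>)\<^sup>2" c2] by (intro add_mono power_mono) auto
      then have "K * t\<^sup>2 * ((norm z)\<^sup>2 + c2) \<le> K * t\<^sup>2 * ((W \<omega>)\<^sup>2 + c2 * (W \<omega>)\<^sup>2)"
        using assms(2) by (intro mult_left_mono) auto
      then show ?thesis by (simp add: K1_def algebra_simps)
    qed
    have rb: "\<bar>r1 \<omega>\<bar> \<le> K1 * t\<^sup>2 * (W \<omega>)\<^sup>2" "\<bar>r2 \<omega>\<bar> \<le> K1 * t\<^sup>2 * (W \<omega>)\<^sup>2" for \<omega>
    proof -
      have "\<bar>r1 \<omega>\<bar> \<le> K * t\<^sup>2 * ((norm (fst \<omega>))\<^sup>2 + c2)"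
        unfolding r1_def \<alpha>_def X1_def u_def c2_def by (rule gav_expansion[OF f _ lf(2)]) simp
      also note rem[OF W(2)]
      finally show "\<bar>r1 \<omega>\<bar> \<le> K1 * t\<^sup>2 * (W \<omega>)\<^sup>2" .
      have "\<bar>r2 \<omega>\<bar> \<le> K * t\<^sup>2 * ((norm (Y \<omega>))\<^sup>2 + c2)"
        unfolding r2_def \<beta>_def X2_def v_def c2_def by (rule gav_expansion[OF g _ lg(2)]) simp
      also note rem[OF Yb]
      finally show "\<bar>r2 \<omega>\<bar> \<le> K1 * t\<^sup>2 * (W \<omega>)\<^sup>2" .
    qed
    have ab: "\<alpha> \<omega> = t * X1 \<omega> + r1 \<omega>" "\<beta> \<omega> = t * X2 \<omega> + r2 \<omega>" for \<omega> by (auto simp: r1_def r2_def)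
    define P where "P = u powr a * v powr b"
    have P: "0 \<le> P" "P \<le> A0 * B0" unfolding P_def using A0(2)[OF u] B0(2)[OF v] A0(1)
      by (auto intro: mult_mono)
    \<comment> \<open>The quadratic part of the expansion, with \<alpha> and \<beta> replaced by
      their linear parts t X1 and t X2 and the factor t^2 taken out.\<close>
    define q where "q = (\<lambda>\<omega>. a * (a - 1) / 2 / u\<^sup>2 * (X1 \<omega> * X1 \<omega>) + a * b / (u * v) * (X1 \<omega> * X2 \<omega>) + b * (b - 1) / 2 / v\<^sup>2 * (X2 \<omega> * X2 \<omega>))"
    define J where "J = (\<lambda>\<omega>. f (x + t *\<^sub>R fst \<omega>) powr a * g (y + t *\<^sub>R Y \<omega>) powr b)"
    have pw: "\<bar>J \<omega> - (P * (1 + a / u * \<alpha> \<omega> + b / v * \<beta> \<omega>) + t\<^sup>2 * P * q \<omega>)\<bar> \<le> C1 * t ^ 3 * W \<omega> ^ 6" for \<omega>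
    proof -
      define e where "e = 3 * K1\<^sup>2 * t ^ 3 * W \<omega> ^ 6"
      have e: "\<bar>\<alpha> \<omega> * \<alpha> \<omega> - t\<^sup>2 * (X1 \<omega> * X1 \<omega>)\<bar> \<le> e" "\<bar>\<alpha> \<omega> * \<beta> \<omega> - t\<^sup>2 * (X1 \<omega> * X2 \<omega>)\<bar> \<le> e"
         "\<bar>\<beta> \<omega> * \<beta> \<omega> - t\<^sup>2 * (X2 \<omega> * X2 \<omega>)\<bar> \<le> e"
        unfolding ab e_def by (rule product_error_bound[OF t W(1) Xb(1) Xb(1) rb(1) rb(1) K1(2)] product_error_bound[OF t W(1) Xb(1) Xb(2) rb(1) rb(2) K1(2)]
          product_error_bound[OF t W(1) Xb(2) Xb(2) rb(2) rb(2) K1(2)])+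
      have e0: "e \<ge> 0" using e(1) by linarith
      have c3: "\<bar>\<alpha> \<omega>\<bar> ^ 3 + \<bar>\<beta> \<omega>\<bar> ^ 3 \<le> 16 * K1 ^ 3 * t ^ 3 * W \<omega> ^ 6"
        using cube_error_bound[OF t W(1) Xb(1)[of \<omega>] rb(1) K1(2)] cube_error_bound[OF t W(1) Xb(2)[of \<omega>] rb(2) K1(2)]
        unfolding ab by linarith
      have T: "\<bar>J \<omega> - P * (1 + a * (\<alpha> \<omega> / u) + b * (\<beta> \<omega> / v)
         + a * (a - 1) / 2 * (\<alpha> \<omega> / u)\<^sup>2 + a * b * (\<alpha> \<omega> / u) * (\<beta> \<omega> / v) + b * (b - 1) / 2 * (\<beta> \<omega> / v)\<^sup>2)\<bar>
         \<le> C0 * (\<bar>\<alpha> \<omega>\<bar> ^ 3 + \<bar>\<beta> \<omega>\<bar> ^ 3)"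
        using C0(2)[OF u v, of "\<alpha> \<omega>" "\<beta> \<omega>"] f g by (simp add: J_def P_def \<alpha>_def \<beta>_def)
      have inv: "1 / u\<^sup>2 \<le> 1 / m\<^sup>2" "1 / (u * v) \<le> 1 / m\<^sup>2" "1 / v\<^sup>2 \<le> 1 / m\<^sup>2" "0 \<le> 1 / u\<^sup>2" "0 \<le> 1 / (u * v)" "0 \<le> 1 / v\<^sup>2"
        using u v assms(1) uv0 by (auto intro!: frac_le mult_mono simp: power2_eq_square)
      define E where "E = a * (a - 1) / 2 * (1 / u\<^sup>2) * (\<alpha> \<omega> * \<alpha> \<omega> - t\<^sup>2 * (X1 \<omega> * X1 \<omega>))
         + a * b * (1 / (u * v)) * (\<alpha> \<omega> * \<beta> \<omega> - t\<^sup>2 * (X1 \<omega> * X2 \<omega>))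
         + b * (b - 1) / 2 * (1 / v\<^sup>2) * (\<beta> \<omega> * \<beta> \<omega> - t\<^sup>2 * (X2 \<omega> * X2 \<omega>))"
      have "\<bar>E\<bar> \<le> \<bar>a * (a - 1) / 2 * (1 / u\<^sup>2) * (\<alpha> \<omega> * \<alpha> \<omega> - t\<^sup>2 * (X1 \<omega> * X1 \<omega>))\<bar>
         + \<bar>a * b * (1 / (u * v)) * (\<alpha> \<omega> * \<beta> \<omega> - t\<^sup>2 * (X1 \<omega> * X2 \<omega>))\<bar>
         + \<bar>b * (b - 1) / 2 * (1 / v\<^sup>2) * (\<beta> \<omega> * \<beta> \<omega> - t\<^sup>2 * (X2 \<omega> * X2 \<omega>))\<bar>"
        unfolding E_def by (rule order_trans[OF abs_triangle_ineq add_mono[OF abs_triangle_ineq order_refl]])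
      also have "\<dots> \<le> \<bar>a * (a - 1)\<bar> * (1 / m\<^sup>2) * e + \<bar>a * b\<bar> * (1 / m\<^sup>2) * e + \<bar>b * (b - 1)\<bar> * (1 / m\<^sup>2) * e"
      proof -
        have k: "\<bar>c1 * d * z\<bar> \<le> c * (1 / m\<^sup>2) * e" if "\<bar>c1\<bar> \<le> c" "0 \<le> d" "d \<le> 1 / m\<^sup>2" "\<bar>z\<bar> \<le> e" for c1 c d z
          unfolding abs_mult using that by (intro mult_mono) auto
        have h: "\<bar>z / 2\<bar> \<le> \<bar>z\<bar>" for z :: real by simp
        show ?thesis
          by (rule add_mono[OF add_mono[OF k[OF h inv(4,1) e(1)] k[OF order_refl inv(5,2) e(2)]] k[OF h inv(6,3) e(3)]])
      qed
      also have "\<dots> = ((\<bar>a * (a - 1)\<bar> + \<bar>a * b\<bar> + \<bar>b * (b - 1)\<bar>) / m\<^sup>2) * e"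
        by (simp only: distrib_right add_divide_distrib) simp
      finally have "\<bar>E\<bar> \<le> ((\<bar>a * (a - 1)\<bar> + \<bar>a * b\<bar> + \<bar>b * (b - 1)\<bar>) / m\<^sup>2) * e" .
      then have E: "\<bar>P * E\<bar> \<le> A0 * B0 * (((\<bar>a * (a - 1)\<bar> + \<bar>a * b\<bar> + \<bar>b * (b - 1)\<bar>) / m\<^sup>2) * e)"
        unfolding abs_mult using P A0(1) B0(1) by (intro mult_mono) auto
      have id: "P * (1 + a * (\<alpha> \<omega> / u) + b * (\<beta> \<omega> / v)
         + a * (a - 1) / 2 * (\<alpha> \<omega> / u)\<^sup>2 + a * b * (\<alpha> \<omega> / u) * (\<beta> \<omega> / v) + b * (b - 1) / 2 * (\<beta> \<omega> / v)\<^sup>2)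
        = (P * (1 + a / u * \<alpha> \<omega> + b / v * \<beta> \<omega>) + t\<^sup>2 * P * q \<omega>) + P * E"
        unfolding E_def q_def by (simp add: power_divide) (simp add: algebra_simps power2_eq_square add_divide_distrib diff_divide_distrib)
      have "\<bar>J \<omega> - (P * (1 + a / u * \<alpha> \<omega> + b / v * \<beta> \<omega>) + t\<^sup>2 * P * q \<omega>)\<bar>
        \<le> C0 * (16 * K1 ^ 3 * t ^ 3 * W \<omega> ^ 6) + A0 * B0 * (((\<bar>a * (a - 1)\<bar> + \<bar>a * b\<bar> + \<bar>b * (b - 1)\<bar>) / m\<^sup>2) * e)"
        using T[unfolded id] mult_left_mono[OF c3 C0(1)] E by linarith
      also have "\<dots> = C1 * t ^ 3 * W \<omega> ^ 6" unfolding C1_def e_def by (simp only: algebra_simps)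
      finally show ?thesis .
    qed
    have meas: "X1 \<in> borel_measurable borel" "X2 \<in> borel_measurable borel"
      "\<alpha> \<in> borel_measurable borel" "\<beta> \<in> borel_measurable borel" "J \<in> borel_measurable borel"
    proof -
      show "X1 \<in> borel_measurable borel" "X2 \<in> borel_measurable borel" unfolding X1_def X2_def Y_def
        by (intro borel_measurable_continuous_onI continuous_intros)+
      have cf: "continuous_on UNIV (\<lambda>\<omega> :: (real ^ 'n) \<times> (real ^ 'n). f (x + t *\<^sub>R fst \<omega>))"
        by (rule continuous_on_compose2[OF fcont[of UNIV]]) (auto intro!: continuous_intros)
      have cg: "continuous_on UNIV (\<lambda>\<omega>. g (y + t *\<^sub>R Y \<omega>))" unfolding Y_def
        by (rule continuous_on_compose2[OF gcont[of UNIV]]) (auto intro!: continuous_intros)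
      show "\<alpha> \<in> borel_measurable borel" "\<beta> \<in> borel_measurable borel" unfolding \<alpha>_def \<beta>_def
        by (intro borel_measurable_continuous_onI continuous_intros cf cg)+
      show "J \<in> borel_measurable borel" unfolding J_def
      proof -
        have "f z \<noteq> 0" "g z \<noteq> 0" for z using f(1)[of z] g(1)[of z] assms(1) by auto
        then show "(\<lambda>\<omega>. f (x + t *\<^sub>R fst \<omega>) powr a * g (y + t *\<^sub>R Y \<omega>) powr b) \<in> borel_measurable borel"
          by (intro borel_measurable_continuous_onI continuous_intros cf cg) simp_all
      qed
    qed
    let ?GG = "gauss2 :: ((real ^ 'n) \<times> (real ^ 'n)) measure"
    have bnds: "\<bar>f z\<bar> \<le> \<bar>m\<bar> + \<bar>M\<bar>" "\<bar>g z\<bar> \<le> \<bar>m\<bar> + \<bar>M\<bar>" "\<bar>u\<bar> \<le> \<bar>m\<bar> + \<bar>M\<bar>" "\<bar>v\<bar> \<le> \<bar>m\<bar> + \<bar>M\<bar>" for z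
      using f g u v by (auto intro: abs_le_of_Icc)
    have int: "integrable ?GG \<alpha>" "integrable ?GG \<beta>"
    proof -
      show "integrable ?GG \<alpha>"
      proof (rule integrable_GG_bounded[OF meas(3)])
        show "norm (\<alpha> z) \<le> 2 * (\<bar>m\<bar> + \<bar>M\<bar>)" for z
          unfolding \<alpha>_def real_norm_def mult_2
          by (rule order_trans[OF abs_triangle_ineq4 add_mono[OF bnds(1) bnds(3)]])
      qed
      show "integrable ?GG \<beta>"
      proof (rule integrable_GG_bounded[OF meas(4)])
        show "norm (\<beta> z) \<le> 2 * (\<bar>m\<bar> + \<bar>M\<bar>)" for z
          unfolding \<beta>_def real_norm_def mult_2
          by (rule order_trans[OF abs_triangle_ineq4 add_mono[OF bnds(2) bnds(4)]])
      qed
    qed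
    have intX: "integrable ?GG (\<lambda>\<omega>. S \<omega> * T \<omega>)"
      if "S \<in> {X1, X2}" "T \<in> {X1, X2}" for S T
    proof (rule integrable_GG_poly[where c = "K1 * K1" and k = 2])
      show "(\<lambda>\<omega>. S \<omega> * T \<omega>) \<in> borel_measurable borel" using that meas by (intro borel_measurable_times) auto
      fix \<omega>
      have "\<bar>S \<omega> * T \<omega>\<bar> \<le> (K1 * W \<omega>) * (K1 * W \<omega>)" unfolding abs_mult
        using that Xb(1)[of \<omega>] Xb(2)[of \<omega>] K1 W(1)[of \<omega>] by (intro mult_mono) auto
      then show "\<bar>S \<omega> * T \<omega>\<bar> \<le> K1 * K1 * ((1 + norm (fst \<omega>)) * (1 + norm (snd \<omega>)))\<^sup>2"
        unfolding W_def by (simp only: power2_eq_square mult_ac)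
    qed
    have intq: "integrable ?GG q" unfolding q_def
      by (intro Bochner_Integration.integrable_add integrable_mult_right intX) auto
    have E\<alpha>: "(\<integral> \<omega>. \<alpha> \<omega> \<partial>?GG) = 0"
    proof -
      have i: "integrable ?GG (\<lambda>\<omega>. f (x + t *\<^sub>R fst \<omega>))"
        using Bochner_Integration.integrable_add[OF int(1), of "\<lambda>_. u"] by (simp add: \<alpha>_def)
      have "(\<integral> \<omega>. f (x + t *\<^sub>R fst \<omega>) \<partial>?GG) = u"
        unfolding u_def gav_def by (rule integral_GG_fst[of "\<lambda>z. f (x + t *\<^sub>R z)"]) simp
      then show ?thesis unfolding \<alpha>_def using i by simp
    qed
    have E\<beta>: "(\<integral> \<omega>. \<beta> \<omega> \<partial>?GG) = 0"
    proof -
      have i: "integrable ?GG (\<lambda>\<omega>. g (y + t *\<^sub>R Y \<omega>))"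
        using Bochner_Integration.integrable_add[OF int(2), of "\<lambda>_. v"] by (simp add: \<beta>_def)
      have "(\<integral> \<omega>. g (y + t *\<^sub>R Y \<omega>) \<partial>?GG) = v"
        unfolding v_def gav_def Y_def using integral_GG_rot[of "\<lambda>z. g (y + t *\<^sub>R z)" \<rho> \<rho>' 1] assms(3,4) by simp
      then show ?thesis unfolding \<beta>_def using i by simp
    qed
    have Eq: "(\<integral> \<omega>. q \<omega> \<partial>?GG) = a * (a - 1) / 2 / u\<^sup>2 * (lf x \<bullet> lf x) + a * b / (u * v) * (\<rho> * (lf x \<bullet> lg y)) + b * (b - 1) / 2 / v\<^sup>2 * (lg y \<bullet> lg y)"
    proof -
      have "(\<integral> \<omega>. X1 \<omega> * X1 \<omega> \<partial>?GG) = lf x \<bullet> lf x"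
        unfolding X1_def using integral_GG_fst[of "\<lambda>z. (lf x \<bullet> z) * (lf x \<bullet> z)"] by (simp add: integral_inner_mult_gauss)
      moreover have "(\<integral> \<omega>. X1 \<omega> * X2 \<omega> \<partial>?GG) = \<rho> * (lf x \<bullet> lg y)"
        unfolding X1_def X2_def Y_def by (rule integral_GG_inner_mult)
      moreover have "(\<integral> \<omega>. X2 \<omega> * X2 \<omega> \<partial>?GG) = lg y \<bullet> lg y"
        unfolding X2_def Y_def using integral_GG_rot[of "\<lambda>z. (lg y \<bullet> z) * (lg y \<bullet> z)" \<rho> \<rho>' 1] assms(3,4) by (simp add: integral_inner_mult_gauss)
      ultimately show ?thesis unfolding q_def using intX by simp
    qed
    have sEq: "\<sigma> * (\<integral> \<omega>. q \<omega> \<partial>?GG) \<le> 0"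
    proof -
      \<comment> \<open>\<open>quad\<close> is used at the lengths of the logarithmic gradients. The
        mixed term \<open>c\<close> is estimated in absolute value, because nothing is known about
        the angle between the two gradients.\<close>
      define s where "s = norm (lf x) / u"
      define r where "r = norm (lg y) / v"
      define c where "c = a * b / (u * v) * (\<rho> * (lf x \<bullet> lg y))"
      have "\<bar>\<sigma> * c\<bar> \<le> \<bar>\<rho> * a * b\<bar> / (u * v) * (norm (lf x) * norm (lg y))"
        unfolding c_def abs_mult assms(5) using uv0 Cauchy_Schwarz_ineq2[of "lf x" "lg y"]
        by (simp add: abs_mult divide_right_mono mult_left_mono mult_ac)
      also have "\<dots> = \<bar>\<rho> * a * b * s * r\<bar>" using uv0 by (simp add: s_def r_def abs_mult)
      finally have c: "\<sigma> * c \<le> \<bar>\<rho> * a * b * s * r\<bar>" by (rule abs_le_D1)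
      have Eq': "(\<integral> \<omega>. q \<omega> \<partial>?GG) = a * (a - 1) / 2 * s\<^sup>2 + c + b * (b - 1) / 2 * r\<^sup>2"
        unfolding Eq by (simp add: s_def r_def c_def power_divide power2_norm_eq_inner)
      have "2 * (\<sigma> * (\<integral> \<omega>. q \<omega> \<partial>?GG)) = \<sigma> * (a * (a - 1) * s\<^sup>2 + b * (b - 1) * r\<^sup>2) + 2 * (\<sigma> * c)"
        unfolding Eq' by (simp add: field_simps)
      also have "\<dots> \<le> \<sigma> * (a * (a - 1) * s\<^sup>2 + b * (b - 1) * r\<^sup>2) + 2 * \<bar>\<rho> * a * b * s * r\<bar>"
        using c by simp
      finally have "2 * (\<sigma> * (\<integral> \<omega>. q \<omega> \<partial>?GG)) \<le> \<sigma> * (a * (a - 1) * s\<^sup>2 + b * (b - 1) * r\<^sup>2) + 2 * \<bar>\<rho> * a * b * s * r\<bar>" .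
      then show ?thesis using quad[of s r] by linarith
    qed
    have Jint: "integrable ?GG J"
    proof (rule integrable_GG_bounded[OF meas(5)])
      show "norm (J \<omega>) \<le> A0 * B0" for \<omega> unfolding J_def real_norm_def abs_mult
        using f g A0 B0 by (intro mult_mono) auto
    qed
    have "\<sigma> * (\<integral> \<omega>. J \<omega> \<partial>?GG) = (\<integral> \<omega>. \<sigma> * J \<omega> \<partial>?GG)" by simp
    also have "\<dots> \<le> (\<integral> \<omega>. \<sigma> * (P * (1 + a / u * \<alpha> \<omega> + b / v * \<beta> \<omega>) + t\<^sup>2 * P * q \<omega>) + C1 * t ^ 3 * W \<omega> ^ 6 \<partial>?GG)"
    proof (rule integral_mono)
      fix \<omega>
      have k: "\<sigma> * z \<le> \<sigma> * z' + d" if "\<bar>z - z'\<bar> \<le> d" for z z' d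
      proof -
        have "\<sigma> * (z - z') \<le> \<bar>\<sigma> * (z - z')\<bar>" by (rule abs_ge_self)
        also have "\<dots> = \<bar>z - z'\<bar>" unfolding abs_mult assms(5) by simp
        also note that
        finally show ?thesis by (simp add: algebra_simps)
      qed
      show "\<sigma> * J \<omega> \<le> \<sigma> * (P * (1 + a / u * \<alpha> \<omega> + b / v * \<beta> \<omega>) + t\<^sup>2 * P * q \<omega>) + C1 * t ^ 3 * W \<omega> ^ 6"
        by (rule k[OF pw])
    qed (use int intq Jint Wi in auto)
    also have "\<dots> = \<sigma> * P + t\<^sup>2 * P * (\<sigma> * (\<integral> \<omega>. q \<omega> \<partial>?GG)) + C * t ^ 3"
      using int intq Wi E\<alpha> E\<beta> by (simp add: C_def algebra_simps)
    also have "\<dots> \<le> \<sigma> * P + C * t ^ 3"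
      using mult_nonneg_nonpos[OF _ sEq, of "t\<^sup>2 * P"] P(1) by simp
    finally show ?thesis unfolding J_def P_def u_def v_def Y_def .
  qed
  with C show ?thesis by (rule that)
qed

section \<open>Composition of many small steps\<close>

text \<open>The two pairs are regrouped by coordinates through an exchange of the two middle
  integrals; each coordinate is then a convolution of its own.\<close>

lemma GG_conv_nn:
  fixes \<Phi> :: "(real ^ 'n) \<times> (real ^ 'n) \<Rightarrow> ennreal"
  assumes \<Phi>: "\<Phi> \<in> borel_measurable borel" and c: "a\<^sup>2 + b\<^sup>2 = c\<^sup>2" "b > 0" "c > 0"
  shows "(\<integral>\<^sup>+ \<omega>'. \<integral>\<^sup>+ \<omega>. \<Phi> (a *\<^sub>R fst \<omega>' + b *\<^sub>R fst \<omega>, a *\<^sub>R snd \<omega>' + b *\<^sub>R snd \<omega>) \<partial>gauss2 \<partial>gauss2)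
       = (\<integral>\<^sup>+ \<omega>. \<Phi> (c *\<^sub>R fst \<omega>, c *\<^sub>R snd \<omega>) \<partial>gauss2)"
proof -
  have [measurable]: "\<Phi> \<in> borel_measurable (borel \<Otimes>\<^sub>M borel)" using \<Phi> by (simp only: borel_prod)
  have "(\<integral>\<^sup>+ \<omega>'. \<integral>\<^sup>+ \<omega>. \<Phi> (a *\<^sub>R fst \<omega>' + b *\<^sub>R fst \<omega>, a *\<^sub>R snd \<omega>' + b *\<^sub>R snd \<omega>) \<partial>gauss2 \<partial>gauss2)
    = (\<integral>\<^sup>+ z'. \<integral>\<^sup>+ w'. \<integral>\<^sup>+ z. \<integral>\<^sup>+ w. \<Phi> (a *\<^sub>R z' + b *\<^sub>R z, a *\<^sub>R w' + b *\<^sub>R w)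
         \<partial>gauss_measure \<partial>gauss_measure \<partial>gauss_measure \<partial>gauss_measure)"
    by (subst G.nn_integral_fst[symmetric], simp, subst (1) G.nn_integral_fst[symmetric], simp) simp
  also have "\<dots> = (\<integral>\<^sup>+ z'. \<integral>\<^sup>+ z. \<integral>\<^sup>+ w'. \<integral>\<^sup>+ w. \<Phi> (a *\<^sub>R z' + b *\<^sub>R z, a *\<^sub>R w' + b *\<^sub>R w)
         \<partial>gauss_measure \<partial>gauss_measure \<partial>gauss_measure \<partial>gauss_measure)"
    by (intro nn_integral_cong GG.Fubini') measurable
  also have "\<dots> = (\<integral>\<^sup>+ z'. \<integral>\<^sup>+ z. \<integral>\<^sup>+ w. \<Phi> (a *\<^sub>R z' + b *\<^sub>R z, c *\<^sub>R w)
         \<partial>gauss_measure \<partial>gauss_measure \<partial>gauss_measure)"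
    by (intro nn_integral_cong gauss_conv[OF c, of "\<lambda>w. \<Phi> (_, w)"]) measurable
  also have "\<dots> = (\<integral>\<^sup>+ z. \<integral>\<^sup>+ w. \<Phi> (c *\<^sub>R z, c *\<^sub>R w) \<partial>gauss_measure \<partial>gauss_measure)"
    by (intro gauss_conv[OF c, of "\<lambda>\<zeta>. \<integral>\<^sup>+ w. \<Phi> (\<zeta>, c *\<^sub>R w) \<partial>gauss_measure"]) measurable
  also have "\<dots> = (\<integral>\<^sup>+ \<omega>. \<Phi> (c *\<^sub>R fst \<omega>, c *\<^sub>R snd \<omega>) \<partial>gauss2)"
    by (subst G.nn_integral_fst[symmetric]) simp_all
  finally show ?thesis .
qed

lemma GG_conv:
  fixes \<Phi> :: "(real ^ 'n) \<times> (real ^ 'n) \<Rightarrow> real"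
  assumes \<Phi>: "continuous_on UNIV \<Phi>" and b: "\<And>\<omega>. 0 \<le> \<Phi> \<omega>" "\<And>\<omega>. \<Phi> \<omega> \<le> B" and c: "a\<^sup>2 + b\<^sup>2 = c\<^sup>2" "b > 0" "c > 0"
  shows "(\<integral> \<omega>'. \<integral> \<omega>. \<Phi> (a *\<^sub>R fst \<omega>' + b *\<^sub>R fst \<omega>, a *\<^sub>R snd \<omega>' + b *\<^sub>R snd \<omega>) \<partial>gauss2 \<partial>gauss2)
       = (\<integral> \<omega>. \<Phi> (c *\<^sub>R fst \<omega>, c *\<^sub>R snd \<omega>) \<partial>gauss2)"
    and "(\<lambda>\<omega>'. \<integral> \<omega>. \<Phi> (a *\<^sub>R fst \<omega>' + b *\<^sub>R fst \<omega>, a *\<^sub>R snd \<omega>' + b *\<^sub>R snd \<omega>) \<partial>gauss2) \<in> borel_measurable borel"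
proof -
  have m: "\<Phi> \<in> borel_measurable borel" by (rule borel_measurable_continuous_onI[OF \<Phi>])
  then have [measurable]: "\<Phi> \<in> borel_measurable (borel \<Otimes>\<^sub>M borel)" by (simp only: borel_prod)
  let ?F = "\<lambda>\<omega>' \<omega>. \<Phi> (a *\<^sub>R fst \<omega>' + b *\<^sub>R fst \<omega>, a *\<^sub>R snd \<omega>' + b *\<^sub>R snd \<omega>)"
  have "(\<lambda>\<omega>'. \<integral> \<omega>. ?F \<omega>' \<omega> \<partial>gauss2) \<in> borel_measurable gauss2"
    by measurable
  then show me: "(\<lambda>\<omega>'. \<integral> \<omega>. ?F \<omega>' \<omega> \<partial>gauss2) \<in> borel_measurable borel"
    by (simp only: measurable_cong_sets[OF sets_GG refl])
  have i: "integrable gauss2 (?F \<omega>')" for \<omega>'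
    by (rule GG.integrable_const_bound[of _ B]) (use b in auto)
  have e: "ennreal (\<integral> \<omega>. ?F \<omega>' \<omega> \<partial>gauss2) = (\<integral>\<^sup>+ \<omega>. ennreal (?F \<omega>' \<omega>) \<partial>gauss2)" for \<omega>'
    by (rule nn_integral_eq_integral[symmetric, OF i]) (use b in auto)
  have "(\<integral> \<omega>'. \<integral> \<omega>. ?F \<omega>' \<omega> \<partial>gauss2 \<partial>gauss2) = enn2real (\<integral>\<^sup>+ \<omega>'. ennreal (\<integral> \<omega>. ?F \<omega>' \<omega> \<partial>gauss2) \<partial>gauss2)"
    by (rule integral_eq_nn_integral[OF measurable_GG[OF me]]) (use b in \<open>auto intro!: integral_nonneg_AE\<close>)
  also have "\<dots> = enn2real (\<integral>\<^sup>+ \<omega>. ennreal (\<Phi> (c *\<^sub>R fst \<omega>, c *\<^sub>R snd \<omega>)) \<partial>gauss2)"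
    unfolding e using GG_conv_nn[of "\<lambda>\<omega>. ennreal (\<Phi> \<omega>)", OF _ c] m by simp
  also have "\<dots> = (\<integral> \<omega>. \<Phi> (c *\<^sub>R fst \<omega>, c *\<^sub>R snd \<omega>) \<partial>gauss2)"
    by (rule integral_eq_nn_integral[symmetric]) (use b in auto)
  finally show "(\<integral> \<omega>'. \<integral> \<omega>. ?F \<omega>' \<omega> \<partial>gauss2 \<partial>gauss2) = (\<integral> \<omega>. \<Phi> (c *\<^sub>R fst \<omega>, c *\<^sub>R snd \<omega>) \<partial>gauss2)" .
qed

lemma gav_gav:
  fixes f :: "real ^ 'n \<Rightarrow> real"
  assumes f: "continuous_on UNIV f" "\<And>x. m \<le> f x" "\<And>x. f x \<le> M" and c: "a\<^sup>2 + b\<^sup>2 = c\<^sup>2" "b > 0" "c > 0"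
  shows "gav a (gav b f) x = gav c f x"
proof -
  have [measurable]: "f \<in> borel_measurable borel" by (rule borel_measurable_continuous_onI[OF f(1)])
  let ?h = "\<lambda>z. f (x + z)"
  have i: "integrable gauss2 (\<lambda>\<omega>. ?h (a *\<^sub>R fst \<omega> + b *\<^sub>R snd \<omega>))"
    by (rule GG.integrable_const_bound[of _ "\<bar>m\<bar> + \<bar>M\<bar>"]) (use f in \<open>auto intro: abs_le_of_Icc\<close>)
  have "gav c f x = (\<integral> \<omega>. ?h (a *\<^sub>R fst \<omega> + b *\<^sub>R snd \<omega>) \<partial>gauss2)"
    unfolding gav_def by (rule integral_GG_rot[symmetric, OF _ c]) simp
  also have "\<dots> = (\<integral> z. \<integral> w. ?h (a *\<^sub>R z + b *\<^sub>R w) \<partial>gauss_measure \<partial>gauss_measure)"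
    using GG.integral_fst'[OF i] by simp
  finally show ?thesis by (simp add: gav_def add.assoc)
qed

text \<open>The variance (k + 1) t^2 is split as k t^2 + t^2. The inner step of size t is handled by
  \<open>step\<close> at a random base point, the outer one by the induction hypothesis for
  \<open>gav t f\<close> and \<open>gav t g\<close>, which belong to the same class by
  \<open>C11_gav\<close>. The errors add up linearly.\<close>

lemma iterated_estimate:
  fixes m M K a b \<rho> \<rho>' \<sigma> C t :: real and f g :: "real ^ 'n \<Rightarrow> real" and x y :: "real ^ 'n"
  assumes m: "0 < m" and rho: "\<rho>\<^sup>2 + \<rho>'\<^sup>2 = 1" "\<rho>' > 0" and s: "\<bar>\<sigma>\<bar> = 1" and t: "0 < t" "t \<le> 1" and C: "C \<ge> 0"
   and step: "\<And>f g (x :: real ^ 'n) y. \<lbrakk>C11 m M K f; C11 m M K g\<rbrakk> \<Longrightarrow>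
    \<sigma> * (\<integral> \<omega>. f (x + t *\<^sub>R fst \<omega>) powr a * g (y + t *\<^sub>R (\<rho> *\<^sub>R fst \<omega> + \<rho>' *\<^sub>R snd \<omega>)) powr b \<partial>gauss2)
      \<le> \<sigma> * (gav t f x powr a * gav t g y powr b) + C * t ^ 3"
   and fg: "C11 m M K f" "C11 m M K g"
  shows "\<sigma> * (\<integral> \<omega>. f (x + (sqrt k * t) *\<^sub>R fst \<omega>) powr a * g (y + (sqrt k * t) *\<^sub>R (\<rho> *\<^sub>R fst \<omega> + \<rho>' *\<^sub>R snd \<omega>)) powr b \<partial>gauss2)
      \<le> \<sigma> * (gav (sqrt k * t) f x powr a * gav (sqrt k * t) g y powr b) + real k * C * t ^ 3"
  using fg
proof (induction k arbitrary: f g)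
  case 0
  show ?case by (simp add: gav_def)
next
  case (Suc k)
  let ?\<tau> = "sqrt k * t" and ?\<tau>' = "sqrt (Suc k) * t"
  have \<tau>: "?\<tau>\<^sup>2 + t\<^sup>2 = ?\<tau>'\<^sup>2" "?\<tau>' > 0" using t by (auto simp: power_mult_distrib algebra_simps)
  obtain f: "\<And>x. m \<le> f x" "\<And>x. f x \<le> M" and g: "\<And>x. m \<le> g x" "\<And>x. g x \<le> M"
    using Suc.prems unfolding C11_def by blast
  have cont: "continuous_on S f" "continuous_on S g" for S using Suc.prems[THEN C11_continuous] by auto
  define \<Phi> where "\<Phi> = (\<lambda>(\<omega> :: (real ^ 'n) \<times> (real ^ 'n)). f (x + fst \<omega>) powr a * g (y + (\<rho> *\<^sub>R fst \<omega> + \<rho>' *\<^sub>R snd \<omega>)) powr b)"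
  have bd: "\<exists>B\<ge>0. \<forall>x. m \<le> x \<longrightarrow> x \<le> M \<longrightarrow> \<bar>x powr d\<bar> \<le> B" for d
  proof -
    have "continuous_on {m..M} (\<lambda>x. x powr d)"
      using m by (auto intro!: continuous_intros)
    then show ?thesis by (metis continuous_bounded_Icc)
  qed
  obtain A0 where A0: "A0 \<ge> 0" "\<And>x. m \<le> x \<Longrightarrow> x \<le> M \<Longrightarrow> \<bar>x powr a\<bar> \<le> A0" using bd[of a] by blast
  obtain B0 where B0: "B0 \<ge> 0" "\<And>x. m \<le> x \<Longrightarrow> x \<le> M \<Longrightarrow> \<bar>x powr b\<bar> \<le> B0" using bd[of b] by blast
  have \<Phi>c: "continuous_on UNIV \<Phi>"
  proof -
    have cf: "continuous_on UNIV (\<lambda>\<omega> :: (real ^ 'n) \<times> (real ^ 'n). f (x + fst \<omega>))"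
      by (rule continuous_on_compose2[OF cont(1)[of UNIV]]) (auto intro!: continuous_intros)
    have cg: "continuous_on UNIV (\<lambda>\<omega>. g (y + (\<rho> *\<^sub>R fst \<omega> + \<rho>' *\<^sub>R snd \<omega>)))"
      by (rule continuous_on_compose2[OF cont(2)[of UNIV]]) (auto intro!: continuous_intros)
    have "f z \<noteq> 0" "g z \<noteq> 0" for z using f[of z] g[of z] m by auto
    then show ?thesis unfolding \<Phi>_def by (intro continuous_intros cf cg) auto
  qed
  have \<Phi>b: "0 \<le> \<Phi> \<omega>" "\<Phi> \<omega> \<le> A0 * B0" for \<omega>
  proof -
    show "0 \<le> \<Phi> \<omega>" by (simp add: \<Phi>_def)
    have "\<bar>f (x + fst \<omega>) powr a\<bar> * \<bar>g (y + (\<rho> *\<^sub>R fst \<omega> + \<rho>' *\<^sub>R snd \<omega>)) powr b\<bar> \<le> A0 * B0"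
      using f g A0 B0 by (intro mult_mono) auto
    then show "\<Phi> \<omega> \<le> A0 * B0" by (simp add: \<Phi>_def)
  qed
  have gb: "m \<le> gav t f z" "gav t f z \<le> M" "m \<le> gav t g z" "gav t g z \<le> M" for z
    using C11_gav[OF Suc.prems(1), of t] C11_gav[OF Suc.prems(2), of t] unfolding C11_def by auto
  let ?H = "\<lambda>\<omega>' :: (real ^ 'n) \<times> (real ^ 'n). gav t f (x + ?\<tau> *\<^sub>R fst \<omega>') powr a * gav t g (y + ?\<tau> *\<^sub>R (\<rho> *\<^sub>R fst \<omega>' + \<rho>' *\<^sub>R snd \<omega>')) powr b"
  let ?I = "\<lambda>\<omega>'. \<integral> \<omega>. \<Phi> (?\<tau> *\<^sub>R fst \<omega>' + t *\<^sub>R fst \<omega>, ?\<tau> *\<^sub>R snd \<omega>' + t *\<^sub>R snd \<omega>) \<partial>gauss2"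
  have Hm: "?H \<in> borel_measurable borel"
  proof (rule borel_measurable_continuous_onI)
    have cf: "continuous_on UNIV (\<lambda>\<omega> :: (real ^ 'n) \<times> (real ^ 'n). gav t f (x + ?\<tau> *\<^sub>R fst \<omega>))"
      by (rule continuous_on_compose2[OF C11_continuous[OF C11_gav[OF Suc.prems(1)], of UNIV]]) (auto intro!: continuous_intros)
    have cg: "continuous_on UNIV (\<lambda>\<omega>. gav t g (y + ?\<tau> *\<^sub>R (\<rho> *\<^sub>R fst \<omega> + \<rho>' *\<^sub>R snd \<omega>)))"
      by (rule continuous_on_compose2[OF C11_continuous[OF C11_gav[OF Suc.prems(2)], of UNIV]]) (auto intro!: continuous_intros)
    have "gav t f z \<noteq> 0" "gav t g z \<noteq> 0" for z using gb[of z] m by auto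
    then show "continuous_on UNIV ?H" by (intro continuous_intros cf cg) auto
  qed
  have Hi: "integrable gauss2 ?H"
  proof (rule integrable_GG_bounded[OF Hm])
    show "norm (?H \<omega>) \<le> A0 * B0" for \<omega> unfolding real_norm_def abs_mult
      using gb A0 B0 by (intro mult_mono) auto
  qed
  have Ii: "integrable gauss2 ?I"
  proof (rule integrable_GG_bounded)
    show "?I \<in> borel_measurable borel" by (rule GG_conv(2)[OF \<Phi>c \<Phi>b \<tau>(1) t(1) \<tau>(2)])
    fix \<omega>'
    have 1: "0 \<le> ?I \<omega>'" using \<Phi>b by (intro integral_nonneg_AE AE_I2)
    have "?I \<omega>' \<le> A0 * B0"
    proof (rule GG.integral_le_const)
      have "\<Phi> \<in> borel_measurable borel" by (rule borel_measurable_continuous_onI[OF \<Phi>c])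
      then have [measurable]: "\<Phi> \<in> borel_measurable (borel \<Otimes>\<^sub>M borel)" by (simp only: borel_prod)
      show "integrable gauss2 (\<lambda>\<omega>. \<Phi> (?\<tau> *\<^sub>R fst \<omega>' + t *\<^sub>R fst \<omega>, ?\<tau> *\<^sub>R snd \<omega>' + t *\<^sub>R snd \<omega>))"
        by (rule GG.integrable_const_bound[of _ "A0 * B0"]) (use \<Phi>b in auto)
    qed (use \<Phi>b in auto)
    with 1 show "norm (?I \<omega>') \<le> A0 * B0" by simp
  qed
  have "\<sigma> * (\<integral> \<omega>. \<Phi> (?\<tau>' *\<^sub>R fst \<omega>, ?\<tau>' *\<^sub>R snd \<omega>) \<partial>gauss2) = (\<integral> \<omega>'. \<sigma> * ?I \<omega>' \<partial>gauss2)"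
    using GG_conv(1)[OF \<Phi>c \<Phi>b \<tau>(1) t(1) \<tau>(2)] by simp
  also have "\<dots> \<le> (\<integral> \<omega>'. \<sigma> * ?H \<omega>' + C * t ^ 3 \<partial>gauss2)"
  proof (rule integral_mono)
    fix \<omega>' :: "(real ^ 'n) \<times> (real ^ 'n)"
    show "\<sigma> * ?I \<omega>' \<le> \<sigma> * ?H \<omega>' + C * t ^ 3"
      using step[OF Suc.prems, of "x + ?\<tau> *\<^sub>R fst \<omega>'" "y + ?\<tau> *\<^sub>R (\<rho> *\<^sub>R fst \<omega>' + \<rho>' *\<^sub>R snd \<omega>')"]
      by (simp add: \<Phi>_def algebra_simps)
  qed (use Ii Hi in auto)
  also have "\<dots> = \<sigma> * (\<integral> \<omega>'. ?H \<omega>' \<partial>gauss2) + C * t ^ 3"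
    using Hi by simp
  also have "\<dots> \<le> \<sigma> * (gav ?\<tau> (gav t f) x powr a * gav ?\<tau> (gav t g) y powr b) + real k * C * t ^ 3 + C * t ^ 3"
    using Suc.IH[OF C11_gav[OF Suc.prems(1)] C11_gav[OF Suc.prems(2)]] by simp
  also have "gav ?\<tau> (gav t f) x = gav ?\<tau>' f x"
    by (rule gav_gav[OF cont(1) f \<tau>(1) t(1) \<tau>(2)])
  also have "gav ?\<tau> (gav t g) y = gav ?\<tau>' g y"
    by (rule gav_gav[OF cont(2) g \<tau>(1) t(1) \<tau>(2)])
  finally show ?case by (simp add: \<Phi>_def algebra_simps)
qed

text \<open>The k + 1 steps of standard deviation t = 1/sqrt(k + 1) compose to the unit Gaussian,
  and the total error (k + 1) C t^3 = C/sqrt(k + 1) vanishes in the limit.\<close>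

lemma gaussian_jensen_C11:
  fixes f g :: "real ^ 'n \<Rightarrow> real"
  assumes "0 < m" "0 \<le> K" "\<rho>\<^sup>2 + \<rho>'\<^sup>2 = 1" "\<rho>' > 0" "\<bar>\<sigma>\<bar> = 1"
    and "\<And>s t. \<sigma> * (a * (a - 1) * s\<^sup>2 + b * (b - 1) * t\<^sup>2) + 2 * \<bar>\<rho> * a * b * s * t\<bar> \<le> 0"
    and "C11 m M K f" "C11 m M K g"
  shows "\<sigma> * (\<integral> \<omega>. f (fst \<omega>) powr a * g (\<rho> *\<^sub>R fst \<omega> + \<rho>' *\<^sub>R snd \<omega>) powr b \<partial>gauss2)
     \<le> \<sigma> * ((\<integral> z. f z \<partial>gauss_measure) powr a * (\<integral> z. g z \<partial>gauss_measure) powr b)"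
proof -
  obtain C where C: "C \<ge> 0" "\<And>f g (x :: real ^ 'n) y t. \<lbrakk>C11 m M K f; C11 m M K g; 0 \<le> t; t \<le> 1\<rbrakk> \<Longrightarrow>
    \<sigma> * (\<integral> \<omega>. f (x + t *\<^sub>R fst \<omega>) powr a * g (y + t *\<^sub>R (\<rho> *\<^sub>R fst \<omega> + \<rho>' *\<^sub>R snd \<omega>)) powr b \<partial>gauss2)
      \<le> \<sigma> * (gav t f x powr a * gav t g y powr b) + C * t ^ 3"
    using small_time_estimate[OF assms(1-6), where 'n = 'n, of M] by blast
  have "\<sigma> * (\<integral> \<omega>. f (fst \<omega>) powr a * g (\<rho> *\<^sub>R fst \<omega> + \<rho>' *\<^sub>R snd \<omega>) powr b \<partial>gauss2)
     \<le> \<sigma> * ((\<integral> z. f z \<partial>gauss_measure) powr a * (\<integral> z. g z \<partial>gauss_measure) powr b) + C * (1 / sqrt (Suc k))" for k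
  proof -
    define t where "t = 1 / sqrt (Suc k)"
    have t: "0 < t" "t \<le> 1" "sqrt (Suc k) * t = 1" by (auto simp: t_def)
    have "real (Suc k) * C * t ^ 3 = C * t * (sqrt (Suc k) * t)\<^sup>2"
      by (simp add: power_mult_distrib power3_eq_cube power2_eq_square)
    also have "\<dots> = C * t" unfolding t(3) by simp
    finally have e: "real (Suc k) * C * t ^ 3 = C * t" .
    have "\<sigma> * (\<integral> \<omega>. f (0 + (sqrt (Suc k) * t) *\<^sub>R fst \<omega>) powr a * g (0 + (sqrt (Suc k) * t) *\<^sub>R (\<rho> *\<^sub>R fst \<omega> + \<rho>' *\<^sub>R snd \<omega>)) powr b \<partial>gauss2)
      \<le> \<sigma> * (gav (sqrt (Suc k) * t) f 0 powr a * gav (sqrt (Suc k) * t) g 0 powr b) + real (Suc k) * C * t ^ 3"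
      by (rule iterated_estimate[OF assms(1,3,4,5) t(1,2) C(1) C(2)[OF _ _ less_imp_le[OF t(1)] t(2)] assms(7,8)])
    then show ?thesis unfolding t(3) e by (simp add: gav_def t_def)
  qed
  moreover have "(\<lambda>k. R + C * (1 / sqrt (Suc k))) \<longlonglongrightarrow> R" for R
    by real_asymp
  ultimately show ?thesis by (rule LIMSEQ_le_const[rotated, OF exI, OF allI, OF impI])
qed

section \<open>Regularization of bounded continuous functions\<close>

text \<open>A second-order expansion valid at all points forces the gradient to be Lipschitz: the
  expansions from x to x + h, from y to x and from y to x + h are combined, with h opposite to l x -
  l y and of length |x - y|. Their errors K, K and 4K add up to the factor 6.\<close>

lemma C11_of_expansion:
  fixes f :: "real ^ 'n \<Rightarrow> real"
  assumes "\<And>x. m \<le> f x" "\<And>x. f x \<le> M" "K \<ge> 0" "\<And>x. norm (l x) \<le> K"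
    and l: "\<And>x h. \<bar>f (x + h) - f x - l x \<bullet> h\<bar> \<le> K * (norm h)\<^sup>2"
  shows "C11 m M (6 * K) f"
proof -
  have "norm (l x - l y) \<le> 6 * K * norm (x - y)" for x y
  proof -
    define d where "d = norm (x - y)"
    have "norm (l x - l y) * d \<le> 6 * K * d * d"
    proof (cases "l x = l y")
      case False
      define h where "h = (- d / norm (l x - l y)) *\<^sub>R (l x - l y)"
      have nh: "norm h = d" using False by (simp add: h_def d_def)
      have ih: "(l x - l y) \<bullet> h = - (norm (l x - l y) * d)"
        using False by (simp add: h_def power2_norm_eq_inner[symmetric] power2_eq_square)
      have 1: "\<bar>f (x + h) - f x - l x \<bullet> h\<bar> \<le> K * d\<^sup>2" using l[of x h] nh by simp
      have 2: "\<bar>f x - f y - l y \<bullet> (x - y)\<bar> \<le> K * d\<^sup>2" using l[of y "x - y"] by (simp add: d_def)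
      have 3: "\<bar>f (x + h) - f y - l y \<bullet> (x - y + h)\<bar> \<le> K * (2 * d)\<^sup>2"
      proof -
        have "norm (x - y + h) \<le> 2 * d" using norm_triangle_ineq[of "x - y" h] nh by (simp add: d_def)
        then have "K * (norm (x - y + h))\<^sup>2 \<le> K * (2 * d)\<^sup>2" using assms(3) by (intro mult_left_mono power_mono) auto
        with l[of y "x - y + h"] show ?thesis by simp
      qed
      have "- ((l x - l y) \<bullet> h) = (f (x + h) - f x - l x \<bullet> h) + (f x - f y - l y \<bullet> (x - y)) - (f (x + h) - f y - l y \<bullet> (x - y + h))"
        by (simp add: inner_diff_left inner_add_right)
      then have "norm (l x - l y) * d \<le> K * d\<^sup>2 + K * d\<^sup>2 + K * (2 * d)\<^sup>2"
        using abs_le_D1[OF 1] abs_le_D1[OF 2] abs_le_D2[OF 3] unfolding ih by linarith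
      then show ?thesis by (simp add: power2_eq_square)
    qed (use assms(3) in \<open>simp add: d_def\<close>)
    then show ?thesis by (cases "d = 0") (auto simp: d_def)
  qed
  moreover have "K * c \<le> 6 * K * c" if "c \<ge> 0" for c using assms(3) that by (intro mult_right_mono) auto
  ultimately show ?thesis unfolding C11_def
  proof (intro conjI allI exI[of _ l])
    fix x h show "norm (l x) \<le> 6 * K" using assms(4)[of x] assms(3) by simp
    show "\<bar>f (x + h) - f x - l x \<bullet> h\<bar> \<le> 6 * K * (norm h)\<^sup>2"
      using l[of x h] assms(3) mult_right_mono[of K "6 * K" "(norm h)\<^sup>2"] by simp
  qed (use assms(1,2) in auto)
qed

lemma C11_mono:
  assumes "C11 m M K f" "K \<le> K'"
  shows "C11 m M K' f"
proof -
  obtain l where f: "\<And>x. m \<le> f x" "\<And>x. f x \<le> M" and l: "\<And>x. norm (l x) \<le> K"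
    "\<And>x y. norm (l x - l y) \<le> K * norm (x - y)" "\<And>x h. \<bar>f (x + h) - f x - l x \<bullet> h\<bar> \<le> K * (norm h)\<^sup>2"
    using assms unfolding C11_def by blast
  show ?thesis unfolding C11_def
  proof (intro conjI allI exI[of _ l])
    fix x y h
    show "norm (l x) \<le> K'" using l(1)[of x] assms(2) by linarith
    show "norm (l x - l y) \<le> K' * norm (x - y)"
      by (rule order_trans[OF l(2) mult_right_mono[OF assms(2)]]) simp
    show "\<bar>f (x + h) - f x - l x \<bullet> h\<bar> \<le> K' * (norm h)\<^sup>2"
      by (rule order_trans[OF l(3) mult_right_mono[OF assms(2)]]) simp
  qed (use f in auto)
qed

lemma exp_remainder2: "\<bar>exp y - 1 - y\<bar> \<le> y\<^sup>2 * exp \<bar>y :: real\<bar>"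
proof -
  obtain t where t: "\<bar>t\<bar> \<le> \<bar>y\<bar>" "exp y = (\<Sum>m<2. y ^ m / fact m) + exp t / fact 2 * y ^ 2"
    using Maclaurin_exp_le[of y 2] by blast
  have "exp y - 1 - y = exp t / 2 * y\<^sup>2" using t(2) by (simp add: numeral_2_eq_2)
  also have "\<bar>\<dots>\<bar> \<le> y\<^sup>2 * exp \<bar>y\<bar>"
  proof -
    have "exp t \<le> exp \<bar>y\<bar>" using t(1) by simp
    then have "exp t / 2 \<le> exp \<bar>y\<bar>" using exp_gt_zero[of t] by linarith
    from mult_right_mono[OF this, of "y\<^sup>2"] show ?thesis by (simp add: abs_mult mult.commute)
  qed
  finally show ?thesis .
qed

lemma power_div_fact_le_exp:
  fixes t :: real
  assumes "t \<ge> 0"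
  shows "t ^ k / fact k \<le> exp t"
proof -
  have "(\<Sum>i\<in>{k}. t ^ i /\<^sub>R fact i) \<le> exp t"
    unfolding exp_def using assms summable_exp_generic[of t] by (intro sum_le_suminf) auto
  then show ?thesis by (simp add: divide_inverse mult.commute)
qed

text \<open>The exponential is the density of the Gaussian translated by k. Beyond its linear part
  it is of order |k|^2, with a weight in z whose coefficient 1/4 is again below the integrability
  threshold; (|z|/2 - 2)^2 >= 0 produces the constant 6.\<close>

lemma exp_tilt_remainder:
  fixes k z :: "'a :: real_inner"
  assumes "norm k \<le> 1"
  shows "\<bar>exp (k \<bullet> z - (norm k)\<^sup>2 / 2) - 1 - k \<bullet> z\<bar> \<le> (norm k)\<^sup>2 * (2 * exp 6 * exp (1 / 4 * (norm z)\<^sup>2) + 1)"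
proof -
  define y where "y = k \<bullet> z - (norm k)\<^sup>2 / 2"
  define n where "n = norm z + 1"
  have n: "n \<ge> 1" by (simp add: n_def)
  have y: "\<bar>y\<bar> \<le> norm k * n"
  proof -
    have "\<bar>y\<bar> \<le> \<bar>k \<bullet> z\<bar> + (norm k)\<^sup>2 / 2" unfolding y_def by (rule order_trans[OF abs_triangle_ineq4]) simp
    also have "\<dots> \<le> norm k * norm z + norm k * 1"
    proof (rule add_mono[OF Cauchy_Schwarz_ineq2])
      have "norm k * norm k \<le> norm k * 1" using assms by (intro mult_left_mono) auto
      then show "(norm k)\<^sup>2 / 2 \<le> norm k * 1" using norm_ge_zero[of k] unfolding power2_eq_square by linarith
    qed
    finally show ?thesis by (simp add: n_def algebra_simps)
  qed
  have yn: "\<bar>y\<bar> \<le> n" using y assms n mult_right_mono[of "norm k" 1 n] by linarith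
  have sq: "n\<^sup>2 \<le> 2 * exp n"
  proof -
    have "n ^ 2 / fact 2 \<le> exp n" using n by (intro power_div_fact_le_exp) auto
    then show ?thesis by simp
  qed
  have "\<bar>exp y - 1 - y\<bar> \<le> y\<^sup>2 * exp \<bar>y\<bar>" by (rule exp_remainder2)
  also have "\<dots> \<le> (norm k * n)\<^sup>2 * exp n"
  proof (rule mult_mono)
    show "y\<^sup>2 \<le> (norm k * n)\<^sup>2" using power_mono[OF y abs_ge_zero, of 2] by simp
  qed (use yn in auto)
  also have "\<dots> = (norm k)\<^sup>2 * (n\<^sup>2 * exp n)" by (simp add: power_mult_distrib)
  also have "\<dots> \<le> (norm k)\<^sup>2 * (2 * exp 6 * exp (1 / 4 * (norm z)\<^sup>2))"
  proof (rule mult_left_mono)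
    have "n\<^sup>2 * exp n \<le> (2 * exp n) * exp n" using sq by (intro mult_right_mono) auto
    also have "\<dots> = 2 * exp (2 * n)" by (simp add: exp_add[symmetric])
    also have "\<dots> \<le> 2 * exp (6 + 1 / 4 * (norm z)\<^sup>2)"
    proof -
      have "0 \<le> (norm z / 2 - 2)\<^sup>2" by simp
      then have "2 * n \<le> 6 + 1 / 4 * (norm z)\<^sup>2" by (simp add: n_def power2_eq_square algebra_simps)
      then show ?thesis by simp
    qed
    finally show "n\<^sup>2 * exp n \<le> 2 * exp 6 * exp (1 / 4 * (norm z)\<^sup>2)" by (simp add: exp_add)
  qed simp
  finally have 1: "\<bar>exp y - 1 - y\<bar> \<le> (norm k)\<^sup>2 * (2 * exp 6 * exp (1 / 4 * (norm z)\<^sup>2))" .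
  have e: "exp y - 1 - k \<bullet> z = (exp y - 1 - y) - (norm k)\<^sup>2 / 2" by (simp add: y_def)
  have "\<bar>exp y - 1 - k \<bullet> z\<bar> \<le> \<bar>exp y - 1 - y\<bar> + \<bar>(norm k)\<^sup>2 / 2\<bar>"
    unfolding e by (rule abs_triangle_ineq4)
  also have "\<dots> \<le> \<bar>exp y - 1 - y\<bar> + (norm k)\<^sup>2" by simp
  finally have "\<bar>exp y - 1 - k \<bullet> z\<bar> \<le> \<bar>exp y - 1 - y\<bar> + (norm k)\<^sup>2" .
  with 1 show ?thesis unfolding y_def by (simp add: algebra_simps)
qed

text \<open>The Cameron-Martin formula.\<close>

lemma integral_gauss_shift:
  fixes F :: "real ^ 'n \<Rightarrow> real"
  assumes [measurable]: "F \<in> borel_measurable borel" and F: "\<And>z. 0 \<le> F z"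
  shows "(\<integral> z. F (k + z) \<partial>gauss_measure) = (\<integral> z. exp (k \<bullet> z - (norm k)\<^sup>2 / 2) * F z \<partial>gauss_measure)"
proof -
  have "(\<integral>\<^sup>+ z. ennreal (exp (k \<bullet> z - (norm k)\<^sup>2 / 2) * F z) \<partial>gauss_measure)
     = (\<integral>\<^sup>+ z. ennreal (exp (- (norm k)\<^sup>2 / 2)) * (ennreal (exp (k \<bullet> z)) * ennreal (F z)) \<partial>gauss_measure)"
  proof (intro nn_integral_cong)
    fix z
    have "exp (k \<bullet> z - (norm k)\<^sup>2 / 2) = exp (- (norm k)\<^sup>2 / 2) * exp (k \<bullet> z)" by (simp add: exp_add[symmetric])
    then show "ennreal (exp (k \<bullet> z - (norm k)\<^sup>2 / 2) * F z) = ennreal (exp (- (norm k)\<^sup>2 / 2)) * (ennreal (exp (k \<bullet> z)) * ennreal (F z))"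
      using F by (simp add: ennreal_mult mult.assoc)
  qed
  also have "\<dots> = ennreal (exp (- (norm k)\<^sup>2 / 2)) * (ennreal (exp ((norm k)\<^sup>2 / 2)) * (\<integral>\<^sup>+ z. ennreal (F (k + z)) \<partial>gauss_measure))"
    by (subst nn_integral_cmult) (auto simp: gauss_shift)
  also have "\<dots> = (\<integral>\<^sup>+ z. ennreal (F (k + z)) \<partial>gauss_measure)"
    by (simp add: mult.assoc[symmetric] ennreal_mult[symmetric] exp_add[symmetric])
  finally show ?thesis using F by (subst (1 2) integral_eq_nn_integral) auto
qed

text \<open>The shift of x is moved onto the Gaussian by \<open>integral_gauss_shift\<close>, so f
  itself is never differentiated. The gradient is 1/\<eta> times the average of f(x + \<eta> z)
  z.\<close>

lemma gav_C11:
  fixes f :: "real ^ 'n \<Rightarrow> real"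
  assumes f: "continuous_on UNIV f" "\<And>x. m \<le> f x" "\<And>x. f x \<le> M" and m: "0 \<le> m" and eta: "0 < \<eta>"
  shows "\<exists>K\<ge>0. C11 m M K (gav \<eta> f)"
proof -
  have [measurable]: "f \<in> borel_measurable borel" by (rule borel_measurable_continuous_onI[OF f(1)])
  have M: "0 \<le> M" using f(2)[of 0] f(3)[of 0] m by linarith
  have fa: "\<bar>f x\<bar> \<le> M" "0 \<le> f x" for x using f(2)[of x] f(3)[of x] m by auto
  define c1 where "c1 = (\<integral> z. norm z \<partial>(gauss_measure :: (real ^ 'n) measure))"
  define w where "w = (\<lambda>z :: real ^ 'n. 2 * exp 6 * exp (1 / 4 * (norm z)\<^sup>2) + 1)"
  define D where "D = (\<integral> z. w z \<partial>gauss_measure)"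
  have wi: "integrable gauss_measure w" unfolding w_def
    by (intro Bochner_Integration.integrable_add integrable_mult_right integrable_exp_norm_sq_gauss) auto
  have nz: "integrable (gauss_measure :: (real ^ 'n) measure) (\<lambda>z. norm z)"
    using integrable_norm_power_gauss[of 1] by simp
  have c1: "c1 \<ge> 0" unfolding c1_def by (intro integral_nonneg_AE) auto
  have D: "D \<ge> 0" unfolding D_def w_def by (intro integral_nonneg_AE) auto
  define l where "l = (\<lambda>x. (1 / \<eta>) *\<^sub>R (\<integral> z. f (x + \<eta> *\<^sub>R z) *\<^sub>R z \<partial>gauss_measure))"
  have fi: "integrable gauss_measure (\<lambda>z. f (x + \<eta> *\<^sub>R z))" for x
    by (rule integrable_gauss_bounded[of _ M]) (use fa in auto)
  have fzi: "integrable gauss_measure (\<lambda>z. f (x + \<eta> *\<^sub>R z) *\<^sub>R z)" for x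
  proof (rule Bochner_Integration.integrable_bound)
    show "integrable gauss_measure (\<lambda>z :: real ^ 'n. M * norm z)" using nz by simp
    show "AE z in gauss_measure. norm (f (x + \<eta> *\<^sub>R z) *\<^sub>R z) \<le> norm (M * norm z)"
      using fa M by (auto intro!: AE_I2 mult_right_mono simp: abs_mult)
  qed simp
  have lb: "norm (l x) \<le> M * c1 / \<eta>" for x
  proof -
    have "norm (\<integral> z. f (x + \<eta> *\<^sub>R z) *\<^sub>R z \<partial>gauss_measure) \<le> (\<integral> z. norm (f (x + \<eta> *\<^sub>R z) *\<^sub>R z) \<partial>gauss_measure)"
      by (rule integral_norm_bound)
    also have "\<dots> \<le> (\<integral> z. M * norm z \<partial>(gauss_measure :: (real ^ 'n) measure))"
      using fa M nz fzi by (intro integral_mono integrable_norm) (auto intro: mult_right_mono)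
    also have "\<dots> = M * c1" by (simp add: c1_def)
    finally show ?thesis using eta by (simp add: l_def divide_right_mono)
  qed
  \<comment> \<open>The first entry bounds the gradient, the second the error of the
    expansion.\<close>
  define K where "K = max (M * c1 / \<eta>) (M * (2 + c1 + D) / \<eta>\<^sup>2)"
  have K0: "K \<ge> 0" unfolding K_def using M c1 eta by (simp add: le_max_iff_disj)
  have exp: "\<bar>gav \<eta> f (x + h) - gav \<eta> f x - l x \<bullet> h\<bar> \<le> K * (norm h)\<^sup>2" for x h
  proof -
    define k where "k = (1 / \<eta>) *\<^sub>R h"
    have nk: "(norm h)\<^sup>2 / \<eta>\<^sup>2 = (norm k)\<^sup>2" "norm h = \<eta> * norm k" using eta by (auto simp: k_def power_divide)
    have gb: "\<bar>gav \<eta> f y\<bar> \<le> M" for y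
    proof -
      have "\<bar>gav \<eta> f y\<bar> \<le> (\<integral> z. \<bar>f (y + \<eta> *\<^sub>R z)\<bar> \<partial>gauss_measure)" unfolding gav_def by (rule integral_abs_bound)
      also have "\<dots> \<le> M" by (rule G.integral_le_const) (use fi fa in auto)
      finally show ?thesis .
    qed
    have "\<bar>gav \<eta> f (x + h) - gav \<eta> f x - l x \<bullet> h\<bar> \<le> M * (2 + c1 + D) * (norm k)\<^sup>2"
    proof (cases "norm k \<le> 1")
      case True
      define G where "G = (\<lambda>z. f (x + \<eta> *\<^sub>R z) * (exp (k \<bullet> z - (norm k)\<^sup>2 / 2) - 1 - k \<bullet> z))"
      have Gm: "G \<in> borel_measurable borel" unfolding G_def by measurable
      have Gb: "\<bar>G z\<bar> \<le> M * ((norm k)\<^sup>2 * w z)" for z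
        unfolding G_def abs_mult w_def using fa M exp_tilt_remainder[OF True, of z] by (intro mult_mono) auto
      have Gi: "integrable gauss_measure G"
      proof (rule Bochner_Integration.integrable_bound)
        show "integrable gauss_measure (\<lambda>z. M * ((norm k)\<^sup>2 * w z))" using wi by simp
        show "AE z in gauss_measure. norm (G z) \<le> norm (M * ((norm k)\<^sup>2 * w z))"
          using Gb by (intro AE_I2) (metis abs_ge_self order_trans real_norm_def)
      qed (use Gm in simp)
      have i3: "integrable gauss_measure (\<lambda>z. f (x + \<eta> *\<^sub>R z) * (k \<bullet> z))"
        using integrable_inner_right[OF fzi, of k x] by (simp)
      have "gav \<eta> f (x + h) = (\<integral> z. f (x + \<eta> *\<^sub>R (k + z)) \<partial>gauss_measure)"
        using eta by (simp add: gav_def k_def algebra_simps)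
      also have "\<dots> = (\<integral> z. exp (k \<bullet> z - (norm k)\<^sup>2 / 2) * f (x + \<eta> *\<^sub>R z) \<partial>gauss_measure)"
        by (rule integral_gauss_shift) (use fa in auto)
      also have "\<dots> = (\<integral> z. G z + f (x + \<eta> *\<^sub>R z) + f (x + \<eta> *\<^sub>R z) * (k \<bullet> z) \<partial>gauss_measure)"
        by (intro Bochner_Integration.integral_cong) (auto simp: G_def algebra_simps)
      also have "\<dots> = (\<integral> z. G z \<partial>gauss_measure) + gav \<eta> f x + (\<integral> z. f (x + \<eta> *\<^sub>R z) * (k \<bullet> z) \<partial>gauss_measure)"
        using Gi fi i3 by (simp add: gav_def)
      also have "(\<integral> z. f (x + \<eta> *\<^sub>R z) * (k \<bullet> z) \<partial>gauss_measure) = l x \<bullet> h"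
      proof -
        have "l x \<bullet> h = k \<bullet> (\<integral> z. f (x + \<eta> *\<^sub>R z) *\<^sub>R z \<partial>gauss_measure)" by (simp add: l_def k_def inner_commute)
        also have "\<dots> = (\<integral> z. k \<bullet> (f (x + \<eta> *\<^sub>R z) *\<^sub>R z) \<partial>gauss_measure)"
          by (rule integral_inner_right[symmetric]) (rule fzi)
        also have "\<dots> = (\<integral> z. f (x + \<eta> *\<^sub>R z) * (k \<bullet> z) \<partial>gauss_measure)" by simp
        finally show ?thesis by simp
      qed
      finally have "gav \<eta> f (x + h) - gav \<eta> f x - l x \<bullet> h = (\<integral> z. G z \<partial>gauss_measure)" by simp
      moreover have "\<bar>\<integral> z. G z \<partial>gauss_measure\<bar> \<le> (\<integral> z. \<bar>G z\<bar> \<partial>gauss_measure)" by (rule integral_abs_bound)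
      moreover have "(\<integral> z. \<bar>G z\<bar> \<partial>gauss_measure) \<le> (\<integral> z. M * ((norm k)\<^sup>2 * w z) \<partial>gauss_measure)"
        using Gb Gi wi by (intro integral_mono) auto
      moreover have "(\<integral> z. M * ((norm k)\<^sup>2 * w z) \<partial>gauss_measure) = M * D * (norm k)\<^sup>2" by (simp add: D_def)
      moreover have "M * D * (norm k)\<^sup>2 \<le> M * (2 + c1 + D) * (norm k)\<^sup>2"
        using M c1 by (intro mult_right_mono mult_left_mono) auto
      ultimately show ?thesis by linarith
    next
      case False
      \<comment> \<open>For |k| > 1 no cancellation is required: the bounds on \<open>gav\<close>
        and on \<open>l\<close> are already dominated by multiples of |k|^2.\<close>
      then have k1: "1 \<le> norm k" by simp
      then have "norm k * 1 \<le> norm k * norm k" by (intro mult_left_mono) auto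
      then have k2: "1 \<le> (norm k)\<^sup>2" "norm k \<le> (norm k)\<^sup>2" using k1 unfolding power2_eq_square by linarith+
      have "\<bar>l x \<bullet> h\<bar> \<le> norm (l x) * norm h" by (rule Cauchy_Schwarz_ineq2)
      also have "\<dots> \<le> (M * c1 / \<eta>) * norm h" using lb by (intro mult_right_mono) auto
      also have "\<dots> = M * c1 * norm k" using eta nk by simp
      also have "\<dots> \<le> M * c1 * (norm k)\<^sup>2" using k2 M c1 by (intro mult_left_mono) auto
      finally have 1: "\<bar>l x \<bullet> h\<bar> \<le> M * c1 * (norm k)\<^sup>2" .
      have "\<bar>gav \<eta> f (x + h) - gav \<eta> f x\<bar> \<le> M + M"
        by (rule order_trans[OF abs_triangle_ineq4 add_mono[OF gb gb]])
      also have "\<dots> \<le> M * 2 * (norm k)\<^sup>2" using k2 M mult_left_mono[of 1 "(norm k)\<^sup>2" "M * 2"] by simp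
      finally have 2: "\<bar>gav \<eta> f (x + h) - gav \<eta> f x\<bar> \<le> M * 2 * (norm k)\<^sup>2" .
      have "\<bar>gav \<eta> f (x + h) - gav \<eta> f x - l x \<bullet> h\<bar> \<le> M * 2 * (norm k)\<^sup>2 + M * c1 * (norm k)\<^sup>2"
        by (rule order_trans[OF abs_triangle_ineq4 add_mono[OF 2 1]])
      also have "\<dots> = M * (2 + c1 + 0) * (norm k)\<^sup>2" by (simp add: algebra_simps)
      also have "\<dots> \<le> M * (2 + c1 + D) * (norm k)\<^sup>2" using M D by (intro mult_right_mono mult_left_mono) auto
      finally show ?thesis .
    qed
    also have "\<dots> = M * (2 + c1 + D) / \<eta>\<^sup>2 * (norm h)\<^sup>2" using eta by (simp add: nk(1)[symmetric])
    also have "\<dots> \<le> K * (norm h)\<^sup>2" unfolding K_def by (intro mult_right_mono) auto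
    finally show ?thesis .
  qed
  have gav_b: "m \<le> gav \<eta> f x" "gav \<eta> f x \<le> M" for x
    unfolding gav_def by (auto intro!: G.integral_ge_const G.integral_le_const fi f)
  have "C11 m M (6 * K) (gav \<eta> f)"
    by (rule C11_of_expansion[OF gav_b K0 _ exp]) (use lb in \<open>auto simp: K_def le_max_iff_disj\<close>)
  then show ?thesis using K0 by (intro exI[of _ "6 * K"]) auto
qed

lemma gav_tendsto:
  fixes f :: "real ^ 'n \<Rightarrow> real"
  assumes f: "continuous_on UNIV f" "\<And>x. m \<le> f x" "\<And>x. f x \<le> M"
  shows "(\<lambda>k. gav (1 / Suc k) f x) \<longlonglongrightarrow> f x"
proof -
  have [measurable]: "f \<in> borel_measurable borel" by (rule borel_measurable_continuous_onI[OF f(1)])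
  have "(\<lambda>k. gav (1 / Suc k) f x) \<longlonglongrightarrow> (\<integral> z. f x \<partial>(gauss_measure :: (real ^ 'n) measure))"
    unfolding gav_def
  proof (rule integral_dominated_convergence[where w = "\<lambda>_. \<bar>m\<bar> + \<bar>M\<bar>"])
    show "AE z in gauss_measure. (\<lambda>k. f (x + (1 / Suc k) *\<^sub>R z)) \<longlonglongrightarrow> f x"
    proof (rule AE_I2)
      fix z
      have "(\<lambda>k. (1 / real (Suc k))) \<longlonglongrightarrow> 0" by real_asymp
      then have "(\<lambda>k. x + (1 / real (Suc k)) *\<^sub>R z) \<longlonglongrightarrow> x + 0 *\<^sub>R z" by (intro tendsto_intros)
      then have "(\<lambda>k. x + (1 / real (Suc k)) *\<^sub>R z) \<longlonglongrightarrow> x" by simp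
      moreover have "isCont f x" using f(1) by (simp add: continuous_on_eq_continuous_at)
      ultimately show "(\<lambda>k. f (x + (1 / Suc k) *\<^sub>R z)) \<longlonglongrightarrow> f x"
        by (rule isCont_tendsto_compose[rotated])
    qed
  qed (use f in \<open>auto intro: abs_le_of_Icc\<close>)
  then show ?thesis by simp
qed

lemma powr_bound_Icc:
  fixes m M d :: real
  assumes "0 < m"
  obtains B where "B \<ge> 0" "\<And>x. m \<le> x \<Longrightarrow> x \<le> M \<Longrightarrow> \<bar>x powr d\<bar> \<le> B"
proof -
  have "continuous_on {m..M} (\<lambda>x. x powr d)"
    using assms by (auto intro!: continuous_intros)
  then show ?thesis using that by (metis continuous_bounded_Icc)
qed

text \<open>Both sides pass to the limit along \<open>gav (1 / Suc k)\<close>. The averages keep the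
  bounds m and M, so their powers stay bounded whatever the signs of a and b.\<close>

lemma gaussian_jensen:
  fixes f g :: "real ^ 'n \<Rightarrow> real"
  assumes m: "0 < m" and rho: "\<rho>\<^sup>2 + \<rho>'\<^sup>2 = 1" "\<rho>' > 0" and s: "\<bar>\<sigma>\<bar> = 1"
    and quad: "\<And>s t. \<sigma> * (a * (a - 1) * s\<^sup>2 + b * (b - 1) * t\<^sup>2) + 2 * \<bar>\<rho> * a * b * s * t\<bar> \<le> 0"
    and f: "continuous_on UNIV f" "\<And>x. m \<le> f x" "\<And>x. f x \<le> M"
    and g: "continuous_on UNIV g" "\<And>x. m \<le> g x" "\<And>x. g x \<le> M"
  shows "\<sigma> * (\<integral> \<omega>. f (fst \<omega>) powr a * g (\<rho> *\<^sub>R fst \<omega> + \<rho>' *\<^sub>R snd \<omega>) powr b \<partial>gauss2)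
     \<le> \<sigma> * ((\<integral> z. f z \<partial>gauss_measure) powr a * (\<integral> z. g z \<partial>gauss_measure) powr b)"
proof -
  have [measurable]: "f \<in> borel_measurable borel" "g \<in> borel_measurable borel"
    using f(1) g(1) by (auto intro: borel_measurable_continuous_onI)
  let ?f = "\<lambda>k::nat. gav (1 / Suc k) f" and ?g = "\<lambda>k::nat. gav (1 / Suc k) g"
  have C: "\<exists>K\<ge>0. C11 m M K (?f k)" "\<exists>K\<ge>0. C11 m M K (?g k)" for k
    using gav_C11[OF f less_imp_le[OF m], of "1 / Suc k"] gav_C11[OF g less_imp_le[OF m], of "1 / Suc k"] by auto
  have fb: "m \<le> ?f k x" "?f k x \<le> M" "m \<le> ?g k x" "?g k x \<le> M" for k x
    using C[of k] unfolding C11_def by auto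
  have [measurable]: "?f k \<in> borel_measurable borel" "?g k \<in> borel_measurable borel" for k
    using C[of k] C11_measurable by blast+
  have main: "\<sigma> * (\<integral> \<omega>. ?f k (fst \<omega>) powr a * ?g k (\<rho> *\<^sub>R fst \<omega> + \<rho>' *\<^sub>R snd \<omega>) powr b \<partial>gauss2)
     \<le> \<sigma> * ((\<integral> z. ?f k z \<partial>gauss_measure) powr a * (\<integral> z. ?g k z \<partial>gauss_measure) powr b)" for k
  proof -
    obtain K1 K2 where K: "K1 \<ge> 0" "C11 m M K1 (?f k)" "K2 \<ge> 0" "C11 m M K2 (?g k)" using C[of k] by blast
    show ?thesis
      by (rule gaussian_jensen_C11[OF m _ rho s quad C11_mono[OF K(2)] C11_mono[OF K(4)], of "max K1 K2"]) (use K in auto)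
  qed
  obtain A0 where A0: "A0 \<ge> 0" "\<And>x. m \<le> x \<Longrightarrow> x \<le> M \<Longrightarrow> \<bar>x powr a\<bar> \<le> A0" using powr_bound_Icc[OF m, of M a] by metis
  obtain B0 where B0: "B0 \<ge> 0" "\<And>x. m \<le> x \<Longrightarrow> x \<le> M \<Longrightarrow> \<bar>x powr b\<bar> \<le> B0" using powr_bound_Icc[OF m, of M b] by metis
  have nz: "f x \<noteq> 0" "g x \<noteq> 0" for x using f(2)[of x] g(2)[of x] m by auto
  have L: "(\<lambda>k. \<integral> \<omega>. ?f k (fst \<omega>) powr a * ?g k (\<rho> *\<^sub>R fst \<omega> + \<rho>' *\<^sub>R snd \<omega>) powr b \<partial>gauss2)
     \<longlonglongrightarrow> (\<integral> \<omega>. f (fst \<omega>) powr a * g (\<rho> *\<^sub>R fst \<omega> + \<rho>' *\<^sub>R snd \<omega>) powr b \<partial>gauss2)"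
  proof (rule integral_dominated_convergence[where w = "\<lambda>_. A0 * B0"])
    show "AE \<omega> in gauss2. (\<lambda>k. ?f k (fst \<omega>) powr a * ?g k (\<rho> *\<^sub>R fst \<omega> + \<rho>' *\<^sub>R snd \<omega>) powr b)
      \<longlonglongrightarrow> f (fst \<omega>) powr a * g (\<rho> *\<^sub>R fst \<omega> + \<rho>' *\<^sub>R snd \<omega>) powr b"
      using nz by (intro AE_I2 tendsto_mult tendsto_powr gav_tendsto[OF f] gav_tendsto[OF g] tendsto_const) auto
    show "AE \<omega> in gauss2. norm (?f k (fst \<omega>) powr a * ?g k (\<rho> *\<^sub>R fst \<omega> + \<rho>' *\<^sub>R snd \<omega>) powr b) \<le> A0 * B0" for k
      unfolding real_norm_def abs_mult using fb A0 B0 by (intro AE_I2 mult_mono) auto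
    show "(\<lambda>\<omega>. ?f k (fst \<omega>) powr a * ?g k (\<rho> *\<^sub>R fst \<omega> + \<rho>' *\<^sub>R snd \<omega>) powr b) \<in> borel_measurable gauss2" for k
      by measurable
    show "(\<lambda>\<omega>. f (fst \<omega>) powr a * g (\<rho> *\<^sub>R fst \<omega> + \<rho>' *\<^sub>R snd \<omega>) powr b) \<in> borel_measurable gauss2"
      by measurable
  qed simp
  have R: "(\<lambda>k. \<integral> z. gav (1 / Suc k) h z \<partial>gauss_measure) \<longlonglongrightarrow> (\<integral> z. h z \<partial>gauss_measure)"
    if h: "continuous_on UNIV h" "\<And>x. m \<le> h x" "\<And>x. h x \<le> M" for h :: "real ^ 'n \<Rightarrow> real"
  proof (rule integral_dominated_convergence[where w = "\<lambda>_. \<bar>m\<bar> + \<bar>M\<bar>"])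
    have Ch: "\<exists>K\<ge>0. C11 m M K (gav (1 / Suc k) h)" for k using gav_C11[OF h less_imp_le[OF m], of "1 / Suc k"] by auto
    show "AE z in gauss_measure. norm (gav (1 / Suc k) h z) \<le> \<bar>m\<bar> + \<bar>M\<bar>" for k
      using Ch[of k] unfolding C11_def real_norm_def by (auto intro!: AE_I2 abs_le_of_Icc)
    show "gav (1 / Suc k) h \<in> borel_measurable gauss_measure" for k
      using Ch[of k] C11_measurable by (auto simp: measurable_cong_sets[OF sets_gauss_measure refl])
    show "AE z in gauss_measure. (\<lambda>k. gav (1 / Suc k) h z) \<longlonglongrightarrow> h z"
      by (intro AE_I2 gav_tendsto[OF h])
    show "h \<in> borel_measurable gauss_measure" using borel_measurable_continuous_onI[OF h(1)]
      by (simp add: measurable_cong_sets[OF sets_gauss_measure refl])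
  qed auto
  have pos: "(\<integral> z. h z \<partial>gauss_measure) \<noteq> 0"
    if h: "continuous_on UNIV h" "\<And>x. m \<le> h x" "\<And>x. h x \<le> M" for h :: "real ^ 'n \<Rightarrow> real"
  proof -
    have "m \<le> (\<integral> z. h z \<partial>gauss_measure)"
    proof (rule G.integral_ge_const)
      show "integrable gauss_measure h"
        by (rule integrable_gauss_bounded[of _ "\<bar>m\<bar> + \<bar>M\<bar>"]) (use h in \<open>auto intro: abs_le_of_Icc borel_measurable_continuous_onI\<close>)
    qed (use h in auto)
    then show ?thesis using m by linarith
  qed
  show ?thesis
    by (rule LIMSEQ_le[OF tendsto_mult[OF tendsto_const L] tendsto_mult[OF tendsto_const tendsto_mult[OF tendsto_powr[OF R[OF f] tendsto_const pos[OF f]] tendsto_powr[OF R[OF g] tendsto_const pos[OF g]]]]])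
       (use main in blast)
qed

text \<open>Test the Jensen inequality on \<open>F\<^sup>q\<close> and \<open>f\<^sup>p\<close>, where \<open>F\<close> is the average of \<open>f\<close>: the left-hand side
  becomes \<open>\<integral> F\<^bsup>q - 1\<^esup> F\<close>. Both hypercontractivity and its reverse are covered, according to the sign of \<open>q - 1\<close>.\<close>

lemma hypercontractivity_bounded:
  fixes f :: "real ^ 'n \<Rightarrow> real"
  assumes m: "0 < m" and rho: "\<rho>\<^sup>2 + \<rho>'\<^sup>2 = 1" "\<rho>' > 0" and s: "\<bar>\<sigma>\<bar> = 1"
    and pq: "p - 1 = \<rho>\<^sup>2 * (q - 1)" "p \<noteq> 0" "q \<noteq> 0" "\<sigma> * (q - 1) \<ge> 0"
    and f: "continuous_on UNIV f" "\<And>x. m \<le> f x" "\<And>x. f x \<le> M"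
  shows "\<sigma> * (\<integral> x. (\<integral> y. f (\<rho> *\<^sub>R x + \<rho>' *\<^sub>R y) \<partial>gauss_measure) powr q \<partial>gauss_measure) powr (1 / q)
     \<le> \<sigma> * (\<integral> z. f z powr p \<partial>gauss_measure) powr (1 / p)"
proof -
  have [measurable]: "f \<in> borel_measurable borel" using f(1) by (auto intro: borel_measurable_continuous_onI)
  define F where "F = (\<lambda>x. \<integral> y. f (\<rho> *\<^sub>R x + \<rho>' *\<^sub>R y) \<partial>gauss_measure)"
  have F_eq: "F x = gav \<rho>' f (\<rho> *\<^sub>R x)" for x by (simp add: F_def gav_def)
  have K: "\<exists>K\<ge>0. C11 m M K (gav \<rho>' f)" by (rule gav_C11[OF f less_imp_le[OF m] rho(2)])
  have Fb: "m \<le> F x" "F x \<le> M" for x using K unfolding F_eq C11_def by auto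
  have Fc: "continuous_on UNIV F"
  proof -
    obtain K where "C11 m M K (gav \<rho>' f)" using K by auto
    from C11_continuous[OF this, of UNIV] show ?thesis unfolding F_eq
      by (rule continuous_on_compose2) (auto intro!: continuous_intros)
  qed
  have [measurable]: "F \<in> borel_measurable borel" using Fc by (auto intro: borel_measurable_continuous_onI)
  have pwb: "\<exists>m' M'. 0 < m' \<and> (\<forall>x. m \<le> x \<longrightarrow> x \<le> M \<longrightarrow> m' \<le> x powr d \<and> x powr d \<le> M')" for d
  proof (cases "d \<ge> 0")
    case True
    then show ?thesis using m by (intro exI[of _ "m powr d"] exI[of _ "M powr d"]) (auto intro!: powr_mono2)
  next
    case False
    then show ?thesis using m f(2)[of 0] f(3)[of 0]
      by (intro exI[of _ "M powr d"] exI[of _ "m powr d"]) (auto intro!: powr_mono2')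
  qed
  obtain m1 M1 where b1: "0 < m1" "\<And>x. m \<le> x \<Longrightarrow> x \<le> M \<Longrightarrow> m1 \<le> x powr p \<and> x powr p \<le> M1" using pwb[of p] by blast
  obtain m2 M2 where b2: "0 < m2" "\<And>x. m \<le> x \<Longrightarrow> x \<le> M \<Longrightarrow> m2 \<le> x powr q \<and> x powr q \<le> M2" using pwb[of q] by blast
  define a where "a = 1 - 1 / q"
  define b where "b = 1 / p"
  have nz: "f x \<noteq> 0" "F x \<noteq> 0" "f x > 0" "F x > 0" for x using f(2)[of x] Fb(1)[of x] m by auto
  \<comment> \<open>The relation p - 1 = \<rho>^2 (q - 1) makes the discriminant vanish: the form is
    -\<sigma>(q - 1) times the square of |s/q| - |\<rho> t/p|.\<close>
  have quad: "\<sigma> * (a * (a - 1) * s\<^sup>2 + b * (b - 1) * t\<^sup>2) + 2 * \<bar>\<rho> * a * b * s * t\<bar> \<le> 0" for s t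
  proof -
    define s' where "s' = s / q"
    define t' where "t' = t / p"
    have 1: "a * (a - 1) * s\<^sup>2 = - (q - 1) * s'\<^sup>2"
      using pq(3) by (simp add: a_def s'_def field_simps power2_eq_square)
    have "b * (b - 1) * t\<^sup>2 = - (p - 1) * t'\<^sup>2"
      using pq(2) by (simp add: b_def t'_def field_simps power2_eq_square)
    then have 2: "b * (b - 1) * t\<^sup>2 = - (q - 1) * (\<rho> * t')\<^sup>2"
      unfolding pq(1) by (simp add: power_mult_distrib algebra_simps)
    have e: "\<rho> * a * b * s * t = (q - 1) * (s' * (\<rho> * t'))"
      using pq(2,3) by (simp add: a_def b_def s'_def t'_def field_simps)
    have n: "\<bar>q - 1\<bar> = \<sigma> * (q - 1)" using pq(4) s
      by (metis abs_mult abs_of_nonneg mult_1)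
    have 3: "\<bar>\<rho> * a * b * s * t\<bar> = \<sigma> * (q - 1) * (\<bar>s'\<bar> * \<bar>\<rho> * t'\<bar>)"
      unfolding e abs_mult n ..
    have "\<sigma> * (a * (a - 1) * s\<^sup>2 + b * (b - 1) * t\<^sup>2) + 2 * \<bar>\<rho> * a * b * s * t\<bar>
      = - (\<sigma> * (q - 1)) * (\<bar>s'\<bar> - \<bar>\<rho> * t'\<bar>)\<^sup>2"
      unfolding 1 2 3 power2_diff power2_abs by (simp add: algebra_simps)
    also have "\<dots> \<le> 0" using pq(4) by (simp add: mult_nonneg_nonneg)
    finally show ?thesis .
  qed
  define N where "N = (\<integral> x. F x powr q \<partial>gauss_measure)"
  define S where "S = (\<integral> z. f z powr p \<partial>gauss_measure)"
  have "\<sigma> * (\<integral> \<omega>. (F (fst \<omega>) powr q) powr a * (f (\<rho> *\<^sub>R fst \<omega> + \<rho>' *\<^sub>R snd \<omega>) powr p) powr b \<partial>gauss2)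
     \<le> \<sigma> * ((\<integral> z. F z powr q \<partial>gauss_measure) powr a * (\<integral> z. f z powr p \<partial>gauss_measure) powr b)"
  proof (rule gaussian_jensen[OF _ rho s quad, of "min m1 m2" _ "max M1 M2"])
    show "continuous_on UNIV (\<lambda>x. F x powr q)" "continuous_on UNIV (\<lambda>x. f x powr p)"
      using nz Fc f(1) by (auto intro!: continuous_intros)
  qed (use b1 b2 f Fb in \<open>auto simp: min_le_iff_disj le_max_iff_disj\<close>)
  also have "(\<lambda>\<omega>. (F (fst \<omega>) powr q) powr a * (f (\<rho> *\<^sub>R fst \<omega> + \<rho>' *\<^sub>R snd \<omega>) powr p) powr b)
     = (\<lambda>\<omega>. F (fst \<omega>) powr (q - 1) * f (\<rho> *\<^sub>R fst \<omega> + \<rho>' *\<^sub>R snd \<omega>))"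
  proof
    fix \<omega> :: "(real ^ 'n) \<times> (real ^ 'n)"
    have "q * a = q - 1" "p * b = 1" using pq by (auto simp: a_def b_def field_simps)
    then show "(F (fst \<omega>) powr q) powr a * (f (\<rho> *\<^sub>R fst \<omega> + \<rho>' *\<^sub>R snd \<omega>) powr p) powr b
      = F (fst \<omega>) powr (q - 1) * f (\<rho> *\<^sub>R fst \<omega> + \<rho>' *\<^sub>R snd \<omega>)"
      using nz by (simp add: powr_powr less_imp_le)
  qed
  \<comment> \<open>Integrating out the second variable turns f into F, so that F^(q - 1) f has the
    same integral as F^q.\<close>
  also have "(\<integral> \<omega>. F (fst \<omega>) powr (q - 1) * f (\<rho> *\<^sub>R fst \<omega> + \<rho>' *\<^sub>R snd \<omega>) \<partial>gauss2) = N"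
  proof -
    obtain B where B: "B \<ge> 0" "\<And>x. m \<le> x \<Longrightarrow> x \<le> M \<Longrightarrow> \<bar>x powr (q - 1)\<bar> \<le> B" using powr_bound_Icc[OF m, of M "q - 1"] by metis
    have "integrable gauss2 (\<lambda>\<omega>. F (fst \<omega>) powr (q - 1) * f (\<rho> *\<^sub>R fst \<omega> + \<rho>' *\<^sub>R snd \<omega>))"
    proof (rule GG.integrable_const_bound[of _ "B * (\<bar>m\<bar> + \<bar>M\<bar>)"])
      show "AE \<omega> in gauss2. norm (F (fst \<omega>) powr (q - 1) * f (\<rho> *\<^sub>R fst \<omega> + \<rho>' *\<^sub>R snd \<omega>)) \<le> B * (\<bar>m\<bar> + \<bar>M\<bar>)"
        unfolding real_norm_def abs_mult using B Fb f by (intro AE_I2 mult_mono abs_le_of_Icc) auto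
    qed simp
    from GG.integral_fst'[OF this]
    have "(\<integral> \<omega>. F (fst \<omega>) powr (q - 1) * f (\<rho> *\<^sub>R fst \<omega> + \<rho>' *\<^sub>R snd \<omega>) \<partial>gauss2)
      = (\<integral> x. F x powr (q - 1) * F x \<partial>gauss_measure)" by (simp add: F_def)
    also have "\<dots> = N" unfolding N_def
    proof (intro Bochner_Integration.integral_cong refl)
      show "F x powr (q - 1) * F x = F x powr q" for x using nz(4)[of x] by (simp add: powr_diff)
    qed
    finally show ?thesis .
  qed
  finally have J: "\<sigma> * N \<le> \<sigma> * (N powr a * S powr b)" by (simp add: N_def S_def)
  have N0: "N > 0"
  proof -
    have "m2 \<le> N" unfolding N_def
    proof (rule G.integral_ge_const)
      show "integrable gauss_measure (\<lambda>x. F x powr q)"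
        by (rule integrable_gauss_bounded[of _ M2]) (use b2 Fb in auto)
    qed (use b2 Fb in auto)
    then show ?thesis using b2(1) by linarith
  qed
  \<comment> \<open>Division by N^a, written as multiplication by the positive number N^(-a), leaves
    the exponent 1 - a = 1/q, whatever the signs of q and a.\<close>
  have "N powr (- a) * (\<sigma> * N) \<le> N powr (- a) * (\<sigma> * (N powr a * S powr b))"
    by (rule mult_left_mono[OF J]) simp
  moreover have "N powr (- a) * (\<sigma> * N) = \<sigma> * (N powr (- a) * N)" by simp
  moreover have "N powr (- a) * N = N powr (1 / q)"
    using N0 powr_add[of N "- a" 1] by (simp add: a_def)
  moreover have "N powr (- a) * (\<sigma> * (N powr a * S powr b)) = \<sigma> * ((N powr (- a) * N powr a) * S powr b)" by simp
  moreover have "N powr (- a) * N powr a = 1" using N0 by (simp add: powr_add[symmetric])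
  ultimately have "\<sigma> * N powr (1 / q) \<le> \<sigma> * S powr b" by simp
  then show ?thesis by (simp add: N_def S_def F_def b_def)
qed

section \<open>Hypercontractivity and reverse hypercontractivity\<close>

lemma epowr_ennreal: "x > 0 \<Longrightarrow> ennreal x epowr a = ennreal (x powr a)"
  by (simp add: ennreal_powr_def)

lemma epowr_mono: "0 \<le> a \<Longrightarrow> x \<le> y \<Longrightarrow> x epowr a \<le> y epowr a"
  by (cases x; cases y) (auto simp: ennreal_powr_def top_unique intro!: ennreal_leI powr_mono2)

lemma epowr_antimono: "a \<le> 0 \<Longrightarrow> x \<le> y \<Longrightarrow> y epowr a \<le> x epowr a"
  by (cases x; cases y) (auto simp: ennreal_powr_def top_unique intro!: ennreal_leI powr_mono2')

lemma epowr_eq_0_iff: "x epowr a = 0 \<longleftrightarrow> (a > 0 \<and> x = 0) \<or> (a < 0 \<and> x = \<infinity>)"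
  by (cases x) (auto simp: ennreal_powr_def)

lemma epowr_one [simp]: "x epowr 1 = x"
  by (cases x) (auto simp: ennreal_powr_def)

lemma one_epowr [simp]: "1 epowr a = 1"
  by (simp add: ennreal_powr_def)

lemma epowr_epowr: "a \<noteq> 0 \<Longrightarrow> b \<noteq> 0 \<Longrightarrow> (x epowr a) epowr b = x epowr (a * b)"
  by (cases x) (auto simp: ennreal_powr_def powr_powr zero_less_mult_iff mult_less_0_iff enn2real_eq_0_iff ennreal_eq_0_iff not_less)

text \<open>A finite nonzero factor rules out the product of 0 and infinity, where the two sides
  differ for a negative exponent.\<close>

lemma epowr_mult:
  assumes "x \<noteq> 0" "x \<noteq> \<infinity>"
  shows "(x * y) epowr a = x epowr a * y epowr a"
  using assms by (cases x; cases y)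
    (auto simp: ennreal_powr_def powr_mult ennreal_mult[symmetric] ennreal_mult_top ennreal_top_mult ennreal_mult_eq_top_iff)

lemma measurable_epowr [measurable]:
  assumes [measurable]: "f \<in> borel_measurable M"
  shows "(\<lambda>x. f x epowr a) \<in> borel_measurable M"
  unfolding ennreal_powr_def by measurable

lemma tendsto_inverse_ennreal':
  fixes f :: "'b \<Rightarrow> ennreal"
  shows "(f \<longlongrightarrow> L) F \<Longrightarrow> ((\<lambda>x. inverse (f x)) \<longlongrightarrow> inverse L) F"
  using continuous_on_tendsto_compose[of UNIV "inverse :: ennreal \<Rightarrow> ennreal" f L F] continuous_on_inverse_ennreal[OF continuous_on_id]
  by auto

text \<open>For b > 0 the map is an order isomorphism of [0, infinity] whose inverse has exponent
  1/b, so convergence can be read off from strict inequalities. Negative exponents are reduced to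
  positive ones by the continuous inverse.\<close>

lemma epowr_tendsto:
  assumes "(f \<longlongrightarrow> L) F" "a \<noteq> 0"
  shows "((\<lambda>x. f x epowr a) \<longlongrightarrow> L epowr a) F"
proof -
  have pos: "((\<lambda>x. f x epowr b) \<longlongrightarrow> L epowr b) F" if "(f \<longlongrightarrow> L) F" "b > 0" for f and L b
  proof -
    show ?thesis
    proof (rule order_tendstoI)
      fix c assume c: "c < L epowr b"
      have "\<forall>\<^sub>F x in F. c epowr (1 / b) < f x"
      proof (rule order_tendstoD(1)[OF that(1)])
        show "c epowr (1 / b) < L"
        proof (rule ccontr)
          assume "\<not> c epowr (1 / b) < L"
          then have "L epowr b \<le> (c epowr (1 / b)) epowr b" using that(2) by (intro epowr_mono) auto
          then show False using c that(2) by (simp add: epowr_epowr)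
        qed
      qed
      then show "\<forall>\<^sub>F x in F. c < f x epowr b"
      proof (rule eventually_mono)
        fix x assume x: "c epowr (1 / b) < f x"
        show "c < f x epowr b"
        proof (rule ccontr)
          assume "\<not> c < f x epowr b"
          then have "(f x epowr b) epowr (1 / b) \<le> c epowr (1 / b)" using that(2) by (intro epowr_mono) auto
          then show False using x that(2) by (simp add: epowr_epowr)
        qed
      qed
    next
      fix c assume c: "L epowr b < c"
      have "\<forall>\<^sub>F x in F. f x < c epowr (1 / b)"
      proof (rule order_tendstoD(2)[OF that(1)])
        show "L < c epowr (1 / b)"
        proof (rule ccontr)
          assume "\<not> L < c epowr (1 / b)"
          then have "(c epowr (1 / b)) epowr b \<le> L epowr b" using that(2) by (intro epowr_mono) auto
          then show False using c that(2) by (simp add: epowr_epowr)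
        qed
      qed
      then show "\<forall>\<^sub>F x in F. f x epowr b < c"
      proof (rule eventually_mono)
        fix x assume x: "f x < c epowr (1 / b)"
        show "f x epowr b < c"
        proof (rule ccontr)
          assume "\<not> f x epowr b < c"
          then have "c epowr (1 / b) \<le> (f x epowr b) epowr (1 / b)" using that(2) by (intro epowr_mono) auto
          then show False using x that(2) by (simp add: epowr_epowr)
        qed
      qed
    qed
  qed
  show ?thesis
  proof (cases "a > 0")
    case True then show ?thesis using pos assms by blast
  next
    case False
    then have a: "- a > 0" using assms(2) by simp
    have inv: "y epowr a = inverse (y epowr (- a))" for y
      using a by (cases y) (auto simp: ennreal_powr_def powr_minus inverse_ennreal ennreal_eq_0_iff enn2real_eq_0_iff not_less)
    have "((\<lambda>x. inverse (f x epowr (- a))) \<longlongrightarrow> inverse (L epowr (- a))) F"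
      by (intro tendsto_inverse_ennreal' pos assms a)
    then show ?thesis by (simp only: inv[symmetric])
  qed
qed

section \<open>Monotone limits of Gaussian norms\<close>

text \<open>For q < 0 the inner power and the outer root both reverse the order, so monotonicity
  survives.\<close>

lemma Lq_gauss_mono:
  assumes "q \<noteq> 0" "\<And>x. f x \<le> g x"
  shows "Lq_gauss q f \<le> Lq_gauss q g"
proof (cases "q > 0")
  case True
  then show ?thesis unfolding Lq_gauss_def using assms(2) by (intro epowr_mono nn_integral_mono) auto
next
  case False
  then show ?thesis unfolding Lq_gauss_def using assms by (intro epowr_antimono nn_integral_mono) auto
qed

lemma Lq_gauss_powr:
  fixes g :: "real ^ 'n \<Rightarrow> ennreal"
  assumes "c \<noteq> 0" "q \<noteq> 0"
  shows "Lq_gauss q (\<lambda>x. g x epowr c) = Lq_gauss (c * q) g epowr c"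
  unfolding Lq_gauss_def using assms by (simp add: epowr_epowr)

text \<open>For q < 0 the integrands f^q decrease, and monotone convergence from above requires the
  first integral to be finite; hence the second condition on q.\<close>

lemma Lq_gauss_incseq:
  fixes f :: "nat \<Rightarrow> real ^ 'n \<Rightarrow> ennreal"
  assumes [measurable]: "\<And>k. f k \<in> borel_measurable borel"
    and inc: "\<And>x. incseq (\<lambda>k. f k x)" and lim: "\<And>x. (\<lambda>k. f k x) \<longlonglongrightarrow> g x"
    and q: "q \<noteq> 0" "q < 0 \<Longrightarrow> (\<integral>\<^sup>+ x. f 0 x epowr q \<partial>gauss_measure) < \<infinity>"
  shows "(\<lambda>k. Lq_gauss q (f k)) \<longlonglongrightarrow> Lq_gauss q g"
  unfolding Lq_gauss_def
proof (rule epowr_tendsto)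
  have l: "(\<lambda>k. f k x epowr q) \<longlonglongrightarrow> g x epowr q" for x using lim q(1) by (intro epowr_tendsto)
  show "(\<lambda>k. \<integral>\<^sup>+ x. f k x epowr q \<partial>gauss_measure) \<longlonglongrightarrow> (\<integral>\<^sup>+ x. g x epowr q \<partial>gauss_measure)"
  proof (cases "q > 0")
    case True
    have i: "incseq (\<lambda>k x. f k x epowr q)"
      using inc True by (auto simp: incseq_def le_fun_def intro!: epowr_mono)
    have s: "(SUP k. f k x epowr q) = g x epowr q" for x
      using LIMSEQ_SUP[of "\<lambda>k. f k x epowr q"] i l[of x] by (auto intro!: LIMSEQ_unique simp: incseq_def le_fun_def)
    have "(\<lambda>k. \<integral>\<^sup>+ x. f k x epowr q \<partial>gauss_measure) \<longlonglongrightarrow> (SUP k. \<integral>\<^sup>+ x. f k x epowr q \<partial>gauss_measure)"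
      by (rule LIMSEQ_SUP) (use i in \<open>auto simp: incseq_def le_fun_def intro!: nn_integral_mono\<close>)
    also have "(SUP k. \<integral>\<^sup>+ x. f k x epowr q \<partial>gauss_measure) = (\<integral>\<^sup>+ x. (SUP k. f k x epowr q) \<partial>gauss_measure)"
      by (rule nn_integral_monotone_convergence_SUP[symmetric, OF i]) measurable
    finally show ?thesis by (simp only: s)
  next
    case False
    then have q0: "q < 0" using q(1) by simp
    have d: "decseq (\<lambda>k x. f k x epowr q)"
      unfolding decseq_def using inc q0 by (auto simp: incseq_def le_fun_def intro!: epowr_antimono)
    have s: "(INF k. f k x epowr q) = g x epowr q" for x
      using LIMSEQ_INF[of "\<lambda>k. f k x epowr q"] d[unfolded decseq_def] l[of x] by (auto intro!: LIMSEQ_unique simp: decseq_def le_fun_def)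
    have "(\<lambda>k. \<integral>\<^sup>+ x. f k x epowr q \<partial>gauss_measure) \<longlonglongrightarrow> (INF k. \<integral>\<^sup>+ x. f k x epowr q \<partial>gauss_measure)"
      by (rule LIMSEQ_INF) (use d[unfolded decseq_def] in \<open>auto simp: decseq_def le_fun_def intro!: nn_integral_mono\<close>)
    also have "(INF k. \<integral>\<^sup>+ x. f k x epowr q \<partial>gauss_measure) = (\<integral>\<^sup>+ x. (INF k. f k x epowr q) \<partial>gauss_measure)"
      by (rule nn_integral_monotone_convergence_INF_decseq[symmetric, OF d _ q(2)[OF q0]]) measurable
    finally show ?thesis by (simp only: s)
  qed
qed (use q in auto)

text \<open>Taking reciprocals turns a decreasing sequence into an increasing one and q into
  -q.\<close>

lemma Lq_gauss_decseq:
  fixes f :: "nat \<Rightarrow> real ^ 'n \<Rightarrow> ennreal"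
  assumes [measurable]: "\<And>k. f k \<in> borel_measurable borel"
    and dec: "\<And>x. decseq (\<lambda>k. f k x)" and lim: "\<And>x. (\<lambda>k. f k x) \<longlonglongrightarrow> g x"
    and q: "q \<noteq> 0" "q > 0 \<Longrightarrow> (\<integral>\<^sup>+ x. f 0 x epowr q \<partial>gauss_measure) < \<infinity>"
  shows "(\<lambda>k. Lq_gauss q (f k)) \<longlonglongrightarrow> Lq_gauss q g"
proof -
  have m1: "(\<lambda>x. f k x epowr (- 1)) \<in> borel_measurable borel" for k by measurable
  have i1: "incseq (\<lambda>k. f k x epowr (- 1))" for x
    using dec[of x] by (auto simp: incseq_def decseq_def intro!: epowr_antimono)
  have l1: "(\<lambda>k. f k x epowr (- 1)) \<longlonglongrightarrow> g x epowr (- 1)" for x using lim by (intro epowr_tendsto) auto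
  have f1: "- q < 0 \<Longrightarrow> (\<integral>\<^sup>+ x. (f 0 x epowr (- 1)) epowr (- q) \<partial>gauss_measure) < \<infinity>"
    using q by (simp add: epowr_epowr)
  have "(\<lambda>k. Lq_gauss (- q) (\<lambda>x. f k x epowr (- 1))) \<longlonglongrightarrow> Lq_gauss (- q) (\<lambda>x. g x epowr (- 1))"
    by (rule Lq_gauss_incseq[OF m1 i1 l1 _ f1]) (use q in auto)
  moreover have "Lq_gauss (- q) (\<lambda>x. h x epowr (- 1)) = Lq_gauss q h epowr (- 1)" for h :: "real ^ 'n \<Rightarrow> ennreal"
    using q(1) by (simp add: Lq_gauss_powr)
  ultimately have "(\<lambda>k. Lq_gauss q (f k) epowr (- 1)) \<longlonglongrightarrow> Lq_gauss q g epowr (- 1)" by simp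
  then have "(\<lambda>k. (Lq_gauss q (f k) epowr (- 1)) epowr (- 1)) \<longlonglongrightarrow> (Lq_gauss q g epowr (- 1)) epowr (- 1)"
    by (rule epowr_tendsto) simp
  then show ?thesis by (simp add: epowr_epowr)
qed

section \<open>From bounded to positive continuous functions\<close>

text \<open>The Ornstein-Uhlenbeck operator has a^2 + b^2 = 1. Completing squares leads out of this
  case, hence two free parameters.\<close>

definition avg :: "real \<Rightarrow> real \<Rightarrow> (real ^ 'n \<Rightarrow> ennreal) \<Rightarrow> real ^ 'n \<Rightarrow> ennreal" where
  "avg a b f x = (\<integral>\<^sup>+ y. f (a *\<^sub>R x + b *\<^sub>R y) \<partial>gauss_measure)"

lemma OU_eq_avg: "OU s = avg (exp (- s)) (sqrt (1 - exp (- 2 * s)))"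
  by (intro ext) (simp add: OU_def avg_def)

lemma measurable_avg [measurable]:
  fixes f :: "real ^ 'n \<Rightarrow> ennreal"
  assumes [measurable]: "f \<in> borel_measurable borel"
  shows "avg a b f \<in> borel_measurable borel"
  unfolding avg_def[abs_def] by (intro G.borel_measurable_nn_integral) measurable

lemma avg_mono: "(\<And>x. f x \<le> g x) \<Longrightarrow> avg a b f x \<le> avg a b g x"
  unfolding avg_def by (intro nn_integral_mono) auto

lemma hypercontractivity_Lq_bounded:
  fixes f :: "real ^ 'n \<Rightarrow> real"
  assumes m: "0 < m" and rho: "\<rho>\<^sup>2 + \<rho>'\<^sup>2 = 1" "\<rho>' > 0"
    and pq: "p - 1 = \<rho>\<^sup>2 * (q - 1)" "p \<noteq> 0" "q \<noteq> 0"
    and f: "continuous_on UNIV f" "\<And>x. m \<le> f x" "\<And>x. f x \<le> M"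
  shows "q \<ge> 1 \<Longrightarrow> Lq_gauss q (avg \<rho> \<rho>' (\<lambda>x. ennreal (f x))) \<le> Lq_gauss p (\<lambda>x. ennreal (f x))"
    and "q \<le> 1 \<Longrightarrow> Lq_gauss p (\<lambda>x. ennreal (f x)) \<le> Lq_gauss q (avg \<rho> \<rho>' (\<lambda>x. ennreal (f x)))"
proof -
  have [measurable]: "f \<in> borel_measurable borel" using f(1) by (auto intro: borel_measurable_continuous_onI)
  define F where "F = (\<lambda>x. \<integral> y. f (\<rho> *\<^sub>R x + \<rho>' *\<^sub>R y) \<partial>gauss_measure)"
  have M: "M > 0" using f(2)[of 0] f(3)[of 0] m by linarith
  have f0: "f x > 0" for x using f(2)[of x] m by linarith
  have fi: "integrable gauss_measure (\<lambda>y. f (\<rho> *\<^sub>R x + \<rho>' *\<^sub>R y))" for x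
    by (rule integrable_gauss_bounded[of _ M]) (use f f0 in \<open>auto simp: abs_of_pos\<close>)
  have [measurable]: "F \<in> borel_measurable borel"
  proof -
    have "F \<in> borel_measurable gauss_measure" unfolding F_def by measurable
    then show ?thesis by (simp only: measurable_cong_sets[OF sets_gauss_measure refl])
  qed
  have Fb: "m \<le> F x" "F x \<le> M" for x unfolding F_def by (auto intro!: G.integral_ge_const G.integral_le_const fi f)
  have F0: "F x > 0" for x using Fb(1)[of x] m by linarith
  have avgF: "avg \<rho> \<rho>' (\<lambda>x. ennreal (f x)) x = ennreal (F x)" for x
    unfolding avg_def F_def using fi f0 by (intro nn_integral_eq_integral) (auto intro: less_imp_le)
  have Lq: "Lq_gauss r (\<lambda>x. ennreal (h x)) = ennreal ((\<integral> x. h x powr r \<partial>gauss_measure) powr (1 / r))"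
    if h: "h \<in> borel_measurable borel" "\<And>x. m \<le> h x" "\<And>x. h x \<le> M" for h :: "real ^ 'n \<Rightarrow> real" and r
  proof -
    have [measurable]: "h \<in> borel_measurable borel" by (rule h)
    have h0: "h x > 0" for x using h(2)[of x] m by linarith
    obtain B where B: "B \<ge> 0" "\<And>x. m \<le> x \<Longrightarrow> x \<le> M \<Longrightarrow> \<bar>x powr r\<bar> \<le> B" using powr_bound_Icc[OF m, of M r] by metis
    have i: "integrable gauss_measure (\<lambda>x. h x powr r)"
      by (rule integrable_gauss_bounded[of _ B]) (use B(2) h in auto)
    have pos: "(\<integral> x. h x powr r \<partial>gauss_measure) > 0"
    proof -
      obtain B' where B': "B' \<ge> 0" "\<And>x. m \<le> x \<Longrightarrow> x \<le> M \<Longrightarrow> \<bar>x powr (- r)\<bar> \<le> B'" using powr_bound_Icc[OF m, of M "- r"] by metis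
      have B'0: "B' > 0" using B'(2)[OF h(2) h(3), of 0] h0[of 0] powr_gt_zero[of "h 0" "- r"] by (simp del: powr_gt_zero)
      have "1 / B' \<le> (\<integral> x. h x powr r \<partial>gauss_measure)"
      proof (rule G.integral_ge_const[OF i], rule AE_I2)
        fix x
        have "h x powr (- r) \<le> B'" using B'(2)[OF h(2) h(3), of x] by simp
        then show "1 / B' \<le> h x powr r" using B'0 h0[of x] by (simp add: powr_minus field_simps)
      qed
      then show ?thesis using B'0 by (meson divide_pos_pos less_le_trans zero_less_one)
    qed
    have "(\<integral>\<^sup>+ x. ennreal (h x) epowr r \<partial>gauss_measure) = ennreal (\<integral> x. h x powr r \<partial>gauss_measure)"
      using h0 i by (simp add: epowr_ennreal nn_integral_eq_integral)
    then show ?thesis unfolding Lq_gauss_def using pos by (simp add: epowr_ennreal)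
  qed
  have LF: "Lq_gauss q (avg \<rho> \<rho>' (\<lambda>x. ennreal (f x))) = ennreal ((\<integral> x. F x powr q \<partial>gauss_measure) powr (1 / q))"
    unfolding avgF[abs_def] by (rule Lq) (use Fb in auto)
  have Lf: "Lq_gauss p (\<lambda>x. ennreal (f x)) = ennreal ((\<integral> x. f x powr p \<partial>gauss_measure) powr (1 / p))"
    by (rule Lq) (use f in auto)
  show "Lq_gauss q (avg \<rho> \<rho>' (\<lambda>x. ennreal (f x))) \<le> Lq_gauss p (\<lambda>x. ennreal (f x))" if "q \<ge> 1"
    unfolding LF Lf using hypercontractivity_bounded[OF m rho, of 1 p q f M] pq f that
    by (intro ennreal_leI) (simp add: F_def)
  show "Lq_gauss p (\<lambda>x. ennreal (f x)) \<le> Lq_gauss q (avg \<rho> \<rho>' (\<lambda>x. ennreal (f x)))" if "q \<le> 1"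
    unfolding LF Lf using hypercontractivity_bounded[OF m rho, of "-1" p q f M] pq f that
    by (intro ennreal_leI) (simp add: F_def)
qed


lemma avg_eq_Lq: "avg a b f x = Lq_gauss 1 (\<lambda>y. f (a *\<^sub>R x + b *\<^sub>R y))"
  by (simp add: avg_def Lq_gauss_def)

lemma Lq_gauss_const_bound_finite:
  assumes "\<And>x. f x \<le> ennreal M" "q > 0"
  shows "(\<integral>\<^sup>+ x. f x epowr q \<partial>(gauss_measure :: (real ^ 'n) measure)) < \<infinity>"
proof -
  have "(\<integral>\<^sup>+ x. f x epowr q \<partial>(gauss_measure :: (real ^ 'n) measure)) \<le> (\<integral>\<^sup>+ x. ennreal (max M 1) epowr q \<partial>(gauss_measure :: (real ^ 'n) measure))"
    using assms(2) by (intro nn_integral_mono epowr_mono order_trans[OF assms(1) ennreal_leI]) auto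
  also have "\<dots> < \<infinity>" by (simp add: epowr_ennreal)
  finally show ?thesis .
qed

text \<open>The cut-offs max(h, 1/(i + 1)) decrease to h. Only the larger side of the inequality is
  followed to the limit; on the smaller side h is simply replaced by a larger function. The bound M
  supplies the finiteness that a decreasing sequence needs for a positive exponent.\<close>

lemma hypercontractivity_Lq_bounded_above:
  fixes h :: "real ^ 'n \<Rightarrow> real"
  assumes rho: "\<rho>\<^sup>2 + \<rho>'\<^sup>2 = 1" "\<rho>' > 0"
    and pq: "p - 1 = \<rho>\<^sup>2 * (q - 1)" "p \<noteq> 0" "q \<noteq> 0"
    and h: "continuous_on UNIV h" "\<And>x. 0 < h x" "\<And>x. h x \<le> M"
  shows "q \<ge> 1 \<Longrightarrow> Lq_gauss q (avg \<rho> \<rho>' (\<lambda>x. ennreal (h x))) \<le> Lq_gauss p (\<lambda>x. ennreal (h x))"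
    and "q \<le> 1 \<Longrightarrow> Lq_gauss p (\<lambda>x. ennreal (h x)) \<le> Lq_gauss q (avg \<rho> \<rho>' (\<lambda>x. ennreal (h x)))"
proof -
  define g where "g = (\<lambda>i::nat. \<lambda>x. max (h x) (1 / Suc i))"
  have gc: "continuous_on UNIV (g i)" for i unfolding g_def by (intro continuous_intros h)
  have [measurable]: "g i \<in> borel_measurable borel" for i using gc by (rule borel_measurable_continuous_onI)
  have gb: "1 / Suc i \<le> g i x" "g i x \<le> max M 1" "h x \<le> g i x" for i x
  proof -
    have "1 / real (Suc i) \<le> 1" by simp
    then show "g i x \<le> max M 1" using h(3)[of x] unfolding g_def by linarith
  qed (auto simp: g_def)
  have gd: "decseq (\<lambda>i. ennreal (g i x))" for x
  proof (rule decseq_SucI)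
    fix i
    have "1 / real (Suc (Suc i)) \<le> 1 / real (Suc i)" by (intro divide_left_mono) auto
    then show "ennreal (g (Suc i) x) \<le> ennreal (g i x)" unfolding g_def by (intro ennreal_leI) linarith
  qed
  have gl: "(\<lambda>i. ennreal (g i x)) \<longlonglongrightarrow> ennreal (h x)" for x
  proof -
    have "(\<lambda>i. 1 / real (Suc i)) \<longlonglongrightarrow> 0" by real_asymp
    then have "(\<lambda>i. g i x) \<longlonglongrightarrow> max (h x) 0" unfolding g_def by (intro tendsto_max tendsto_const)
    then show ?thesis using h(2)[of x] by (simp add: max_def)
  qed
  have bd: "(\<lambda>x. ennreal (g i x)) x \<le> ennreal (max M 1)" for i x using gb(2) by (simp add: ennreal_leI)
  show "Lq_gauss q (avg \<rho> \<rho>' (\<lambda>x. ennreal (h x))) \<le> Lq_gauss p (\<lambda>x. ennreal (h x))" if "q \<ge> 1"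
  proof (rule LIMSEQ_le_const)
    have "0 \<le> \<rho>\<^sup>2 * (q - 1)" using that by (intro mult_nonneg_nonneg) auto
    then have "p \<ge> 1" using pq(1) by linarith
    then show "(\<lambda>i. Lq_gauss p (\<lambda>x. ennreal (g i x))) \<longlonglongrightarrow> Lq_gauss p (\<lambda>x. ennreal (h x))"
      by (intro Lq_gauss_decseq gd gl Lq_gauss_const_bound_finite[OF bd]) auto
    show "\<exists>N. \<forall>i\<ge>N. Lq_gauss q (avg \<rho> \<rho>' (\<lambda>x. ennreal (h x))) \<le> Lq_gauss p (\<lambda>x. ennreal (g i x))"
    proof (intro exI[of _ 0] allI impI)
      fix i
      have "Lq_gauss q (avg \<rho> \<rho>' (\<lambda>x. ennreal (h x))) \<le> Lq_gauss q (avg \<rho> \<rho>' (\<lambda>x. ennreal (g i x)))"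
        using gb pq by (intro Lq_gauss_mono avg_mono ennreal_leI) auto
      also have "\<dots> \<le> Lq_gauss p (\<lambda>x. ennreal (g i x))"
        by (rule hypercontractivity_Lq_bounded(1)[OF _ rho pq gc gb(1,2) that]) simp
      finally show "Lq_gauss q (avg \<rho> \<rho>' (\<lambda>x. ennreal (h x))) \<le> Lq_gauss p (\<lambda>x. ennreal (g i x))" .
    qed
  qed
  show "Lq_gauss p (\<lambda>x. ennreal (h x)) \<le> Lq_gauss q (avg \<rho> \<rho>' (\<lambda>x. ennreal (h x)))" if "q \<le> 1"
  proof (rule LIMSEQ_le_const)
    have ad: "decseq (\<lambda>i. avg \<rho> \<rho>' (\<lambda>x. ennreal (g i x)) x)" for x
      using gd unfolding decseq_def by (auto intro!: avg_mono)
    have al: "(\<lambda>i. avg \<rho> \<rho>' (\<lambda>x. ennreal (g i x)) x) \<longlonglongrightarrow> avg \<rho> \<rho>' (\<lambda>x. ennreal (h x)) x" for x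
      unfolding avg_eq_Lq by (intro Lq_gauss_decseq gd gl Lq_gauss_const_bound_finite[OF bd]) auto
    have ab: "avg \<rho> \<rho>' (\<lambda>x. ennreal (g i x)) x \<le> ennreal (max M 1)" for i x
    proof -
      have "avg \<rho> \<rho>' (\<lambda>x. ennreal (g i x)) x \<le> avg \<rho> \<rho>' (\<lambda>x. ennreal (max M 1)) x" using gb by (intro avg_mono ennreal_leI)
      then show ?thesis by (simp add: avg_def)
    qed
    show "(\<lambda>i. Lq_gauss q (avg \<rho> \<rho>' (\<lambda>x. ennreal (g i x)))) \<longlonglongrightarrow> Lq_gauss q (avg \<rho> \<rho>' (\<lambda>x. ennreal (h x)))"
      by (intro Lq_gauss_decseq ad al Lq_gauss_const_bound_finite[OF ab] pq) auto
    show "\<exists>N. \<forall>i\<ge>N. Lq_gauss p (\<lambda>x. ennreal (h x)) \<le> Lq_gauss q (avg \<rho> \<rho>' (\<lambda>x. ennreal (g i x)))"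
    proof (intro exI[of _ 0] allI impI)
      fix i
      have "Lq_gauss p (\<lambda>x. ennreal (h x)) \<le> Lq_gauss p (\<lambda>x. ennreal (g i x))"
        using gb pq by (intro Lq_gauss_mono ennreal_leI) auto
      also have "\<dots> \<le> Lq_gauss q (avg \<rho> \<rho>' (\<lambda>x. ennreal (g i x)))"
        by (rule hypercontractivity_Lq_bounded(2)[OF _ rho pq gc gb(1,2) that]) simp
      finally show "Lq_gauss p (\<lambda>x. ennreal (h x)) \<le> Lq_gauss q (avg \<rho> \<rho>' (\<lambda>x. ennreal (g i x)))" .
    qed
  qed
qed

text \<open>The cut-offs min(f, j + 1) increase to f, and now the smaller side is the one followed
  to the limit.\<close>

theorem hypercontractivity:
  fixes f :: "real ^ 'n \<Rightarrow> real"
  assumes rho: "\<rho>\<^sup>2 + \<rho>'\<^sup>2 = 1" "\<rho>' > 0"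
    and pq: "p - 1 = \<rho>\<^sup>2 * (q - 1)" "p \<noteq> 0" "q \<noteq> 0"
    and f: "continuous_on UNIV f" "\<And>x. 0 < f x"
  shows "q \<ge> 1 \<Longrightarrow> Lq_gauss q (avg \<rho> \<rho>' (\<lambda>x. ennreal (f x))) \<le> Lq_gauss p (\<lambda>x. ennreal (f x))"
    and "q \<le> 1 \<Longrightarrow> Lq_gauss p (\<lambda>x. ennreal (f x)) \<le> Lq_gauss q (avg \<rho> \<rho>' (\<lambda>x. ennreal (f x)))"
proof -
  have [measurable]: "f \<in> borel_measurable borel" using f(1) by (rule borel_measurable_continuous_onI)
  define h where "h = (\<lambda>j::nat. \<lambda>x. min (f x) (Suc j))"
  have hc: "continuous_on UNIV (h j)" for j unfolding h_def by (intro continuous_intros f)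
  have [measurable]: "h j \<in> borel_measurable borel" for j using hc by (rule borel_measurable_continuous_onI)
  have hb: "0 < h j x" "h j x \<le> Suc j" "h j x \<le> f x" for j x using f(2)[of x] by (auto simp: h_def)
  have hi: "incseq (\<lambda>j. ennreal (h j x))" for x
    by (rule incseq_SucI) (auto simp: h_def intro!: ennreal_leI)
  have hl: "(\<lambda>j. ennreal (h j x)) \<longlonglongrightarrow> ennreal (f x)" for x
  proof (rule tendsto_eventually)
    obtain N where N: "f x \<le> real N" using real_arch_simple by blast
    show "\<forall>\<^sub>F j in sequentially. ennreal (h j x) = ennreal (f x)"
      using eventually_ge_at_top[of N] by eventually_elim (use N in \<open>auto simp: h_def\<close>)
  qed
  show "Lq_gauss q (avg \<rho> \<rho>' (\<lambda>x. ennreal (f x))) \<le> Lq_gauss p (\<lambda>x. ennreal (f x))" if q: "q \<ge> 1"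
  proof (rule LIMSEQ_le_const2)
    have ai: "incseq (\<lambda>i. avg \<rho> \<rho>' (\<lambda>x. ennreal (h i x)) x)" for x
      using hi unfolding incseq_def by (auto intro!: avg_mono)
    have al: "(\<lambda>i. avg \<rho> \<rho>' (\<lambda>x. ennreal (h i x)) x) \<longlonglongrightarrow> avg \<rho> \<rho>' (\<lambda>x. ennreal (f x)) x" for x
      unfolding avg_eq_Lq by (intro Lq_gauss_incseq hi hl) auto
    show "(\<lambda>i. Lq_gauss q (avg \<rho> \<rho>' (\<lambda>x. ennreal (h i x)))) \<longlonglongrightarrow> Lq_gauss q (avg \<rho> \<rho>' (\<lambda>x. ennreal (f x)))"
      using q by (intro Lq_gauss_incseq ai al) auto
    show "\<exists>N. \<forall>i\<ge>N. Lq_gauss q (avg \<rho> \<rho>' (\<lambda>x. ennreal (h i x))) \<le> Lq_gauss p (\<lambda>x. ennreal (f x))"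
    proof (intro exI[of _ 0] allI impI)
      fix i
      have "Lq_gauss q (avg \<rho> \<rho>' (\<lambda>x. ennreal (h i x))) \<le> Lq_gauss p (\<lambda>x. ennreal (h i x))"
        by (rule hypercontractivity_Lq_bounded_above(1)[OF rho pq hc hb(1,2) q])
      also have "\<dots> \<le> Lq_gauss p (\<lambda>x. ennreal (f x))"
        using hb pq by (intro Lq_gauss_mono ennreal_leI) auto
      finally show "Lq_gauss q (avg \<rho> \<rho>' (\<lambda>x. ennreal (h i x))) \<le> Lq_gauss p (\<lambda>x. ennreal (f x))" .
    qed
  qed
  show "Lq_gauss p (\<lambda>x. ennreal (f x)) \<le> Lq_gauss q (avg \<rho> \<rho>' (\<lambda>x. ennreal (f x)))" if q: "q \<le> 1"
  \<comment> \<open>If p < 0 and f^p is not integrable, the smaller side is 0. Otherwise min(f, 1)^p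
    <= f^p + 1 gives the finite integral from which the monotone limit with a negative exponent
    starts.\<close>
  proof (cases "p < 0 \<and> (\<integral>\<^sup>+ x. ennreal (f x) epowr p \<partial>gauss_measure) = \<infinity>")
    case True
    then have "Lq_gauss p (\<lambda>x. ennreal (f x)) = 0" unfolding Lq_gauss_def by (simp add: epowr_eq_0_iff)
    then show ?thesis by simp
  next
    case False
    have fin: "(\<integral>\<^sup>+ x. ennreal (h 0 x) epowr p \<partial>gauss_measure) < \<infinity>" if "p < 0"
    proof -
      have "ennreal (h 0 x) epowr p \<le> ennreal (f x) epowr p + 1" for x
        by (cases "f x \<le> 1") (auto simp: h_def min_def)
      then have "(\<integral>\<^sup>+ x. ennreal (h 0 x) epowr p \<partial>gauss_measure) \<le> (\<integral>\<^sup>+ x. ennreal (f x) epowr p + 1 \<partial>gauss_measure)"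
        by (intro nn_integral_mono)
      also have "\<dots> = (\<integral>\<^sup>+ x. ennreal (f x) epowr p \<partial>gauss_measure) + 1"
        by (subst nn_integral_add) auto
      also have "\<dots> < \<infinity>" using False that by (simp add: less_top)
      finally show ?thesis .
    qed
    show ?thesis
    proof (rule LIMSEQ_le_const2)
      show "(\<lambda>i. Lq_gauss p (\<lambda>x. ennreal (h i x))) \<longlonglongrightarrow> Lq_gauss p (\<lambda>x. ennreal (f x))"
        by (intro Lq_gauss_incseq hi hl fin pq) auto
      show "\<exists>N. \<forall>i\<ge>N. Lq_gauss p (\<lambda>x. ennreal (h i x)) \<le> Lq_gauss q (avg \<rho> \<rho>' (\<lambda>x. ennreal (f x)))"
      proof (intro exI[of _ 0] allI impI)
        fix i
        have "Lq_gauss p (\<lambda>x. ennreal (h i x)) \<le> Lq_gauss q (avg \<rho> \<rho>' (\<lambda>x. ennreal (h i x)))"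
          by (rule hypercontractivity_Lq_bounded_above(2)[OF rho pq hc hb(1,2) q])
        also have "\<dots> \<le> Lq_gauss q (avg \<rho> \<rho>' (\<lambda>x. ennreal (f x)))"
          using hb pq by (intro Lq_gauss_mono avg_mono ennreal_leI) auto
        finally show "Lq_gauss p (\<lambda>x. ennreal (h i x)) \<le> Lq_gauss q (avg \<rho> \<rho>' (\<lambda>x. ennreal (f x)))" .
      qed
    qed
  qed
qed

section \<open>Subharmonic functions and Gaussian averages\<close>

lemma integral_cbox_shift:
  fixes f :: "'a::euclidean_space \<Rightarrow> real"
  assumes "continuous_on UNIV f"
  shows "integral (cbox c d) (\<lambda>y. f (y + v)) = integral (cbox (c + v) (d + v)) f"
proof -
  have "f integrable_on cbox (c + v) (d + v)"
    by (intro integrable_continuous continuous_on_subset[OF assms]) auto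
  then have "(f has_integral integral (cbox (c + v) (d + v)) f) (cbox (c + v) (d + v))"
    by (rule integrable_integral)
  from has_integral_affinity'[OF this, of 1 v] show ?thesis
    by (intro integral_unique) simp
qed

text \<open>A cube and its translate by \<epsilon> along an axis share a block whose contribution
  cancels. Two slabs of thickness \<epsilon> remain, each of volume \<epsilon> s^(n - 1). After
  division by \<epsilon> the bound is independent of \<epsilon>.\<close>

lemma integral_translate_slab:
  fixes f :: "'a::euclidean_space \<Rightarrow> real"
  assumes f: "continuous_on UNIV f" and k: "k \<in> Basis" and cube: "\<And>i. i \<in> Basis \<Longrightarrow> (d - c) \<bullet> i = s"
    and eps: "0 < \<epsilon>" "\<epsilon> \<le> s" and B: "\<And>y. y \<in> cbox c (d + \<epsilon> *\<^sub>R k) \<Longrightarrow> \<bar>f y\<bar> \<le> B"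
  shows "\<bar>integral (cbox c d) (\<lambda>y. f (y + \<epsilon> *\<^sub>R k)) - integral (cbox c d) f\<bar> \<le> 2 * B * \<epsilon> * s ^ (DIM('a) - 1)"
proof -
  let ?Q = "cbox c d" and ?Q' = "cbox (c + \<epsilon> *\<^sub>R k) (d + \<epsilon> *\<^sub>R k)"
  let ?S1 = "cbox c (d + (\<epsilon> - s) *\<^sub>R k)" and ?S2 = "cbox (c + s *\<^sub>R k) (d + \<epsilon> *\<^sub>R k)"
  have int: "f integrable_on cbox a b" for a b
    by (intro integrable_continuous continuous_on_subset[OF f]) auto
  have dc: "d \<bullet> i = c \<bullet> i + s" if "i \<in> Basis" for i using cube[OF that] by (simp add: inner_diff_left)
  have ik: "k \<bullet> i = (if i = k then 1 else 0)" if "i \<in> Basis" for i using k that by (auto simp: inner_Basis)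
  have s: "s > 0" using eps by simp
  have kk: "k \<bullet> k = 1" using k by simp
  have S1: "?Q \<inter> {x. x \<bullet> k \<le> c \<bullet> k + \<epsilon>} = ?S1"
  proof (rule set_eqI)
    fix x
    show "x \<in> ?Q \<inter> {x. x \<bullet> k \<le> c \<bullet> k + \<epsilon>} \<longleftrightarrow> x \<in> ?S1"
    proof
      assume x: "x \<in> ?Q \<inter> {x. x \<bullet> k \<le> c \<bullet> k + \<epsilon>}"
      show "x \<in> ?S1" unfolding mem_box
      proof
        fix i :: 'a assume i: "i \<in> Basis"
        show "c \<bullet> i \<le> x \<bullet> i \<and> x \<bullet> i \<le> (d + (\<epsilon> - s) *\<^sub>R k) \<bullet> i"
          using x i dc[OF i] by (cases "i = k") (auto simp: mem_box inner_add_left ik kk)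
      qed
    next
      assume x: "x \<in> ?S1"
      then have *: "c \<bullet> i \<le> x \<bullet> i \<and> x \<bullet> i \<le> (d + (\<epsilon> - s) *\<^sub>R k) \<bullet> i" if "i \<in> Basis" for i using that by (auto simp: mem_box)
      have "x \<bullet> k \<le> c \<bullet> k + \<epsilon>" using *[OF k] dc[OF k] k by (simp add: inner_add_left)
      moreover have "c \<bullet> i \<le> x \<bullet> i \<and> x \<bullet> i \<le> d \<bullet> i" if i: "i \<in> Basis" for i
        using *[OF i] eps by (cases "i = k") (auto simp: inner_add_left ik[OF i] kk)
      ultimately show "x \<in> ?Q \<inter> {x. x \<bullet> k \<le> c \<bullet> k + \<epsilon>}" by (auto simp: mem_box)
    qed
  qed
  have S2: "?Q' \<inter> {x. x \<bullet> k \<ge> d \<bullet> k} = ?S2"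
  proof (rule set_eqI)
    fix x
    show "x \<in> ?Q' \<inter> {x. x \<bullet> k \<ge> d \<bullet> k} \<longleftrightarrow> x \<in> ?S2"
    proof
      assume x: "x \<in> ?Q' \<inter> {x. x \<bullet> k \<ge> d \<bullet> k}"
      show "x \<in> ?S2" unfolding mem_box
      proof
        fix i :: 'a assume i: "i \<in> Basis"
        show "(c + s *\<^sub>R k) \<bullet> i \<le> x \<bullet> i \<and> x \<bullet> i \<le> (d + \<epsilon> *\<^sub>R k) \<bullet> i"
          using x i dc[OF i] by (cases "i = k") (auto simp: mem_box inner_add_left ik kk)
      qed
    next
      assume x: "x \<in> ?S2"
      then have *: "(c + s *\<^sub>R k) \<bullet> i \<le> x \<bullet> i \<and> x \<bullet> i \<le> (d + \<epsilon> *\<^sub>R k) \<bullet> i" if "i \<in> Basis" for i using that by (auto simp: mem_box)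
      have "d \<bullet> k \<le> x \<bullet> k" using *[OF k] dc[OF k] k by (simp add: inner_add_left)
      moreover have "(c + \<epsilon> *\<^sub>R k) \<bullet> i \<le> x \<bullet> i \<and> x \<bullet> i \<le> (d + \<epsilon> *\<^sub>R k) \<bullet> i" if i: "i \<in> Basis" for i
        using *[OF i] eps by (cases "i = k") (auto simp: inner_add_left ik[OF i] kk)
      ultimately show "x \<in> ?Q' \<inter> {x. x \<bullet> k \<ge> d \<bullet> k}" by (auto simp: mem_box)
    qed
  qed
  have mid: "?Q \<inter> {x. x \<bullet> k \<ge> c \<bullet> k + \<epsilon>} = ?Q' \<inter> {x. x \<bullet> k \<le> d \<bullet> k}"
  proof (rule set_eqI)
    fix x
    have "(\<forall>i\<in>Basis. c \<bullet> i \<le> x \<bullet> i \<and> x \<bullet> i \<le> d \<bullet> i) \<and> x \<bullet> k \<ge> c \<bullet> k + \<epsilon>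
      \<longleftrightarrow> (\<forall>i\<in>Basis. (c + \<epsilon> *\<^sub>R k) \<bullet> i \<le> x \<bullet> i \<and> x \<bullet> i \<le> (d + \<epsilon> *\<^sub>R k) \<bullet> i) \<and> x \<bullet> k \<le> d \<bullet> k" (is "?L \<longleftrightarrow> ?R")
    proof
      assume L: ?L
      show ?R
      proof (intro conjI ballI)
        fix i :: 'a assume i: "i \<in> Basis"
        show "(c + \<epsilon> *\<^sub>R k) \<bullet> i \<le> x \<bullet> i" "x \<bullet> i \<le> (d + \<epsilon> *\<^sub>R k) \<bullet> i"
          using L i eps by (cases "i = k"; force simp: inner_add_left ik[OF i] kk)+
      qed (use L k in auto)
    next
      assume R: ?R
      show ?L
      proof (intro conjI ballI)
        fix i :: 'a assume i: "i \<in> Basis"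
        have "(c + \<epsilon> *\<^sub>R k) \<bullet> i \<le> x \<bullet> i \<and> x \<bullet> i \<le> (d + \<epsilon> *\<^sub>R k) \<bullet> i" using R i by blast
        then show "c \<bullet> i \<le> x \<bullet> i" "x \<bullet> i \<le> d \<bullet> i"
          using R eps by (cases "i = k"; simp add: inner_add_left ik[OF i] kk)+
      next
        have "(c + \<epsilon> *\<^sub>R k) \<bullet> k \<le> x \<bullet> k" using R k by blast
        then show "c \<bullet> k + \<epsilon> \<le> x \<bullet> k" using k by (simp add: inner_add_left)
      qed
    qed
    then show "x \<in> ?Q \<inter> {x. x \<bullet> k \<ge> c \<bullet> k + \<epsilon>} \<longleftrightarrow> x \<in> ?Q' \<inter> {x. x \<bullet> k \<le> d \<bullet> k}"
      by (simp only: Int_iff mem_Collect_eq mem_box)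
  qed
  have prod: "(\<Prod>i\<in>Basis. if i = k then \<epsilon> else s) = \<epsilon> * s ^ (DIM('a) - 1)"
    using k by (subst prod.remove[of _ k]) (auto intro!: prod.cong)
  have e1: "(d + (\<epsilon> - s) *\<^sub>R k) \<bullet> i - c \<bullet> i = (if i = k then \<epsilon> else s)" if "i \<in> Basis" for i
    using that dc[OF that] ik[OF that] by (simp add: inner_add_left)
  have e2: "(d + \<epsilon> *\<^sub>R k) \<bullet> i - (c + s *\<^sub>R k) \<bullet> i = (if i = k then \<epsilon> else s)" if "i \<in> Basis" for i
    using that dc[OF that] ik[OF that] by (simp add: inner_add_left)
  have c1: "measure lborel ?S1 = \<epsilon> * s ^ (DIM('a) - 1)"
  proof -
    have "\<forall>i\<in>Basis. c \<bullet> i \<le> (d + (\<epsilon> - s) *\<^sub>R k) \<bullet> i" using e1 eps s by (smt (verit))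
    then have "measure lborel ?S1 = (\<Prod>i\<in>Basis. (d + (\<epsilon> - s) *\<^sub>R k) \<bullet> i - c \<bullet> i)" by (rule content_cbox)
    also have "\<dots> = (\<Prod>i\<in>Basis. if i = k then \<epsilon> else s)" by (intro prod.cong refl e1)
    finally show ?thesis by (simp only: prod)
  qed
  have c2: "measure lborel ?S2 = \<epsilon> * s ^ (DIM('a) - 1)"
  proof -
    have "\<forall>i\<in>Basis. (c + s *\<^sub>R k) \<bullet> i \<le> (d + \<epsilon> *\<^sub>R k) \<bullet> i" using e2 eps s by (smt (verit))
    then have "measure lborel ?S2 = (\<Prod>i\<in>Basis. (d + \<epsilon> *\<^sub>R k) \<bullet> i - (c + s *\<^sub>R k) \<bullet> i)" by (rule content_cbox)
    also have "\<dots> = (\<Prod>i\<in>Basis. if i = k then \<epsilon> else s)" by (intro prod.cong refl e2)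
    finally show ?thesis by (simp only: prod)
  qed
  have sub: "?S1 \<subseteq> cbox c (d + \<epsilon> *\<^sub>R k)" "?S2 \<subseteq> cbox c (d + \<epsilon> *\<^sub>R k)"
    unfolding subset_box using s by (auto simp: inner_add_left ik kk)
  have "B \<ge> 0"
  proof -
    have "c \<in> cbox c (d + \<epsilon> *\<^sub>R k)" unfolding mem_box using dc eps s by (auto simp: inner_add_left ik kk)
    from B[OF this] show ?thesis by linarith
  qed
  then have b: "\<bar>integral ?S1 f\<bar> \<le> B * (\<epsilon> * s ^ (DIM('a) - 1))" "\<bar>integral ?S2 f\<bar> \<le> B * (\<epsilon> * s ^ (DIM('a) - 1))"
    using has_integral_bound[OF _ integrable_integral[OF int], of B c "d + (\<epsilon> - s) *\<^sub>R k"]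
      has_integral_bound[OF _ integrable_integral[OF int], of B "c + s *\<^sub>R k" "d + \<epsilon> *\<^sub>R k"] B sub c1 c2
    by auto
  have "integral ?Q' f = integral (?Q' \<inter> {x. x \<bullet> k \<le> d \<bullet> k}) f + integral ?S2 f"
    unfolding S2[symmetric] by (rule integral_split[OF int k])
  moreover have "integral ?Q f = integral ?S1 f + integral (?Q' \<inter> {x. x \<bullet> k \<le> d \<bullet> k}) f"
    unfolding S1[symmetric] mid[symmetric] by (rule integral_split[OF int k])
  ultimately have eq: "integral ?Q (\<lambda>y. f (y + \<epsilon> *\<^sub>R k)) - integral ?Q f = integral ?S2 f - integral ?S1 f"
    unfolding integral_cbox_shift[OF f] by linarith
  have "\<bar>integral ?S2 f - integral ?S1 f\<bar> \<le> B * (\<epsilon> * s ^ (DIM('a) - 1)) + B * (\<epsilon> * s ^ (DIM('a) - 1))"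
    by (rule order_trans[OF abs_triangle_ineq4 add_mono[OF b(2,1)]])
  then show ?thesis unfolding eq by simp
qed

text \<open>Goursat's bisection argument. Halving one coordinate at a time keeps the boxes cubes.\<close>

lemma cube_bisection_step:
  fixes Q :: "'a::euclidean_space set \<Rightarrow> bool"
  assumes split: "\<And>a b k m. k \<in> Basis \<Longrightarrow> Q (cbox a b \<inter> {x. x \<bullet> k \<le> m}) \<Longrightarrow> Q (cbox a b \<inter> {x. x \<bullet> k \<ge> m}) \<Longrightarrow> Q (cbox a b)"
    and "\<not> Q (cbox a b)" and side: "\<And>i. i \<in> Basis \<Longrightarrow> (b - a) \<bullet> i = s" and s: "s > 0"
  shows "\<exists>c d. \<not> Q (cbox c d) \<and> cbox c d \<subseteq> cbox a b \<and> (\<forall>i\<in>Basis. (d - c) \<bullet> i = s / 2)"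
proof -
  \<comment> \<open>Induction over the set K of coordinates already halved. The intermediate boxes
    have sides s/2 and s; at K = Basis the box is a cube again.\<close>
  have "\<exists>c d. \<not> Q (cbox c d) \<and> cbox c d \<subseteq> cbox a b \<and> (\<forall>i\<in>Basis. (d - c) \<bullet> i = (if i \<in> K then s / 2 else s))"
    if "finite K" "K \<subseteq> Basis" for K
    using that
  proof (induction K rule: finite_induct)
    case empty
    then show ?case using assms(2) side by (intro exI[of _ a] exI[of _ b]) auto
  next
    case (insert k K)
    then obtain c d where cd: "\<not> Q (cbox c d)" "cbox c d \<subseteq> cbox a b" "\<And>i. i \<in> Basis \<Longrightarrow> (d - c) \<bullet> i = (if i \<in> K then s / 2 else s)"
      by auto
    have k: "k \<in> Basis" "k \<notin> K" using insert by auto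
    define m where "m = c \<bullet> k + s / 2"
    have dk: "d \<bullet> k = c \<bullet> k + s" using cd(3)[OF k(1)] k(2) by (simp add: inner_diff_left)
    have "\<not> Q (cbox c d \<inter> {x. x \<bullet> k \<le> m}) \<or> \<not> Q (cbox c d \<inter> {x. x \<bullet> k \<ge> m})"
      using split[OF k(1)] cd(1) by blast
    then show ?case
    proof
      assume n: "\<not> Q (cbox c d \<inter> {x. x \<bullet> k \<le> m})"
      define e where "e = (\<Sum>i\<in>Basis. (if i = k then min (d \<bullet> k) m else d \<bullet> i) *\<^sub>R i)"
      have e: "cbox c d \<inter> {x. x \<bullet> k \<le> m} = cbox c e" unfolding e_def by (rule interval_split(1)[OF k(1)])
      show ?thesis
      proof (rule exI[of _ c], rule exI[of _ e], intro conjI ballI)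
        show "\<not> Q (cbox c e)" using n unfolding e .
        show "cbox c e \<subseteq> cbox a b" using cd(2) unfolding e[symmetric] by auto
        fix i :: 'a assume i: "i \<in> Basis"
        show "(e - c) \<bullet> i = (if i \<in> insert k K then s / 2 else s)"
          using cd(3)[OF i] dk s i by (auto simp: e_def inner_diff_left m_def min_def)
      qed
    next
      assume n: "\<not> Q (cbox c d \<inter> {x. x \<bullet> k \<ge> m})"
      define e where "e = (\<Sum>i\<in>Basis. (if i = k then max (c \<bullet> k) m else c \<bullet> i) *\<^sub>R i)"
      have e: "cbox c d \<inter> {x. x \<bullet> k \<ge> m} = cbox e d" unfolding e_def by (rule interval_split(2)[OF k(1)])
      show ?thesis
      proof (rule exI[of _ e], rule exI[of _ d], intro conjI ballI)
        show "\<not> Q (cbox e d)" using n unfolding e .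
        show "cbox e d \<subseteq> cbox a b" using cd(2) unfolding e[symmetric] by auto
        fix i :: 'a assume i: "i \<in> Basis"
        show "(d - e) \<bullet> i = (if i \<in> insert k K then s / 2 else s)"
          using cd(3)[OF i] dk s i by (auto simp: e_def inner_diff_left m_def max_def)
      qed
    qed
  qed
  from this[of Basis] show ?thesis by auto
qed

text \<open>Nested compact cubes have a common point, and around it Q fails at arbitrarily small
  scales.\<close>

lemma cube_bisection:
  fixes Q :: "'a::euclidean_space set \<Rightarrow> bool"
  assumes split: "\<And>a b k m. k \<in> Basis \<Longrightarrow> Q (cbox a b \<inter> {x. x \<bullet> k \<le> m}) \<Longrightarrow> Q (cbox a b \<inter> {x. x \<bullet> k \<ge> m}) \<Longrightarrow> Q (cbox a b)"
    and "\<not> Q (cbox a b)" and side: "\<And>i. i \<in> Basis \<Longrightarrow> (b - a) \<bullet> i = s" and s: "s > 0"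
  obtains x where "\<And>\<delta>. \<delta> > 0 \<Longrightarrow> \<exists>c d r. 0 < r \<and> r < \<delta> \<and> (\<forall>i\<in>Basis. (d - c) \<bullet> i = r) \<and> x \<in> cbox c d \<and> \<not> Q (cbox c d)"
proof -
  define P where "P = (\<lambda>(n::nat) (cd :: 'a \<times> 'a). \<not> Q (cbox (fst cd) (snd cd)) \<and> (\<forall>i\<in>Basis. (snd cd - fst cd) \<bullet> i = s / 2 ^ n))"
  have "\<exists>F. \<forall>n. P n (F n) \<and> cbox (fst (F (Suc n))) (snd (F (Suc n))) \<subseteq> cbox (fst (F n)) (snd (F n))"
  proof (rule dependent_nat_choice)
    show "\<exists>cd. P 0 cd" using assms(2) side by (intro exI[of _ "(a, b)"]) (auto simp: P_def)
    fix cd n assume "P n cd"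
    then have "\<exists>c d. \<not> Q (cbox c d) \<and> cbox c d \<subseteq> cbox (fst cd) (snd cd) \<and> (\<forall>i\<in>Basis. (d - c) \<bullet> i = (s / 2 ^ n) / 2)"
      unfolding P_def by (intro cube_bisection_step split) (use s in auto)
    then obtain c d where "\<not> Q (cbox c d)" "cbox c d \<subseteq> cbox (fst cd) (snd cd)" "\<forall>i\<in>Basis. (d - c) \<bullet> i = (s / 2 ^ n) / 2" by blast
    then show "\<exists>y. P (Suc n) y \<and> cbox (fst y) (snd y) \<subseteq> cbox (fst cd) (snd cd)"
      by (intro exI[of _ "(c, d)"]) (auto simp: P_def field_simps)
  qed
  then obtain F where F: "\<And>n. P n (F n)" "\<And>n. cbox (fst (F (Suc n))) (snd (F (Suc n))) \<subseteq> cbox (fst (F n)) (snd (F n))" by blast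
  let ?B = "\<lambda>n. cbox (fst (F n)) (snd (F n))"
  have "\<Inter>(range ?B) \<noteq> {}"
  proof (rule compact_nest)
    show "?B n \<noteq> {}" for n
    proof -
      have "0 \<le> (snd (F n) - fst (F n)) \<bullet> i" if "i \<in> Basis" for i using F(1)[of n] that s by (auto simp: P_def)
      then show ?thesis unfolding box_ne_empty by (auto simp: inner_diff_left)
    qed
    show "?B n \<subseteq> ?B m" if "m \<le> n" for m n
      using that by (induction n rule: dec_induct) (use F(2) in auto)
  qed (rule compact_cbox)
  then obtain x where x: "\<And>n. x \<in> ?B n" by auto
  show ?thesis
  proof (rule that[of x])
    fix \<delta> :: real assume "\<delta> > 0"
    have "(\<lambda>n. s / 2 ^ n) \<longlonglongrightarrow> 0" by real_asymp
    then have "\<forall>\<^sub>F n in sequentially. s / 2 ^ n < \<delta>" using \<open>\<delta> > 0\<close> by (rule order_tendstoD)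
    then obtain n where n: "s / 2 ^ n < \<delta>" by (auto simp: eventually_sequentially)
    show "\<exists>c d r. 0 < r \<and> r < \<delta> \<and> (\<forall>i\<in>Basis. (d - c) \<bullet> i = r) \<and> x \<in> cbox c d \<and> \<not> Q (cbox c d)"
      using F(1)[of n] x[of n] n s by (intro exI[of _ "fst (F n)"] exI[of _ "snd (F n)"] exI[of _ "s / 2 ^ n"]) (auto simp: P_def)
  qed
qed

text \<open>A weak divergence theorem for merely differentiable fields: no integrability of the divergence is required.\<close>

lemma divergence_lower_bound:
  fixes G :: "'a::euclidean_space \<Rightarrow> 'a" and c :: "'a \<Rightarrow> real"
  assumes G: "\<And>x. (G has_derivative G' x) (at x)" and c: "continuous_on UNIV c"
    and div: "\<And>x. c x \<le> (\<Sum>i\<in>Basis. G' x i \<bullet> i)"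
    and supp: "\<And>x. x \<notin> cbox (- One) One \<Longrightarrow> G x = 0"
  shows "integral (cbox (- (2 *\<^sub>R One)) (2 *\<^sub>R One)) c \<le> 0"
proof (rule ccontr)
  let ?N = "real DIM('a)"
  let ?Q0 = "cbox (- (2 *\<^sub>R One)) (2 *\<^sub>R One) :: 'a set"
  assume "\<not> ?thesis"
  then have I: "integral ?Q0 c > 0" by simp
  define V where "V = measure lborel ?Q0"
  have c0: "V > 0" unfolding V_def
    by (subst content_cbox) (auto simp: inner_minus_left intro!: prod_pos)
  \<comment> \<open>Half the mean of c over the big cube: adding \<eta> still leaves the total
    integral of \<open>w\<close> negative.\<close>
  define \<eta> where "\<eta> = integral ?Q0 c / (2 * V)"
  have eta: "\<eta> > 0" using I c0 by (simp add: \<eta>_def)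
  have Gc: "continuous_on UNIV G"
    using has_derivative_continuous[OF G] by (simp add: continuous_on_eq_continuous_at)
  \<comment> \<open>Difference quotients stand in for the divergence; unlike it, they are continuous
    and can be integrated over boxes.\<close>
  define w where "w = (\<lambda>\<epsilon> x. (\<Sum>i\<in>Basis. (G (x + \<epsilon> *\<^sub>R i) \<bullet> i - G x \<bullet> i) / \<epsilon>) - c x + \<eta>)"
  have Gs: "continuous_on UNIV (\<lambda>x. G (x + v))" for v
    by (rule continuous_on_compose2[OF Gc]) (auto intro!: continuous_intros)
  have wc: "continuous_on UNIV (w \<epsilon>)" for \<epsilon>
    unfolding w_def divide_inverse by (intro continuous_intros Gc Gs c)
  have int: "f integrable_on cbox a b" if "continuous_on UNIV f" for f :: "'a \<Rightarrow> real" and a b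
    by (intro integrable_continuous continuous_on_subset[OF that]) auto
  \<comment> \<open>The threshold for \<epsilon> may depend on the box, since gluing two boxes only
    takes a minimum of two thresholds.\<close>
  define Q where "Q = (\<lambda>S. \<exists>\<epsilon>0>0. \<forall>\<epsilon>. 0 < \<epsilon> \<longrightarrow> \<epsilon> < \<epsilon>0 \<longrightarrow> 0 \<le> integral S (w \<epsilon>))"
  have split: "Q (cbox a b)" if k: "k \<in> Basis" and q1: "Q (cbox a b \<inter> {x. x \<bullet> k \<le> m})" and q2: "Q (cbox a b \<inter> {x. x \<bullet> k \<ge> m})" for a b k m
  proof -
    obtain e1 where e1: "e1 > 0" "\<And>\<epsilon>. 0 < \<epsilon> \<Longrightarrow> \<epsilon> < e1 \<Longrightarrow> 0 \<le> integral (cbox a b \<inter> {x. x \<bullet> k \<le> m}) (w \<epsilon>)"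
      using q1 by (auto simp: Q_def)
    obtain e2 where e2: "e2 > 0" "\<And>\<epsilon>. 0 < \<epsilon> \<Longrightarrow> \<epsilon> < e2 \<Longrightarrow> 0 \<le> integral (cbox a b \<inter> {x. x \<bullet> k \<ge> m}) (w \<epsilon>)"
      using q2 by (auto simp: Q_def)
    show ?thesis unfolding Q_def
      using e1 e2 integral_split[OF int[OF wc] k, of a b _ m]
      by (intro exI[of _ "min e1 e2"]) auto
  qed
  have notQ0: "\<not> Q ?Q0"
  proof
    assume "Q ?Q0"
    then obtain e0 where e0: "e0 > 0" "\<And>\<epsilon>. 0 < \<epsilon> \<Longrightarrow> \<epsilon> < e0 \<Longrightarrow> 0 \<le> integral ?Q0 (w \<epsilon>)" by (auto simp: Q_def)
    define \<epsilon> where "\<epsilon> = min e0 1 / 2"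
    have eps: "0 < \<epsilon>" "\<epsilon> < e0" "\<epsilon> < 1" using e0(1) by (auto simp: \<epsilon>_def)
    \<comment> \<open>The support lies in the cube of half-side 1 and the shift is less than 1, so
      the cube of half-side 2 contains the supports of G and of its translate.\<close>
    have z: "integral ?Q0 (\<lambda>x. (G (x + \<epsilon> *\<^sub>R i) \<bullet> i - G x \<bullet> i) / \<epsilon>) = 0" if i: "i \<in> Basis" for i
    proof -
      let ?f = "\<lambda>x. G x \<bullet> i"
      have fc: "continuous_on UNIV ?f" by (intro continuous_intros Gc)
      have fcs: "continuous_on UNIV (\<lambda>x. G (x + \<epsilon> *\<^sub>R i) \<bullet> i)" by (intro continuous_intros Gs)
      have res: "integral (cbox a b) ?f = integral (cbox (- One) One) ?f" if "cbox (- One) One \<subseteq> cbox a b" for a b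
      proof -
        have "integral (cbox a b) ?f = integral (cbox a b) (\<lambda>x. if x \<in> cbox (- One) One then ?f x else 0)"
          by (rule integral_cong) (use supp in auto)
        also have "\<dots> = integral (cbox a b \<inter> cbox (- One) One) ?f"
          using integral_restrict_Int[of "cbox a b" "cbox (- One) One" ?f] by (simp add: Int_commute)
        also have "cbox a b \<inter> cbox (- One) One = cbox (- One) One" using that by auto
        finally show ?thesis by simp
      qed
      have "integral ?Q0 (\<lambda>x. ?f (x + \<epsilon> *\<^sub>R i)) = integral (cbox (- (2 *\<^sub>R One) + \<epsilon> *\<^sub>R i) (2 *\<^sub>R One + \<epsilon> *\<^sub>R i)) ?f"
        by (rule integral_cbox_shift[OF fc])
      also have "\<dots> = integral (cbox (- One) One) ?f"
        by (rule res) (use eps i in \<open>auto simp: subset_box inner_add_left inner_diff_left inner_minus_left inner_Basis\<close>)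
      finally have "integral ?Q0 (\<lambda>x. ?f (x + \<epsilon> *\<^sub>R i)) = integral (cbox (- One) One) ?f" .
      moreover have "integral ?Q0 ?f = integral (cbox (- One) One) ?f"
        by (rule res) (auto simp: subset_box inner_minus_left)
      ultimately show ?thesis
        by (simp add: integral_diff[OF int[OF fcs] int[OF fc]])
    qed
    have "integral ?Q0 (w \<epsilon>) = (\<Sum>i\<in>Basis. integral ?Q0 (\<lambda>x. (G (x + \<epsilon> *\<^sub>R i) \<bullet> i - G x \<bullet> i) / \<epsilon>)) - integral ?Q0 c + integral ?Q0 (\<lambda>x. \<eta>)"
    proof -
      have ii: "(\<lambda>x. (G (x + \<epsilon> *\<^sub>R i) \<bullet> i - G x \<bullet> i) / \<epsilon>) integrable_on ?Q0" for i
        using eps by (intro int continuous_intros Gc Gs) auto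
      show ?thesis unfolding w_def
        by (subst integral_add, intro integrable_diff integrable_sum ii int[OF c], simp, rule int, simp,
            subst integral_diff, intro integrable_sum ii, simp, rule int[OF c], subst integral_sum) (auto intro: ii)
    qed
    also have "(\<Sum>i\<in>Basis. integral ?Q0 (\<lambda>x. (G (x + \<epsilon> *\<^sub>R i) \<bullet> i - G x \<bullet> i) / \<epsilon>)) = 0"
      by (intro sum.neutral ballI z)
    also have "0 - integral ?Q0 c + integral ?Q0 (\<lambda>x. \<eta>) = - integral ?Q0 c + \<eta> * V" by (simp add: V_def)
    also have "\<dots> < 0" using I c0 by (simp add: \<eta>_def)
    finally show False using e0(2)[OF eps(1,2)] by linarith
  qed
  have sd: "(2 *\<^sub>R One - - (2 *\<^sub>R One)) \<bullet> i = (4 :: real)" if "i \<in> Basis" for i :: 'a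
    using that by (simp add: inner_diff_left inner_minus_left inner_add_left)
  obtain x where x: "\<And>\<delta>. \<delta> > 0 \<Longrightarrow> \<exists>c d r. 0 < r \<and> r < \<delta> \<and> (\<forall>i\<in>Basis. (d - c) \<bullet> i = r) \<and> x \<in> cbox c d \<and> \<not> Q (cbox c d)"
    by (rule cube_bisection[of Q, OF split notQ0 sd]) auto
  \<comment> \<open>Each coordinate direction will cost 2 \<theta> (n + 1) times the volume, n being
    the dimension; with this choice all n directions together cost \<eta>/4.\<close>
  define \<theta> where "\<theta> = \<eta> / (8 * ?N * (?N + 1))"
  have N: "?N \<ge> 1" using DIM_positive[where 'a = 'a] by linarith
  have theta: "\<theta> > 0" "2 * \<theta> * (?N + 1) * ?N = \<eta> / 4"
  proof -
    define K where "K = ?N * (?N + 1)"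
    have "K > 0" unfolding K_def using N by (intro mult_pos_pos) auto
    moreover have "\<theta> = \<eta> / (8 * K)" by (simp add: \<theta>_def K_def)
    ultimately have "\<theta> > 0 \<and> 2 * \<theta> * K = \<eta> / 4" using eta by simp
    then show "\<theta> > 0" "2 * \<theta> * (?N + 1) * ?N = \<eta> / 4" by (simp_all add: K_def mult_ac)
  qed
  obtain \<delta>1 where d1: "\<delta>1 > 0" "\<And>y. norm (y - x) < \<delta>1 \<Longrightarrow> norm (G y - G x - G' x (y - x)) \<le> \<theta> * norm (y - x)"
    using G[of x] theta(1) unfolding has_derivative_at_alt by blast
  have "isCont c x" using c by (simp add: continuous_on_eq_continuous_at)
  then obtain \<delta>2 where d2: "\<delta>2 > 0" "\<And>y. norm (y - x) < \<delta>2 \<Longrightarrow> \<bar>c y - c x\<bar> < \<eta> / 4"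
    using eta unfolding continuous_at_eps_delta dist_norm by (metis divide_pos_pos zero_less_numeral real_norm_def)
  define \<delta> where "\<delta> = min \<delta>1 \<delta>2 / (?N + 1)"
  have "\<delta> > 0" using d1 d2 N by (simp add: \<delta>_def)
  then obtain a b s where ab: "0 < s" "s < \<delta>" "\<And>i. i \<in> Basis \<Longrightarrow> (b - a) \<bullet> i = s" "x \<in> cbox a b" "\<not> Q (cbox a b)"
    using x by blast
  obtain \<epsilon> where eps: "0 < \<epsilon>" "\<epsilon> < s" "integral (cbox a b) (w \<epsilon>) < 0"
    using ab(1,5) unfolding Q_def by (auto simp: not_le)
  \<comment> \<open>The factor n + 1: each of the n coordinates differs by at most s, and the
    translation adds at most one more s along k.\<close>
  have dist: "norm (y - x) \<le> (?N + 1) * s" if y: "y \<in> cbox a (b + \<epsilon> *\<^sub>R k)" and k: "k \<in> Basis" for y k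
  proof -
    have ba: "b \<bullet> i = a \<bullet> i + s" if "i \<in> Basis" for i using ab(3)[OF that] by (simp add: inner_diff_left)
    have "norm (y - x) \<le> (\<Sum>i\<in>Basis. \<bar>(y - x) \<bullet> i\<bar>)" by (rule norm_le_l1)
    also have "\<dots> \<le> (\<Sum>i\<in>Basis. s + (if i = k then s else 0))"
    proof (rule sum_mono)
      fix i :: 'a assume i: "i \<in> Basis"
      have "a \<bullet> i \<le> x \<bullet> i" "x \<bullet> i \<le> b \<bullet> i" using ab(4) i by (auto simp: mem_box)
      moreover have "a \<bullet> i \<le> y \<bullet> i" "y \<bullet> i \<le> (b + \<epsilon> *\<^sub>R k) \<bullet> i" using y i by (auto simp: mem_box)
      ultimately show "\<bar>(y - x) \<bullet> i\<bar> \<le> s + (if i = k then s else 0)"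
        using ba[OF i] eps ab(1) i k by (cases "i = k") (auto simp: inner_add_left inner_diff_left inner_Basis abs_le_iff)
    qed
    also have "\<dots> = (?N + 1) * s" using k by (simp add: sum.distrib algebra_simps)
    finally show ?thesis .
  qed
  have small: "(?N + 1) * s < min \<delta>1 \<delta>2" using ab(2) N unfolding \<delta>_def by (simp add: field_simps)
  have lin: "linear (G' x)" using G[of x] by (rule has_derivative_linear)
  have cont: "measure lborel (cbox a b) = s ^ DIM('a)"
  proof -
    have "\<forall>i\<in>Basis. a \<bullet> i \<le> b \<bullet> i" using ab(1,3) by (metis inner_diff_left diff_ge_0_iff_ge less_imp_le)
    then have "measure lborel (cbox a b) = (\<Prod>i\<in>Basis. b \<bullet> i - a \<bullet> i)" by (rule content_cbox)
    also have "\<dots> = (\<Prod>i\<in>(Basis :: 'a set). s)" by (rule prod.cong) (use ab(3) in \<open>auto simp: inner_diff_left\<close>)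
    finally show ?thesis by simp
  qed
  \<comment> \<open>Near x the field G is affine up to R. The affine part gives the exact term, and
    \<open>integral_translate_slab\<close> bounds the difference quotients of R by a multiple of
    \<theta>, however small \<epsilon> is compared with s.\<close>
  have lower: "integral (cbox a b) (\<lambda>y. (G (y + \<epsilon> *\<^sub>R k) \<bullet> k - G y \<bullet> k) / \<epsilon>) \<ge> (G' x k \<bullet> k) * s ^ DIM('a) - 2 * \<theta> * (?N + 1) * s ^ DIM('a)"
    if k: "k \<in> Basis" for k
  proof -
    define R where "R = (\<lambda>y. (G y - G x - G' x (y - x)) \<bullet> k)"
    have Rc: "continuous_on UNIV R"
      unfolding R_def
      by (intro continuous_intros Gc continuous_on_compose2[OF linear_continuous_on[OF linear_conv_bounded_linear[THEN iffD1, OF lin]], of UNIV]) auto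
    have Rcs: "continuous_on UNIV (\<lambda>y. R (y + \<epsilon> *\<^sub>R k))"
      by (rule continuous_on_compose2[OF Rc]) (auto intro!: continuous_intros)
    have B: "\<bar>R y\<bar> \<le> \<theta> * ((?N + 1) * s)" if "y \<in> cbox a (b + \<epsilon> *\<^sub>R k)" for y
    proof -
      have "\<bar>R y\<bar> \<le> norm (G y - G x - G' x (y - x)) * norm k" unfolding R_def by (rule Cauchy_Schwarz_ineq2)
      also have "\<dots> \<le> \<theta> * norm (y - x) * 1"
        using dist[OF that k] small k theta by (intro mult_mono d1(2)) auto
      also have "\<dots> \<le> \<theta> * ((?N + 1) * s)" using dist[OF that k] theta by simp
      finally show ?thesis .
    qed
    have "(\<lambda>y. (G (y + \<epsilon> *\<^sub>R k) \<bullet> k - G y \<bullet> k) / \<epsilon>) = (\<lambda>y. G' x k \<bullet> k + (R (y + \<epsilon> *\<^sub>R k) - R y) / \<epsilon>)"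
    proof
      fix y
      have "G' x (y + \<epsilon> *\<^sub>R k - x) = G' x (y - x) + \<epsilon> *\<^sub>R G' x k"
        using linear_add[OF lin, of "y - x" "\<epsilon> *\<^sub>R k"] linear_scale[OF lin, of \<epsilon> k] by (simp add: algebra_simps)
      then have "R (y + \<epsilon> *\<^sub>R k) - R y = G (y + \<epsilon> *\<^sub>R k) \<bullet> k - G y \<bullet> k - \<epsilon> * (G' x k \<bullet> k)"
        by (simp add: R_def inner_diff_left inner_add_left)
      then show "(G (y + \<epsilon> *\<^sub>R k) \<bullet> k - G y \<bullet> k) / \<epsilon> = G' x k \<bullet> k + (R (y + \<epsilon> *\<^sub>R k) - R y) / \<epsilon>"
        using eps by (simp add: field_simps)
    qed
    then have "integral (cbox a b) (\<lambda>y. (G (y + \<epsilon> *\<^sub>R k) \<bullet> k - G y \<bullet> k) / \<epsilon>)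
       = integral (cbox a b) (\<lambda>y. G' x k \<bullet> k) + integral (cbox a b) (\<lambda>y. (R (y + \<epsilon> *\<^sub>R k) - R y) / \<epsilon>)"
      using eps by (simp only:) (subst integral_add, auto intro!: int continuous_intros Rc Rcs)
    also have "integral (cbox a b) (\<lambda>y. (R (y + \<epsilon> *\<^sub>R k) - R y) / \<epsilon>)
       = (integral (cbox a b) (\<lambda>y. R (y + \<epsilon> *\<^sub>R k)) - integral (cbox a b) R) / \<epsilon>"
      by (simp add: integral_diff[OF int[OF Rcs] int[OF Rc]])
    also have "integral (cbox a b) (\<lambda>y. G' x k \<bullet> k) = (G' x k \<bullet> k) * s ^ DIM('a)" by (simp add: cont)
    finally have e: "integral (cbox a b) (\<lambda>y. (G (y + \<epsilon> *\<^sub>R k) \<bullet> k - G y \<bullet> k) / \<epsilon>)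
      = (G' x k \<bullet> k) * s ^ DIM('a) + (integral (cbox a b) (\<lambda>y. R (y + \<epsilon> *\<^sub>R k)) - integral (cbox a b) R) / \<epsilon>" .
    have "\<bar>integral (cbox a b) (\<lambda>y. R (y + \<epsilon> *\<^sub>R k)) - integral (cbox a b) R\<bar> \<le> 2 * (\<theta> * ((?N + 1) * s)) * \<epsilon> * s ^ (DIM('a) - 1)"
      by (rule integral_translate_slab[OF Rc k ab(3) eps(1) less_imp_le[OF eps(2)] B])
    also have "\<dots> = 2 * \<theta> * (?N + 1) * (s * s ^ (DIM('a) - 1)) * \<epsilon>" by simp
    also have "s * s ^ (DIM('a) - 1) = s ^ DIM('a)" using DIM_positive[where 'a = 'a] by (simp flip: power_Suc)
    finally have "\<bar>integral (cbox a b) (\<lambda>y. R (y + \<epsilon> *\<^sub>R k)) - integral (cbox a b) R\<bar> \<le> 2 * \<theta> * (?N + 1) * s ^ DIM('a) * \<epsilon>" .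
    then have "- (2 * \<theta> * (?N + 1) * s ^ DIM('a) * \<epsilon>) \<le> integral (cbox a b) (\<lambda>y. R (y + \<epsilon> *\<^sub>R k)) - integral (cbox a b) R"
      by (rule abs_le_D2[THEN minus_le_iff[THEN iffD1]])
    then have "- (2 * \<theta> * (?N + 1) * s ^ DIM('a)) \<le> (integral (cbox a b) (\<lambda>y. R (y + \<epsilon> *\<^sub>R k)) - integral (cbox a b) R) / \<epsilon>"
      using eps(1) by (simp add: pos_le_divide_eq)
    then show ?thesis unfolding e by linarith
  qed
  have ci: "integral (cbox a b) c \<le> (c x + \<eta> / 4) * s ^ DIM('a)"
  proof -
    have "integral (cbox a b) c \<le> integral (cbox a b) (\<lambda>y. c x + \<eta> / 4)"
    proof (rule integral_le[OF int[OF c]])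
      fix y assume y: "y \<in> cbox a b"
      obtain k :: 'a where k: "k \<in> Basis" using nonempty_Basis by blast
      have "y \<in> cbox a (b + \<epsilon> *\<^sub>R k)" using y eps k by (auto simp: mem_box inner_add_left inner_Basis)
      from dist[OF this k] small have "norm (y - x) < \<delta>2" by linarith
      from d2(2)[OF this] show "c y \<le> c x + \<eta> / 4" by linarith
    qed (rule int, simp)
    then show ?thesis by (simp add: cont mult.commute)
  qed
  have "integral (cbox a b) (w \<epsilon>) = (\<Sum>i\<in>Basis. integral (cbox a b) (\<lambda>x. (G (x + \<epsilon> *\<^sub>R i) \<bullet> i - G x \<bullet> i) / \<epsilon>)) - integral (cbox a b) c + integral (cbox a b) (\<lambda>x. \<eta>)"
  proof -
    have ii: "(\<lambda>x. (G (x + \<epsilon> *\<^sub>R i) \<bullet> i - G x \<bullet> i) / \<epsilon>) integrable_on cbox a b" for i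
      using eps by (intro int continuous_intros Gc Gs) auto
    show ?thesis unfolding w_def
      by (subst integral_add, intro integrable_diff integrable_sum ii int[OF c], simp, rule int, simp,
          subst integral_diff, intro integrable_sum ii, simp, rule int[OF c], subst integral_sum) (auto intro: ii)
  qed
  also have "\<dots> \<ge> (\<Sum>i\<in>Basis. (G' x i \<bullet> i) * s ^ DIM('a) - 2 * \<theta> * (?N + 1) * s ^ DIM('a)) - (c x + \<eta> / 4) * s ^ DIM('a) + \<eta> * s ^ DIM('a)"
    using sum_mono[OF lower, of Basis "\<lambda>i. i"] ci by (simp add: cont mult.commute)
  also have "(\<Sum>i\<in>Basis. (G' x i \<bullet> i) * s ^ DIM('a) - 2 * \<theta> * (?N + 1) * s ^ DIM('a))
     = (\<Sum>i\<in>Basis. G' x i \<bullet> i) * s ^ DIM('a) - (2 * \<theta> * (?N + 1) * ?N) * s ^ DIM('a)"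
    by (simp add: sum_subtractf sum_distrib_right)
  \<comment> \<open>Of the margin \<eta>, one quarter went into the remainders and one quarter into
    the oscillation of c.\<close>
  finally have "integral (cbox a b) (w \<epsilon>) \<ge> ((\<Sum>i\<in>Basis. G' x i \<bullet> i) - c x + \<eta> / 2) * s ^ DIM('a)"
    unfolding theta(2) by (simp add: algebra_simps)
  moreover have "((\<Sum>i\<in>Basis. G' x i \<bullet> i) - c x + \<eta> / 2) * s ^ DIM('a) \<ge> 0"
    using div[of x] eta ab(1) by (intro mult_nonneg_nonneg) auto
  ultimately show False using eps(3) by linarith
qed

section \<open>The mean value inequality for subharmonic functions\<close>

text \<open>Squaring removes the kink of the positive part at the unit sphere. Up to the factor -4
  the gradient is z times max(0, 1 - |z|^2), the weight of the mean value inequality.\<close>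

lemma has_derivative_square_pos_part:
  fixes z :: "'a::real_inner"
  shows "((\<lambda>z. (max 0 (1 - (norm z)\<^sup>2))\<^sup>2) has_derivative (\<lambda>v. - (4 * max 0 (1 - (norm z)\<^sup>2) * (z \<bullet> v)))) (at z)"
proof -
  have sq: "((\<lambda>t. (max 0 t)\<^sup>2) has_real_derivative 2 * max 0 t) (at t)" for t :: real
  proof -
    consider "t > 0" | "t < 0" | "t = 0" by linarith
    then show ?thesis
    proof cases
      case 1
      have "((\<lambda>t. t\<^sup>2) has_real_derivative 2 * max 0 t) (at t)"
        using 1 by (auto intro!: derivative_eq_intros)
      moreover have "\<forall>\<^sub>F y in nhds t. y\<^sup>2 = (max 0 y)\<^sup>2"
        using eventually_nhds_in_open[of "{0<..}" t] 1 by (auto elim!: eventually_mono)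
      ultimately show ?thesis by (subst (asm) DERIV_cong_ev[OF refl _ refl]) auto
    next
      case 2
      have "((\<lambda>t. 0) has_real_derivative 2 * max 0 t) (at t)"
        using 2 by (auto intro!: derivative_eq_intros)
      moreover have "\<forall>\<^sub>F y in nhds t. 0 = (max 0 y)\<^sup>2"
        using eventually_nhds_in_open[of "{..<0}" t] 2 by (auto elim!: eventually_mono)
      ultimately show ?thesis by (subst (asm) DERIV_cong_ev[OF refl _ refl]) auto
    next
      case 3
      have "(\<lambda>h. ((max 0 (0 + h))\<^sup>2 - (max 0 0)\<^sup>2) / h) \<midarrow>0\<rightarrow> (0::real)"
      proof (rule Lim_null_comparison)
        show "\<forall>\<^sub>F h in at 0. norm (((max 0 (0 + h))\<^sup>2 - (max 0 0)\<^sup>2) / h) \<le> \<bar>h :: real\<bar>"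
        proof (rule always_eventually, rule allI)
          fix h :: real
          have "(max 0 h)\<^sup>2 \<le> \<bar>h\<bar> * \<bar>h\<bar>" by (auto simp: max_def power2_eq_square)
          then show "norm (((max 0 (0 + h))\<^sup>2 - (max 0 0)\<^sup>2) / h) \<le> \<bar>h\<bar>"
            by (cases "h = 0") (auto simp: divide_le_eq)
        qed
        show "((\<lambda>h :: real. \<bar>h\<bar>) \<longlongrightarrow> 0) (at 0)" by (auto intro!: tendsto_eq_intros)
      qed
      then show ?thesis using 3 by (simp add: DERIV_def)
    qed
  qed
  have n: "((\<lambda>z. 1 - (norm z)\<^sup>2) has_derivative (\<lambda>v. - (2 * (z \<bullet> v)))) (at z)"
    unfolding power2_norm_eq_inner by (auto intro!: derivative_eq_intros simp: inner_commute)
  have "((\<lambda>z. (max 0 (1 - (norm z)\<^sup>2))\<^sup>2) has_derivative (\<lambda>v. 2 * max 0 (1 - (norm z)\<^sup>2) * (- (2 * (z \<bullet> v))))) (at z)"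
    by (rule has_derivative_compose[OF n, where g = "\<lambda>t. (max 0 t)\<^sup>2" and g' = "(*) (2 * max 0 (1 - (norm z)\<^sup>2))"])
      (use sq[of "1 - (norm z)\<^sup>2"] in \<open>simp add: has_field_derivative_def\<close>)
  then show ?thesis by (simp add: mult_ac)
qed

lemma pos_part_supp: "z \<notin> cbox (- One) One \<Longrightarrow> max 0 (1 - (norm (z :: 'a::euclidean_space))\<^sup>2) = 0"
proof -
  assume z: "z \<notin> cbox (- One) One"
  have "norm z > 1"
  proof (rule ccontr)
    assume n: "\<not> norm z > 1"
    have "- 1 \<le> z \<bullet> i \<and> z \<bullet> i \<le> 1" if "i \<in> Basis" for i
      using Basis_le_norm[OF that, of z] n by (auto simp: abs_le_iff)
    then show False using z by (auto simp: mem_box inner_minus_left)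
  qed
  then have "(norm z)\<^sup>2 \<ge> 1" by simp
  then show ?thesis by simp
qed

text \<open>\<open>divergence_lower_bound\<close> is applied to D times the squared cut-off. The
  divergence of this field is the squared cut-off times the divergence of D, which is nonnegative,
  minus 4 max(0, 1 - |z|^2) times the inner product of z and D z. Only the last, continuous term is
  kept as the lower bound.\<close>

lemma radial_derivative_nonneg:
  fixes D :: "'a::euclidean_space \<Rightarrow> 'a"
  assumes D: "\<And>x. (D has_derivative D' x) (at x)" and lap: "\<And>x. 0 \<le> (\<Sum>i\<in>Basis. D' x i \<bullet> i)"
  shows "0 \<le> integral (cbox (- (2 *\<^sub>R One)) (2 *\<^sub>R One)) (\<lambda>z. max 0 (1 - (norm z)\<^sup>2) * (z \<bullet> D z))"
proof -
  let ?Q = "cbox (- (2 *\<^sub>R One)) (2 *\<^sub>R One) :: 'a set"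
  let ?p = "\<lambda>z :: 'a. max 0 (1 - (norm z)\<^sup>2)"
  have Dc: "continuous_on UNIV D"
    using has_derivative_continuous[OF D] by (simp add: continuous_on_eq_continuous_at)
  have "integral ?Q (\<lambda>z. - (4 * ?p z * (z \<bullet> D z))) \<le> 0"
  proof (rule divergence_lower_bound[of "\<lambda>z. (?p z)\<^sup>2 *\<^sub>R D z" "\<lambda>z v. (?p z)\<^sup>2 *\<^sub>R D' z v + (- (4 * ?p z * (z \<bullet> v))) *\<^sub>R D z"])
    show "((\<lambda>z. (?p z)\<^sup>2 *\<^sub>R D z) has_derivative (\<lambda>v. (?p z)\<^sup>2 *\<^sub>R D' z v + (- (4 * ?p z * (z \<bullet> v))) *\<^sub>R D z)) (at z)" for z
      by (rule has_derivative_scaleR[OF has_derivative_square_pos_part D])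
    show "continuous_on UNIV (\<lambda>z. - (4 * ?p z * (z \<bullet> D z)))" by (intro continuous_intros Dc)
    show "(?p z)\<^sup>2 *\<^sub>R D z = 0" if "z \<notin> cbox (- One) One" for z using pos_part_supp[OF that] by simp
    fix z
    have "(\<Sum>i\<in>Basis. ((?p z)\<^sup>2 *\<^sub>R D' z i + (- (4 * ?p z * (z \<bullet> i))) *\<^sub>R D z) \<bullet> i)
       = (?p z)\<^sup>2 * (\<Sum>i\<in>Basis. D' z i \<bullet> i) - 4 * ?p z * (\<Sum>i\<in>Basis. (z \<bullet> i) * (D z \<bullet> i))"
      by (simp only: inner_add_left inner_scaleR_left sum.distrib sum_distrib_left) (simp add: sum_negf[symmetric] mult_ac sum_distrib_left)
    also have "(\<Sum>i\<in>Basis. (z \<bullet> i) * (D z \<bullet> i)) = z \<bullet> D z" by (rule euclidean_inner[symmetric])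
    finally show "- (4 * ?p z * (z \<bullet> D z)) \<le> (\<Sum>i\<in>Basis. ((?p z)\<^sup>2 *\<^sub>R D' z i + (- (4 * ?p z * (z \<bullet> i))) *\<^sub>R D z) \<bullet> i)"
      using lap[of z] by simp
  qed
  also have "integral ?Q (\<lambda>z. - (4 * ?p z * (z \<bullet> D z))) = - 4 * integral ?Q (\<lambda>z. ?p z * (z \<bullet> D z))"
    by (simp only: integral_mult_right[symmetric]) (rule integral_cong, simp)
  finally show ?thesis by simp
qed

text \<open>The r-derivative of the weighted mean is the weighted integral of the inner product of y
  and D(x + r y). It is nonnegative by \<open>radial_derivative_nonneg\<close>, because y -> D(x + r
  y) has divergence r times that of D. The Leibniz rule meets only the continuous D and never
  D'.\<close>

lemma subharmonic_mean_value:
  fixes h :: "'a::euclidean_space \<Rightarrow> real" and D :: "'a \<Rightarrow> 'a"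
  assumes h: "\<And>x. (h has_derivative (\<lambda>v. D x \<bullet> v)) (at x)"
    and D: "\<And>x. (D has_derivative D' x) (at x)" and lap: "\<And>x. 0 \<le> (\<Sum>i\<in>Basis. D' x i \<bullet> i)"
    and r: "0 \<le> r"
  shows "integral (cbox (- (2 *\<^sub>R One)) (2 *\<^sub>R One)) (\<lambda>y :: 'a. max 0 (1 - (norm y)\<^sup>2) * h x)
     \<le> integral (cbox (- (2 *\<^sub>R One)) (2 *\<^sub>R One)) (\<lambda>y. max 0 (1 - (norm y)\<^sup>2) * h (x + r *\<^sub>R y))"
proof -
  let ?Q = "cbox (- (2 *\<^sub>R One)) (2 *\<^sub>R One) :: 'a set"
  let ?p = "\<lambda>z :: 'a. max 0 (1 - (norm z)\<^sup>2)"
  have hc: "continuous_on UNIV h"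
    using has_derivative_continuous[OF h] by (simp add: continuous_on_eq_continuous_at)
  have Dc: "continuous_on UNIV D"
    using has_derivative_continuous[OF D] by (simp add: continuous_on_eq_continuous_at)
  define S where "S = (\<lambda>r. integral ?Q (\<lambda>y. ?p y * h (x + r *\<^sub>R y)))"
  have "S 0 \<le> S r"
  proof (rule DERIV_nonneg_imp_nondecreasing[OF r])
    fix t :: real assume t: "0 \<le> t"
    have "((\<lambda>r. integral ?Q ((\<lambda>r y. ?p y * h (x + r *\<^sub>R y)) r)) has_field_derivative integral ?Q ((\<lambda>r y. ?p y * (D (x + r *\<^sub>R y) \<bullet> y)) t)) (at t within UNIV)"
    proof (rule leibniz_rule_field_derivative)
      fix r y
      have "((\<lambda>r. h (x + r *\<^sub>R y)) has_derivative (\<lambda>s. D (x + r *\<^sub>R y) \<bullet> (s *\<^sub>R y))) (at r)"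
        by (rule has_derivative_compose[OF _ h]) (auto intro!: derivative_eq_intros)
      then have "((\<lambda>r. h (x + r *\<^sub>R y)) has_real_derivative (D (x + r *\<^sub>R y) \<bullet> y)) (at r)"
        unfolding has_field_derivative_def by (rule has_derivative_eq_rhs) (auto simp: mult.commute)
      then show "((\<lambda>r. ?p y * h (x + r *\<^sub>R y)) has_real_derivative ?p y * (D (x + r *\<^sub>R y) \<bullet> y)) (at r within UNIV)"
        by (rule DERIV_cmult)
    next
      fix r
      show "(\<lambda>y. ?p y * h (x + r *\<^sub>R y)) integrable_on ?Q"
        by (intro integrable_continuous continuous_intros continuous_on_compose2[OF hc, of _ "\<lambda>y. x + r *\<^sub>R y"]) auto
      show "continuous_on (UNIV \<times> ?Q) (\<lambda>(r, y). ?p y * (D (x + r *\<^sub>R y) \<bullet> y))"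
        unfolding case_prod_beta
        by (intro continuous_intros continuous_on_compose2[OF Dc, of _ "\<lambda>z. x + fst z *\<^sub>R snd z"]) auto
    qed auto
    then have "(S has_real_derivative integral ?Q (\<lambda>y. ?p y * (D (x + t *\<^sub>R y) \<bullet> y))) (at t)"
      by (simp add: S_def)
    moreover have "0 \<le> integral ?Q (\<lambda>y. ?p y * (D (x + t *\<^sub>R y) \<bullet> y))"
    proof -
      have lin: "linear (D' z)" for z using D[of z] by (rule has_derivative_linear)
      have "0 \<le> integral ?Q (\<lambda>y. ?p y * (y \<bullet> D (x + t *\<^sub>R y)))"
      proof (rule radial_derivative_nonneg[of _ "\<lambda>y v. t *\<^sub>R D' (x + t *\<^sub>R y) v"])
        fix y
        have "((\<lambda>y. D (x + t *\<^sub>R y)) has_derivative (\<lambda>v. D' (x + t *\<^sub>R y) (t *\<^sub>R v))) (at y)"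
          by (rule has_derivative_compose[OF _ D]) (auto intro!: derivative_eq_intros)
        then show "((\<lambda>y. D (x + t *\<^sub>R y)) has_derivative (\<lambda>v. t *\<^sub>R D' (x + t *\<^sub>R y) v)) (at y)"
          by (simp add: linear_scale[OF lin])
        have "(\<Sum>i\<in>Basis. (t *\<^sub>R D' (x + t *\<^sub>R y) i) \<bullet> i) = t * (\<Sum>i\<in>Basis. D' (x + t *\<^sub>R y) i \<bullet> i)"
          by (simp add: sum_distrib_left)
        then show "0 \<le> (\<Sum>i\<in>Basis. (t *\<^sub>R D' (x + t *\<^sub>R y) i) \<bullet> i)" using lap t by simp
      qed
      then show ?thesis by (simp add: inner_commute)
    qed
    ultimately show "\<exists>d. (S has_real_derivative d) (at t) \<and> 0 \<le> d" by blast
  qed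
  then show ?thesis by (simp add: S_def)
qed

text \<open>The Gaussian is a mixture of the kernels \<open>(\<rho> - |y|\<^sup>2)\<^sub>+\<close>.\<close>

lemma exp_as_mixture:
  fixes t :: real
  assumes "0 \<le> t"
  shows "(\<integral>\<^sup>+ \<rho>. ennreal (exp (- \<rho> / 2) / 4) * ennreal (max 0 (\<rho> - t)) * indicator {0<..} \<rho> \<partial>lborel) = ennreal (exp (- t / 2))"
proof -
  have "(\<integral>\<^sup>+ \<rho>. ennreal (exp (- \<rho> / 2) / 4) * ennreal (max 0 (\<rho> - t)) * indicator {0<..} \<rho> \<partial>lborel)
     = ennreal 2 * (\<integral>\<^sup>+ s. ennreal (exp (- (t + 2 * s) / 2) / 4) * ennreal (max 0 ((t + 2 * s) - t)) * indicator {0<..} (t + 2 * s) \<partial>lborel)"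
    by (subst nn_integral_real_affine[where c = 2 and t = t]) auto
  \<comment> \<open>The substitution \<rho> = t + 2 s leaves the integral of s e^(-s) over s >= 0,
    which is 1.\<close>
  also have "\<dots> = ennreal 2 * (\<integral>\<^sup>+ s. ennreal (exp (- t / 2) / 2) * (ennreal (s ^ 1 * exp (- s)) * indicator {0..} s) \<partial>lborel)"
  proof (intro arg_cong[where f = "\<lambda>x. ennreal 2 * x"] nn_integral_cong)
    fix s :: real
    have "exp (- (t + 2 * s) / 2) = exp (- t / 2) * exp (- s)" by (simp add: exp_add[symmetric] field_simps)
    then show "ennreal (exp (- (t + 2 * s) / 2) / 4) * ennreal (max 0 ((t + 2 * s) - t)) * indicator {0<..} (t + 2 * s)
      = ennreal (exp (- t / 2) / 2) * (ennreal (s ^ 1 * exp (- s)) * indicator {0..} s)"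
      using assms by (cases "s > 0") (auto simp: ennreal_mult[symmetric] indicator_def max_def mult_ac)
  qed
  also have "\<dots> = ennreal 2 * (ennreal (exp (- t / 2) / 2) * (\<integral>\<^sup>+ s. ennreal (s ^ 1 * exp (- s)) * indicator {0..} s \<partial>lborel))"
    by (subst nn_integral_cmult) auto
  also have "\<dots> = ennreal (exp (- t / 2))"
    unfolding nn_intergal_power_times_exp_Ici
    by (subst ennreal_mult[symmetric], simp, simp, subst ennreal_mult[symmetric], simp, simp, simp)
  finally show ?thesis .
qed

text \<open>Scaling by sqrt \<rho> reduces both sides to the unit weight on the fixed cube with the
  same factors in front, the left-hand side being the case of dilation 0.\<close>

lemma subharmonic_kernel_nn:
  fixes h :: "real ^ 'n \<Rightarrow> real" and D :: "real ^ 'n \<Rightarrow> real ^ 'n"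
  assumes h: "\<And>x. (h has_derivative (\<lambda>v. D x \<bullet> v)) (at x)"
    and D: "\<And>x. (D has_derivative D' x) (at x)" and lap: "\<And>x. 0 \<le> (\<Sum>i\<in>Basis. D' x i \<bullet> i)"
    and pos: "\<And>x. 0 \<le> h x" and "0 < \<rho>" and s: "0 \<le> s"
  shows "(\<integral>\<^sup>+ y. ennreal (max 0 (\<rho> - (norm (y :: real ^ 'n))\<^sup>2)) * ennreal (h x) \<partial>lborel)
     \<le> (\<integral>\<^sup>+ y. ennreal (max 0 (\<rho> - (norm y)\<^sup>2)) * ennreal (h (x + s *\<^sub>R y)) \<partial>lborel)"
proof -
  let ?Q = "cbox (- (2 *\<^sub>R One)) (2 *\<^sub>R One) :: (real ^ 'n) set"
  let ?p = "\<lambda>z :: real ^ 'n. max 0 (1 - (norm z)\<^sup>2)"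
  have hc: "continuous_on UNIV h"
    using has_derivative_continuous[OF h] by (simp add: continuous_on_eq_continuous_at)
  have hm [measurable]: "h \<in> borel_measurable borel" using hc by (rule borel_measurable_continuous_onI)
  define c where "c = sqrt \<rho>"
  have c: "c > 0" "c\<^sup>2 = \<rho>" using assms(5) by (auto simp: c_def)
  have resc: "(\<integral>\<^sup>+ y. ennreal (max 0 (\<rho> - (norm y)\<^sup>2)) * ennreal (h (x + t *\<^sub>R y)) \<partial>lborel)
     = ennreal (c ^ CARD('n)) * (ennreal \<rho> * ennreal (integral ?Q (\<lambda>y. ?p y * h (x + (t * c) *\<^sub>R y))))" for t
  proof -
    have "(\<integral>\<^sup>+ y. ennreal (max 0 (\<rho> - (norm y)\<^sup>2)) * ennreal (h (x + t *\<^sub>R y)) \<partial>lborel)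
      = ennreal (\<bar>c\<bar> ^ CARD('n)) * (\<integral>\<^sup>+ y. ennreal (max 0 (\<rho> - (norm (0 + c *\<^sub>R y))\<^sup>2)) * ennreal (h (x + t *\<^sub>R (0 + c *\<^sub>R y))) \<partial>lborel)"
      using c by (intro nn_integral_lborel_scale) auto
    also have "(\<integral>\<^sup>+ y. ennreal (max 0 (\<rho> - (norm (0 + c *\<^sub>R y))\<^sup>2)) * ennreal (h (x + t *\<^sub>R (0 + c *\<^sub>R y))) \<partial>lborel)
      = (\<integral>\<^sup>+ y. ennreal \<rho> * (ennreal (?p y * h (x + (t * c) *\<^sub>R y)) * indicator ?Q y) \<partial>lborel)"
    proof (intro nn_integral_cong)
      fix y :: "real ^ 'n"
      have "max 0 (\<rho> - (norm (0 + c *\<^sub>R y))\<^sup>2) = \<rho> * ?p y"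
        using assms(5) c by (auto simp: power_mult_distrib max_def algebra_simps)
      moreover have "?p y = 0" if "y \<notin> ?Q"
      proof (rule pos_part_supp)
        have "cbox (- One) One \<subseteq> ?Q" by (auto simp: subset_box inner_minus_left)
        then show "y \<notin> cbox (- One) One" using that by auto
      qed
      ultimately show "ennreal (max 0 (\<rho> - (norm (0 + c *\<^sub>R y))\<^sup>2)) * ennreal (h (x + t *\<^sub>R (0 + c *\<^sub>R y)))
        = ennreal \<rho> * (ennreal (?p y * h (x + (t * c) *\<^sub>R y)) * indicator ?Q y)"
        using assms(5) pos by (cases "y \<in> ?Q") (auto simp: ennreal_mult[symmetric] mult_ac)
    qed
    also have "\<dots> = ennreal \<rho> * (\<integral>\<^sup>+ y. ennreal (?p y * h (x + (t * c) *\<^sub>R y)) * indicator ?Q y \<partial>lborel)"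
      by (subst nn_integral_cmult) auto
    also have "(\<integral>\<^sup>+ y. ennreal (?p y * h (x + (t * c) *\<^sub>R y)) * indicator ?Q y \<partial>lborel)
      = ennreal (integral ?Q (\<lambda>y. ?p y * h (x + (t * c) *\<^sub>R y)))"
    proof -
      have "continuous_on ?Q (\<lambda>y. ?p y * h (x + (t * c) *\<^sub>R y))"
        by (intro continuous_intros continuous_on_compose2[OF hc, of _ "\<lambda>y. x + (t * c) *\<^sub>R y"]) auto
      then have "(\<lambda>y. ?p y * h (x + (t * c) *\<^sub>R y)) integrable_on ?Q" by (rule integrable_continuous)
      then have "((\<lambda>y. ?p y * h (x + (t * c) *\<^sub>R y)) has_integral integral ?Q (\<lambda>y. ?p y * h (x + (t * c) *\<^sub>R y))) ?Q"
        by (rule integrable_integral)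
      then show ?thesis
        by (rule nn_integral_has_integral_lebesgue'[rotated]) (use pos in auto)
    qed
    finally show ?thesis using c by simp
  qed
  have "integral ?Q (\<lambda>y. ?p y * h x) \<le> integral ?Q (\<lambda>y. ?p y * h (x + (s * c) *\<^sub>R y))"
    using s c by (intro subharmonic_mean_value[OF h D lap]) auto
  then show ?thesis using resc[of 0] resc[of s]
    by (simp add: ennreal_leI mult_left_mono)
qed

text \<open>The Gaussian is written as a mixture of kernels and the inequality holds kernel by
  kernel. Since h >= 0, the exchange of integrals asks for no integrability. The same representation
  with s = 0 gives back h(x).\<close>

lemma subharmonic_le_gauss_average:
  fixes h :: "real ^ 'n \<Rightarrow> real" and D :: "real ^ 'n \<Rightarrow> real ^ 'n"
  assumes h: "\<And>x. (h has_derivative (\<lambda>v. D x \<bullet> v)) (at x)"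
    and D: "\<And>x. (D has_derivative D' x) (at x)" and lap: "\<And>x. 0 \<le> (\<Sum>i\<in>Basis. D' x i \<bullet> i)"
    and pos: "\<And>x. 0 \<le> h x" and s: "0 \<le> s"
  shows "ennreal (h x) \<le> (\<integral>\<^sup>+ y. ennreal (h (x + s *\<^sub>R y)) \<partial>gauss_measure)"
proof -
  have hc: "continuous_on UNIV h"
    using has_derivative_continuous[OF h] by (simp add: continuous_on_eq_continuous_at)
  have hm [measurable]: "h \<in> borel_measurable borel" using hc by (rule borel_measurable_continuous_onI)
  define K where "K = (2 * pi) powr (- real CARD('n) / 2)"
  have K: "K \<ge> 0" by (simp add: K_def)
  let ?m = "\<lambda>\<rho> :: real. ennreal (exp (- \<rho> / 2) / 4) * indicator {0<..} \<rho>"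
  have rep: "(\<integral>\<^sup>+ y. ennreal (h (x + t *\<^sub>R y)) \<partial>gauss_measure)
    = ennreal K * (\<integral>\<^sup>+ \<rho>. ?m \<rho> * (\<integral>\<^sup>+ y. ennreal (max 0 (\<rho> - (norm y)\<^sup>2)) * ennreal (h (x + t *\<^sub>R y)) \<partial>lborel) \<partial>lborel)" for t
  proof -
    have "(\<integral>\<^sup>+ y. ennreal (h (x + t *\<^sub>R y)) \<partial>gauss_measure)
      = (\<integral>\<^sup>+ y. ennreal K * (ennreal (exp (- (norm y)\<^sup>2 / 2)) * ennreal (h (x + t *\<^sub>R y))) \<partial>lborel)"
      by (subst nn_integral_gauss_measure) (auto simp: gauss_def K_def ennreal_mult mult.assoc)
    also have "\<dots> = ennreal K * (\<integral>\<^sup>+ y. ennreal (exp (- (norm y)\<^sup>2 / 2)) * ennreal (h (x + t *\<^sub>R y)) \<partial>lborel)"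
      by (subst nn_integral_cmult) auto
    also have "(\<integral>\<^sup>+ y. ennreal (exp (- (norm y)\<^sup>2 / 2)) * ennreal (h (x + t *\<^sub>R y)) \<partial>lborel)
      = (\<integral>\<^sup>+ y. (\<integral>\<^sup>+ \<rho>. ?m \<rho> * (ennreal (max 0 (\<rho> - (norm y)\<^sup>2)) * ennreal (h (x + t *\<^sub>R y))) \<partial>lborel) \<partial>lborel)"
    proof (intro nn_integral_cong)
      fix y :: "real ^ 'n"
      have "ennreal (exp (- (norm y)\<^sup>2 / 2)) * ennreal (h (x + t *\<^sub>R y))
        = (\<integral>\<^sup>+ \<rho>. ennreal (exp (- \<rho> / 2) / 4) * ennreal (max 0 (\<rho> - (norm y)\<^sup>2)) * indicator {0<..} \<rho> \<partial>lborel) * ennreal (h (x + t *\<^sub>R y))"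
        by (subst exp_as_mixture) auto
      also have "\<dots> = (\<integral>\<^sup>+ \<rho>. ?m \<rho> * (ennreal (max 0 (\<rho> - (norm y)\<^sup>2)) * ennreal (h (x + t *\<^sub>R y))) \<partial>lborel)"
        by (subst nn_integral_multc[symmetric]) (auto simp: mult_ac intro!: nn_integral_cong)
      finally show "ennreal (exp (- (norm y)\<^sup>2 / 2)) * ennreal (h (x + t *\<^sub>R y)) = \<dots>" .
    qed
    also have "\<dots> = (\<integral>\<^sup>+ \<rho>. (\<integral>\<^sup>+ y. ?m \<rho> * (ennreal (max 0 (\<rho> - (norm y)\<^sup>2)) * ennreal (h (x + t *\<^sub>R y))) \<partial>lborel) \<partial>lborel)"
      by (intro lborel_pair.Fubini') measurable
    also have "\<dots> = (\<integral>\<^sup>+ \<rho>. ?m \<rho> * (\<integral>\<^sup>+ y. ennreal (max 0 (\<rho> - (norm y)\<^sup>2)) * ennreal (h (x + t *\<^sub>R y)) \<partial>lborel) \<partial>lborel)"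
      by (intro nn_integral_cong nn_integral_cmult) measurable
    finally show ?thesis .
  qed
  have "ennreal (h x) = (\<integral>\<^sup>+ y. ennreal (h (x + 0 *\<^sub>R y)) \<partial>(gauss_measure :: (real ^ 'n) measure))" by simp
  also have "\<dots> \<le> (\<integral>\<^sup>+ y. ennreal (h (x + s *\<^sub>R y)) \<partial>gauss_measure)"
    unfolding rep
  proof (rule mult_left_mono[OF nn_integral_mono])
    fix \<rho> :: real
    show "?m \<rho> * (\<integral>\<^sup>+ y. ennreal (max 0 (\<rho> - (norm y)\<^sup>2)) * ennreal (h (x + 0 *\<^sub>R y)) \<partial>lborel)
      \<le> ?m \<rho> * (\<integral>\<^sup>+ y. ennreal (max 0 (\<rho> - (norm y)\<^sup>2)) * ennreal (h (x + s *\<^sub>R y)) \<partial>lborel)"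
    proof (cases "\<rho> > 0")
      case True
      from subharmonic_kernel_nn[OF h D lap pos True s, of x] show ?thesis by (intro mult_left_mono) auto
    qed simp
  qed simp
  finally show ?thesis .
qed

text \<open>The Laplacian of exp(e L) is e exp(e L) times the sum of the Laplacian of L and e |D|^2,
  hence nonnegative for every e >= 0.\<close>

lemma log_subharmonic_powr_le_gauss_average:
  fixes L :: "real ^ 'n \<Rightarrow> real" and D :: "real ^ 'n \<Rightarrow> real ^ 'n"
  assumes L: "\<And>x. (L has_derivative (\<lambda>v. D x \<bullet> v)) (at x)"
    and D: "\<And>x. (D has_derivative D' x) (at x)" and lap: "\<And>x. 0 \<le> (\<Sum>i\<in>Basis. D' x i \<bullet> i)"
    and s: "0 \<le> s" and e: "0 \<le> e"
  shows "ennreal (exp (e * L x)) \<le> (\<integral>\<^sup>+ y. ennreal (exp (e * L (x + s *\<^sub>R y))) \<partial>gauss_measure)"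
proof (rule subharmonic_le_gauss_average[where D = "\<lambda>x. (e * exp (e * L x)) *\<^sub>R D x"
      and D' = "\<lambda>x v. (e * exp (e * L x)) *\<^sub>R D' x v + (e * (exp (e * L x) * (e * (D x \<bullet> v)))) *\<^sub>R D x", OF _ _ _ _ s])
  fix x
  have E: "((\<lambda>x. exp (e * L x)) has_derivative (\<lambda>v. exp (e * L x) * (e * (D x \<bullet> v)))) (at x)"
    by (auto intro!: derivative_eq_intros L)
  then show "((\<lambda>x. exp (e * L x)) has_derivative (\<lambda>v. (e * exp (e * L x)) *\<^sub>R D x \<bullet> v)) (at x)"
    by (rule has_derivative_eq_rhs) (auto simp: mult_ac)
  show "((\<lambda>x. (e * exp (e * L x)) *\<^sub>R D x) has_derivative
     (\<lambda>v. (e * exp (e * L x)) *\<^sub>R D' x v + (e * (exp (e * L x) * (e * (D x \<bullet> v)))) *\<^sub>R D x)) (at x)"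
    by (intro has_derivative_scaleR D has_derivative_mult_right E)
  have "(\<Sum>i\<in>Basis. ((e * exp (e * L x)) *\<^sub>R D' x i + (e * (exp (e * L x) * (e * (D x \<bullet> i)))) *\<^sub>R D x) \<bullet> i)
     = (e * exp (e * L x)) * (\<Sum>i\<in>Basis. D' x i \<bullet> i) + (e * exp (e * L x) * e) * (\<Sum>i\<in>Basis. (D x \<bullet> i) * (D x \<bullet> i))"
    by (simp only: inner_add_left inner_scaleR_left sum.distrib sum_distrib_left) (simp add: mult_ac)
  also have "\<dots> \<ge> 0"
  proof (intro add_nonneg_nonneg mult_nonneg_nonneg lap)
    show "0 \<le> (\<Sum>i\<in>Basis. (D x \<bullet> i) * (D x \<bullet> i))" by (rule sum_nonneg) (rule zero_le_square)
  qed (use e in auto)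
  finally show "0 \<le> (\<Sum>i\<in>Basis. ((e * exp (e * L x)) *\<^sub>R D' x i + (e * (exp (e * L x) * (e * (D x \<bullet> i)))) *\<^sub>R D x) \<bullet> i)" .
qed auto

section \<open>Prekopa's theorem\<close>

text \<open>Segments [x, x'] in A and [y, y'] in B combine to a segment in C of length (1 - l)(x' -
  x) + l (y' - y). Suprema and infima over the four endpoints, taken one at a time, replace these
  lengths by those of A and B.\<close>

lemma interval_brunn_minkowski:
  fixes A B C :: "real set"
  assumes A: "A \<noteq> {}" "convex A" and B: "B \<noteq> {}" "convex B" and C: "C \<in> sets borel" and l: "0 < l" "l < 1"
    and sub: "\<And>s t. s \<in> A \<Longrightarrow> t \<in> B \<Longrightarrow> (1 - l) * s + l * t \<in> C"
  shows "ennreal (1 - l) * emeasure lborel A + ennreal l * emeasure lborel B \<le> emeasure lborel C"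
proof (cases "emeasure lborel C")
  case top
  then show ?thesis by simp
next
  case (real M)
  have seg: "x + \<theta> * (x' - x) \<in> S" if "convex S" "x \<in> S" "x' \<in> S" "0 \<le> \<theta>" "\<theta> \<le> 1" for S and x x' \<theta> :: real
    using convexD[OF that(1,2,3), of "1 - \<theta>" \<theta>] that(4,5) by (simp add: algebra_simps)
  have ordered: "(1 - l) * (x' - x) + l * (y' - y) \<le> M"
    if x: "x \<in> A" "x' \<in> A" "x \<le> x'" and y: "y \<in> B" "y' \<in> B" "y \<le> y'" for x x' y y'
  proof -
    let ?a = "(1 - l) * x + l * y" and ?b = "(1 - l) * x' + l * y'"
    have "?a \<le> ?b" using l x y by (intro add_mono mult_left_mono) auto
    have "{?a..?b} \<subseteq> C"
    proof
      fix z assume z: "z \<in> {?a..?b}"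
      obtain \<theta> where th: "0 \<le> \<theta>" "\<theta> \<le> 1" "z = ?a + \<theta> * (?b - ?a)"
      proof (cases "?a = ?b")
        case True
        then show ?thesis using z that[of 0] by auto
      next
        case False
        then have "?b - ?a > 0" using \<open>?a \<le> ?b\<close> by linarith
        then show ?thesis using z that[of "(z - ?a) / (?b - ?a)"] by auto
      qed
      have "z = (1 - l) * (x + \<theta> * (x' - x)) + l * (y + \<theta> * (y' - y))" unfolding th(3) by (simp add: algebra_simps)
      then show "z \<in> C" using sub[OF seg[OF A(2) x(1,2) th(1,2)] seg[OF B(2) y(1,2) th(1,2)]] by simp
    qed
    then have "emeasure lborel {?a..?b} \<le> emeasure lborel C" using C by (intro emeasure_mono) auto
    then have "ennreal (?b - ?a) \<le> ennreal M" using \<open>?a \<le> ?b\<close> real by simp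
    then have "?b - ?a \<le> M" using real by (simp add: ennreal_le_iff)
    then show ?thesis by (simp add: algebra_simps)
  qed
  \<comment> \<open>Sorting endpoints that are in the wrong order only increases the left-hand
    side.\<close>
  have gen: "(1 - l) * (x' - x) + l * (y' - y) \<le> M" if x: "x \<in> A" "x' \<in> A" and y: "y \<in> B" "y' \<in> B" for x x' y y'
  proof -
    have "(1 - l) * (x' - x) + l * (y' - y) \<le> (1 - l) * (max x x' - min x x') + l * (max y y' - min y y')"
      using l by (intro add_mono mult_left_mono) auto
    also have "\<dots> \<le> M" by (rule ordered) (use x y in \<open>auto simp: max_def min_def\<close>)
    finally show ?thesis .
  qed
  obtain a0 b0 where a0: "a0 \<in> A" and b0: "b0 \<in> B" using A B by auto
  \<comment> \<open>Finite measure of C forces A and B to be bounded, so that \<open>Sup\<close> and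
    \<open>Inf\<close> are meaningful.\<close>
  have bdA: "bdd_above A" "bdd_below A"
  proof -
    have "(1 - l) * \<bar>x - a0\<bar> \<le> M" if "x \<in> A" for x
      using gen[OF that a0 b0 b0] gen[OF a0 that b0 b0] by (auto simp: abs_real_def)
    then have *: "\<bar>x - a0\<bar> \<le> M / (1 - l)" if "x \<in> A" for x using that l by (simp add: field_simps)
    have "x \<le> a0 + M / (1 - l)" if "x \<in> A" for x using abs_le_D1[OF *[OF that]] by linarith
    then show "bdd_above A" by (rule bdd_aboveI)
    have "a0 - M / (1 - l) \<le> x" if "x \<in> A" for x using abs_le_D2[OF *[OF that]] by linarith
    then show "bdd_below A" by (rule bdd_belowI)
  qed
  have bdB: "bdd_above B" "bdd_below B"
  proof -
    have "l * \<bar>y - b0\<bar> \<le> M" if "y \<in> B" for y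
      using gen[OF a0 a0 that b0] gen[OF a0 a0 b0 that] by (auto simp: abs_real_def)
    then have *: "\<bar>y - b0\<bar> \<le> M / l" if "y \<in> B" for y using that l by (simp add: field_simps)
    have "x \<le> b0 + M / l" if "x \<in> B" for x using abs_le_D1[OF *[OF that]] by linarith
    then show "bdd_above B" by (rule bdd_aboveI)
    have "b0 - M / l \<le> x" if "x \<in> B" for x using abs_le_D2[OF *[OF that]] by linarith
    then show "bdd_below B" by (rule bdd_belowI)
  qed
  have s1: "(1 - l) * (Sup A - x) + l * (y' - y) \<le> M" if "x \<in> A" "y \<in> B" "y' \<in> B" for x y y'
  proof -
    have "Sup A \<le> x + (M - l * (y' - y)) / (1 - l)"
    proof (rule cSup_least[OF A(1)])
      fix x' assume "x' \<in> A"
      from gen[OF that(1) this that(2,3)] show "x' \<le> x + (M - l * (y' - y)) / (1 - l)" using l by (simp add: field_simps)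
    qed
    then show ?thesis using l by (simp add: field_simps)
  qed
  have s2: "(1 - l) * (Sup A - Inf A) + l * (y' - y) \<le> M" if "y \<in> B" "y' \<in> B" for y y'
  proof -
    have "Sup A - (M - l * (y' - y)) / (1 - l) \<le> Inf A"
    proof (rule cInf_greatest[OF A(1)])
      fix x assume "x \<in> A"
      from s1[OF this that] show "Sup A - (M - l * (y' - y)) / (1 - l) \<le> x" using l by (simp add: field_simps)
    qed
    then show ?thesis using l by (simp add: field_simps)
  qed
  have s3: "(1 - l) * (Sup A - Inf A) + l * (Sup B - y) \<le> M" if "y \<in> B" for y
  proof -
    have "Sup B \<le> y + (M - (1 - l) * (Sup A - Inf A)) / l"
    proof (rule cSup_least[OF B(1)])
      fix y' assume "y' \<in> B"
      from s2[OF that this] show "y' \<le> y + (M - (1 - l) * (Sup A - Inf A)) / l" using l by (simp add: field_simps)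
    qed
    then show ?thesis using l by (simp add: field_simps)
  qed
  have s4: "(1 - l) * (Sup A - Inf A) + l * (Sup B - Inf B) \<le> M"
  proof -
    have "Sup B - (M - (1 - l) * (Sup A - Inf A)) / l \<le> Inf B"
    proof (rule cInf_greatest[OF B(1)])
      fix y assume "y \<in> B"
      from s3[OF this] show "Sup B - (M - (1 - l) * (Sup A - Inf A)) / l \<le> y" using l by (simp add: field_simps)
    qed
    then show ?thesis using l by (simp add: field_simps)
  qed
  have em: "emeasure lborel S \<le> ennreal (Sup S - Inf S)" "Inf S \<le> Sup S" if "S \<noteq> {}" "bdd_above S" "bdd_below S" for S :: "real set"
  proof -
    have s: "S \<subseteq> {Inf S..Sup S}" using that by (auto intro: cSup_upper cInf_lower)
    then show "Inf S \<le> Sup S" using that(1) by force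
    then show "emeasure lborel S \<le> ennreal (Sup S - Inf S)" using emeasure_mono[OF s, of lborel] by simp
  qed
  have "ennreal (1 - l) * emeasure lborel A + ennreal l * emeasure lborel B
     \<le> ennreal (1 - l) * ennreal (Sup A - Inf A) + ennreal l * ennreal (Sup B - Inf B)"
    by (intro add_mono mult_left_mono em A(1) B(1) bdA bdB) auto
  also have "\<dots> = ennreal ((1 - l) * (Sup A - Inf A) + l * (Sup B - Inf B))"
    using l em(2)[OF A(1) bdA] em(2)[OF B(1) bdB] by (simp add: ennreal_mult[symmetric] ennreal_plus[symmetric] del: ennreal_plus)
  also have "\<dots> \<le> ennreal M" using s4 by (rule ennreal_leI)
  finally show ?thesis using real by simp
qed

lemma nn_integral_layer_cake:
  fixes f :: "real \<Rightarrow> ennreal"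
  assumes [measurable]: "f \<in> borel_measurable borel"
  shows "(\<integral>\<^sup>+ x. f x \<partial>lborel) = (\<integral>\<^sup>+ c. indicator {0<..} c * emeasure lborel {x. ennreal c < f x} \<partial>lborel)"
proof -
  have lc: "y = (\<integral>\<^sup>+ c. indicator {0<..} c * indicator {c. ennreal c < y} c \<partial>lborel)" for y :: ennreal
  proof (cases y)
    case (real r)
    have "(\<integral>\<^sup>+ c. indicator {0<..} c * indicator {c. ennreal c < y} c \<partial>lborel) = (\<integral>\<^sup>+ c. indicator {0<..<r} c \<partial>lborel)"
      using real by (intro nn_integral_cong) (auto simp: indicator_def ennreal_less_iff)
    then show ?thesis using real by simp
  next
    case top
    have "(\<integral>\<^sup>+ c. indicator {0<..} c * indicator {c. ennreal c < y} c \<partial>lborel) = (\<integral>\<^sup>+ c. indicator {0 :: real<..} c \<partial>lborel)"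
      using top by (intro nn_integral_cong) (auto simp: indicator_def)
    also have "\<dots> = emeasure lborel {0 :: real<..}" by simp
    also have "\<dots> = \<infinity>"
    proof -
      have le: "ennreal (real n) \<le> emeasure lborel {0 :: real<..}" for n
      proof -
        have "emeasure lborel {0<..<real n} \<le> emeasure lborel {0 :: real<..}" by (rule emeasure_mono) auto
        then show ?thesis by simp
      qed
      show ?thesis
      proof (cases "emeasure lborel {0 :: real<..}")
        case (real r)
        obtain n where "r < real n" using reals_Archimedean2 by blast
        then show ?thesis using le[of n] real by simp
      qed simp
    qed
    finally show ?thesis using top by simp
  qed
  have "(\<integral>\<^sup>+ x. f x \<partial>lborel) = (\<integral>\<^sup>+ x. \<integral>\<^sup>+ c. indicator {0<..} c * indicator {c. ennreal c < f x} c \<partial>lborel \<partial>lborel)"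
    by (subst lc) simp
  also have "\<dots> = (\<integral>\<^sup>+ c. \<integral>\<^sup>+ x. indicator {0<..} c * indicator {x. ennreal c < f x} x \<partial>lborel \<partial>lborel)"
    by (subst lborel_pair.Fubini') (auto intro!: nn_integral_cong simp: indicator_def split: prod.split)
  also have "\<dots> = (\<integral>\<^sup>+ c. indicator {0<..} c * emeasure lborel {x. ennreal c < f x} \<partial>lborel)"
    by (intro nn_integral_cong) (simp add: nn_integral_cmult)
  finally show ?thesis .
qed

text \<open>Superlevel sets are intervals. This gives the measurability of one-dimensional sections
  of log-concave functions.\<close>

lemma quasi_concave_measurable:
  fixes f :: "real \<Rightarrow> ennreal"
  assumes "\<And>c. convex {x. c < f x}"
  shows "f \<in> borel_measurable borel"
  by (rule borel_measurableI_greater)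
    (use assms in \<open>auto intro!: real_interval_borel_measurable simp: is_interval_convex_1\<close>)

lemma epowr_strict_mono_le:
  assumes "0 < l" "c < y"
  shows "c epowr l < y epowr l"
proof (rule ccontr)
  assume "\<not> c epowr l < y epowr l"
  then have "(y epowr l) epowr (1 / l) \<le> (c epowr l) epowr (1 / l)" using assms by (intro epowr_mono[of "1 / l"]) auto
  then show False using assms by (simp add: epowr_epowr)
qed

lemma zero_epowr: "0 < r \<Longrightarrow> 0 epowr r = 0"
  by (simp add: ennreal_powr_def)

lemma mult_strict_mono_ennreal:
  fixes a b c d :: ennreal
  assumes "a < b" "c < d"
  shows "a * c < b * d"
  using assms by (cases a; cases b; cases c; cases d)
    (auto simp: ennreal_mult[symmetric] ennreal_less_iff ennreal_mult_top ennreal_top_mult intro: mult_strict_mono')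

lemma epowr_split: "0 < l \<Longrightarrow> l < 1 \<Longrightarrow> c epowr (1 - l) * c epowr l = c"
  by (cases c) (auto simp: ennreal_powr_def ennreal_mult[symmetric] powr_add[symmetric] ennreal_mult_top)

text \<open>With both suprema equal to 1, the superlevel sets of f and of g are nonempty for the
  same levels c < 1, so \<open>interval_brunn_minkowski\<close> applies level by level. The
  normalization yields an arithmetic mean on the left, which dominates the geometric one.\<close>

lemma prekopa_leindler_sup_1:
  fixes f g h :: "real \<Rightarrow> ennreal"
  assumes f: "\<And>c. convex {x. c < f x}" "(SUP x. f x) = 1" and g: "\<And>c. convex {x. c < g x}" "(SUP x. g x) = 1"
    and h: "h \<in> borel_measurable borel" and l: "0 < l" "l < 1"
    and le: "\<And>s t. f s epowr (1 - l) * g t epowr l \<le> h ((1 - l) * s + l * t)"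
  shows "ennreal (1 - l) * (\<integral>\<^sup>+ x. f x \<partial>lborel) + ennreal l * (\<integral>\<^sup>+ x. g x \<partial>lborel) \<le> (\<integral>\<^sup>+ x. h x \<partial>lborel)"
proof -
  have [measurable]: "f \<in> borel_measurable borel" "g \<in> borel_measurable borel" "h \<in> borel_measurable borel"
    using quasi_concave_measurable f(1) g(1) h by auto
  have meas: "(\<lambda>c. emeasure lborel {x. ennreal c < k x}) \<in> borel_measurable borel" if "k \<in> borel_measurable borel" for k :: "real \<Rightarrow> ennreal"
  proof -
    have [measurable]: "k \<in> borel_measurable borel" by (rule that)
    have "(\<lambda>c. \<integral>\<^sup>+ x. (if ennreal c < k x then 1 else 0) \<partial>lborel) \<in> borel_measurable borel"
      by (rule lborel.borel_measurable_nn_integral) measurable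
    also have "(\<lambda>c. \<integral>\<^sup>+ x. (if ennreal c < k x then 1 else 0) \<partial>lborel) = (\<lambda>c. emeasure lborel {x. ennreal c < k x})"
    proof
      fix c :: real
      have "(\<integral>\<^sup>+ x. (if ennreal c < k x then 1 else 0) \<partial>lborel) = (\<integral>\<^sup>+ x. indicator {x. ennreal c < k x} x \<partial>lborel)"
        by (intro nn_integral_cong) (auto simp: indicator_def)
      then show "(\<integral>\<^sup>+ x. (if ennreal c < k x then 1 else 0) \<partial>lborel) = emeasure lborel {x. ennreal c < k x}" by simp
    qed
    finally show ?thesis .
  qed
  have "ennreal (1 - l) * (\<integral>\<^sup>+ x. f x \<partial>lborel) + ennreal l * (\<integral>\<^sup>+ x. g x \<partial>lborel)
     = (\<integral>\<^sup>+ c. ennreal (1 - l) * (indicator {0<..} c * emeasure lborel {x. ennreal c < f x})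
              + ennreal l * (indicator {0<..} c * emeasure lborel {x. ennreal c < g x}) \<partial>lborel)"
    unfolding nn_integral_layer_cake[OF \<open>f \<in> borel_measurable borel\<close>] nn_integral_layer_cake[OF \<open>g \<in> borel_measurable borel\<close>]
    by (simp add: nn_integral_add nn_integral_cmult meas)
  also have "\<dots> \<le> (\<integral>\<^sup>+ c. indicator {0<..} c * emeasure lborel {x. ennreal c < h x} \<partial>lborel)"
  proof (intro nn_integral_mono)
    fix c :: real
    show "ennreal (1 - l) * (indicator {0<..} c * emeasure lborel {x. ennreal c < f x})
              + ennreal l * (indicator {0<..} c * emeasure lborel {x. ennreal c < g x})
       \<le> indicator {0<..} c * emeasure lborel {x. ennreal c < h x}"
    proof (cases "0 < c")
      case True
      have "ennreal (1 - l) * emeasure lborel {x. ennreal c < f x} + ennreal l * emeasure lborel {x. ennreal c < g x}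
         \<le> emeasure lborel {x. ennreal c < h x}"
      proof (cases "c < 1")
        case c1: True
        show ?thesis
        proof (rule interval_brunn_minkowski[OF _ f(1) _ g(1) _ l])
          have c1': "ennreal c < 1" using c1 True by (simp add: ennreal_less_one_iff)
          show "{x. ennreal c < f x} \<noteq> {}" using c1' unfolding f(2)[symmetric] less_SUP_iff by auto
          show "{x. ennreal c < g x} \<noteq> {}" using c1' unfolding g(2)[symmetric] less_SUP_iff by auto
          fix s t assume s: "s \<in> {x. ennreal c < f x}" and t: "t \<in> {x. ennreal c < g x}"
          have "ennreal c = ennreal c epowr (1 - l) * ennreal c epowr l" using l by (simp add: epowr_split)
          also have "\<dots> < f s epowr (1 - l) * g t epowr l"
            using s t l by (intro mult_strict_mono_ennreal epowr_strict_mono_le) auto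
          also have "\<dots> \<le> h ((1 - l) * s + l * t)" by (rule le)
          finally show "(1 - l) * s + l * t \<in> {x. ennreal c < h x}" by simp
        qed measurable
      next
        case False
        have "k x \<le> ennreal c" if k: "(SUP x. k x) = 1" for k :: "real \<Rightarrow> ennreal" and x
        proof -
          have "k x \<le> (SUP x. k x)" by (rule SUP_upper) simp
          also have "\<dots> \<le> ennreal c" unfolding k using False ennreal_leI[of 1 c] by simp
          finally show ?thesis .
        qed
        then have "{x. ennreal c < f x} = {}" "{x. ennreal c < g x} = {}" using f(2) g(2) by (auto simp: not_less)
        then show ?thesis by simp
      qed
      then show ?thesis using True by simp
    qed simp
  qed
  also have "\<dots> = (\<integral>\<^sup>+ x. h x \<partial>lborel)" by (rule nn_integral_layer_cake[symmetric]) simp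
  finally show ?thesis .
qed

lemma epowr_weighted_am_gm:
  assumes l: "0 < l" "l < 1"
  shows "x epowr (1 - l) * y epowr l \<le> ennreal (1 - l) * x + ennreal l * y"
proof (cases "x = 0 \<or> y = 0 \<or> x = \<infinity> \<or> y = \<infinity>")
  case True
  then show ?thesis using l by (auto simp: ennreal_powr_def ennreal_mult_top)
next
  case False
  then obtain a b where ab: "x = ennreal a" "y = ennreal b" "a > 0" "b > 0"
    by (cases x; cases y) (auto simp: less_le)
  have "a powr (1 - l) * b powr l \<le> (1 - l) * a + l * b" using l ab by (intro Youngs_inequality_0) auto
  then show ?thesis using ab l by (simp add: epowr_ennreal ennreal_mult[symmetric] ennreal_plus[symmetric] ennreal_leI del: ennreal_plus)
qed

text \<open>By homogeneity f and g are divided by their suprema a and b, and h by a^(1 - l) b^l. The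
  bound M keeps a and b finite; if one of them is 0, the left-hand side vanishes.\<close>

lemma prekopa_leindler_bounded:
  fixes f g h :: "real \<Rightarrow> ennreal"
  assumes f: "\<And>c. convex {x. c < f x}" "\<And>x. f x \<le> ennreal M" and g: "\<And>c. convex {x. c < g x}" "\<And>x. g x \<le> ennreal M"
    and h: "h \<in> borel_measurable borel" and l: "0 < l" "l < 1"
    and le: "\<And>s t. f s epowr (1 - l) * g t epowr l \<le> h ((1 - l) * s + l * t)"
  shows "(\<integral>\<^sup>+ x. f x \<partial>lborel) epowr (1 - l) * (\<integral>\<^sup>+ x. g x \<partial>lborel) epowr l \<le> (\<integral>\<^sup>+ x. h x \<partial>lborel)"
proof -
  have [measurable]: "f \<in> borel_measurable borel" "g \<in> borel_measurable borel" "h \<in> borel_measurable borel"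
    using quasi_concave_measurable f(1) g(1) h by auto
  have fin: "(SUP x. f x) < \<infinity>" "(SUP x. g x) < \<infinity>"
    using f(2) g(2) by (auto intro!: le_less_trans[OF SUP_least])
  show ?thesis
  proof (cases "(SUP x. f x) = 0 \<or> (SUP x. g x) = 0")
    case True
    then consider "f = (\<lambda>_. 0)" | "g = (\<lambda>_. 0)"
      by (auto simp: fun_eq_iff bot_ennreal[symmetric] SUP_bot_conv)
    then show ?thesis using l by cases (auto simp: zero_epowr)
  next
    case False
    obtain a b where ab: "(SUP x. f x) = ennreal a" "(SUP x. g x) = ennreal b" "a > 0" "b > 0"
      using fin False by (cases "SUP x. f x"; cases "SUP x. g x") (auto simp: less_le)
    have scale: "(ennreal c * y < z) = (y < ennreal (1 / c) * z)" if "c > 0" for c :: real and y z :: ennreal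
      using that by (cases y; cases z) (auto simp: ennreal_mult[symmetric] ennreal_less_iff ennreal_mult_top field_simps)
    define f' where "f' = (\<lambda>x. ennreal (1 / a) * f x)"
    define g' where "g' = (\<lambda>x. ennreal (1 / b) * g x)"
    define k where "k = a powr (1 - l) * b powr l"
    have k: "k > 0" using ab by (simp add: k_def)
    define h' where "h' = (\<lambda>x. ennreal (1 / k) * h x)"
    have "ennreal (1 - l) * (\<integral>\<^sup>+ x. f' x \<partial>lborel) + ennreal l * (\<integral>\<^sup>+ x. g' x \<partial>lborel) \<le> (\<integral>\<^sup>+ x. h' x \<partial>lborel)"
    proof (rule prekopa_leindler_sup_1[OF _ _ _ _ _ l])
      show "convex {x. c < f' x}" for c unfolding f'_def scale[OF ab(3), symmetric] by (rule f)
      show "convex {x. c < g' x}" for c unfolding g'_def scale[OF ab(4), symmetric] by (rule g)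
      show "(SUP x. f' x) = 1" unfolding f'_def using ab by (simp add: SUP_mult_left_ennreal[symmetric] ennreal_mult[symmetric])
      show "(SUP x. g' x) = 1" unfolding g'_def using ab by (simp add: SUP_mult_left_ennreal[symmetric] ennreal_mult[symmetric])
      show "h' \<in> borel_measurable borel" unfolding h'_def by measurable
      fix s t
      have "f' s epowr (1 - l) * g' t epowr l = (ennreal (1 / a) epowr (1 - l) * ennreal (1 / b) epowr l) * (f s epowr (1 - l) * g t epowr l)"
        unfolding f'_def g'_def using ab by (subst (1 2) epowr_mult) (auto simp: mult_ac)
      also have "ennreal (1 / a) epowr (1 - l) * ennreal (1 / b) epowr l = ennreal (1 / k)"
        using ab by (simp add: epowr_ennreal k_def ennreal_mult[symmetric] powr_divide)
      also have "ennreal (1 / k) * (f s epowr (1 - l) * g t epowr l) \<le> h' ((1 - l) * s + l * t)"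
        unfolding h'_def by (intro mult_left_mono le) auto
      finally show "f' s epowr (1 - l) * g' t epowr l \<le> h' ((1 - l) * s + l * t)" .
    qed
    then have "(\<integral>\<^sup>+ x. f' x \<partial>lborel) epowr (1 - l) * (\<integral>\<^sup>+ x. g' x \<partial>lborel) epowr l \<le> (\<integral>\<^sup>+ x. h' x \<partial>lborel)"
      by (rule order_trans[OF epowr_weighted_am_gm[OF l]])
    then have *: "ennreal k * ((\<integral>\<^sup>+ x. f' x \<partial>lborel) epowr (1 - l) * (\<integral>\<^sup>+ x. g' x \<partial>lborel) epowr l) \<le> ennreal k * (\<integral>\<^sup>+ x. h' x \<partial>lborel)"
      by (intro mult_left_mono) auto
    have hh: "ennreal k * (\<integral>\<^sup>+ x. h' x \<partial>lborel) = (\<integral>\<^sup>+ x. h x \<partial>lborel)"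
      unfolding h'_def using k by (simp add: nn_integral_cmult mult.assoc[symmetric] ennreal_mult[symmetric])
    have ff: "(\<integral>\<^sup>+ x. f x \<partial>lborel) = ennreal a * (\<integral>\<^sup>+ x. f' x \<partial>lborel)"
      unfolding f'_def using ab by (simp add: nn_integral_cmult mult.assoc[symmetric] ennreal_mult[symmetric])
    have gg: "(\<integral>\<^sup>+ x. g x \<partial>lborel) = ennreal b * (\<integral>\<^sup>+ x. g' x \<partial>lborel)"
      unfolding g'_def using ab by (simp add: nn_integral_cmult mult.assoc[symmetric] ennreal_mult[symmetric])
    have kk: "ennreal k = ennreal a epowr (1 - l) * ennreal b epowr l"
      using ab by (simp add: epowr_ennreal k_def ennreal_mult)
    have "(\<integral>\<^sup>+ x. f x \<partial>lborel) epowr (1 - l) * (\<integral>\<^sup>+ x. g x \<partial>lborel) epowr l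
       = ennreal k * ((\<integral>\<^sup>+ x. f' x \<partial>lborel) epowr (1 - l) * (\<integral>\<^sup>+ x. g' x \<partial>lborel) epowr l)"
      unfolding ff gg kk using ab by (subst (1 2) epowr_mult) (auto simp: mult_ac)
    with * hh show ?thesis by simp
  qed
qed

text \<open>Truncation at a constant height keeps superlevel sets convex. It can be undone for f and
  g separately, because the right-hand side does not involve the heights.\<close>

lemma prekopa_leindler:
  fixes f g h :: "real \<Rightarrow> ennreal"
  assumes f: "\<And>c. convex {x. c < f x}" and g: "\<And>c. convex {x. c < g x}"
    and h: "h \<in> borel_measurable borel" and l: "0 < l" "l < 1"
    and le: "\<And>s t. f s epowr (1 - l) * g t epowr l \<le> h ((1 - l) * s + l * t)"
  shows "(\<integral>\<^sup>+ x. f x \<partial>lborel) epowr (1 - l) * (\<integral>\<^sup>+ x. g x \<partial>lborel) epowr l \<le> (\<integral>\<^sup>+ x. h x \<partial>lborel)"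
proof -
  let ?t = "\<lambda>k (u :: real \<Rightarrow> ennreal) x. min (u x) (ennreal (real k))"
  let ?I = "\<lambda>u. \<integral>\<^sup>+ x. u x \<partial>lborel"
  have conv: "convex {x. c < ?t k u x}" if "\<And>c. convex {x. c < u x}" for c k and u :: "real \<Rightarrow> ennreal"
  proof (cases "c < ennreal (real k)")
    case True
    then have "{x. c < ?t k u x} = {x. c < u x}" by auto
    then show ?thesis using that by simp
  qed simp
  have lim: "(SUP k. ?I (?t k u) epowr r) = ?I u epowr r" if u: "u \<in> borel_measurable borel" and r: "r > 0" for u :: "real \<Rightarrow> ennreal" and r
  proof -
    have "?t j u x \<le> ?t k u x" if "j \<le> k" for j k x
      by (rule min.mono[OF order_refl ennreal_leI]) (use that in simp)
    then have inc: "incseq (\<lambda>k. ?t k u)" unfolding incseq_def le_fun_def by blast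
    have "(SUP k. ?t k u x) = u x" for x
    proof (cases "u x")
      case (real y)
      obtain n where "y \<le> real n" using real_arch_simple by blast
      then have "?t n u x = u x" using real by (simp add: min_def ennreal_leI)
      then show ?thesis by (intro antisym SUP_least) (auto intro: SUP_upper2[of n])
    next
      case top
      then have "?t k u x = of_nat k" for k by (simp add: ennreal_of_nat_eq_real_of_nat)
      then show ?thesis using top by (simp add: ennreal_SUP_of_nat_eq_top)
    qed
    then have "?I u = (SUP k. ?I (?t k u))"
      using nn_integral_monotone_convergence_SUP[OF inc, of lborel] u by simp
    moreover have "(\<lambda>k. ?I (?t k u)) \<longlonglongrightarrow> (SUP k. ?I (?t k u))"
      by (rule LIMSEQ_SUP) (use inc in \<open>auto simp: incseq_def le_fun_def intro!: nn_integral_mono\<close>)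
    ultimately have "(\<lambda>k. ?I (?t k u) epowr r) \<longlonglongrightarrow> ?I u epowr r" using r by (intro epowr_tendsto) auto
    moreover have "(\<lambda>k. ?I (?t k u) epowr r) \<longlonglongrightarrow> (SUP k. ?I (?t k u) epowr r)"
      by (rule LIMSEQ_SUP) (use inc r in \<open>auto simp: incseq_def le_fun_def intro!: nn_integral_mono epowr_mono\<close>)
    ultimately show ?thesis by (rule LIMSEQ_unique[rotated])
  qed
  have step: "?I (?t j f) epowr (1 - l) * ?I (?t k g) epowr l \<le> ?I h" for j k
  proof (rule prekopa_leindler_bounded[OF conv[OF f] _ conv[OF g] _ h l])
    show "?t j f x \<le> ennreal (real (max j k))" for x by (intro min.coboundedI2 ennreal_leI) auto
    show "?t k g x \<le> ennreal (real (max j k))" for x by (intro min.coboundedI2 ennreal_leI) auto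
    fix s t
    have "?t j f s epowr (1 - l) * ?t k g t epowr l \<le> f s epowr (1 - l) * g t epowr l"
      using l by (intro mult_mono epowr_mono) auto
    also note le
    finally show "?t j f s epowr (1 - l) * ?t k g t epowr l \<le> h ((1 - l) * s + l * t)" .
  qed
  have "?I f epowr (1 - l) * ?I g epowr l = (SUP j. ?I (?t j f) epowr (1 - l)) * (SUP k. ?I (?t k g) epowr l)"
    using lim[OF quasi_concave_measurable[OF f], of "1 - l"] lim[OF quasi_concave_measurable[OF g], of l] l by simp
  also have "\<dots> = (SUP j. SUP k. ?I (?t j f) epowr (1 - l) * ?I (?t k g) epowr l)"
    by (subst SUP_mult_right_ennreal, subst SUP_mult_left_ennreal) simp
  also have "\<dots> \<le> ?I h" by (intro SUP_least step)
  finally show ?thesis .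
qed

text \<open>Prekopa's theorem, integrating out one coordinate at a time.\<close>

definition log_concave_fun :: "('v::real_vector \<Rightarrow> ('i \<Rightarrow> real) \<Rightarrow> ennreal) \<Rightarrow> bool" where
  "log_concave_fun G \<longleftrightarrow> (\<forall>x y \<phi> \<psi> l. 0 < l \<longrightarrow> l < 1 \<longrightarrow>
     G x \<phi> epowr (1 - l) * G y \<psi> epowr l \<le> G ((1 - l) *\<^sub>R x + l *\<^sub>R y) (\<lambda>i. (1 - l) * \<phi> i + l * \<psi> i))"

text \<open>A weighted geometric mean of two values above c is above c: log-concavity along a
  coordinate line gives the quasi-concavity that \<open>prekopa_leindler\<close> asks for.\<close>

lemma log_concave_fun_section_convex:
  fixes G :: "'v::real_vector \<Rightarrow> ('i \<Rightarrow> real) \<Rightarrow> ennreal"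
  assumes "log_concave_fun G"
  shows "convex {t :: real. c < G x (\<phi>(i := t))}"
proof (rule convexI)
  fix s t :: real and u v :: real
  assume s: "s \<in> {t. c < G x (\<phi>(i := t))}" and t: "t \<in> {t. c < G x (\<phi>(i := t))}" and uv: "0 \<le> u" "0 \<le> v" "u + v = 1"
  show "u *\<^sub>R s + v *\<^sub>R t \<in> {t. c < G x (\<phi>(i := t))}"
  proof (cases "u = 0 \<or> v = 0")
    case True
    then show ?thesis using s t uv by auto
  next
    case False
    then have l: "0 < v" "v < 1" "u = 1 - v" using uv by auto
    have "c = c epowr (1 - v) * c epowr v" using l by (simp add: epowr_split)
    also have "\<dots> < G x (\<phi>(i := s)) epowr (1 - v) * G x (\<phi>(i := t)) epowr v"
      using s t l by (intro mult_strict_mono_ennreal epowr_strict_mono_le) auto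
    also have "\<dots> \<le> G ((1 - v) *\<^sub>R x + v *\<^sub>R x) (\<lambda>j. (1 - v) * (\<phi>(i := s)) j + v * (\<phi>(i := t)) j)"
      using assms l unfolding log_concave_fun_def by blast
    also have "(\<lambda>j. (1 - v) * (\<phi>(i := s)) j + v * (\<phi>(i := t)) j) = \<phi>(i := u * s + v * t)"
      by (auto simp: l(3) algebra_simps)
    also have "(1 - v) *\<^sub>R x + v *\<^sub>R x = x" by (simp add: scaleR_left_distrib[symmetric])
    finally show ?thesis by (simp add: fun_upd_def)
  qed
qed

text \<open>For fixed x, y and remaining coordinates, the sections at the two endpoints and at their
  convex combination satisfy the hypothesis of \<open>prekopa_leindler\<close> in the coordinate
  i.\<close>

lemma log_concave_fun_marginal:
  fixes G :: "'v::real_vector \<Rightarrow> ('i \<Rightarrow> real) \<Rightarrow> ennreal"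
  assumes "log_concave_fun G"
  shows "log_concave_fun (\<lambda>x \<phi>. \<integral>\<^sup>+ t. G x (\<phi>(i := t)) \<partial>lborel)"
  unfolding log_concave_fun_def
proof (intro allI impI)
  fix x y :: 'v and \<phi> \<psi> :: "'i \<Rightarrow> real" and l :: real assume l: "0 < l" "l < 1"
  let ?z = "(1 - l) *\<^sub>R x + l *\<^sub>R y" and ?\<chi> = "\<lambda>i. (1 - l) * \<phi> i + l * \<psi> i"
  note conv = log_concave_fun_section_convex[OF assms]
  show "(\<integral>\<^sup>+ t. G x (\<phi>(i := t)) \<partial>lborel) epowr (1 - l) * (\<integral>\<^sup>+ t. G y (\<psi>(i := t)) \<partial>lborel) epowr l
     \<le> (\<integral>\<^sup>+ t. G ?z (?\<chi>(i := t)) \<partial>lborel)"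
  proof (rule prekopa_leindler[OF conv conv quasi_concave_measurable[OF conv] l])
    fix s t
    have "G x (\<phi>(i := s)) epowr (1 - l) * G y (\<psi>(i := t)) epowr l
      \<le> G ?z (\<lambda>j. (1 - l) * (\<phi>(i := s)) j + l * (\<psi>(i := t)) j)"
      using assms l unfolding log_concave_fun_def by blast
    also have "(\<lambda>j. (1 - l) * (\<phi>(i := s)) j + l * (\<psi>(i := t)) j) = ?\<chi>(i := (1 - l) * s + l * t)" by auto
    finally show "G x (\<phi>(i := s)) epowr (1 - l) * G y (\<psi>(i := t)) epowr l \<le> G ?z (?\<chi>(i := (1 - l) * s + l * t))" .
  qed
qed

interpretation lborel_product: product_sigma_finite "\<lambda>_. lborel :: real measure"
  by unfold_locales

lemma prekopa_PiM:
  fixes G :: "'v::real_vector \<Rightarrow> ('i \<Rightarrow> real) \<Rightarrow> ennreal"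
  assumes "finite I" "log_concave_fun G" "\<And>x. G x \<in> borel_measurable (\<Pi>\<^sub>M i\<in>I. lborel)" and l: "0 < l" "l < 1"
  shows "(\<integral>\<^sup>+ \<phi>. G x \<phi> \<partial>(\<Pi>\<^sub>M i\<in>I. lborel)) epowr (1 - l) * (\<integral>\<^sup>+ \<phi>. G y \<phi> \<partial>(\<Pi>\<^sub>M i\<in>I. lborel)) epowr l
     \<le> (\<integral>\<^sup>+ \<phi>. G ((1 - l) *\<^sub>R x + l *\<^sub>R y) \<phi> \<partial>(\<Pi>\<^sub>M i\<in>I. lborel))"
  using assms(1-3)
proof (induction I arbitrary: G rule: finite_induct)
  case empty
  \<comment> \<open>Over the empty index set the only point is the function that is constantly
    \<open>undefined\<close>; a convex combination of \<open>undefined\<close> with itself is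
    \<open>undefined\<close> again.\<close>
  have "(\<lambda>i. (1 - l) * undefined + l * undefined) = (\<lambda>i :: 'i. undefined :: real)"
    by (auto simp: algebra_simps)
  moreover have "G x (\<lambda>i. undefined) epowr (1 - l) * G y (\<lambda>i. undefined) epowr l
    \<le> G ((1 - l) *\<^sub>R x + l *\<^sub>R y) (\<lambda>i. (1 - l) * undefined + l * undefined)"
    using empty.prems(1) l unfolding log_concave_fun_def by blast
  ultimately show ?case by (simp add: lborel_product.nn_integral_empty)
next
  case (insert i I)
  define G' where "G' = (\<lambda>x \<phi>. \<integral>\<^sup>+ t. G x (\<phi>(i := t)) \<partial>lborel)"
  have Gm [measurable]: "G x \<in> borel_measurable (\<Pi>\<^sub>M i\<in>insert i I. lborel)" for x by (rule insert.prems(2))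
  have eq: "(\<integral>\<^sup>+ \<phi>. G x \<phi> \<partial>(\<Pi>\<^sub>M i\<in>insert i I. lborel)) = (\<integral>\<^sup>+ \<phi>. G' x \<phi> \<partial>(\<Pi>\<^sub>M i\<in>I. lborel))" for x
    unfolding G'_def by (rule lborel_product.product_nn_integral_insert[OF insert.hyps(1,2) Gm])
  have "G' x \<in> borel_measurable (\<Pi>\<^sub>M i\<in>I. lborel)" for x
    unfolding G'_def
  proof (rule lborel.borel_measurable_nn_integral)
    have "(\<lambda>(f, y). f(i := y)) \<in> measurable ((\<Pi>\<^sub>M i\<in>I. lborel) \<Otimes>\<^sub>M lborel) (\<Pi>\<^sub>M i\<in>insert i I. lborel :: real measure)"
      by (rule measurable_add_dim)
    from measurable_compose[OF this Gm[of x]]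
    show "(\<lambda>(\<phi>, t). G x (\<phi>(i := t))) \<in> borel_measurable ((\<Pi>\<^sub>M i\<in>I. lborel) \<Otimes>\<^sub>M lborel)"
      by (simp add: case_prod_beta)
  qed
  then show ?case unfolding eq
    by (intro insert.IH) (auto simp: G'_def intro: log_concave_fun_marginal insert.prems)
qed

theorem prekopa:
  fixes K :: "'v::real_vector \<Rightarrow> 'a::euclidean_space \<Rightarrow> ennreal"
  assumes K: "\<And>x y u w l. 0 < l \<Longrightarrow> l < 1 \<Longrightarrow> K x u epowr (1 - l) * K y w epowr l \<le> K ((1 - l) *\<^sub>R x + l *\<^sub>R y) ((1 - l) *\<^sub>R u + l *\<^sub>R w)"
    and [measurable]: "\<And>x. K x \<in> borel_measurable borel" and l: "0 < l" "l < 1"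
  shows "(\<integral>\<^sup>+ u. K x u \<partial>lborel) epowr (1 - l) * (\<integral>\<^sup>+ u. K y u \<partial>lborel) epowr l
     \<le> (\<integral>\<^sup>+ u. K ((1 - l) *\<^sub>R x + l *\<^sub>R y) u \<partial>lborel)"
proof -
  let ?P = "\<Pi>\<^sub>M b\<in>(Basis :: 'a set). (lborel :: real measure)"
  let ?v = "\<lambda>\<phi>. \<Sum>b\<in>(Basis :: 'a set). \<phi> b *\<^sub>R b"
  have [measurable]: "?v \<in> measurable ?P borel" by measurable
  have eq: "(\<integral>\<^sup>+ u. K x u \<partial>lborel) = (\<integral>\<^sup>+ \<phi>. K x (?v \<phi>) \<partial>?P)" for x
    by (subst lborel_eq) (simp add: nn_integral_distr)
  show ?thesis unfolding eq
  proof (rule prekopa_PiM[OF finite_Basis _ _ l])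
    show "log_concave_fun (\<lambda>x \<phi>. K x (?v \<phi>))" unfolding log_concave_fun_def
    proof (intro allI impI)
      fix x y \<phi> \<psi> and l :: real assume l: "0 < l" "l < 1"
      have "?v (\<lambda>i. (1 - l) * \<phi> i + l * \<psi> i) = (1 - l) *\<^sub>R ?v \<phi> + l *\<^sub>R ?v \<psi>"
        by (simp add: scaleR_sum_right scaleR_left_distrib sum.distrib)
      then show "K x (?v \<phi>) epowr (1 - l) * K y (?v \<psi>) epowr l \<le> K ((1 - l) *\<^sub>R x + l *\<^sub>R y) (?v (\<lambda>i. (1 - l) * \<phi> i + l * \<psi> i))"
        using K[OF l, of x "?v \<phi>" y "?v \<psi>"] by simp
    qed
  qed measurable
qed

section \<open>Dilations of log-concave and log-subharmonic functions\<close>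

text \<open>Near a maximum point of \<open>ln h - |x|\<^sup>2 / 2\<close> strong concavity gives a Gaussian upper bound for \<open>h\<close>.
  Almost maximum points suffice, so no compactness is needed.\<close>

lemma log_concave_integral_le:
  fixes h :: "real ^ 'n \<Rightarrow> real"
  assumes pos: "\<And>x. 0 < h x"
    and lc: "\<And>x y t. 0 < t \<Longrightarrow> t < 1 \<Longrightarrow> (1 - t) * ln (h x) + t * ln (h y) \<le> ln (h ((1 - t) *\<^sub>R x + t *\<^sub>R y))"
    and bound: "\<And>x. h x \<le> S * exp ((norm x)\<^sup>2 / 2)"
  shows "(\<integral>\<^sup>+ x. ennreal (h x) \<partial>gauss_measure) \<le> ennreal S"
proof -
  define \<phi> where "\<phi> = (\<lambda>x. h x * exp (- (norm x)\<^sup>2 / 2))"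
  have phi_pos: "\<phi> x > 0" for x using pos by (simp add: \<phi>_def)
  have phi_le: "\<phi> x \<le> S" for x
  proof -
    have "h x * exp (- (norm x)\<^sup>2 / 2) \<le> (S * exp ((norm x)\<^sup>2 / 2)) * exp (- (norm x)\<^sup>2 / 2)"
      by (intro mult_right_mono bound) auto
    then show ?thesis by (simp add: \<phi>_def mult.assoc exp_add[symmetric])
  qed
  define M where "M = (SUP x. \<phi> x)"
  have bdd: "bdd_above (range \<phi>)" using phi_le by (auto simp: bdd_above_def)
  have phi_M: "\<phi> x \<le> M" for x unfolding M_def by (intro cSUP_upper bdd) auto
  have M: "M > 0" using phi_pos[of 0] phi_M[of 0] by linarith
  have MS: "M \<le> S" unfolding M_def by (intro cSUP_least phi_le) auto
  have key: "(\<integral>\<^sup>+ x. ennreal (h x) \<partial>gauss_measure) \<le> ennreal (M * exp t * (1 - t) powr (- real CARD('n) / 2))" if t: "0 < t" "t < 1" for t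
  proof -
    \<comment> \<open>The point a maximizes \<open>\<phi>\<close> up to the factor exp(-t^2). This
      defect t^2 in the logarithm turns into t after the division by t below, and so disappears in
      the limit.\<close>
    have "M * exp (- t\<^sup>2) < M" using M t by simp
    then obtain a where a: "M * exp (- t\<^sup>2) < \<phi> a" unfolding M_def using less_cSUP_iff[OF _ bdd] by auto
    have Ha: "ln M - t\<^sup>2 + (norm a)\<^sup>2 / 2 \<le> ln (h a)"
    proof -
      have "ln (M * exp (- t\<^sup>2)) \<le> ln (\<phi> a)" using a M by (intro ln_mono) auto
      then show ?thesis using M pos[of a] by (simp add: \<phi>_def ln_mult)
    qed
    have Hx: "ln (h x) \<le> ln M + (norm x)\<^sup>2 / 2" for x
    proof -
      have "ln (\<phi> x) \<le> ln M" using phi_M[of x] phi_pos[of x] by (intro ln_mono) auto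
      then show ?thesis using pos[of x] by (simp add: \<phi>_def ln_mult)
    qed
    define c where "c = ln M + t - (1 - t) * (norm a)\<^sup>2 / 2"
    have "h x \<le> exp c * exp (((1 - t) *\<^sub>R a) \<bullet> x + (1 - (1 - t)) * (norm x)\<^sup>2 / 2)" for x
    proof -
      \<comment> \<open>Concavity on the segment from a to x: the value at \<open>?z\<close> is
        bounded above through M and the value at a is bounded below, which leaves a bound for t ln(h
        x).\<close>
      let ?z = "(1 - t) *\<^sub>R a + t *\<^sub>R x"
      have nz: "(norm ?z)\<^sup>2 = (1 - t)\<^sup>2 * (norm a)\<^sup>2 + 2 * (t * (1 - t)) * (a \<bullet> x) + t\<^sup>2 * (norm x)\<^sup>2"
        unfolding power2_norm_eq_inner by (simp add: inner_add_left inner_add_right inner_commute power2_eq_square algebra_simps)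
      have h2: "(1 - t) * (ln M - t\<^sup>2 + (norm a)\<^sup>2 / 2) \<le> (1 - t) * ln (h a)"
        using t by (intro mult_left_mono Ha) auto
      have "e \<le> f - c" if "b + e \<le> d" "d \<le> f" "c \<le> b" for b c d e f :: real using that by linarith
      from this[OF lc[OF t, of a x] Hx[of ?z] h2]
      have "t * ln (h x) \<le> ln M + ((1 - t)\<^sup>2 * (norm a)\<^sup>2 + 2 * (t * (1 - t)) * (a \<bullet> x) + t\<^sup>2 * (norm x)\<^sup>2) / 2
          - (1 - t) * (ln M - t\<^sup>2 + (norm a)\<^sup>2 / 2)"
        unfolding nz .
      also have "\<dots> = t * (ln M + t * (1 - t) - (1 - t) * (norm a)\<^sup>2 / 2 + (1 - t) * (a \<bullet> x) + t * (norm x)\<^sup>2 / 2)"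
        by (simp add: field_simps power2_eq_square)
      finally have "ln (h x) \<le> ln M + t * (1 - t) - (1 - t) * (norm a)\<^sup>2 / 2 + (1 - t) * (a \<bullet> x) + t * (norm x)\<^sup>2 / 2"
        using t by (simp only: mult_le_cancel_left_pos)
      also have "\<dots> \<le> c + (((1 - t) *\<^sub>R a) \<bullet> x + (1 - (1 - t)) * (norm x)\<^sup>2 / 2)"
        using t mult_left_mono[of "1 - t" 1 t] by (simp add: c_def)
      finally have "exp (ln (h x)) \<le> exp (c + (((1 - t) *\<^sub>R a) \<bullet> x + (1 - (1 - t)) * (norm x)\<^sup>2 / 2))" by simp
      then show ?thesis using pos[of x] by (simp only: exp_ln exp_add)
    qed
    then have "(\<integral>\<^sup>+ x. ennreal (h x) \<partial>gauss_measure)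
      \<le> (\<integral>\<^sup>+ x. ennreal (exp c) * (ennreal (exp (((1 - t) *\<^sub>R a) \<bullet> x + (1 - (1 - t)) * (norm x)\<^sup>2 / 2)) * 1) \<partial>gauss_measure)"
      by (intro nn_integral_mono) (simp add: ennreal_mult[symmetric] ennreal_leI)
    also have "\<dots> = ennreal (exp c) * (\<integral>\<^sup>+ x. ennreal (exp (((1 - t) *\<^sub>R a) \<bullet> x + (1 - (1 - t)) * (norm x)\<^sup>2 / 2)) * 1 \<partial>gauss_measure)"
      by (intro nn_integral_cmult) measurable
    \<comment> \<open>The quadratic coefficient of the bound is t < 1, so it is Gaussian integrable,
      by \<open>gauss_tilt\<close> with \<theta> = 1 - t.\<close>
    also have "\<dots> = ennreal (exp c) * ennreal ((1 - t) powr (- real CARD('n) / 2) * exp ((norm ((1 - t) *\<^sub>R a))\<^sup>2 / (2 * (1 - t))))"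
      using gauss_tilt[of "1 - t" "\<lambda>_. 1" "(1 - t) *\<^sub>R a"] t by simp
    also have "\<dots> = ennreal (M * exp t * (1 - t) powr (- real CARD('n) / 2))"
    proof -
      have "(norm ((1 - t) *\<^sub>R a))\<^sup>2 / (2 * (1 - t)) = (1 - t) * (norm a)\<^sup>2 / 2"
      proof -
        have "(r * n) / (2 * r) = n / 2" if "r \<noteq> 0" for r n :: real using that by simp
        from this[of "1 - t" "(1 - t) * (norm a)\<^sup>2"] show ?thesis using t
          by (simp only: norm_scaleR power_mult_distrib power2_abs power2_eq_square[of "1 - t"] mult.assoc)
      qed
      moreover have "exp c = M * exp t * exp (- ((1 - t) * (norm a)\<^sup>2 / 2))"
      proof -
        have "exp (ln m + t - k) = m * exp t * exp (- k)" if "m > 0" for m k :: real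
          using that by (simp add: exp_add exp_diff exp_minus divide_inverse)
        from this[OF M, of "(1 - t) * (norm a)\<^sup>2 / 2"] show ?thesis unfolding c_def .
      qed
      ultimately have "exp c * ((1 - t) powr (- real CARD('n) / 2) * exp ((norm ((1 - t) *\<^sub>R a))\<^sup>2 / (2 * (1 - t))))
        = M * exp t * (1 - t) powr (- real CARD('n) / 2) * (exp (- ((1 - t) * (norm a)\<^sup>2 / 2)) * exp ((1 - t) * (norm a)\<^sup>2 / 2))"
        by simp
      also have "exp (- ((1 - t) * (norm a)\<^sup>2 / 2)) * exp ((1 - t) * (norm a)\<^sup>2 / 2) = 1" by (simp add: exp_add[symmetric])
      finally show ?thesis by (simp only: ennreal_mult'[OF exp_ge_zero, symmetric] mult_1_right)
    qed
    finally show ?thesis .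
  qed
  \<comment> \<open>A sequence of admissible t; the 2 keeps every term strictly below 1.\<close>
  have t0: "(\<lambda>k. 1 / (real k + 2)) \<longlonglongrightarrow> 0" by real_asymp
  have "(\<lambda>k. M * exp (1 / (real k + 2)) * (1 - 1 / (real k + 2)) powr (- real CARD('n) / 2)) \<longlonglongrightarrow> M * exp 0 * (1 - 0) powr (- real CARD('n) / 2)"
    by (intro tendsto_intros t0) auto
  then have "(\<lambda>k. ennreal (M * exp (1 / (real k + 2)) * (1 - 1 / (real k + 2)) powr (- real CARD('n) / 2))) \<longlonglongrightarrow> ennreal M"
    by (intro tendsto_ennrealI) simp
  then have "(\<integral>\<^sup>+ x. ennreal (h x) \<partial>gauss_measure) \<le> ennreal M"
  proof (rule LIMSEQ_le_const, intro exI[of _ 0] allI impI)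
    fix k :: nat
    have "0 < 1 / (real k + 2)" "1 / (real k + 2) < 1" by auto
    then show "(\<integral>\<^sup>+ x. ennreal (h x) \<partial>gauss_measure) \<le> ennreal (M * exp (1 / (real k + 2)) * (1 - 1 / (real k + 2)) powr (- real CARD('n) / 2))"
      by (rule key)
  qed
  also have "\<dots> \<le> ennreal S" using MS by (rule ennreal_leI)
  finally show ?thesis .
qed

text \<open>Hoelder's inequality against \<open>e\<^bsup>b z\<^esup>\<close> bounds the translates of \<open>e\<^sup>L\<close>.\<close>

lemma gauss_translate_bound:
  fixes L :: "real ^ 'n \<Rightarrow> real"
  assumes p: "p > 1" and [measurable]: "L \<in> borel_measurable borel"
    and A: "(\<integral>\<^sup>+ z. ennreal (exp (p * L z)) \<partial>gauss_measure) = ennreal A" "A > 0"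
  shows "(\<integral>\<^sup>+ z. ennreal (exp (L (b + z))) \<partial>gauss_measure) \<le> ennreal (A powr (1 / p) * exp ((norm b)\<^sup>2 / (2 * (p - 1))))"
proof -
  define p' where "p' = p / (p - 1)"
  have p': "p' > 1" "1 / p + 1 / p' = 1" using p by (auto simp: p'_def field_simps)
  \<comment> \<open>\<open>S\<close> is the norm of order p of e^L and \<open>B\<close> the norm of
    order p' of the exponential of z -> b . z. Young's inequality for the normalized factors,
    integrated, is Hoelder's inequality.\<close>
  define S where "S = A powr (1 / p)"
  define B where "B = exp (p' * (norm b)\<^sup>2 / 2)"
  have S: "S > 0" "S powr p = A" using A p by (auto simp: S_def powr_powr)
  have B: "B > 0" by (simp add: B_def)
  have Bp: "B powr p' = exp (p'\<^sup>2 * (norm b)\<^sup>2 / 2)" by (simp add: B_def powr_def power2_eq_square)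
  have young: "exp (b \<bullet> z) * exp (L z) \<le> S * B * (exp (p * L z) / A / p + exp ((p' *\<^sub>R b) \<bullet> z) / (B powr p') / p')" for z
  proof -
    have "(exp (L z) / S) * (exp (b \<bullet> z) / B) \<le> (exp (L z) / S) powr p / p + (exp (b \<bullet> z) / B) powr p' / p'"
      using S B by (intro Youngs_inequality p p') auto
    also have "(exp (L z) / S) powr p = exp (p * L z) / A"
      using S by (simp add: powr_divide) (simp add: powr_def)
    also have "(exp (b \<bullet> z) / B) powr p' = exp ((p' *\<^sub>R b) \<bullet> z) / (B powr p')"
      using B by (simp add: powr_divide) (simp add: powr_def)
    finally have "S * B * ((exp (L z) / S) * (exp (b \<bullet> z) / B)) \<le> S * B * (exp (p * L z) / A / p + exp ((p' *\<^sub>R b) \<bullet> z) / (B powr p') / p')"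
      using S B by (intro mult_left_mono) auto
    then show ?thesis using S B by (simp add: mult.commute)
  qed
  have i1: "(\<integral>\<^sup>+ z. ennreal (exp (p * L z) / A / p) \<partial>gauss_measure) = ennreal (1 / p)"
  proof -
    have "(\<integral>\<^sup>+ z. ennreal (exp (p * L z) / A / p) \<partial>gauss_measure) = (\<integral>\<^sup>+ z. ennreal (1 / A / p) * ennreal (exp (p * L z)) \<partial>gauss_measure)"
      using A p by (intro nn_integral_cong) (simp add: ennreal_mult[symmetric])
    also have "\<dots> = ennreal (1 / A / p) * ennreal A" using A(1) by (simp add: nn_integral_cmult)
    finally show ?thesis using A(2) p by (simp add: ennreal_mult[symmetric])
  qed
  have i2: "(\<integral>\<^sup>+ z. ennreal (exp ((p' *\<^sub>R b) \<bullet> z) / (B powr p') / p') \<partial>gauss_measure) = ennreal (1 / p')"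
  proof -
    have "(\<integral>\<^sup>+ z. ennreal (exp ((p' *\<^sub>R b) \<bullet> z) / (B powr p') / p') \<partial>gauss_measure)
      = (\<integral>\<^sup>+ z. ennreal (1 / (B powr p') / p') * ennreal (exp ((p' *\<^sub>R b) \<bullet> z)) \<partial>gauss_measure)"
      using p' by (intro nn_integral_cong) (simp add: ennreal_mult[symmetric])
    also have "\<dots> = ennreal (1 / (B powr p') / p') * ennreal (exp ((norm (p' *\<^sub>R b))\<^sup>2 / 2))"
      by (subst nn_integral_cmult, measurable, subst nn_integral_exp_gauss) simp
    also have "exp ((norm (p' *\<^sub>R b))\<^sup>2 / 2) = B powr p'" unfolding Bp by (simp add: power_mult_distrib)
    finally show ?thesis using p' B by (simp add: ennreal_mult[symmetric])
  qed
  have "ennreal (exp ((norm b)\<^sup>2 / 2)) * (\<integral>\<^sup>+ z. ennreal (exp (L (b + z))) \<partial>gauss_measure)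
     = (\<integral>\<^sup>+ z. ennreal (exp (b \<bullet> z)) * ennreal (exp (L z)) \<partial>gauss_measure)"
    by (rule gauss_shift[symmetric]) simp
  also have "\<dots> \<le> (\<integral>\<^sup>+ z. ennreal (S * B) * (ennreal (exp (p * L z) / A / p) + ennreal (exp ((p' *\<^sub>R b) \<bullet> z) / (B powr p') / p')) \<partial>gauss_measure)"
    using young S B A p p'
    by (intro nn_integral_mono) (simp add: ennreal_mult[symmetric] ennreal_plus[symmetric] ennreal_leI del: ennreal_plus)
  also have "\<dots> = ennreal (S * B) * (ennreal (1 / p) + ennreal (1 / p'))"
    by (subst nn_integral_cmult, measurable, subst nn_integral_add, measurable, simp only: i1 i2)
  also have "ennreal (1 / p) + ennreal (1 / p') = 1" using p p' by (simp add: ennreal_plus[symmetric] del: ennreal_plus)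
  finally have le: "ennreal (exp ((norm b)\<^sup>2 / 2)) * (\<integral>\<^sup>+ z. ennreal (exp (L (b + z))) \<partial>gauss_measure) \<le> ennreal (S * B)" by simp
  have "(\<integral>\<^sup>+ z. ennreal (exp (L (b + z))) \<partial>gauss_measure)
      = ennreal (exp (- (norm b)\<^sup>2 / 2)) * (ennreal (exp ((norm b)\<^sup>2 / 2)) * (\<integral>\<^sup>+ z. ennreal (exp (L (b + z))) \<partial>gauss_measure))"
    by (simp add: mult.assoc[symmetric] ennreal_mult[symmetric] exp_add[symmetric])
  also have "\<dots> \<le> ennreal (exp (- (norm b)\<^sup>2 / 2)) * ennreal (S * B)" by (intro mult_left_mono le) auto
  also have "\<dots> = ennreal (S * (exp (- (norm b)\<^sup>2 / 2) * B))" using S B by (simp add: ennreal_mult[symmetric] mult_ac)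
  \<comment> \<open>The exponents combine by p' - 1 = 1/(p - 1).\<close>
  also have "exp (- (norm b)\<^sup>2 / 2) * B = exp ((norm b)\<^sup>2 / (2 * (p - 1)))"
    unfolding B_def exp_add[symmetric] p'_def using p by (simp add: field_simps)
  finally show ?thesis by (simp add: S_def)
qed

text \<open>With \<kappa>^2 = p - 1, let h(x) be the Gaussian integral over z of exp(L(\<kappa> x +
  z)). By Prekopa h is log-concave, and by \<open>gauss_translate_bound\<close> it is at most the
  right-hand side times exp(|x|^2/2), so \<open>log_concave_integral_le\<close> bounds its integral.
  As \<kappa>^2 + 1 = p, that integral is the left-hand side. The affine majorant of L makes all
  these integrals finite.\<close>

theorem log_concave_dilation:
  fixes L :: "real ^ 'n \<Rightarrow> real"
  assumes conc: "\<And>x y t. 0 < t \<Longrightarrow> t < 1 \<Longrightarrow> (1 - t) * L x + t * L y \<le> L ((1 - t) *\<^sub>R x + t *\<^sub>R y)"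
    and cont: "continuous_on UNIV L" and affine: "\<And>y. L y \<le> c + v \<bullet> y" and p: "p > 1"
  shows "(\<integral>\<^sup>+ z. ennreal (exp (L (sqrt p *\<^sub>R z))) \<partial>gauss_measure) \<le> (\<integral>\<^sup>+ z. ennreal (exp (p * L z)) \<partial>gauss_measure) epowr (1 / p)"
proof -
  have [measurable]: "L \<in> borel_measurable borel" using cont by (rule borel_measurable_continuous_onI)
  have fin: "(\<integral>\<^sup>+ z. ennreal (exp (r * L (b + z))) \<partial>(gauss_measure :: (real ^ 'n) measure)) < \<infinity>" if r: "r > 0" for r b
  proof -
    have "(\<integral>\<^sup>+ z. ennreal (exp (r * L (b + z))) \<partial>gauss_measure)
      \<le> (\<integral>\<^sup>+ z. ennreal (exp (r * (c + v \<bullet> b))) * ennreal (exp ((r *\<^sub>R v) \<bullet> z)) \<partial>gauss_measure)"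
    proof (intro nn_integral_mono)
      fix z
      have "r * L (b + z) \<le> r * (c + v \<bullet> (b + z))" using r by (intro mult_left_mono affine) auto
      also have "\<dots> = r * (c + v \<bullet> b) + (r *\<^sub>R v) \<bullet> z" by (simp add: inner_add_right algebra_simps)
      finally show "ennreal (exp (r * L (b + z))) \<le> ennreal (exp (r * (c + v \<bullet> b))) * ennreal (exp ((r *\<^sub>R v) \<bullet> z))"
        by (simp add: ennreal_mult[symmetric] exp_add[symmetric] ennreal_leI)
    qed
    also have "\<dots> = ennreal (exp (r * (c + v \<bullet> b))) * ennreal (exp ((norm (r *\<^sub>R v))\<^sup>2 / 2))"
      by (subst nn_integral_cmult, measurable, subst nn_integral_exp_gauss) simp
    also have "\<dots> < \<infinity>" by (simp add: ennreal_mult[symmetric])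
    finally show ?thesis .
  qed
  have posi: "(\<integral>\<^sup>+ z. ennreal (exp (r * L (b + z))) \<partial>(gauss_measure :: (real ^ 'n) measure)) \<noteq> 0" for r b
  proof
    assume "(\<integral>\<^sup>+ z. ennreal (exp (r * L (b + z))) \<partial>(gauss_measure :: (real ^ 'n) measure)) = 0"
    then have "AE z in (gauss_measure :: (real ^ 'n) measure). ennreal (exp (r * L (b + z))) = 0" by (subst (asm) nn_integral_0_iff_AE) auto
    then have "AE z in (gauss_measure :: (real ^ 'n) measure). False" by simp
    then show False by (simp add: G.AE_False)
  qed
  obtain A where A: "(\<integral>\<^sup>+ z. ennreal (exp (p * L z)) \<partial>gauss_measure) = ennreal A" "A > 0"
    using fin[of p 0] posi[of p 0] p by (cases "\<integral>\<^sup>+ z. ennreal (exp (p * L z)) \<partial>gauss_measure") (auto simp: less_le)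
  define \<kappa> where "\<kappa> = sqrt (p - 1)"
  have k: "\<kappa> > 0" "\<kappa>\<^sup>2 = p - 1" using p by (auto simp: \<kappa>_def)
  define h where "h = (\<lambda>x. enn2real (\<integral>\<^sup>+ z. ennreal (exp (L (\<kappa> *\<^sub>R x + z))) \<partial>gauss_measure))"
  have h: "ennreal (h x) = (\<integral>\<^sup>+ z. ennreal (exp (L (\<kappa> *\<^sub>R x + z))) \<partial>gauss_measure)" for x
    unfolding h_def using fin[of 1 "\<kappa> *\<^sub>R x"] by (simp add: less_top)
  have hpos: "h x > 0" for x
    using posi[of 1 "\<kappa> *\<^sub>R x"] h[of x] by (simp add: ennreal_eq_0_iff not_le[symmetric]) (metis ennreal_neg linorder_not_le)
  have "(\<integral>\<^sup>+ x. ennreal (h x) \<partial>gauss_measure) \<le> ennreal (A powr (1 / p))"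
  proof (rule log_concave_integral_le[OF hpos])
    fix x
    have "ennreal (h x) \<le> ennreal (A powr (1 / p) * exp ((norm (\<kappa> *\<^sub>R x))\<^sup>2 / (2 * (p - 1))))"
      unfolding h by (rule gauss_translate_bound[OF p _ A]) simp
    also have "(norm (\<kappa> *\<^sub>R x))\<^sup>2 / (2 * (p - 1)) = (norm x)\<^sup>2 / 2"
    proof -
      have "(r * n) / (2 * r) = n / 2" if "r \<noteq> 0" for r n :: real using that by simp
      from this[of "p - 1" "(norm x)\<^sup>2"] show ?thesis using p k(2) by (simp only: norm_scaleR power_mult_distrib power2_abs)
    qed
    finally show "h x \<le> A powr (1 / p) * exp ((norm x)\<^sup>2 / 2)" by (subst (asm) ennreal_le_iff) auto
  next
    fix x y :: "real ^ 'n" and t :: real assume t: "0 < t" "t < 1"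
    let ?K = "\<lambda>(x :: real ^ 'n) (u :: real ^ 'n). ennreal (gauss 1 u * exp (L (\<kappa> *\<^sub>R x + u)))"
    let ?z = "(1 - t) *\<^sub>R x + t *\<^sub>R y"
    have hK: "ennreal (h x) = (\<integral>\<^sup>+ u. ?K x u \<partial>lborel)" for x
      unfolding h by (subst nn_integral_gauss_measure) (auto simp: ennreal_mult)
    have "(\<integral>\<^sup>+ u. ?K x u \<partial>lborel) epowr (1 - t) * (\<integral>\<^sup>+ u. ?K y u \<partial>lborel) epowr t \<le> (\<integral>\<^sup>+ u. ?K ?z u \<partial>lborel)"
    proof (rule prekopa[OF _ _ t])
      fix x y u w :: "real ^ 'n" and l :: real assume l: "0 < l" "l < 1"
      define g0 where "g0 = (2 * pi) powr (- real CARD('n) / 2)"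
      have g0: "g0 > 0" by (simp add: g0_def)
      have K: "gauss 1 u * exp (L (\<kappa> *\<^sub>R x + u)) = exp (ln g0 + (L (\<kappa> *\<^sub>R x + u) - (norm u)\<^sup>2 / 2))" for x u
      proof -
        have "g * exp (- b) * exp a = exp (ln g + (a - b))" if "g > 0" for g a b :: real
          using that by (simp add: exp_add exp_diff exp_minus divide_inverse)
        from this[OF g0, of "(norm u)\<^sup>2 / 2" "L (\<kappa> *\<^sub>R x + u)"] show ?thesis by (simp add: gauss_def g0_def)
      qed
      let ?zz = "(1 - l) *\<^sub>R x + l *\<^sub>R y" and ?ww = "(1 - l) *\<^sub>R u + l *\<^sub>R w"
      have "(1 - l) *\<^sub>R (\<kappa> *\<^sub>R x + u) + l *\<^sub>R (\<kappa> *\<^sub>R y + w) = \<kappa> *\<^sub>R ?zz + ?ww" by (simp add: algebra_simps)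
      then have Lz: "(1 - l) * L (\<kappa> *\<^sub>R x + u) + l * L (\<kappa> *\<^sub>R y + w) \<le> L (\<kappa> *\<^sub>R ?zz + ?ww)"
        using conc[OF l, of "\<kappa> *\<^sub>R x + u" "\<kappa> *\<^sub>R y + w"] by simp
      \<comment> \<open>Convexity of the squared norm makes the Gaussian density log-concave, so the
        integrand is jointly log-concave in x and u.\<close>
      have nz: "(norm ?ww)\<^sup>2 \<le> (1 - l) * (norm u)\<^sup>2 + l * (norm w)\<^sup>2"
      proof -
        have "(1 - l) * (norm u)\<^sup>2 + l * (norm w)\<^sup>2 - (norm ?ww)\<^sup>2 = l * (1 - l) * (norm (u - w))\<^sup>2"
          unfolding power2_norm_eq_inner by (simp add: inner_add_left inner_add_right inner_diff_left inner_diff_right inner_commute algebra_simps)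
        moreover have "\<dots> \<ge> 0" using l by simp
        ultimately show ?thesis by linarith
      qed
      have "(1 - l) * (g + (a - m / 2)) + l * (g + (b - n / 2)) \<le> g + (c - k / 2)"
        if "(1 - l) * a + l * b \<le> c" "k \<le> (1 - l) * m + l * n" for a b c g k m n :: real
      proof -
        have "(1 - l) * (g + (a - m / 2)) + l * (g + (b - n / 2)) = g + (((1 - l) * a + l * b) - ((1 - l) * m + l * n) / 2)"
          by (simp add: field_simps)
        also have "\<dots> \<le> g + (c - k / 2)" using that by (intro add_left_mono diff_mono divide_right_mono) auto
        finally show ?thesis .
      qed
      from this[OF Lz nz, of "ln g0"]
      have "(1 - l) * (ln g0 + (L (\<kappa> *\<^sub>R x + u) - (norm u)\<^sup>2 / 2)) + l * (ln g0 + (L (\<kappa> *\<^sub>R y + w) - (norm w)\<^sup>2 / 2))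
        \<le> ln g0 + (L (\<kappa> *\<^sub>R ?zz + ?ww) - (norm ?ww)\<^sup>2 / 2)" .
      then have "exp (ln g0 + (L (\<kappa> *\<^sub>R x + u) - (norm u)\<^sup>2 / 2)) powr (1 - l) * exp (ln g0 + (L (\<kappa> *\<^sub>R y + w) - (norm w)\<^sup>2 / 2)) powr l
        \<le> exp (ln g0 + (L (\<kappa> *\<^sub>R ?zz + ?ww) - (norm ?ww)\<^sup>2 / 2))"
        by (simp add: powr_def exp_add[symmetric])
      then show "?K x u epowr (1 - l) * ?K y w epowr l \<le> ?K ?zz ?ww"
        unfolding K by (simp add: epowr_ennreal ennreal_mult[symmetric] ennreal_leI)
    qed measurable
    then have "ennreal (h x) epowr (1 - t) * ennreal (h y) epowr t \<le> ennreal (h ?z)" by (simp only: hK)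
    then have "h x powr (1 - t) * h y powr t \<le> h ?z"
      using hpos by (simp add: epowr_ennreal ennreal_mult[symmetric] ennreal_le_iff less_imp_le)
    then have "ln (h x powr (1 - t) * h y powr t) \<le> ln (h ?z)" using hpos[of x] hpos[of y] by (intro ln_mono mult_pos_pos) auto
    then show "(1 - t) * ln (h x) + t * ln (h y) \<le> ln (h ?z)" using hpos[of x] hpos[of y] by (simp add: ln_mult ln_powr)
  qed
  moreover have "(\<integral>\<^sup>+ x. ennreal (h x) \<partial>gauss_measure) = (\<integral>\<^sup>+ z. ennreal (exp (L (sqrt p *\<^sub>R z))) \<partial>gauss_measure)"
    unfolding h using gauss_conv[of \<kappa> 1 "sqrt p" "\<lambda>w. ennreal (exp (L w))"] k p by simp
  moreover have "ennreal (A powr (1 / p)) = (\<integral>\<^sup>+ z. ennreal (exp (p * L z)) \<partial>gauss_measure) epowr (1 / p)"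
    unfolding A(1) using A(2) by (simp add: epowr_ennreal)
  ultimately show ?thesis by simp
qed

text \<open>Janson's strong hypercontractivity. The powers \<open>u\<^sup>e\<close> of a log-subharmonic \<open>u\<close> are subharmonic for
  all \<open>e > 0\<close>; the claim is the limit \<open>e \<rightarrow> 0\<close> of hypercontractivity for \<open>u\<^sup>e\<close>.\<close>

theorem log_subharmonic_dilation:
  fixes L :: "real ^ 'n \<Rightarrow> real" and D :: "real ^ 'n \<Rightarrow> real ^ 'n"
  assumes L: "\<And>x. (L has_derivative (\<lambda>v. D x \<bullet> v)) (at x)"
    and D: "\<And>x. (D has_derivative D' x) (at x)" and lap: "\<And>x. 0 \<le> (\<Sum>i\<in>Basis. D' x i \<bullet> i)"
    and \<rho>: "0 < \<rho>" "\<rho> < 1" and Q: "0 < Q" and \<delta>: "0 < \<delta>"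
    and fin: "(\<integral>\<^sup>+ x. ennreal (exp ((\<rho>\<^sup>2 * Q + \<delta>) * L x)) \<partial>gauss_measure) < \<infinity>"
  shows "Lq_gauss Q (\<lambda>x. ennreal (exp (L (\<rho> *\<^sub>R x)))) \<le> Lq_gauss (\<rho>\<^sup>2 * Q) (\<lambda>x. ennreal (exp (L x)))"
proof -
  have Lc: "continuous_on UNIV L"
    using has_derivative_continuous[OF L] by (simp add: continuous_on_eq_continuous_at)
  have [measurable]: "L \<in> borel_measurable borel" using Lc by (rule borel_measurable_continuous_onI)
  define \<rho>' where "\<rho>' = sqrt (1 - \<rho>\<^sup>2)"
  have r2: "\<rho>\<^sup>2 < 1" using \<rho> by (simp add: power_less_one_iff abs_square_less_1)
  have \<rho>': "\<rho>' > 0" "\<rho>\<^sup>2 + \<rho>'\<^sup>2 = 1" using r2 by (auto simp: \<rho>'_def)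
  \<comment> \<open>Chosen so that q = Q/e and p = P(e)/e satisfy p - 1 = \<rho>^2 (q - 1). As e
    decreases to 0, P(e) decreases to \<rho>^2 Q.\<close>
  define P where "P = (\<lambda>e. \<rho>\<^sup>2 * Q + e * (1 - \<rho>\<^sup>2))"
  have exp_epowr: "ennreal (exp (e * y)) = ennreal (exp y) epowr e" for e y :: real
    by (simp add: epowr_ennreal powr_def)
  have step: "Lq_gauss Q (\<lambda>x. ennreal (exp (L (\<rho> *\<^sub>R x)))) \<le> Lq_gauss (P e) (\<lambda>x. ennreal (exp (L x)))" if e: "0 < e" "e \<le> Q" for e
  proof -
    define q where "q = Q / e"
    define p where "p = P e / e"
    have q: "q \<ge> 1" "q \<noteq> 0" using e Q by (auto simp: q_def)
    have Pe: "P e > 0" unfolding P_def using e r2 Q \<rho> by (intro add_pos_pos mult_pos_pos) auto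
    have p: "p - 1 = \<rho>\<^sup>2 * (q - 1)" "p \<noteq> 0" using e Pe by (auto simp: p_def q_def P_def field_simps)
    \<comment> \<open>Subharmonicity bounds exp(e L) at \<rho> x by its average around that point,
      and hypercontractivity then applies to the average.\<close>
    have "Lq_gauss q (\<lambda>x. ennreal (exp (e * L (\<rho> *\<^sub>R x)))) \<le> Lq_gauss q (avg \<rho> \<rho>' (\<lambda>x. ennreal (exp (e * L x))))"
      unfolding avg_def using q \<rho>' e
      by (intro Lq_gauss_mono log_subharmonic_powr_le_gauss_average[OF L D lap]) auto
    also have "\<dots> \<le> Lq_gauss p (\<lambda>x. ennreal (exp (e * L x)))"
      by (rule hypercontractivity(1)[OF \<rho>'(2,1) p q(2) _ _ q(1)]) (auto intro!: continuous_intros Lc)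
    finally have "Lq_gauss (e * q) (\<lambda>x. ennreal (exp (L (\<rho> *\<^sub>R x)))) epowr e \<le> Lq_gauss (e * p) (\<lambda>x. ennreal (exp (L x))) epowr e"
      unfolding exp_epowr using e p q by (simp add: Lq_gauss_powr)
    then have "(Lq_gauss (e * q) (\<lambda>x. ennreal (exp (L (\<rho> *\<^sub>R x)))) epowr e) epowr (1 / e) \<le> (Lq_gauss (e * p) (\<lambda>x. ennreal (exp (L x))) epowr e) epowr (1 / e)"
      using e by (intro epowr_mono[of "1 / e"]) auto
    then show ?thesis using e by (simp add: epowr_epowr q_def p_def)
  qed
  \<comment> \<open>e <= Q gives q >= 1, and e <= \<delta> keeps P(e) in the range where
    \<open>fin\<close> provides an integrable majorant.\<close>
  define e where "e = (\<lambda>k::nat. min Q \<delta> / (real k + 1))"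
  have e: "0 < e k" "e k \<le> Q" "e k \<le> \<delta>" for k
  proof -
    have "min Q \<delta> / (real k + 1) \<le> min Q \<delta> / 1" using Q \<delta> by (intro divide_left_mono) auto
    then show "e k \<le> Q" "e k \<le> \<delta>" by (auto simp: e_def)
  qed (use Q \<delta> in \<open>simp add: e_def\<close>)
  have el: "e \<longlonglongrightarrow> 0" unfolding e_def by real_asymp
  define p0 where "p0 = \<rho>\<^sup>2 * Q"
  have p0: "p0 > 0" using \<rho> Q by (simp add: p0_def)
  have Pk: "p0 \<le> P (e k)" "P (e k) \<le> p0 + \<delta>" for k
  proof -
    have "e k * (1 - \<rho>\<^sup>2) \<le> \<delta> * 1" using e[of k] r2 by (intro mult_mono) auto
    then show "p0 \<le> P (e k)" "P (e k) \<le> p0 + \<delta>" using e[of k] r2 by (auto simp: P_def p0_def)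
  qed
  have Pl: "(\<lambda>k. P (e k)) \<longlonglongrightarrow> p0"
  proof -
    have "(\<lambda>k. \<rho>\<^sup>2 * Q + e k * (1 - \<rho>\<^sup>2)) \<longlonglongrightarrow> \<rho>\<^sup>2 * Q + 0 * (1 - \<rho>\<^sup>2)" by (intro tendsto_intros el)
    then show ?thesis by (simp add: P_def p0_def)
  qed
  define W where "W = (\<lambda>x. 1 + exp ((p0 + \<delta>) * L x))"
  have Wb: "exp (r * L x) \<le> W x" if "0 \<le> r" "r \<le> p0 + \<delta>" for r x
  proof (cases "L x \<ge> 0")
    case True
    then have "r * L x \<le> (p0 + \<delta>) * L x" using that by (intro mult_right_mono) auto
    then show ?thesis by (simp add: W_def add_increasing)
  next
    case False
    then have "r * L x \<le> 0" using that by (simp add: mult_nonneg_nonpos)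
    then show ?thesis by (simp add: W_def add_increasing2)
  qed
  have Wi: "integrable gauss_measure W"
  proof -
    have "integrable gauss_measure (\<lambda>x. exp ((p0 + \<delta>) * L x))"
      by (rule integrableI_nonneg) (use fin in \<open>auto simp: p0_def\<close>)
    then show ?thesis unfolding W_def by (intro Bochner_Integration.integrable_add) auto
  qed
  have ri: "integrable gauss_measure (\<lambda>x. exp (r * L x))" if "0 \<le> r" "r \<le> p0 + \<delta>" for r
    by (rule Bochner_Integration.integrable_bound[OF Wi])
       (use Wb[OF that] in \<open>auto intro!: AE_I2 order_trans[OF Wb[OF that] abs_ge_self]\<close>)
  define J where "J = (\<lambda>r. \<integral> x. exp (r * L x) \<partial>gauss_measure)"
  have Jl: "(\<lambda>k. J (P (e k))) \<longlonglongrightarrow> J p0" unfolding J_def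
  proof (rule integral_dominated_convergence[OF _ _ Wi])
    show "AE x in gauss_measure. (\<lambda>k. exp (P (e k) * L x)) \<longlonglongrightarrow> exp (p0 * L x)"
      by (intro AE_I2 tendsto_intros Pl)
    show "AE x in gauss_measure. norm (exp (P (e k) * L x)) \<le> W x" for k
      using Pk[of k] p0 by (auto intro!: AE_I2 Wb)
  qed auto
  have Lq: "Lq_gauss r (\<lambda>x. ennreal (exp (L x))) = ennreal (J r powr (1 / r))" and Jpos: "J r > 0" if "0 < r" "r \<le> p0 + \<delta>" for r
  proof -
    have i: "(\<integral>\<^sup>+ x. ennreal (exp (r * L x)) \<partial>gauss_measure) = ennreal (J r)"
      unfolding J_def using ri[of r] that by (intro nn_integral_eq_integral) auto
    show "J r > 0"
    proof (rule ccontr)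
      assume "\<not> J r > 0"
      then have "(\<integral>\<^sup>+ x. ennreal (exp (r * L x)) \<partial>gauss_measure) = 0" unfolding i by (simp add: ennreal_neg)
      then have "AE x in (gauss_measure :: (real ^ 'n) measure). ennreal (exp (r * L x)) = 0" by (subst (asm) nn_integral_0_iff_AE) auto
      then have "AE x in (gauss_measure :: (real ^ 'n) measure). False" by simp
      then show False by (simp add: G.AE_False)
    qed
    then show "Lq_gauss r (\<lambda>x. ennreal (exp (L x))) = ennreal (J r powr (1 / r))"
      unfolding Lq_gauss_def exp_epowr[symmetric] i by (simp add: epowr_ennreal)
  qed
  have "(\<lambda>k. ennreal (J (P (e k)) powr (1 / P (e k)))) \<longlonglongrightarrow> ennreal (J p0 powr (1 / p0))"
    using Jpos[of p0] p0 \<delta> by (intro tendsto_ennrealI tendsto_powr tendsto_divide Jl Pl tendsto_const) auto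
  then have "Lq_gauss Q (\<lambda>x. ennreal (exp (L (\<rho> *\<^sub>R x)))) \<le> ennreal (J p0 powr (1 / p0))"
  proof (rule LIMSEQ_le_const, intro exI[of _ 0] allI impI)
    fix k
    have "0 < P (e k)" using Pk(1)[of k] p0 by linarith
    from step[OF e(1,2), of k] Lq[OF this Pk(2)]
    show "Lq_gauss Q (\<lambda>x. ennreal (exp (L (\<rho> *\<^sub>R x)))) \<le> ennreal (J (P (e k)) powr (1 / P (e k)))" by simp
  qed
  also have "\<dots> = Lq_gauss p0 (\<lambda>x. ennreal (exp (L x)))" using Lq[OF p0] \<delta> by simp
  finally show ?thesis by (simp add: p0_def)
qed

section \<open>Removing the Gaussian factor\<close>

lemma avg_cmult:
  fixes f :: "real ^ 'n \<Rightarrow> ennreal"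
  assumes [measurable]: "f \<in> borel_measurable borel"
  shows "avg a b (\<lambda>x. c * f x) x = c * avg a b f x"
  unfolding avg_def by (rule nn_integral_cmult) measurable

lemma Lq_gauss_cmult:
  fixes g :: "real ^ 'n \<Rightarrow> ennreal"
  assumes k: "k > 0" and q: "q \<noteq> 0" and [measurable]: "g \<in> borel_measurable borel"
  shows "Lq_gauss q (\<lambda>x. ennreal k * g x) = ennreal k * Lq_gauss q g"
proof -
  have "Lq_gauss q (\<lambda>x. ennreal k * g x) = (\<integral>\<^sup>+ x. ennreal (k powr q) * g x epowr q \<partial>gauss_measure) epowr (1 / q)"
    unfolding Lq_gauss_def using k by (simp add: epowr_mult epowr_ennreal ennreal_eq_0_iff)
  also have "\<dots> = (ennreal (k powr q) * (\<integral>\<^sup>+ x. g x epowr q \<partial>gauss_measure)) epowr (1 / q)"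
    by (subst nn_integral_cmult) auto
  also have "\<dots> = ennreal ((k powr q) powr (1 / q)) * Lq_gauss q g"
    unfolding Lq_gauss_def using k by (simp add: epowr_mult epowr_ennreal ennreal_eq_0_iff)
  finally show ?thesis using k q by (simp add: powr_powr)
qed

text \<open>Completing the square in y moves the Gaussian factor out of the average, at the price of
  a Gaussian factor in x and of the new parameters a/\<theta> and b/sqrt \<theta>. The integral over
  y converges because \<open>\<theta> > 0\<close>.\<close>

lemma avg_tilt:
  fixes f :: "real ^ 'n \<Rightarrow> ennreal"
  assumes \<theta>: "\<theta> = 1 - \<kappa> * b\<^sup>2" "\<theta> > 0" and [measurable]: "f \<in> borel_measurable borel"
  shows "avg a b (\<lambda>x. ennreal (exp (\<kappa> * (norm x)\<^sup>2 / 2)) * f x) x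
    = ennreal (\<theta> powr (- real CARD('n) / 2)) * (ennreal (exp (\<kappa> * a\<^sup>2 / \<theta> * (norm x)\<^sup>2 / 2)) * avg (a / \<theta>) (b / sqrt \<theta>) f x)"
proof -
  define m where "m = (\<kappa> * a * b) *\<^sub>R x"
  have e: "exp (\<kappa> * (norm (a *\<^sub>R x + b *\<^sub>R y))\<^sup>2 / 2) = exp (\<kappa> * a\<^sup>2 * (norm x)\<^sup>2 / 2) * exp (m \<bullet> y + (1 - \<theta>) * (norm y)\<^sup>2 / 2)" for y
    unfolding exp_add[symmetric] power2_norm_eq_inner m_def \<theta>(1)
    by (simp add: inner_add_left inner_add_right inner_commute power2_eq_square algebra_simps add_divide_distrib)
  have c: "a + b * (1 / \<theta>) * (\<kappa> * a * b) = a / \<theta>"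
  proof -
    have "a * \<theta> + b * (\<kappa> * a * b) = a" unfolding \<theta>(1) by (simp add: power2_eq_square algebra_simps)
    then show ?thesis using \<theta>(2) by (simp add: field_simps)
  qed
  have arg: "a *\<^sub>R x + b *\<^sub>R ((1 / \<theta>) *\<^sub>R m + (1 / sqrt \<theta>) *\<^sub>R y) = (a / \<theta>) *\<^sub>R x + (b / sqrt \<theta>) *\<^sub>R y" for y
    unfolding c[symmetric] m_def by (simp add: scaleR_add_left scaleR_add_right)
  have "avg a b (\<lambda>x. ennreal (exp (\<kappa> * (norm x)\<^sup>2 / 2)) * f x) x
     = (\<integral>\<^sup>+ y. ennreal (exp (\<kappa> * a\<^sup>2 * (norm x)\<^sup>2 / 2)) * (ennreal (exp (m \<bullet> y + (1 - \<theta>) * (norm y)\<^sup>2 / 2)) * f (a *\<^sub>R x + b *\<^sub>R y)) \<partial>gauss_measure)"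
    unfolding avg_def e by (simp add: ennreal_mult mult.assoc)
  also have "\<dots> = ennreal (exp (\<kappa> * a\<^sup>2 * (norm x)\<^sup>2 / 2)) * (\<integral>\<^sup>+ y. ennreal (exp (m \<bullet> y + (1 - \<theta>) * (norm y)\<^sup>2 / 2)) * f (a *\<^sub>R x + b *\<^sub>R y) \<partial>gauss_measure)"
    by (rule nn_integral_cmult) measurable
  also have "(\<integral>\<^sup>+ y. ennreal (exp (m \<bullet> y + (1 - \<theta>) * (norm y)\<^sup>2 / 2)) * f (a *\<^sub>R x + b *\<^sub>R y) \<partial>gauss_measure)
     = ennreal (\<theta> powr (- real CARD('n) / 2) * exp ((norm m)\<^sup>2 / (2 * \<theta>))) * avg (a / \<theta>) (b / sqrt \<theta>) f x"
    unfolding avg_def by (subst gauss_tilt[OF \<theta>(2)]) (simp_all only: arg, measurable)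
  also have "ennreal (exp (\<kappa> * a\<^sup>2 * (norm x)\<^sup>2 / 2)) * (ennreal (\<theta> powr (- real CARD('n) / 2) * exp ((norm m)\<^sup>2 / (2 * \<theta>))) * avg (a / \<theta>) (b / sqrt \<theta>) f x)
     = ennreal (\<theta> powr (- real CARD('n) / 2)) * (ennreal (exp (\<kappa> * a\<^sup>2 * (norm x)\<^sup>2 / 2) * exp ((norm m)\<^sup>2 / (2 * \<theta>))) * avg (a / \<theta>) (b / sqrt \<theta>) f x)"
    by (simp add: ennreal_mult mult_ac)
  also have "exp (\<kappa> * a\<^sup>2 * (norm x)\<^sup>2 / 2) * exp ((norm m)\<^sup>2 / (2 * \<theta>)) = exp (\<kappa> * a\<^sup>2 / \<theta> * (norm x)\<^sup>2 / 2)"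
  proof -
    have "\<kappa> * a\<^sup>2 * \<theta> + \<kappa> * a\<^sup>2 * (\<kappa> * b\<^sup>2) = \<kappa> * a\<^sup>2" unfolding \<theta>(1) by (simp add: algebra_simps)
    then have "\<kappa> * a\<^sup>2 * n / 2 + (\<kappa> * a * b)\<^sup>2 * n / (2 * \<theta>) = \<kappa> * a\<^sup>2 / \<theta> * n / 2" for n
      using \<theta>(2) by (simp add: field_simps power2_eq_square) algebra
    from this[of "(norm x)\<^sup>2"] show ?thesis by (simp add: m_def exp_add[symmetric] power_mult_distrib)
  qed
  finally show ?thesis .
qed

text \<open>The same completion of squares for the outer integral, where the power q multiplies
  \<mu>; a dilation of g is left over.\<close>

lemma Lq_gauss_tilt:
  fixes g :: "real ^ 'n \<Rightarrow> ennreal"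
  assumes \<theta>: "1 - q * \<mu> > 0" and q: "q \<noteq> 0" and [measurable]: "g \<in> borel_measurable borel"
  shows "Lq_gauss q (\<lambda>x. ennreal (exp (\<mu> * (norm x)\<^sup>2 / 2)) * g x)
    = ennreal (((1 - q * \<mu>) powr (- real CARD('n) / 2)) powr (1 / q)) * Lq_gauss q (\<lambda>x. g ((1 / sqrt (1 - q * \<mu>)) *\<^sub>R x))"
proof -
  have "(ennreal (exp (\<mu> * (norm x)\<^sup>2 / 2)) * g x) epowr q
      = ennreal (exp (0 \<bullet> x + (1 - (1 - q * \<mu>)) * (norm x)\<^sup>2 / 2)) * g x epowr q" for x
    by (simp add: epowr_mult epowr_ennreal ennreal_eq_0_iff powr_def mult.assoc)
  then have "(\<integral>\<^sup>+ x. (ennreal (exp (\<mu> * (norm x)\<^sup>2 / 2)) * g x) epowr q \<partial>gauss_measure)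
     = ennreal ((1 - q * \<mu>) powr (- real CARD('n) / 2) * exp ((norm (0 :: real ^ 'n))\<^sup>2 / (2 * (1 - q * \<mu>))))
       * (\<integral>\<^sup>+ x. g ((1 / (1 - q * \<mu>)) *\<^sub>R 0 + (1 / sqrt (1 - q * \<mu>)) *\<^sub>R x) epowr q \<partial>gauss_measure)"
    by (simp only:) (rule gauss_tilt[OF \<theta>, of "\<lambda>x. g x epowr q" 0], measurable)
  then show ?thesis unfolding Lq_gauss_def using \<theta>
    by (simp add: epowr_mult epowr_ennreal ennreal_eq_0_iff)
qed

text \<open>Two tilts, one in the average and one in the norm, remove the quotient of
  \<open>gauss \<beta>\<close> by \<open>gauss 1\<close>. The point is that C precedes v: the choice
  v = \<open>gauss \<beta>\<close> later identifies it as the constant of the theorem.\<close>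

lemma OU_gaussian_reduction:
  fixes s p q \<beta> :: real
  defines "E \<equiv> exp (- 2 * s)"
  defines "\<theta> \<equiv> 1 - (1 - 1 / \<beta>) / p * (1 - E)"
  assumes s: "s > 0" and \<beta>: "\<beta> > 0" and pq: "p \<noteq> 0" "q \<noteq> 0" "q * E + (1 - E) = p" and \<theta>: "\<theta> > 0"
  shows "\<exists>C>0. \<forall>v :: real ^ 'n \<Rightarrow> real. continuous_on UNIV v \<longrightarrow> (\<forall>x. 0 < v x) \<longrightarrow>
      Lq_gauss q (OU s (\<lambda>x. ennreal ((v x / gauss 1 x) powr (1 / p))))
      = ennreal C * Lq_gauss q (avg (sqrt (E / \<theta>)) (sqrt ((1 - E) / (\<theta> * \<beta>)))
          (\<lambda>x. ennreal (exp (ln (v (sqrt \<beta> *\<^sub>R x) / gauss \<beta> (sqrt \<beta> *\<^sub>R x)) / p))))"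
proof -
  define \<kappa> where "\<kappa> = (1 - 1 / \<beta>) / p"
  define a where "a = exp (- s)"
  define b where "b = sqrt (1 - E)"
  have E: "0 < E" "E < 1" using s by (auto simp: E_def)
  have a: "a > 0" "a\<^sup>2 = E" by (auto simp: a_def E_def power2_eq_square exp_add[symmetric])
  have b: "b > 0" "b\<^sup>2 = 1 - E" using E by (auto simp: b_def)
  have \<theta>': "\<theta> = 1 - \<kappa> * b\<^sup>2" by (simp add: \<theta>_def \<kappa>_def b)
  \<comment> \<open>The parameter of the second tilt. The relation q E + (1 - E) = p collapses it to
    1/(\<beta> \<theta>), so it is positive together with \<theta>.\<close>
  define \<eta> where "\<eta> = 1 - q * (\<kappa> * a\<^sup>2 / \<theta>)"
  have \<eta>: "\<eta> = 1 / (\<beta> * \<theta>)" "\<eta> > 0"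
  proof -
    have "\<theta> * \<eta> = \<theta> - q * \<kappa> * E" using \<theta> by (simp add: \<eta>_def a algebra_simps)
    also have "\<dots> = 1 - \<kappa> * p" unfolding \<theta>' b pq(3)[symmetric] by (simp add: algebra_simps)
    also have "\<dots> = 1 / \<beta>" using pq by (simp add: \<kappa>_def)
    finally show "\<eta> = 1 / (\<beta> * \<theta>)" using \<theta> \<beta> by (simp add: field_simps)
    then show "\<eta> > 0" using \<theta> \<beta> by simp
  qed
  define c where "c = \<beta> powr (- real CARD('n) / 2 / p)"
  define C1 where "C1 = \<theta> powr (- real CARD('n) / 2)"
  define C2 where "C2 = (\<eta> powr (- real CARD('n) / 2)) powr (1 / q)"
  have pos: "c > 0" "C1 > 0" "C2 > 0" using \<beta> \<theta> \<eta> by (auto simp: c_def C1_def C2_def)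
  show ?thesis
  proof (intro exI[of _ "c * C1 * C2"] conjI allI impI)
    show "c * C1 * C2 > 0" using pos by simp
    fix v :: "real ^ 'n \<Rightarrow> real" assume vc: "continuous_on UNIV v" and "\<forall>x. 0 < v x"
    then have vp: "0 < v x" for x by simp
    define f where "f = (\<lambda>x. ennreal (exp (ln (v x / gauss \<beta> x) / p)))"
    have [measurable]: "v \<in> borel_measurable borel" using vc by (rule borel_measurable_continuous_onI)
    have [measurable]: "f \<in> borel_measurable borel" unfolding f_def by measurable
    have [measurable]: "(\<lambda>x :: real ^ 'n. norm x) \<in> borel_measurable borel" by measurable
    have "ennreal ((v x / gauss 1 x) powr (1 / p)) = ennreal c * (ennreal (exp (\<kappa> * (norm x)\<^sup>2 / 2)) * f x)" for x
    proof -
      have "v x / gauss 1 x = (v x / gauss \<beta> x) * (\<beta> powr (- real CARD('n) / 2) * exp ((1 - 1 / \<beta>) * (norm x)\<^sup>2 / 2))"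
      proof -
        have "gauss \<beta> x = gauss 1 x * (\<beta> powr (- real CARD('n) / 2) * exp ((1 - 1 / \<beta>) * (norm x)\<^sup>2 / 2))"
        proof -
          have "exp (- (norm x)\<^sup>2 / (2 * \<beta>)) = exp (- (norm x)\<^sup>2 / 2) * exp ((1 - 1 / \<beta>) * (norm x)\<^sup>2 / 2)"
            using \<beta> by (simp add: exp_add[symmetric] field_simps)
          then show ?thesis using \<beta> by (simp add: gauss_def powr_mult)
        qed
        then show ?thesis using \<beta> gauss_pos[OF \<beta>, of x] by simp
      qed
      note e1 = this
      have e2: "exp ((1 - 1 / \<beta>) * (norm x)\<^sup>2 / 2) powr (1 / p) = exp (\<kappa> * (norm x)\<^sup>2 / 2)"
        by (simp add: powr_def \<kappa>_def)
      have e3: "(\<beta> powr (- real CARD('n) / 2)) powr (1 / p) = c" by (simp add: c_def powr_powr)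
      have e4: "(v x / gauss \<beta> x) powr (1 / p) = exp (ln (v x / gauss \<beta> x) / p)"
        using vp[of x] gauss_pos[OF \<beta>, of x] by (simp add: powr_def)
      have "(A * (M * N)) powr e = M powr e * (N powr e * A powr e)" if "A \<ge> 0" "M \<ge> 0" "N \<ge> 0" for A M N e :: real
        using that by (simp add: powr_mult mult_ac)
      from this[of "v x / gauss \<beta> x" "\<beta> powr (- real CARD('n) / 2)" "exp ((1 - 1 / \<beta>) * (norm x)\<^sup>2 / 2)" "1 / p"]
      have "(v x / gauss 1 x) powr (1 / p) = c * (exp (\<kappa> * (norm x)\<^sup>2 / 2) * exp (ln (v x / gauss \<beta> x) / p))"
        using vp[of x] unfolding e1 e2 e3 e4 by (simp add: less_imp_le)
      then show ?thesis using pos by (simp add: f_def ennreal_mult)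
    qed
    then have pw: "(\<lambda>x. ennreal ((v x / gauss 1 x) powr (1 / p))) = (\<lambda>x. ennreal c * (ennreal (exp (\<kappa> * (norm x)\<^sup>2 / 2)) * f x))"
      by (rule ext)
    have "OU s (\<lambda>x. ennreal ((v x / gauss 1 x) powr (1 / p)))
       = (\<lambda>x. ennreal c * (ennreal C1 * (ennreal (exp (\<kappa> * a\<^sup>2 / \<theta> * (norm x)\<^sup>2 / 2)) * avg (a / \<theta>) (b / sqrt \<theta>) f x)))"
    proof
      fix x :: "real ^ 'n"
      have "OU s (\<lambda>x. ennreal ((v x / gauss 1 x) powr (1 / p))) x = avg a b (\<lambda>x. ennreal c * (ennreal (exp (\<kappa> * (norm x)\<^sup>2 / 2)) * f x)) x"
        unfolding pw OU_eq_avg a_def b_def E_def ..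
      also have "\<dots> = ennreal c * avg a b (\<lambda>x. ennreal (exp (\<kappa> * (norm x)\<^sup>2 / 2)) * f x) x" by (rule avg_cmult) measurable
      also have "avg a b (\<lambda>x. ennreal (exp (\<kappa> * (norm x)\<^sup>2 / 2)) * f x) x
         = ennreal C1 * (ennreal (exp (\<kappa> * a\<^sup>2 / \<theta> * (norm x)\<^sup>2 / 2)) * avg (a / \<theta>) (b / sqrt \<theta>) f x)"
        unfolding C1_def by (rule avg_tilt[OF \<theta>' \<theta>]) measurable
      finally show "OU s (\<lambda>x. ennreal ((v x / gauss 1 x) powr (1 / p))) x
         = ennreal c * (ennreal C1 * (ennreal (exp (\<kappa> * a\<^sup>2 / \<theta> * (norm x)\<^sup>2 / 2)) * avg (a / \<theta>) (b / sqrt \<theta>) f x))" .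
    qed
    note OU_eq = this
    have "Lq_gauss q (\<lambda>x. ennreal c * (ennreal C1 * G x)) = ennreal c * (ennreal C1 * Lq_gauss q G)"
      if [measurable]: "G \<in> borel_measurable borel" for G :: "real ^ 'n \<Rightarrow> ennreal"
      using Lq_gauss_cmult[OF pos(1) pq(2), of "\<lambda>x. ennreal C1 * G x"] Lq_gauss_cmult[OF pos(2) pq(2), of G] by simp
    then have "Lq_gauss q (OU s (\<lambda>x. ennreal ((v x / gauss 1 x) powr (1 / p))))
      = ennreal c * (ennreal C1 * Lq_gauss q (\<lambda>x. ennreal (exp (\<kappa> * a\<^sup>2 / \<theta> * (norm x)\<^sup>2 / 2)) * avg (a / \<theta>) (b / sqrt \<theta>) f x))"
      unfolding OU_eq by this measurable
    also have "Lq_gauss q (\<lambda>x. ennreal (exp (\<kappa> * a\<^sup>2 / \<theta> * (norm x)\<^sup>2 / 2)) * avg (a / \<theta>) (b / sqrt \<theta>) f x)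
      = ennreal C2 * Lq_gauss q (\<lambda>x. avg (a / \<theta>) (b / sqrt \<theta>) f ((1 / sqrt \<eta>) *\<^sub>R x))"
      unfolding C2_def \<eta>_def by (rule Lq_gauss_tilt) (use \<eta>(2) pq in \<open>auto simp only: \<eta>_def\<close>, measurable)
    also have "ennreal c * (ennreal C1 * (ennreal C2 * Lq_gauss q (\<lambda>x. avg (a / \<theta>) (b / sqrt \<theta>) f ((1 / sqrt \<eta>) *\<^sub>R x))))
      = ennreal (c * C1 * C2) * Lq_gauss q (\<lambda>x. avg (a / \<theta>) (b / sqrt \<theta>) f ((1 / sqrt \<eta>) *\<^sub>R x))"
      using pos by (simp add: ennreal_mult mult.assoc)
    also have "(\<lambda>x. avg (a / \<theta>) (b / sqrt \<theta>) f ((1 / sqrt \<eta>) *\<^sub>R x))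
      = avg (sqrt (E / \<theta>)) (sqrt ((1 - E) / (\<theta> * \<beta>))) (\<lambda>x. f (sqrt \<beta> *\<^sub>R x))"
    proof -
      \<comment> \<open>The dilation 1/sqrt \<eta> = sqrt(\<beta> \<theta>) brings out of both
        parameters a common factor sqrt \<beta>, which is moved into the argument of f.\<close>
      have "a = sqrt E" using a by (simp add: real_sqrt_unique[symmetric])
      then have 1: "a / \<theta> * (1 / sqrt \<eta>) = sqrt \<beta> * sqrt (E / \<theta>)"
        using \<theta> \<beta> unfolding \<eta>(1) by (simp add: real_sqrt_divide real_sqrt_mult real_div_sqrt field_simps)
      have 2: "b / sqrt \<theta> = sqrt \<beta> * sqrt ((1 - E) / (\<theta> * \<beta>))"
        using \<theta> \<beta> by (simp add: b_def real_sqrt_divide real_sqrt_mult)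
      have "f ((a / \<theta>) *\<^sub>R (1 / sqrt \<eta>) *\<^sub>R x + (b / sqrt \<theta>) *\<^sub>R y)
        = f (sqrt \<beta> *\<^sub>R (sqrt (E / \<theta>) *\<^sub>R x + sqrt ((1 - E) / (\<theta> * \<beta>)) *\<^sub>R y))" for x y
        unfolding scaleR_scaleR scaleR_add_right 1 2 ..
      then show ?thesis by (simp only: avg_def fun_eq_iff simp_thms)
    qed
    finally show "Lq_gauss q (OU s (\<lambda>x. ennreal ((v x / gauss 1 x) powr (1 / p))))
      = ennreal (c * C1 * C2) * Lq_gauss q (avg (sqrt (E / \<theta>)) (sqrt ((1 - E) / (\<theta> * \<beta>)))
          (\<lambda>x. ennreal (exp (ln (v (sqrt \<beta> *\<^sub>R x) / gauss \<beta> (sqrt \<beta> *\<^sub>R x)) / p))))"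
      by (simp only: f_def)
  qed
qed

lemma nn_integral_gauss_scale:
  fixes h :: "real ^ 'n \<Rightarrow> ennreal"
  assumes \<beta>: "\<beta> > 0" and [measurable]: "h \<in> borel_measurable borel"
  shows "(\<integral>\<^sup>+ x. ennreal (gauss \<beta> x) * h x \<partial>lborel) = (\<integral>\<^sup>+ x. h (sqrt \<beta> *\<^sub>R x) \<partial>gauss_measure)"
proof -
  have "(\<integral>\<^sup>+ x. ennreal (gauss \<beta> x) * h x \<partial>lborel)
     = ennreal (\<bar>sqrt \<beta>\<bar> ^ CARD('n)) * (\<integral>\<^sup>+ x. ennreal (gauss \<beta> (0 + sqrt \<beta> *\<^sub>R x)) * h (0 + sqrt \<beta> *\<^sub>R x) \<partial>lborel)"
    by (rule nn_integral_lborel_scale) (use \<beta> in auto)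
  also have "\<dots> = (\<integral>\<^sup>+ x. ennreal (\<bar>sqrt \<beta>\<bar> ^ CARD('n)) * (ennreal (gauss \<beta> (0 + sqrt \<beta> *\<^sub>R x)) * h (0 + sqrt \<beta> *\<^sub>R x)) \<partial>lborel)"
    by (rule nn_integral_cmult[symmetric]) measurable
  also have "\<dots> = (\<integral>\<^sup>+ x. ennreal (gauss 1 x) * h (sqrt \<beta> *\<^sub>R x) \<partial>lborel)"
  proof (intro nn_integral_cong)
    fix x :: "real ^ 'n"
    have "sqrt \<beta> ^ CARD('n) * \<beta> powr (- real CARD('n) / 2) = 1"
    proof -
      have "sqrt \<beta> ^ CARD('n) = \<beta> powr (real CARD('n) / 2)"
        using \<beta> by (simp add: powr_half_sqrt[symmetric] powr_powr flip: powr_realpow)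
      then show ?thesis using \<beta> by (simp add: powr_add[symmetric])
    qed
    then have "sqrt \<beta> ^ CARD('n) * gauss \<beta> (sqrt \<beta> *\<^sub>R x) = gauss 1 x"
      using \<beta> by (simp add: gauss_def powr_mult power_mult_distrib)
    then show "ennreal (\<bar>sqrt \<beta>\<bar> ^ CARD('n)) * (ennreal (gauss \<beta> (0 + sqrt \<beta> *\<^sub>R x)) * h (0 + sqrt \<beta> *\<^sub>R x)) = ennreal (gauss 1 x) * h (sqrt \<beta> *\<^sub>R x)"
      using \<beta> by (simp add: mult.assoc[symmetric] ennreal_mult[symmetric])
  qed
  also have "\<dots> = (\<integral>\<^sup>+ x. h (sqrt \<beta> *\<^sub>R x) \<partial>gauss_measure)" by (subst nn_integral_gauss_measure) auto
  finally show ?thesis .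
qed

section \<open>Derivatives of semi-log-subharmonic and semi-log-concave functions\<close>

lemma gradient_eq: "GDERIV f x :> D \<Longrightarrow> gradient f x = D"
  unfolding gradient_def
proof (rule the_equality)
  fix D' assume "GDERIV f x :> D" "GDERIV f x :> D'"
  then have "(\<lambda>h. h \<bullet> D') = (\<lambda>h. h \<bullet> D)" unfolding gderiv_def by (rule has_derivative_unique[rotated])
  then show "D' = D" by (metis vector_eq_ldot)
qed

lemma GDERIV_gradient: "f differentiable (at x) \<Longrightarrow> GDERIV f x :> gradient f x"
proof -
  assume "f differentiable (at x)"
  then obtain f' where f': "(f has_derivative f') (at x)" by (auto simp: differentiable_def)
  then have "GDERIV f x :> adjoint f' 1"
    unfolding gderiv_def by (simp add: adjoint_works[OF has_derivative_linear[OF f']])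
  then show ?thesis using gradient_eq by metis
qed

text \<open>Up to a constant the function is ln v(sqrt \<beta> x) + |x|^2/2, so its Hessian is
  \<beta> times that of ln v plus the identity. The two assumptions on v thus become a nonnegative
  Laplacian and a nonpositive Hessian.\<close>

lemma ln_ratio_derivatives:
  fixes v :: "real ^ 'n \<Rightarrow> real"
  assumes \<beta>: "\<beta> > 0" and pos: "\<And>x. v x > 0" and v: "twice_differentiable v"
  defines "w \<equiv> \<lambda>y. ln (v y)"
  defines "D \<equiv> \<lambda>x. sqrt \<beta> *\<^sub>R gradient w (sqrt \<beta> *\<^sub>R x) + x"
  shows "((\<lambda>x. ln (v (sqrt \<beta> *\<^sub>R x) / gauss \<beta> (sqrt \<beta> *\<^sub>R x))) has_derivative (\<lambda>h. D x \<bullet> h)) (at x)"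
    and "(D has_derivative (\<lambda>h. \<beta> *\<^sub>R (hessian w (sqrt \<beta> *\<^sub>R x) *v h) + h)) (at x)"
proof -
  have v1: "v differentiable (at x)" and v2: "gradient v differentiable (at x)" for x
    using v by (auto simp: twice_differentiable_def)
  have gw: "GDERIV w x :> inverse (v x) *\<^sub>R gradient v x" for x
    unfolding w_def using pos by (intro GDERIV_DERIV_compose GDERIV_gradient v1 DERIV_ln)
  then have "gradient w = (\<lambda>x. inverse (v x) *\<^sub>R gradient v x)" by (intro ext gradient_eq)
  moreover have "(\<lambda>x. inverse (v x) *\<^sub>R gradient v x) differentiable (at x)" for x
    using pos[of x] by (intro differentiable_scaleR differentiable_inverse v1 v2) auto
  ultimately have dw: "gradient w differentiable (at x)" for x by simp
  have W: "(w has_derivative (\<lambda>h. gradient w x \<bullet> h)) (at x)" for x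
    using gw[of x] gradient_eq[OF gw] by (simp add: gderiv_def inner_commute)
  have DW: "(gradient w has_derivative (\<lambda>h. hessian w x *v h)) (at x)" for x
    using dw unfolding hessian_def by (simp add: jacobian_works)
  have S: "((\<lambda>x. sqrt \<beta> *\<^sub>R x) has_derivative (\<lambda>h. sqrt \<beta> *\<^sub>R h)) (at x)" for x :: "real ^ 'n"
    by (intro derivative_intros)
  have ln_eq: "ln (v (sqrt \<beta> *\<^sub>R x) / gauss \<beta> (sqrt \<beta> *\<^sub>R x)) = w (sqrt \<beta> *\<^sub>R x) + (x \<bullet> x) / 2 - ln ((2 * pi * \<beta>) powr (- real CARD('n) / 2))" for x
  proof -
    have "gauss \<beta> (sqrt \<beta> *\<^sub>R x) = (2 * pi * \<beta>) powr (- real CARD('n) / 2) * exp (- ((x \<bullet> x) / 2))"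
      using \<beta> by (simp add: gauss_def power_mult_distrib power2_norm_eq_inner)
    moreover have "ln (a / (c * exp (- k))) = ln a + k - ln c" if "a > 0" "c > 0" for a c k :: real
      using that by (simp add: ln_div ln_mult)
    ultimately show ?thesis using pos \<beta> by (simp add: w_def)
  qed
  show "((\<lambda>x. ln (v (sqrt \<beta> *\<^sub>R x) / gauss \<beta> (sqrt \<beta> *\<^sub>R x))) has_derivative (\<lambda>h. D x \<bullet> h)) (at x)"
    unfolding ln_eq D_def
    by (rule derivative_eq_intros has_derivative_compose[OF S W] refl | simp add: inner_add_left inner_add_right inner_commute fun_eq_iff)+
  have "((\<lambda>x. gradient w (sqrt \<beta> *\<^sub>R x)) has_derivative (\<lambda>h. hessian w (sqrt \<beta> *\<^sub>R x) *v (sqrt \<beta> *\<^sub>R h))) (at x)"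
    by (rule has_derivative_compose[OF S DW])
  then have "(D has_derivative (\<lambda>h. sqrt \<beta> *\<^sub>R (hessian w (sqrt \<beta> *\<^sub>R x) *v (sqrt \<beta> *\<^sub>R h)) + h)) (at x)"
    unfolding D_def by (intro has_derivative_add has_derivative_scaleR_right has_derivative_ident)
  then show "(D has_derivative (\<lambda>h. \<beta> *\<^sub>R (hessian w (sqrt \<beta> *\<^sub>R x) *v h) + h)) (at x)"
    using \<beta> by (simp add: matrix_vector_mult_scaleR)
qed

lemma sum_Basis_matrix_vector_mult: "(\<Sum>i\<in>Basis. (A *v i) \<bullet> i) = trace (A :: real ^ 'n ^ 'n)"
proof -
  have Basis: "(Basis :: (real ^ 'n) set) = (\<lambda>k. axis k 1) ` UNIV" by (auto simp: Basis_vec_def)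
  have "(\<Sum>i\<in>Basis. (A *v i) \<bullet> i) = (\<Sum>k\<in>UNIV. (A *v axis k 1) \<bullet> axis k 1)"
    unfolding Basis by (subst sum.reindex) (auto simp: inj_on_def axis_eq_axis)
  then show ?thesis by (simp add: trace_def matrix_vector_mult_basis inner_axis column_def)
qed

lemma mat_matrix_vector_mult: "mat c *v u = c *\<^sub>R (u :: real ^ 'n)"
  by (simp add: vec_eq_iff matrix_vector_mult_def mat_def if_distrib[of "\<lambda>y. y * _"] cong: if_cong)

text \<open>Restriction to lines reduces both claims to one variable. The tangent plane at 0
  provides the affine majorant required by \<open>log_concave_dilation\<close>.\<close>

lemma concave_of_second_derivative:
  fixes L :: "'a :: euclidean_space \<Rightarrow> real"
  assumes L: "\<And>x. (L has_derivative (\<lambda>h. D x \<bullet> h)) (at x)"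
    and D: "\<And>x. (D has_derivative D' x) (at x)" and le: "\<And>x u. u \<bullet> D' x u \<le> 0"
  shows "0 < t \<Longrightarrow> t < 1 \<Longrightarrow> (1 - t) * L x + t * L y \<le> L ((1 - t) *\<^sub>R x + t *\<^sub>R y)"
    and "L y \<le> L 0 + D 0 \<bullet> y"
proof -
  have deriv: "((\<lambda>\<tau>. L (x + \<tau> *\<^sub>R d)) has_real_derivative D (x + \<tau> *\<^sub>R d) \<bullet> d) (at \<tau>)" for x d \<tau>
  proof -
    have l: "((\<lambda>\<tau>. x + \<tau> *\<^sub>R d) has_derivative (\<lambda>\<tau>. \<tau> *\<^sub>R d)) (at \<tau>)" by (auto intro!: derivative_eq_intros)
    from has_derivative_compose[OF l L] show ?thesis by (simp add: has_field_derivative_def mult.commute[of _ "D _ \<bullet> d"])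
  qed
  have conc: "concave_on UNIV (\<lambda>\<tau>. L (x + \<tau> *\<^sub>R d))" for x d
  proof (rule f''_le0_imp_concave[OF _ deriv])
    fix \<tau>
    have l: "((\<lambda>\<tau>. x + \<tau> *\<^sub>R d) has_derivative (\<lambda>\<tau>. \<tau> *\<^sub>R d)) (at \<tau>)" by (auto intro!: derivative_eq_intros)
    have "((\<lambda>\<tau>. D (x + \<tau> *\<^sub>R d) \<bullet> d) has_derivative (\<lambda>\<tau>'. D' (x + \<tau> *\<^sub>R d) (\<tau>' *\<^sub>R d) \<bullet> d)) (at \<tau>)"
      by (intro has_derivative_inner_left has_derivative_compose[OF l D])
    moreover have "D' (x + \<tau> *\<^sub>R d) (\<tau>' *\<^sub>R d) = \<tau>' *\<^sub>R D' (x + \<tau> *\<^sub>R d) d" for \<tau>'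
      using linear_scale[OF has_derivative_linear[OF D]] .
    ultimately show "((\<lambda>\<tau>. D (x + \<tau> *\<^sub>R d) \<bullet> d) has_real_derivative d \<bullet> D' (x + \<tau> *\<^sub>R d) d) (at \<tau>)"
      by (simp add: has_field_derivative_def inner_commute mult.commute[of _ "d \<bullet> _"])
    show "d \<bullet> D' (x + \<tau> *\<^sub>R d) d \<le> 0" by (rule le)
  qed simp
  show "(1 - t) * L x + t * L y \<le> L ((1 - t) *\<^sub>R x + t *\<^sub>R y)" if "0 < t" "t < 1"
    using concave_onD[OF conc, of t 0 1 x "y - x"] that by (simp add: algebra_simps)
  have "convex_on UNIV (\<lambda>\<tau>. - L (0 + \<tau> *\<^sub>R y))" using conc[of 0 y] by (simp add: concave_on_def)
  then have "(- L (0 + 1 *\<^sub>R y)) - (- L (0 + 0 *\<^sub>R y)) \<ge> (- (D (0 + 0 *\<^sub>R y) \<bullet> y)) * (1 - 0)"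
    using DERIV_minus[OF deriv[of 0 y 0]] by (intro convex_on_imp_above_tangent) auto
  then show "L y \<le> L 0 + D 0 \<bullet> y" by simp
qed

section \<open>Norms of dilations\<close>

lemma exp_epowr: "ennreal (exp y) epowr e = ennreal (exp (e * y))"
  by (simp add: epowr_ennreal powr_def)

lemma Lq_gauss_exp_one: "Lq_gauss 1 (\<lambda>x. ennreal (exp (L x))) = (\<integral>\<^sup>+ x. ennreal (exp (L x)) \<partial>gauss_measure)"
  by (simp add: Lq_gauss_def)

text \<open>The dilation is undone by a tilt with \<theta> = 1/r^2. The resulting exponent is a
  convex combination of 2 L, with weight t/2, and of \<alpha> |z|^2/2. The condition t r^2 < 2 means
  \<alpha> < 1, which is the integrability of the Gaussian part.\<close>

lemma exp_dilation_integrable: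
  fixes L :: "real ^ 'n \<Rightarrow> real"
  assumes [measurable]: "L \<in> borel_measurable borel" and r: "r \<ge> 1" and t: "0 < t" "t * r\<^sup>2 < 2"
    and fin: "(\<integral>\<^sup>+ x. ennreal (exp (2 * L x)) \<partial>gauss_measure) < \<infinity>"
  shows "(\<integral>\<^sup>+ x. ennreal (exp (t * L (r *\<^sub>R x))) \<partial>gauss_measure) < \<infinity>"
proof -
  define l where "l = t / 2"
  have r2: "r\<^sup>2 \<ge> 1" using r by simp
  have tr: "t \<le> t * r\<^sup>2" using mult_left_mono[OF r2, of t] t by linarith
  have "0 < r\<^sup>2" using r2 by linarith
  then have l: "0 < l" "l < 1" "l < 1 / r\<^sup>2" unfolding l_def using t tr by (linarith, linarith, simp add: pos_less_divide_eq)
  define \<theta> where "\<theta> = 1 / r\<^sup>2"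
  define \<alpha> where "\<alpha> = (1 - \<theta>) / (1 - l)"
  have \<theta>: "\<theta> > 0" "1 / sqrt \<theta> = r" using r r2 by (auto simp: \<theta>_def real_sqrt_divide)
  have \<alpha>: "\<alpha> < 1" using l by (simp add: \<alpha>_def \<theta>_def field_simps)
  have "exp (0 \<bullet> z + (1 - \<theta>) * (norm z)\<^sup>2 / 2) * exp (t * L z) \<le> exp (2 * L z) + exp (0 \<bullet> z + (1 - (1 - \<alpha>)) * (norm z)\<^sup>2 / 2)" for z
  proof -
    have m: "l * A + (1 - l) * B \<le> max A B" for A B
    proof -
      have "l * A + (1 - l) * B \<le> l * max A B + (1 - l) * max A B" using l by (intro add_mono mult_left_mono) auto
      then show ?thesis by (simp add: algebra_simps)
    qed
    have a: "(1 - l) * \<alpha> = 1 - \<theta>" using l by (simp add: \<alpha>_def)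
    have "exp (0 \<bullet> z + (1 - \<theta>) * (norm z)\<^sup>2 / 2) * exp (t * L z) = exp (l * (2 * L z) + (1 - l) * (\<alpha> * (norm z)\<^sup>2 / 2))"
      unfolding exp_add[symmetric] mult.assoc[symmetric] times_divide_eq_right a by (simp add: l_def)
    also have "\<dots> \<le> exp (max (2 * L z) (\<alpha> * (norm z)\<^sup>2 / 2))" using m[of "2 * L z" "\<alpha> * (norm z)\<^sup>2 / 2"] by (simp only: exp_le_cancel_iff)
    also have "\<dots> \<le> exp (2 * L z) + exp (\<alpha> * (norm z)\<^sup>2 / 2)" by (simp add: max_def add_increasing add_increasing2)
    finally show ?thesis by simp
  qed
  then have "(\<integral>\<^sup>+ z. ennreal (exp (0 \<bullet> z + (1 - \<theta>) * (norm z)\<^sup>2 / 2)) * ennreal (exp (t * L z)) \<partial>(gauss_measure :: (real ^ 'n) measure))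
    \<le> (\<integral>\<^sup>+ z. ennreal (exp (2 * L z)) + ennreal (exp (0 \<bullet> z + (1 - (1 - \<alpha>)) * (norm z)\<^sup>2 / 2)) * 1 \<partial>gauss_measure)"
    by (intro nn_integral_mono) (simp add: ennreal_mult[symmetric] ennreal_plus[symmetric] ennreal_leI del: ennreal_plus)
  also have "\<dots> = (\<integral>\<^sup>+ z. ennreal (exp (2 * L z)) \<partial>gauss_measure)
     + (\<integral>\<^sup>+ z. ennreal (exp (0 \<bullet> z + (1 - (1 - \<alpha>)) * (norm z)\<^sup>2 / 2)) * 1 \<partial>(gauss_measure :: (real ^ 'n) measure))"
    by (rule nn_integral_add) measurable
  also have "(\<integral>\<^sup>+ z. ennreal (exp (0 \<bullet> z + (1 - (1 - \<alpha>)) * (norm z)\<^sup>2 / 2)) * 1 \<partial>(gauss_measure :: (real ^ 'n) measure)) < \<infinity>"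
    by (subst gauss_tilt) (use \<alpha> in \<open>auto simp: ennreal_mult_eq_top_iff less_top\<close>)
  finally have "(\<integral>\<^sup>+ z. ennreal (exp (0 \<bullet> z + (1 - \<theta>) * (norm z)\<^sup>2 / 2)) * ennreal (exp (t * L z)) \<partial>(gauss_measure :: (real ^ 'n) measure)) < \<infinity>"
    using fin by simp
  moreover have "(\<integral>\<^sup>+ z. ennreal (exp (0 \<bullet> z + (1 - \<theta>) * (norm z)\<^sup>2 / 2)) * ennreal (exp (t * L z)) \<partial>(gauss_measure :: (real ^ 'n) measure))
    = ennreal (\<theta> powr (- real CARD('n) / 2)) * (\<integral>\<^sup>+ z. ennreal (exp (t * L (r *\<^sub>R z))) \<partial>gauss_measure)"
    using \<theta> by (subst gauss_tilt) auto
  ultimately show ?thesis using \<theta> by (auto simp: ennreal_mult_less_top)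
qed

text \<open>For r < 1, \<open>log_subharmonic_dilation\<close> is used with \<rho> = r, Q = 1/r^2
  and \<delta> = 1, so the integrability it needs is that of exponent 2. For r > 1 it is applied to
  x -> L(r x) with \<rho> = 1/r and Q = 1.\<close>

lemma Lq_dilation_log_subharmonic:
  fixes L :: "real ^ 'n \<Rightarrow> real" and D :: "real ^ 'n \<Rightarrow> real ^ 'n"
  assumes L: "\<And>x. (L has_derivative (\<lambda>v. D x \<bullet> v)) (at x)"
    and D: "\<And>x. (D has_derivative D' x) (at x)" and lap: "\<And>x. 0 \<le> (\<Sum>i\<in>Basis. D' x i \<bullet> i)"
    and fin: "(\<integral>\<^sup>+ x. ennreal (exp (2 * L x)) \<partial>gauss_measure) < \<infinity>" and r: "0 < r"
  shows "r < 1 \<Longrightarrow> Lq_gauss (1 / r\<^sup>2) (\<lambda>x. ennreal (exp (L (r *\<^sub>R x)))) \<le> (\<integral>\<^sup>+ x. ennreal (exp (L x)) \<partial>gauss_measure)"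
    and "1 < r \<Longrightarrow> (\<integral>\<^sup>+ x. ennreal (exp (L x)) \<partial>gauss_measure) \<le> Lq_gauss (1 / r\<^sup>2) (\<lambda>x. ennreal (exp (L (r *\<^sub>R x))))"
proof -
  have Lc: "continuous_on UNIV L"
    using has_derivative_continuous[OF L] by (simp add: continuous_on_eq_continuous_at)
  have [measurable]: "L \<in> borel_measurable borel" using Lc by (rule borel_measurable_continuous_onI)
  assume "r < 1"
  then show "Lq_gauss (1 / r\<^sup>2) (\<lambda>x. ennreal (exp (L (r *\<^sub>R x)))) \<le> (\<integral>\<^sup>+ x. ennreal (exp (L x)) \<partial>gauss_measure)"
    using log_subharmonic_dilation[OF L D lap r, of "1 / r\<^sup>2" 1] r fin by (simp add: Lq_gauss_exp_one)
next
  have Lc: "continuous_on UNIV L"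
    using has_derivative_continuous[OF L] by (simp add: continuous_on_eq_continuous_at)
  have [measurable]: "L \<in> borel_measurable borel" using Lc by (rule borel_measurable_continuous_onI)
  assume r1: "1 < r"
  have S: "((\<lambda>x. r *\<^sub>R x) has_derivative (\<lambda>h. r *\<^sub>R h)) (at x)" for x :: "real ^ 'n"
    by (intro derivative_intros)
  have L': "((\<lambda>x. L (r *\<^sub>R x)) has_derivative (\<lambda>h. (r *\<^sub>R D (r *\<^sub>R x)) \<bullet> h)) (at x)" for x
    using has_derivative_compose[OF S L] by simp
  have D'': "((\<lambda>x. r *\<^sub>R D (r *\<^sub>R x)) has_derivative (\<lambda>h. r *\<^sub>R D' (r *\<^sub>R x) (r *\<^sub>R h))) (at x)" for x
    by (intro has_derivative_scaleR_right has_derivative_compose[OF S D])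
  have lin: "D' x (r *\<^sub>R h) = r *\<^sub>R D' x h" for x h
    using linear_scale[OF has_derivative_linear[OF D]] .
  have lap': "0 \<le> (\<Sum>i\<in>Basis. (r *\<^sub>R D' (r *\<^sub>R x) (r *\<^sub>R i)) \<bullet> i)" for x
    using lap[of "r *\<^sub>R x"] r by (simp add: lin sum_distrib_left[symmetric])
  have "(\<integral>\<^sup>+ x. ennreal (exp ((1 / r\<^sup>2 + 1 / (2 * r\<^sup>2)) * L (r *\<^sub>R x))) \<partial>gauss_measure) < \<infinity>"
    \<comment> \<open>Here \<rho>^2 Q = 1/r^2 and \<delta> = 1/(2 r^2); their sum times r^2 is 3/2,
      below the bound 2.\<close>
    by (rule exp_dilation_integrable[OF _ _ _ _ fin]) (use r1 in \<open>auto simp: field_simps add_pos_pos\<close>)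
  then show "(\<integral>\<^sup>+ x. ennreal (exp (L x)) \<partial>gauss_measure) \<le> Lq_gauss (1 / r\<^sup>2) (\<lambda>x. ennreal (exp (L (r *\<^sub>R x))))"
    using log_subharmonic_dilation[OF L' D'' lap', of "1 / r" 1 "1 / (2 * r\<^sup>2)"] r1
    by (simp add: Lq_gauss_exp_one power_divide)
qed

text \<open>Two uses of \<open>log_concave_dilation\<close>: for r > 1 on L/r^2 with p = r^2,
  followed by raising to the power r^2; for r < 1 on x -> L(r x) with p = 1/r^2, where the two
  dilations cancel on the left.\<close>

lemma Lq_dilation_log_concave:
  fixes L :: "real ^ 'n \<Rightarrow> real"
  assumes conc: "\<And>x y t. 0 < t \<Longrightarrow> t < 1 \<Longrightarrow> (1 - t) * L x + t * L y \<le> L ((1 - t) *\<^sub>R x + t *\<^sub>R y)"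
    and cont: "continuous_on UNIV L" and affine: "\<And>y. L y \<le> c + v \<bullet> y" and r: "0 < r"
  shows "1 < r \<Longrightarrow> Lq_gauss (1 / r\<^sup>2) (\<lambda>x. ennreal (exp (L (r *\<^sub>R x)))) \<le> (\<integral>\<^sup>+ x. ennreal (exp (L x)) \<partial>gauss_measure)"
    and "r < 1 \<Longrightarrow> (\<integral>\<^sup>+ x. ennreal (exp (L x)) \<partial>gauss_measure) \<le> Lq_gauss (1 / r\<^sup>2) (\<lambda>x. ennreal (exp (L (r *\<^sub>R x))))"
proof -
  assume r1: "1 < r"
  have "(\<integral>\<^sup>+ z. ennreal (exp (L (sqrt (r\<^sup>2) *\<^sub>R z) / r\<^sup>2)) \<partial>gauss_measure)
      \<le> (\<integral>\<^sup>+ z. ennreal (exp (r\<^sup>2 * (L z / r\<^sup>2))) \<partial>gauss_measure) epowr (1 / r\<^sup>2)"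
  proof (rule log_concave_dilation[where c = "c / r\<^sup>2" and v = "(1 / r\<^sup>2) *\<^sub>R v"])
    fix x y :: "real ^ 'n" and t :: real assume t: "0 < t" "t < 1"
    show "(1 - t) * (L x / r\<^sup>2) + t * (L y / r\<^sup>2) \<le> L ((1 - t) *\<^sub>R x + t *\<^sub>R y) / r\<^sup>2"
      using divide_right_mono[OF conc[OF t, of x y], of "r\<^sup>2"] by (simp add: add_divide_distrib)
  next
    fix y show "L y / r\<^sup>2 \<le> c / r\<^sup>2 + ((1 / r\<^sup>2) *\<^sub>R v) \<bullet> y"
      using divide_right_mono[OF affine[of y], of "r\<^sup>2"] by (simp add: add_divide_distrib)
  qed (use r1 cont in \<open>auto intro!: continuous_intros\<close>)
  then have "(\<integral>\<^sup>+ z. ennreal (exp (L (r *\<^sub>R z) / r\<^sup>2)) \<partial>gauss_measure) epowr (r\<^sup>2)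
      \<le> ((\<integral>\<^sup>+ z. ennreal (exp (L z)) \<partial>gauss_measure) epowr (1 / r\<^sup>2)) epowr (r\<^sup>2)"
    using r1 by (intro epowr_mono[of "r\<^sup>2"]) auto
  then show "Lq_gauss (1 / r\<^sup>2) (\<lambda>x. ennreal (exp (L (r *\<^sub>R x)))) \<le> (\<integral>\<^sup>+ x. ennreal (exp (L x)) \<partial>gauss_measure)"
    using r1 by (simp add: Lq_gauss_def exp_epowr epowr_epowr)
next
  assume r1: "r < 1"
  have "(\<integral>\<^sup>+ z. ennreal (exp (L (r *\<^sub>R (sqrt (1 / r\<^sup>2) *\<^sub>R z)))) \<partial>gauss_measure)
      \<le> (\<integral>\<^sup>+ z. ennreal (exp (1 / r\<^sup>2 * L (r *\<^sub>R z))) \<partial>gauss_measure) epowr (1 / (1 / r\<^sup>2))"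
  proof (rule log_concave_dilation[where c = c and v = "r *\<^sub>R v"])
    fix x y :: "real ^ 'n" and t :: real assume t: "0 < t" "t < 1"
    show "(1 - t) * L (r *\<^sub>R x) + t * L (r *\<^sub>R y) \<le> L (r *\<^sub>R ((1 - t) *\<^sub>R x + t *\<^sub>R y))"
      using conc[OF t, of "r *\<^sub>R x" "r *\<^sub>R y"] by (simp add: scaleR_add_right mult.commute)
  next
    fix y show "L (r *\<^sub>R y) \<le> c + (r *\<^sub>R v) \<bullet> y" using affine[of "r *\<^sub>R y"] by simp
  next
    show "continuous_on UNIV (\<lambda>x. L (r *\<^sub>R x))"
      by (rule continuous_on_compose2[OF cont]) (auto intro!: continuous_intros)
  qed (use r1 r in \<open>auto simp: power_less_one_iff abs_square_less_1\<close>)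
  then show "(\<integral>\<^sup>+ x. ennreal (exp (L x)) \<partial>gauss_measure) \<le> Lq_gauss (1 / r\<^sup>2) (\<lambda>x. ennreal (exp (L (r *\<^sub>R x))))"
    using r by (simp add: Lq_gauss_def exp_epowr real_sqrt_divide)
qed

section \<open>Assembly of the inequality\<close>

text \<open>Dividing a and b by r gives an average of unit variance of the dilated function, and q
  a^2 + b^2 = p becomes p/r^2 - 1 = (a/r)^2 (q - 1), the exponent relation of hypercontractivity.
  The norm of order p/r^2 of e^(L/p) is the power 1/p of the norm of order 1/r^2 of e^L.\<close>

lemma hypercontractive_comparison:
  fixes L :: "real ^ 'n \<Rightarrow> real"
  assumes cont: "continuous_on UNIV L" and ab: "a > 0" "b > 0" and r: "a\<^sup>2 + b\<^sup>2 = r\<^sup>2" "r > 0"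
    and pq: "p \<noteq> 0" "q \<noteq> 0" "q * a\<^sup>2 + b\<^sup>2 = p"
  shows "q \<ge> 1 \<Longrightarrow> Lq_gauss q (avg a b (\<lambda>x. ennreal (exp (L x / p)))) \<le> Lq_gauss (1 / r\<^sup>2) (\<lambda>x. ennreal (exp (L (r *\<^sub>R x)))) epowr (1 / p)"
    and "q \<le> 1 \<Longrightarrow> Lq_gauss (1 / r\<^sup>2) (\<lambda>x. ennreal (exp (L (r *\<^sub>R x)))) epowr (1 / p) \<le> Lq_gauss q (avg a b (\<lambda>x. ennreal (exp (L x / p))))"
proof -
  have avg_eq: "avg a b (\<lambda>x. ennreal (exp (L x / p))) = avg (a / r) (b / r) (\<lambda>x. ennreal (exp (L (r *\<^sub>R x) / p)))"
    using r by (simp add: avg_def fun_eq_iff scaleR_add_right)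
  have Lq_eq: "Lq_gauss (p / r\<^sup>2) (\<lambda>x. ennreal (exp (L (r *\<^sub>R x) / p))) = Lq_gauss (1 / r\<^sup>2) (\<lambda>x. ennreal (exp (L (r *\<^sub>R x)))) epowr (1 / p)"
    using Lq_gauss_powr[of "1 / p" "p / r\<^sup>2" "\<lambda>x. ennreal (exp (L (r *\<^sub>R x)))"] pq r by (simp add: exp_epowr)
  have 1: "(a / r)\<^sup>2 + (b / r)\<^sup>2 = 1" using r by (simp add: power_divide add_divide_distrib[symmetric])
  have 2: "p / r\<^sup>2 - 1 = (a / r)\<^sup>2 * (q - 1)" using r(2) pq(3)[symmetric] r(1)[symmetric]
  proof -
    have "p - r\<^sup>2 = a\<^sup>2 * (q - 1)" unfolding pq(3)[symmetric] r(1)[symmetric] by (simp add: algebra_simps)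
    then show ?thesis using r(2) by (simp add: field_simps)
  qed
  have c: "continuous_on UNIV (\<lambda>x. exp (L (r *\<^sub>R x) / p))"
    using pq by (intro continuous_intros continuous_on_compose2[OF cont]) auto
  note hyper = hypercontractivity[OF 1 _ 2 _ pq(2) c exp_gt_zero]
  show "Lq_gauss q (avg a b (\<lambda>x. ennreal (exp (L x / p)))) \<le> Lq_gauss (1 / r\<^sup>2) (\<lambda>x. ennreal (exp (L (r *\<^sub>R x)))) epowr (1 / p)" if "q \<ge> 1"
    unfolding avg_eq Lq_eq[symmetric] using that ab r pq by (intro hyper(1)) auto
  show "Lq_gauss (1 / r\<^sup>2) (\<lambda>x. ennreal (exp (L (r *\<^sub>R x)))) epowr (1 / p) \<le> Lq_gauss q (avg a b (\<lambda>x. ennreal (exp (L x / p))))" if "q \<le> 1"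
    unfolding avg_eq Lq_eq[symmetric] using that ab r pq by (intro hyper(2)) auto
qed

theorem theorem1p3:
  fixes s p q \<beta> :: real and v :: "real ^ 'n \<Rightarrow> real"
  assumes "s > 0"
    and "p \<noteq> 1" and "q \<noteq> 1"
    and "(q - 1) / (p - 1) = exp (2 * s)"
    and "\<beta> > 0"
    and "\<forall>x. v x > 0"
    and "twice_differentiable v"
    and "in_L2_inv_gauss \<beta> v"
  shows
    "(1 < p \<and> p < q
        \<and> (\<beta> > 1 \<longrightarrow> semi_log_subharmonic \<beta> v)
        \<and> (\<beta> < 1 \<longrightarrow> semi_log_concave \<beta> v)
      \<longrightarrow> Lq_gauss q (OU s (\<lambda>x. ennreal ((v x / gauss 1 x) powr (1 / p))))
          \<le> Lq_gauss q (OU s (\<lambda>x :: real ^ 'n. ennreal ((gauss \<beta> x / gauss 1 x) powr (1 / p))))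
             * (\<integral>\<^sup>+ x. ennreal (v x / gauss 1 x) \<partial>gauss_measure) epowr (1 / p))
     \<and>
     (q < p \<and> p < 1 \<and> p \<noteq> 0 \<and> p \<noteq> 1 - exp (- 2 * s)
      \<longrightarrow> (p * q > 0 \<and> \<beta> > 1 \<and> semi_log_subharmonic \<beta> v
           \<longrightarrow> Lq_gauss q (OU s (\<lambda>x. ennreal ((v x / gauss 1 x) powr (1 / p))))
               \<ge> Lq_gauss q (OU s (\<lambda>x :: real ^ 'n. ennreal ((gauss \<beta> x / gauss 1 x) powr (1 / p))))
                  * (\<integral>\<^sup>+ x. ennreal (v x / gauss 1 x) \<partial>gauss_measure) epowr (1 / p))
        \<and> (p * q < 0 \<and> 0 < \<beta> \<and> \<beta> < 1 \<and> semi_log_concave \<beta> v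
           \<longrightarrow> Lq_gauss q (OU s (\<lambda>x. ennreal ((v x / gauss 1 x) powr (1 / p))))
               \<ge> Lq_gauss q (OU s (\<lambda>x :: real ^ 'n. ennreal ((gauss \<beta> x / gauss 1 x) powr (1 / p))))
                  * (\<integral>\<^sup>+ x. ennreal (v x / gauss 1 x) \<partial>gauss_measure) epowr (1 / p)))"
proof -
  define E where "E = exp (- 2 * s)"
  define A where "A = 1 - E"
  define \<kappa> where "\<kappa> = (1 - 1 / \<beta>) / p"
  define \<theta> where "\<theta> = 1 - \<kappa> * A"
  define L where "L = (\<lambda>x. ln (v (sqrt \<beta> *\<^sub>R x) / gauss \<beta> (sqrt \<beta> *\<^sub>R x)))"
  define w where "w = (\<lambda>y. ln (v y))"
  define D where "D = (\<lambda>x. sqrt \<beta> *\<^sub>R gradient w (sqrt \<beta> *\<^sub>R x) + x)"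
  define D' where "D' = (\<lambda>x h. \<beta> *\<^sub>R (hessian w (sqrt \<beta> *\<^sub>R x) *v h) + h)"
  have \<beta>: "\<beta> > 0" and pos: "v x > 0" for x using assms by auto
  have E: "0 < E" "E < 1" "exp (2 * s) * E = 1" using assms by (auto simp: E_def exp_add[symmetric])
  have A: "0 < A" "A < 1" using E by (auto simp: A_def)
  \<comment> \<open>The exponent relation in linear form; since E > 0, it shows that p > A exactly
    when q > 0.\<close>
  have qp: "q * E + A = p"
  proof -
    have "q - 1 = exp (2 * s) * (p - 1)" using assms by (simp add: field_simps)
    then have "(q - 1) * E = (exp (2 * s) * E) * (p - 1)" by simp
    then show ?thesis unfolding E(3) A_def by (simp add: algebra_simps)
  qed
  have L_deriv: "(L has_derivative (\<lambda>h. D x \<bullet> h)) (at x)" for x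
    unfolding L_def D_def w_def by (rule ln_ratio_derivatives(1)) (use assms in auto)
  have D_deriv: "(D has_derivative D' x) (at x)" for x
    unfolding D_def D'_def w_def by (rule ln_ratio_derivatives(2)) (use assms in auto)
  have L_cont: "continuous_on UNIV L"
    using has_derivative_continuous[OF L_deriv] by (simp add: continuous_on_eq_continuous_at)
  have v_cont: "continuous_on UNIV v"
    using assms(7) by (auto simp: twice_differentiable_def continuous_on_eq_continuous_at intro!: differentiable_imp_continuous_within)
  have [measurable]: "v \<in> borel_measurable borel" using v_cont by (rule borel_measurable_continuous_onI)
  have exp_L: "exp (L x) = v (sqrt \<beta> *\<^sub>R x) / gauss \<beta> (sqrt \<beta> *\<^sub>R x)" for x
    using divide_pos_pos[OF pos gauss_pos[OF \<beta>]] by (simp add: L_def)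
  define Y where "Y = (\<integral>\<^sup>+ x. ennreal (exp (L x)) \<partial>gauss_measure)"
  have Y: "(\<integral>\<^sup>+ x. ennreal (v x / gauss 1 x) \<partial>gauss_measure) = Y"
  proof -
    have "(\<integral>\<^sup>+ x. ennreal (v x / gauss 1 x) \<partial>gauss_measure) = (\<integral>\<^sup>+ x. ennreal (gauss 1 x) * ennreal (v x / gauss 1 x) \<partial>lborel)"
      by (rule nn_integral_gauss_measure) measurable
    also have "\<dots> = (\<integral>\<^sup>+ x. ennreal (gauss \<beta> x) * ennreal (v x / gauss \<beta> x) \<partial>lborel)"
    proof (intro nn_integral_cong)
      fix x
      have "ennreal (gauss b x) * ennreal (v x / gauss b x) = ennreal (v x)" if "b > 0" for b
        using gauss_pos[OF that, of x] pos[of x] by (simp add: ennreal_mult[symmetric])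
      from this[of 1] this[OF \<beta>] show "ennreal (gauss 1 x) * ennreal (v x / gauss 1 x) = ennreal (gauss \<beta> x) * ennreal (v x / gauss \<beta> x)" by simp
    qed
    also have "\<dots> = Y" unfolding Y_def exp_L by (rule nn_integral_gauss_scale[OF \<beta>]) measurable
    finally show ?thesis .
  qed
  \<comment> \<open>The change of variables x -> sqrt \<beta> x translates the L^2 assumption on
    v.\<close>
  have L2: "(\<integral>\<^sup>+ x. ennreal (exp (2 * L x)) \<partial>gauss_measure) < \<infinity>"
  proof -
    have "exp (2 * L x) = (v (sqrt \<beta> *\<^sub>R x) / gauss \<beta> (sqrt \<beta> *\<^sub>R x))\<^sup>2" for x
      by (simp add: exp_L[symmetric] exp_double)
    then have "(\<integral>\<^sup>+ x. ennreal (exp (2 * L x)) \<partial>gauss_measure) = (\<integral>\<^sup>+ x. ennreal (gauss \<beta> x) * ennreal ((v x / gauss \<beta> x)\<^sup>2) \<partial>lborel)"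
      by (simp only:) (rule nn_integral_gauss_scale[OF \<beta>, of "\<lambda>x. ennreal ((v x / gauss \<beta> x)\<^sup>2)", symmetric], measurable)
    also have "\<dots> = (\<integral>\<^sup>+ x. ennreal ((v x)\<^sup>2 * inverse (gauss \<beta> x)) \<partial>lborel)"
    proof (intro nn_integral_cong)
      fix x
      show "ennreal (gauss \<beta> x) * ennreal ((v x / gauss \<beta> x)\<^sup>2) = ennreal ((v x)\<^sup>2 * inverse (gauss \<beta> x))"
        using gauss_pos[OF \<beta>, of x] by (simp add: ennreal_mult[symmetric] power2_eq_square divide_inverse)
    qed
    finally show ?thesis using assms(8) by (simp add: in_L2_inv_gauss_def)
  qed
  have lap: "0 \<le> (\<Sum>i\<in>Basis. D' x i \<bullet> i)" if "semi_log_subharmonic \<beta> v" for x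
  proof -
    have "(\<Sum>i\<in>Basis. D' x i \<bullet> i) = \<beta> * trace (hessian w (sqrt \<beta> *\<^sub>R x)) + real CARD('n)"
      by (simp add: D'_def inner_add_left sum.distrib sum_distrib_left[symmetric] sum_Basis_matrix_vector_mult inner_Basis)
    moreover have "\<beta> * (- real CARD('n) / \<beta>) \<le> \<beta> * trace (hessian w (sqrt \<beta> *\<^sub>R x))"
      using that \<beta> unfolding semi_log_subharmonic_def laplacian_def w_def by (intro mult_left_mono) auto
    ultimately show ?thesis using \<beta> by simp
  qed
  have neg: "u \<bullet> D' x u \<le> 0" if "semi_log_concave \<beta> v" for x u
  proof -
    have "u \<bullet> (hessian w (sqrt \<beta> *\<^sub>R x) *v u) \<le> u \<bullet> (mat (- 1 / \<beta>) *v u)"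
      using that unfolding semi_log_concave_def loewner_le_def w_def by blast
    then have "\<beta> * (u \<bullet> (hessian w (sqrt \<beta> *\<^sub>R x) *v u)) \<le> \<beta> * (- 1 / \<beta> * (u \<bullet> u))"
      using \<beta> by (intro mult_left_mono) (simp_all add: mat_matrix_vector_mult)
    then show ?thesis using \<beta> by (simp add: D'_def inner_add_right)
  qed
  \<comment> \<open>The number a^2 + b^2 for the parameters a, b left by
    \<open>OU_gaussian_reduction\<close>.\<close>
  define R2 where "R2 = (E + A / \<beta>) / \<theta>"
  define r where "r = sqrt R2"
  define X where "X = Lq_gauss (1 / r\<^sup>2) (\<lambda>x. ennreal (exp (L (r *\<^sub>R x))))"
  have main:
    "q \<ge> 1 \<Longrightarrow> X epowr (1 / p) \<le> Y epowr (1 / p) \<Longrightarrow>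
      Lq_gauss q (OU s (\<lambda>x. ennreal ((v x / gauss 1 x) powr (1 / p))))
        \<le> Lq_gauss q (OU s (\<lambda>x :: real ^ 'n. ennreal ((gauss \<beta> x / gauss 1 x) powr (1 / p)))) * Y epowr (1 / p)"
    "q \<le> 1 \<Longrightarrow> Y epowr (1 / p) \<le> X epowr (1 / p) \<Longrightarrow>
      Lq_gauss q (OU s (\<lambda>x :: real ^ 'n. ennreal ((gauss \<beta> x / gauss 1 x) powr (1 / p)))) * Y epowr (1 / p)
        \<le> Lq_gauss q (OU s (\<lambda>x. ennreal ((v x / gauss 1 x) powr (1 / p))))"
    and R2: "r > 0" "R2 - 1 = A * (1 - 1 / \<beta>) * (1 / p - 1) / \<theta>"
    if \<theta>: "\<theta> > 0" and pq: "p \<noteq> 0" "q \<noteq> 0"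
  proof -
    define a where "a = sqrt (E / \<theta>)"
    define b where "b = sqrt (A / (\<theta> * \<beta>))"
    have ab: "a > 0" "b > 0" using E A \<theta> \<beta> by (auto simp: a_def b_def)
    have ab2: "a\<^sup>2 = E / \<theta>" "b\<^sup>2 = A / (\<theta> * \<beta>)" using E A \<theta> \<beta> by (auto simp: a_def b_def)
    have "R2 > 0" using E A \<theta> \<beta> by (auto simp: R2_def intro!: divide_pos_pos add_pos_pos)
    then show r0: "r > 0" by (simp add: r_def)
    have r2: "a\<^sup>2 + b\<^sup>2 = r\<^sup>2" using \<open>R2 > 0\<close> \<beta> \<theta> by (simp add: ab2 r_def R2_def field_simps)
    have abp: "q * a\<^sup>2 + b\<^sup>2 = p"
    proof -
      have "\<theta> * (q * a\<^sup>2 + b\<^sup>2) = q * E + A / \<beta>" using \<theta> \<beta> by (simp add: ab2 field_simps)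
      also have "\<dots> = p - A * (1 - 1 / \<beta>)" using qp by (simp add: algebra_simps)
      also have "1 - 1 / \<beta> = \<kappa> * p" using pq by (simp add: \<kappa>_def)
      also have "p - A * (\<kappa> * p) = \<theta> * p" by (simp add: \<theta>_def algebra_simps)
      finally show ?thesis using \<theta> by simp
    qed
    show "R2 - 1 = A * (1 - 1 / \<beta>) * (1 / p - 1) / \<theta>"
    proof -
      have "R2 - 1 = (E + A / \<beta> - \<theta>) / \<theta>" using \<theta> by (simp add: R2_def diff_divide_distrib)
      also have "E + A / \<beta> - \<theta> = A * (1 - 1 / \<beta>) * (1 / p - 1)"
      proof -
        have "(1 - A) + A * x - (1 - (1 - x) * y * A) = A * (1 - x) * (y - 1)" for x y :: real by (simp add: algebra_simps)
        from this[of "1 / \<beta>" "1 / p"] show ?thesis by (simp add: \<theta>_def \<kappa>_def A_def)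
      qed
      finally show ?thesis .
    qed
    obtain C where C: "C > 0" and OU: "\<forall>v :: real ^ 'n \<Rightarrow> real. continuous_on UNIV v \<longrightarrow> (\<forall>x. 0 < v x) \<longrightarrow>
        Lq_gauss q (OU s (\<lambda>x. ennreal ((v x / gauss 1 x) powr (1 / p))))
        = ennreal C * Lq_gauss q (avg a b (\<lambda>x. ennreal (exp (ln (v (sqrt \<beta> *\<^sub>R x) / gauss \<beta> (sqrt \<beta> *\<^sub>R x)) / p))))"
      using OU_gaussian_reduction[OF assms(1) \<beta> pq, where 'n = 'n, folded E_def, folded A_def, folded \<kappa>_def,
            folded \<theta>_def, folded a_def b_def, OF qp \<theta>] by (elim exE conjE)
    have OU_v: "Lq_gauss q (OU s (\<lambda>x. ennreal ((v x / gauss 1 x) powr (1 / p)))) = ennreal C * Lq_gauss q (avg a b (\<lambda>x. ennreal (exp (L x / p))))"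
      unfolding L_def using OU v_cont pos by blast
    \<comment> \<open>For v = \<open>gauss \<beta>\<close> the logarithm is 0, the average of 1 is
      1, and only C remains.\<close>
    have OU_g: "Lq_gauss q (OU s (\<lambda>x :: real ^ 'n. ennreal ((gauss \<beta> x / gauss 1 x) powr (1 / p)))) = ennreal C"
    proof -
      have nz: "gauss \<beta> y \<noteq> 0" for y :: "real ^ 'n" using gauss_pos[OF \<beta>, of y] by simp
      have "Lq_gauss q (OU s (\<lambda>x :: real ^ 'n. ennreal ((gauss \<beta> x / gauss 1 x) powr (1 / p))))
        = ennreal C * Lq_gauss q (avg a b (\<lambda>x :: real ^ 'n. ennreal (exp (ln (gauss \<beta> (sqrt \<beta> *\<^sub>R x) / gauss \<beta> (sqrt \<beta> *\<^sub>R x)) / p))))"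
        using OU continuous_on_gauss gauss_pos[OF \<beta>] by blast
      then show ?thesis by (simp add: nz avg_def Lq_gauss_def)
    qed
    note hyper = hypercontractive_comparison[OF L_cont ab r2 r0 pq abp, folded X_def]
    show "Lq_gauss q (OU s (\<lambda>x. ennreal ((v x / gauss 1 x) powr (1 / p))))
        \<le> Lq_gauss q (OU s (\<lambda>x :: real ^ 'n. ennreal ((gauss \<beta> x / gauss 1 x) powr (1 / p)))) * Y epowr (1 / p)"
      if "q \<ge> 1" "X epowr (1 / p) \<le> Y epowr (1 / p)"
      unfolding OU_v OU_g using order_trans[OF hyper(1)[OF that(1)] that(2)] by (intro mult_left_mono) auto
    show "Lq_gauss q (OU s (\<lambda>x :: real ^ 'n. ennreal ((gauss \<beta> x / gauss 1 x) powr (1 / p)))) * Y epowr (1 / p)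
        \<le> Lq_gauss q (OU s (\<lambda>x. ennreal ((v x / gauss 1 x) powr (1 / p))))"
      if "q \<le> 1" "Y epowr (1 / p) \<le> X epowr (1 / p)"
      unfolding OU_v OU_g using order_trans[OF that(2) hyper(2)[OF that(1)]] by (intro mult_left_mono) auto
  qed
  have sgn: "r < 1 \<longleftrightarrow> (1 - 1 / \<beta>) * (1 / p - 1) < 0" "1 < r \<longleftrightarrow> 0 < (1 - 1 / \<beta>) * (1 / p - 1)" "r = 1 \<longleftrightarrow> (1 - 1 / \<beta>) * (1 / p - 1) = 0"
    if \<theta>: "\<theta> > 0" and pq: "p \<noteq> 0" "q \<noteq> 0"
  proof -
    have "R2 - 1 = (A / \<theta>) * ((1 - 1 / \<beta>) * (1 / p - 1))" using R2(2)[OF that] by simp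
    moreover have "A / \<theta> > 0" using A \<theta> by simp
    ultimately have "R2 - 1 < 0 \<longleftrightarrow> (1 - 1 / \<beta>) * (1 / p - 1) < 0" "0 < R2 - 1 \<longleftrightarrow> 0 < (1 - 1 / \<beta>) * (1 / p - 1)" "R2 - 1 = 0 \<longleftrightarrow> (1 - 1 / \<beta>) * (1 / p - 1) = 0"
      by (simp_all only: mult_less_0_iff zero_less_mult_iff mult_eq_0_iff) auto
    then show "r < 1 \<longleftrightarrow> (1 - 1 / \<beta>) * (1 / p - 1) < 0" "1 < r \<longleftrightarrow> 0 < (1 - 1 / \<beta>) * (1 / p - 1)" "r = 1 \<longleftrightarrow> (1 - 1 / \<beta>) * (1 / p - 1) = 0"
      by (auto simp: r_def)
  qed
  have XY_subharmonic: "r < 1 \<Longrightarrow> X \<le> Y" "1 < r \<Longrightarrow> Y \<le> X" if "semi_log_subharmonic \<beta> v" "r > 0"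
    unfolding X_def Y_def using Lq_dilation_log_subharmonic[OF L_deriv D_deriv lap[OF that(1)] L2 that(2)] by auto
  have XY_concave: "1 < r \<Longrightarrow> X \<le> Y" "r < 1 \<Longrightarrow> Y \<le> X" if "semi_log_concave \<beta> v" "r > 0"
    unfolding X_def Y_def
    using Lq_dilation_log_concave[OF concave_of_second_derivative(1)[OF L_deriv D_deriv neg[OF that(1)]] L_cont
        concave_of_second_derivative(2)[OF L_deriv D_deriv neg[OF that(1)]] that(2)] by auto
  have XY_one: "X = Y" if "r = 1" using that by (simp add: X_def Y_def Lq_gauss_exp_one)
  have \<theta>_neg: "\<theta> > 0" if "\<kappa> \<le> 0"
    using mult_nonpos_nonneg[OF that, of A] A by (simp add: \<theta>_def)
  have \<beta>_gt: "0 < 1 - 1 / \<beta>" "1 - 1 / \<beta> < 1" if "\<beta> > 1" using that by auto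
  have \<beta>_lt: "1 - 1 / \<beta> < 0" if "\<beta> < 1" using that \<beta> by (simp add: field_simps)
  have \<theta>_pos: "\<theta> > 0" if "\<beta> > 1" "p > A"
  proof -
    have "(1 - 1 / \<beta>) * A < 1 * p" using \<beta>_gt[OF that(1)] A that(2) by (intro mult_strict_mono) auto
    then have "\<kappa> * A < 1" using A that(2) by (simp add: \<kappa>_def pos_divide_less_eq)
    then show ?thesis by (simp add: \<theta>_def)
  qed
  show ?thesis unfolding Y
  proof (intro conjI impI)
    assume h: "1 < p \<and> p < q \<and> (\<beta> > 1 \<longrightarrow> semi_log_subharmonic \<beta> v) \<and> (\<beta> < 1 \<longrightarrow> semi_log_concave \<beta> v)"
    then have pq: "p \<noteq> 0" "q \<noteq> 0" "q \<ge> 1" and p1: "1 / p - 1 < 0" by auto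
    have \<theta>: "\<theta> > 0"
    proof (cases "\<beta> > 1")
      case True
      then show ?thesis using \<theta>_pos A h by auto
    next
      case False
      then have "1 - 1 / \<beta> \<le> 0" using \<beta> by (simp add: field_simps)
      then show ?thesis using h by (intro \<theta>_neg) (simp add: \<kappa>_def divide_nonpos_pos)
    qed
    note r0 = R2(1)[OF \<theta> pq(1,2)] and sg = sgn[OF \<theta> pq(1,2)]
    consider "\<beta> > 1" | "\<beta> < 1" | "\<beta> = 1" by linarith
    then have "X \<le> Y"
    proof cases
      case 1
      then have "r < 1" unfolding sg using \<beta>_gt p1 by (intro mult_pos_neg)
      then show ?thesis using XY_subharmonic(1)[OF _ r0] h 1 by auto
    next
      case 2
      then have "1 < r" unfolding sg using \<beta>_lt p1 by (intro mult_neg_neg)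
      then show ?thesis using XY_concave(1)[OF _ r0] h 2 by auto
    next
      \<comment> \<open>For \<beta> = 1 no condition on the second derivatives of ln v is available;
        r = 1 makes the two norms equal, so hypercontractivity alone suffices.\<close>
      case 3
      then have "r = 1" unfolding sg by simp
      then show ?thesis using XY_one by simp
    qed
    then have "X epowr (1 / p) \<le> Y epowr (1 / p)" using h by (intro epowr_mono[of "1 / p"]) auto
    then show "Lq_gauss q (OU s (\<lambda>x. ennreal ((v x / gauss 1 x) powr (1 / p))))
      \<le> Lq_gauss q (OU s (\<lambda>x :: real ^ 'n. ennreal ((gauss \<beta> x / gauss 1 x) powr (1 / p)))) * Y epowr (1 / p)"
      by (rule main(1)[OF \<theta> pq])
  next
    assume h: "q < p \<and> p < 1 \<and> p \<noteq> 0 \<and> p \<noteq> 1 - exp (- 2 * s)" and c: "p * q > 0 \<and> \<beta> > 1 \<and> semi_log_subharmonic \<beta> v"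
    then have pq: "p \<noteq> 0" "q \<noteq> 0" "q \<le> 1" by auto
    have "Y epowr (1 / p) \<le> X epowr (1 / p)"
      and \<theta>: "\<theta> > 0"
    proof -
      have "(p > 0 \<and> q > 0) \<or> (p < 0 \<and> q < 0)" using c by (simp add: zero_less_mult_iff)
      then have "\<theta> > 0 \<and> Y epowr (1 / p) \<le> X epowr (1 / p)"
      proof
        \<comment> \<open>Here q > 0 is used to get p = q E + A > A, hence \<theta> > 0.\<close>
        assume p: "p > 0 \<and> q > 0"
        then have "p > A" unfolding qp[symmetric] using E by simp
        then have \<theta>: "\<theta> > 0" using \<theta>_pos c by auto
        have "1 / p - 1 > 0" using p h by auto
        then have "1 < r" unfolding sgn[OF \<theta> pq(1,2)] using \<beta>_gt c by (intro mult_pos_pos) auto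
        then have "Y \<le> X" using XY_subharmonic(2)[OF _ R2(1)[OF \<theta> pq(1,2)]] c by auto
        then show ?thesis using p \<theta> by (auto intro!: epowr_mono[of "1 / p"])
      next
        \<comment> \<open>Now 1/p is negative and reverses the order, so the comparison needed is X
          <= Y. It is available because 1/p - 1 < 0 puts r below 1.\<close>
        assume p: "p < 0 \<and> q < 0"
        have \<theta>: "\<theta> > 0" using \<beta>_gt c p by (intro \<theta>_neg) (auto simp: \<kappa>_def intro!: divide_nonneg_neg)
        have "1 / p < 0" using p by auto
        then have "1 / p - 1 < 0" by linarith
        then have "r < 1" unfolding sgn[OF \<theta> pq(1,2)] using \<beta>_gt c by (intro mult_pos_neg) auto
        then have "X \<le> Y" using XY_subharmonic(1)[OF _ R2(1)[OF \<theta> pq(1,2)]] c by auto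
        then show ?thesis using p \<theta> by (auto intro!: epowr_antimono[of "1 / p"])
      qed
      then show "Y epowr (1 / p) \<le> X epowr (1 / p)" "\<theta> > 0" by auto
    qed
    then show "Lq_gauss q (OU s (\<lambda>x :: real ^ 'n. ennreal ((gauss \<beta> x / gauss 1 x) powr (1 / p)))) * Y epowr (1 / p)
      \<le> Lq_gauss q (OU s (\<lambda>x. ennreal ((v x / gauss 1 x) powr (1 / p))))"
      by (intro main(2)[OF \<theta> pq])
  next
    assume h: "q < p \<and> p < 1 \<and> p \<noteq> 0 \<and> p \<noteq> 1 - exp (- 2 * s)" and c: "p * q < 0 \<and> 0 < \<beta> \<and> \<beta> < 1 \<and> semi_log_concave \<beta> v"
    \<comment> \<open>As q < p, a negative product means q < 0 < p; with \<beta> < 1 this makes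
      \<kappa> negative and r < 1.\<close>
    then have p: "p > 0" "q < 0" by (auto simp: mult_less_0_iff)
    then have pq: "p \<noteq> 0" "q \<noteq> 0" "q \<le> 1" by auto
    have \<theta>: "\<theta> > 0" using \<beta>_lt c p by (intro \<theta>_neg) (auto simp: \<kappa>_def intro!: divide_nonpos_pos)
    have "1 / p - 1 > 0" using p h by auto
    then have "r < 1" unfolding sgn[OF \<theta> pq(1,2)] using \<beta>_lt c by (intro mult_neg_pos) auto
    then have "Y \<le> X" using XY_concave(2)[OF _ R2(1)[OF \<theta> pq(1,2)]] c by auto
    then have "Y epowr (1 / p) \<le> X epowr (1 / p)" using p by (intro epowr_mono[of "1 / p"]) auto
    then show "Lq_gauss q (OU s (\<lambda>x :: real ^ 'n. ennreal ((gauss \<beta> x / gauss 1 x) powr (1 / p)))) * Y epowr (1 / p)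
      \<le> Lq_gauss q (OU s (\<lambda>x. ennreal ((v x / gauss 1 x) powr (1 / p))))"
      by (rule main(2)[OF \<theta> pq])
  qed
qed

end
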